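(* Let $(X,\mathcal{B},T,m,\alpha)$ be a topologically mixing probability preserving Markov map. Let $\gamma\subset\alpha$ be such that the induced map $T_Y$ on $Y=\bigcup_{a\in\gamma}a$ has a locally $\theta$-Hölder distortion for some $\theta<1$ and has the big image property. Let $f\in I(X,Y)$ be integrable with $\int f\,dm=0$, and assume that the induced function $f_Y$ is in $L^2(dm_Y)$. Then there exists a constant $\sigma^2\ge 0$ such that $\frac{1}{\sqrt n}\sum_{i=0}^{n-1}f\circ T^i$ converges in distribution (with respect to $m$) to the normal law $\mathcal{N}(0,\sigma^2)$. Moreover, $\sigma^2=0$ if and only if there exists a measurable function $\chi:X\to\mathbb{R}$ satisfying $f=\chi\circ T-\chi$.
   Context: Markov maps. A Markov map is a non-singular transformation $T$ of a Lebesgue space $(X,\mathcal{B},m)$ of finite mass, together with a measurable partition $\alpha$ of $X$ such that for every $a\in\alpha$: $m(a)>0$, $Ta$ is a union (mod $m$) of elements of $\alpha$, and $T:a\to Ta$ is invertible; moreover the completion of $\bigvee_{i=0}^\infty T^{-i}\alpha$ is $\mathcal{B}$. It is probability preserving if $m$ is a $T$-invariant probability measure. It is topologically mixing if $\forall a,b\in\alpha$, $\exists N$, $\forall n\ge N$, $b\subset T^na$. Induced map. For $\gamma\subset\alpha$ and $Y=\bigcup_{a\in\gamma}a$, let $\phi(x)=\phi_Y(x)=\inf\{n\ge1 : T^nx\in Y\}$ for $x\in Y$ (return time), $T_Y=T^{\phi_Y}:Y\to Y$, and $m_Y=m_{|Y}$. Let $\delta$ be the partition of $Y$ into the non-empty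 sets $[a,\xi_1,\dots,\xi_{n-1},Y]:=a\cap T^{-1}\xi_1\cap\dots\cap T^{-(n-1)}\xi_{n-1}\cap T^{-n}Y$ with $a\in\gamma$, $\xi_1,\dots,\xi_{n-1}\in\alpha\setminus\gamma$. $T_Y$ is a Markov map for $\delta$ and $m_Y$. The function $\phi$ is constant on each $d\in\delta$, with value denoted $\phi(d)$. Separation time. For $x,y\in Y$, $s(x,y)=\inf\{n\in\mathbb{N} : T_Y^nx \text{ and } T_Y^ny \text{ are not in the same element of }\delta\}$. For general $x,y\in X$, let $x',y'$ be their first returns to $Y$; if $T^ix$ and $T^iy$ stay in the same element of $\alpha$ until the first return to $Y$, set $s(x,y)=s(x',y')+1$; otherwise $s(x,y)=0$. A function $g$ on $Y$ (resp. $X$) is locally $\theta$-Hölder if there is $C$ with $|g(x)-g(y)|\le C\theta^{s(x,y)}$ whenever $x,y\in Y$ (resp. $X$) and $s(x,y)\ge1$ (functions having such a version are also called locally $\theta$-Hölder). Distortion and big image. Let $g_{m_Y}=\frac{dm_Y}{dm_Y\circ T_Y}$, the inverse of the jacobian of $T_Y$ (so the transfer operator of $T_Y$ is $\hat T_Yf(x)=\sum_{T_Yy=x}g_{m_Y}(y)f(y)$). $T_Y$ has locally $\theta$-Hölder distortion if $\log g_{m_Y}$ is locally $\theta$-Hölder. $T_Y$ has the big image property if there is $\eta>0$ with $m[T_Yd]\ge\eta$ for all $d\in\delta$. The class $I(X,Y)$. For $f:X\to\mathbb{R}$ let $f_Y(x)=\sum_{i=0}^{\phi(x)-1}f(T^ix)$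 for $x\in Y$. Then $f\in I(X,Y)$ if: (1) for all $N\in\mathbb{N}$ there exist constants $C_N$ and $0<\theta_N<1$ such that on $Y_N=\bigcup_{i=0}^{N-1}T^i(Y)$ we have $|f|\le C_N$, and $|f(x)-f(y)|\le C_N\theta_N^{s(x,y)}$ for all $x,y\in Y_N$ with $s(x,y)\ge1$; (2) there exists $\theta<1$ such that $\sum_{d\in\delta}\phi(d)\,m[d]\,D_\theta f_Y(d)<\infty$, where $D_\theta f_Y(d)$ is the least $\theta$-Hölder constant (with respect to $s$) of $f_Y$ restricted to $d$. $\mathcal{N}(0,0)$ denotes the Dirac mass at $0$. Equalities between measurable functions are understood $m$-almost everywhere. *)

theory Defs
  imports "HOL-Probability.Probability"
begin

text \<open>A Lebesgue space of finite mass in the sense of Rokhlin: a complete finite measure space that is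
  isomorphic mod 0 to the disjoint union of an interval \<open>[0, c]\<close> with Lebesgue measure and of
  countably many point masses. Below, \<open>A\<close> is the set of point masses, and \<open>h\<close> is the
  isomorphism between full-measure subsets of the remaining part and of \<open>[0, c]\<close>.\<close>

definition lebesgue_space :: "'a measure \<Rightarrow> bool" where
  "lebesgue_space M \<longleftrightarrow> finite_measure M \<and> complete_measure M \<and>
    (\<exists>A X0 c R0 h.
       countable A \<and> A \<subseteq> space M \<and> (\<forall>x\<in>A. {x} \<in> sets M \<and> emeasure M {x} > 0) \<and>
       X0 \<in> sets M \<and> X0 \<inter> A = {} \<and> space M - A - X0 \<in> null_sets M \<and>
       0 \<le> c \<and> R0 \<in> sets lebesgue \<and> R0 \<subseteq> {0..c::real} \<and> {0..c} - R0 \<in> null_sets lebesgue \<and>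
       bij_betw h X0 R0 \<and>
       h \<in> measurable (restrict_space M X0) (restrict_space lebesgue R0) \<and>
       the_inv_into X0 h \<in> measurable (restrict_space lebesgue R0) (restrict_space M X0) \<and>
       distr (restrict_space M X0) (restrict_space lebesgue R0) h = restrict_space lebesgue R0)"

definition nonsingular_transformation :: "'a measure \<Rightarrow> ('a \<Rightarrow> 'a) \<Rightarrow> bool" where
  "nonsingular_transformation M T \<longleftrightarrow> T \<in> measurable M M \<and>
    (\<forall>A\<in>sets M. emeasure M (T -` A \<inter> space M) = 0 \<longleftrightarrow> emeasure M A = 0)"

text \<open>\<open>T : a \<rightarrow> T a\<close> is invertible as a non-singular map: it is injective on \<open>a\<close>, and its inverse is
  measurable and non-singular.\<close>

definition invertible_on :: "'a measure \<Rightarrow> ('a \<Rightarrow> 'a) \<Rightarrow> 'a set \<Rightarrow> bool" where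
  "invertible_on M T a \<longleftrightarrow> inj_on T a \<and>
    (\<forall>A\<in>sets M. A \<subseteq> a \<longrightarrow> T ` A \<in> sets M \<and> (emeasure M (T ` A) = 0 \<longleftrightarrow> emeasure M A = 0))"

definition measurable_partition :: "'a measure \<Rightarrow> 'a set set \<Rightarrow> bool" where
  "measurable_partition M \<alpha> \<longleftrightarrow> \<alpha> \<subseteq> sets M \<and> disjoint \<alpha> \<and> \<Union>\<alpha> = space M"

definition markov_map :: "'a measure \<Rightarrow> ('a \<Rightarrow> 'a) \<Rightarrow> 'a set set \<Rightarrow> bool" where
  "markov_map M T \<alpha> \<longleftrightarrow>
    lebesgue_space M \<and> nonsingular_transformation M T \<and> measurable_partition M \<alpha> \<and>
    (\<forall>a\<in>\<alpha>. emeasure M a > 0 \<and>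
       (\<exists>\<beta>\<subseteq>\<alpha>. sym_diff (T ` a) (\<Union>\<beta>) \<in> null_sets M) \<and>
       invertible_on M T a) \<and>
    sets (completion (measure_of (space M)
      {(T ^^ i) -` a \<inter> space M | i a. a \<in> \<alpha>} (emeasure M))) = sets M"

definition probability_preserving :: "'a measure \<Rightarrow> ('a \<Rightarrow> 'a) \<Rightarrow> bool" where
  "probability_preserving M T \<longleftrightarrow> prob_space M \<and> T \<in> measurable M M \<and> distr M M T = M"

definition topologically_mixing :: "('a \<Rightarrow> 'a) \<Rightarrow> 'a set set \<Rightarrow> bool" where
  "topologically_mixing T \<alpha> \<longleftrightarrow> (\<forall>a\<in>\<alpha>. \<forall>b\<in>\<alpha>. \<exists>N. \<forall>n\<ge>N. b \<subseteq> (T ^^ n) ` a)"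

text \<open>Points that never come back to \<open>Y\<close> get the dummy return time \<open>0\<close>, hence are fixed by the
  dummy value of \<open>induced_map\<close>. Such points belong to no element of the partition
  \<open>induced_partition\<close> below, so that they are separated from every point at time \<open>0\<close>.\<close>

definition return_time :: "('a \<Rightarrow> 'a) \<Rightarrow> 'a set \<Rightarrow> 'a \<Rightarrow> nat" where
  "return_time T Y x =
    (if \<exists>n\<ge>1. (T ^^ n) x \<in> Y then LEAST n. n \<ge> 1 \<and> (T ^^ n) x \<in> Y else 0)"

definition induced_map :: "('a \<Rightarrow> 'a) \<Rightarrow> 'a set \<Rightarrow> 'a \<Rightarrow> 'a" where
  "induced_map T Y x = (T ^^ return_time T Y x) x"

definition induced_function :: "('a \<Rightarrow> 'a) \<Rightarrow> 'a set \<Rightarrow> ('a \<Rightarrow> real) \<Rightarrow> 'a \<Rightarrow> real" where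
  "induced_function T Y f x = (\<Sum>i<return_time T Y x. f ((T ^^ i) x))"

text \<open>The partition \<open>\<delta>\<close> of \<open>Y = \<Union>\<gamma>\<close>.\<close>

definition induced_partition :: "('a \<Rightarrow> 'a) \<Rightarrow> 'a set set \<Rightarrow> 'a set set \<Rightarrow> 'a set set" where
  "induced_partition T \<alpha> \<gamma> =
    {d. d \<noteq> {} \<and> (\<exists>a\<in>\<gamma>. \<exists>n\<ge>1. \<exists>\<xi>. (\<forall>i\<in>{1..<n}. \<xi> i \<in> \<alpha> - \<gamma>) \<and>
          d = {x\<in>a. (\<forall>i\<in>{1..<n}. (T ^^ i) x \<in> \<xi> i) \<and> (T ^^ n) x \<in> \<Union>\<gamma>})}"

definition return_time_on :: "('a \<Rightarrow> 'a) \<Rightarrow> 'a set \<Rightarrow> 'a set \<Rightarrow> nat" where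
  "return_time_on T Y d = (THE n. \<forall>x\<in>d. return_time T Y x = n)"

text \<open>The infimum of the empty set is \<open>\<infinity>\<close> in \<^typ>\<open>enat\<close>.\<close>

definition separation_time_base ::
  "('a \<Rightarrow> 'a) \<Rightarrow> 'a set set \<Rightarrow> 'a set set \<Rightarrow> 'a \<Rightarrow> 'a \<Rightarrow> enat" where
  "separation_time_base T \<alpha> \<gamma> x y =
    Inf (enat ` {n. \<not> (\<exists>d\<in>induced_partition T \<alpha> \<gamma>.
      (induced_map T (\<Union>\<gamma>) ^^ n) x \<in> d \<and> (induced_map T (\<Union>\<gamma>) ^^ n) y \<in> d)})"

definition separation_time ::
  "('a \<Rightarrow> 'a) \<Rightarrow> 'a set set \<Rightarrow> 'a set set \<Rightarrow> 'a \<Rightarrow> 'a \<Rightarrow> enat" where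
  "separation_time T \<alpha> \<gamma> x y =
    (let Y = \<Union>\<gamma>; n = return_time T Y x in
     if x \<in> Y \<and> y \<in> Y then separation_time_base T \<alpha> \<gamma> x y
     else if n \<ge> 1 \<and> return_time T Y y = n \<and>
             (\<forall>i<n. \<exists>a\<in>\<alpha>. (T ^^ i) x \<in> a \<and> (T ^^ i) y \<in> a)
     then separation_time_base T \<alpha> \<gamma> (induced_map T Y x) (induced_map T Y y) + 1
     else 0)"

text \<open>\<open>\<theta>\<^sup>s\<close> for \<open>0 < \<theta> < 1\<close> and a possibly infinite separation time \<open>s\<close>.\<close>

definition epower :: "real \<Rightarrow> enat \<Rightarrow> real" where
  "epower \<theta> s = (case s of enat n \<Rightarrow> \<theta> ^ n | \<infinity> \<Rightarrow> 0)"

text \<open>\<open>m\<^sub>Y \<circ> T\<^sub>Y\<close> is the measure \<open>A \<mapsto> \<Sum>\<^sub>d m(T\<^sub>Y(A \<inter> d))\<close>: images are counted with multiplicity,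
  one injectivity domain \<open>d \<in> \<delta>\<close> at a time.\<close>

definition image_measure ::
  "'a measure \<Rightarrow> ('a \<Rightarrow> 'a) \<Rightarrow> 'a set set \<Rightarrow> 'a set set \<Rightarrow> 'a measure" where
  "image_measure M T \<alpha> \<gamma> = measure_of (\<Union>\<gamma>) (sets (restrict_space M (\<Union>\<gamma>)))
    (\<lambda>A. \<Sum>\<^sub>\<infinity>d\<in>induced_partition T \<alpha> \<gamma>. emeasure M (induced_map T (\<Union>\<gamma>) ` (A \<inter> d)))"

definition inverse_jacobian ::
  "'a measure \<Rightarrow> ('a \<Rightarrow> 'a) \<Rightarrow> 'a set set \<Rightarrow> 'a set set \<Rightarrow> 'a \<Rightarrow> real" where
  "inverse_jacobian M T \<alpha> \<gamma> x =
    enn2real (RN_deriv (image_measure M T \<alpha> \<gamma>) (restrict_space M (\<Union>\<gamma>)) x)"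

text \<open>The inverse jacobian is only defined almost everywhere, so the Hoelder condition is required
  of some version \<open>u\<close> of its logarithm.\<close>

definition locally_holder_distortion ::
  "'a measure \<Rightarrow> ('a \<Rightarrow> 'a) \<Rightarrow> 'a set set \<Rightarrow> 'a set set \<Rightarrow> real \<Rightarrow> bool" where
  "locally_holder_distortion M T \<alpha> \<gamma> \<theta> \<longleftrightarrow>
    (\<exists>u C. (AE x in restrict_space M (\<Union>\<gamma>). u x = ln (inverse_jacobian M T \<alpha> \<gamma> x)) \<and>
       (\<forall>x\<in>\<Union>\<gamma>. \<forall>y\<in>\<Union>\<gamma>. separation_time T \<alpha> \<gamma> x y \<ge> 1 \<longrightarrow>
          \<bar>u x - u y\<bar> \<le> C * epower \<theta> (separation_time T \<alpha> \<gamma> x y)))"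

definition big_image :: "'a measure \<Rightarrow> ('a \<Rightarrow> 'a) \<Rightarrow> 'a set set \<Rightarrow> 'a set set \<Rightarrow> bool" where
  "big_image M T \<alpha> \<gamma> \<longleftrightarrow>
    (\<exists>\<eta>>0. \<forall>d\<in>induced_partition T \<alpha> \<gamma>. measure M (induced_map T (\<Union>\<gamma>) ` d) \<ge> \<eta>)"

text \<open>The least Hoelder constant on \<open>d\<close>; it is \<open>\<infinity>\<close> if there is no finite one.\<close>

definition holder_const ::
  "('a \<Rightarrow> 'a) \<Rightarrow> 'a set set \<Rightarrow> 'a set set \<Rightarrow> real \<Rightarrow> ('a \<Rightarrow> real) \<Rightarrow> 'a set \<Rightarrow> ennreal" where
  "holder_const T \<alpha> \<gamma> \<theta> g d =
    Inf {C. \<forall>x\<in>d. \<forall>y\<in>d.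
      ennreal \<bar>g x - g y\<bar> \<le> C * ennreal (epower \<theta> (separation_time T \<alpha> \<gamma> x y))}"

text \<open>The class \<open>I(X, Y)\<close>, for \<open>Y = \<Union>\<gamma>\<close>.\<close>

definition class_I ::
  "'a measure \<Rightarrow> ('a \<Rightarrow> 'a) \<Rightarrow> 'a set set \<Rightarrow> 'a set set \<Rightarrow> ('a \<Rightarrow> real) set" where
  "class_I M T \<alpha> \<gamma> = {f.
    (\<forall>N::nat. \<exists>C \<theta>. 0 < \<theta> \<and> \<theta> < 1 \<and>
       (let YN = (\<Union>i<N. (T ^^ i) ` \<Union>\<gamma>) in
         (\<forall>x\<in>YN. \<bar>f x\<bar> \<le> C) \<and>
         (\<forall>x\<in>YN. \<forall>y\<in>YN. separation_time T \<alpha> \<gamma> x y \<ge> 1 \<longrightarrow>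
            \<bar>f x - f y\<bar> \<le> C * epower \<theta> (separation_time T \<alpha> \<gamma> x y)))) \<and>
    (\<exists>\<theta>. 0 < \<theta> \<and> \<theta> < 1 \<and>
       (\<Sum>\<^sub>\<infinity>d\<in>induced_partition T \<alpha> \<gamma>.
          of_nat (return_time_on T (\<Union>\<gamma>) d) * emeasure M d *
          holder_const T \<alpha> \<gamma> \<theta> (induced_function T (\<Union>\<gamma>) f) d) < \<infinity>)}"

text \<open>The normal law with mean \<open>0\<close> and variance \<open>v\<close>; \<^const>\<open>normal_density\<close> takes the standard
  deviation as its parameter.\<close>

definition centered_normal :: "real \<Rightarrow> real measure" where
  "centered_normal v =
    (if v = 0 then return borel 0 else density lborel (normal_density 0 (sqrt v)))"

end

theory Submission
  imports Defs "HOL-Complex_Analysis.Great_Picard"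
begin

text \<open>
  Inducing turns the problem into one about the map \<open>F = T\<^sub>Y\<close>, which is a Gibbs-Markov map: its
  jacobian has Hoelder distortion, its images are big, and cylinders generate. The image of an element of
  \<open>\<delta>\<close> is a union of elements only modulo null sets, and the jacobian is only defined almost
  everywhere; removing a null set that is invariant under \<open>T\<close> in both directions makes all these
  properties exact (\<open>gibbs_markov_N\<close>).

  The transfer operator \<open>P\<close> of \<open>F\<close> contracts Hoelder seminorms up to a multiple of the
  supremum (\<open>lasota_yorke\<close>), bounded sets of Hoelder functions are compact for pointwise convergence
  (\<open>hol_compact\<close>), and by ergodicity a fixed point of \<open>P\<close> with mean zero vanishes almost
  everywhere. A compactness argument then bounds a Hoelder function \<open>v\<close> of mean zero by \<open>v - P
  v\<close> (\<open>apriori_bound\<close>), and averages of the partial sums of the Neumann series converge along a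
  subsequence to a solution of \<open>u - P u = w\<close> (\<open>poisson_equation\<close>). Because the local Hoelder
  constants of \<open>f\<^sub>Y\<close> are summable against the measure, \<open>P f\<^sub>Y\<close> is a bounded
  Hoelder function. Solving \<open>u - P u = P f\<^sub>Y\<close> yields \<open>f\<^sub>Y = \<psi> + u \<circ> F -
  u\<close> with \<open>P \<psi> = 0\<close> and \<open>\<psi>\<close> square integrable
  (\<open>gordin_decomposition\<close>): up to a coboundary, \<open>f\<^sub>Y\<close> is a reverse martingale
  difference.

  By Kac's formula the original system is a factor of the tower over \<open>F\<close> whose height is the return time
  (\<open>distr_proj\<close>). Summing \<open>f\<close> along the columns shows that, on the tower, \<open>f\<close>
  is cohomologous to the function that is \<open>\<psi>\<close> on the top floor and \<open>0\<close> elsewhere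
  (\<open>tower_coboundary\<close>). This function is a reverse martingale difference for the tower map, which is
  ergodic, so the central limit theorem for such functions applies on the tower itself. It is proved with
  characteristic functions: blocks of a fixed length \<open>L\<close> are expanded to second order, and the mean
  ergodic theorem replaces the sum of squares over a block by its mean (\<open>cf_block\<close>,
  \<open>cf_limit\<close>). Coboundaries do not affect the limit law (\<open>cf_coboundary\<close>). The variance is
  \<open>\<sigma>\<^sup>2 = \<integral> \<psi>\<^sup>2\<close>.

  If \<open>\<sigma>\<^sup>2 = 0\<close>, then \<open>f\<^sub>Y = u \<circ> F - u\<close>, and following orbits until
  they enter \<open>Y\<close> extends \<open>u\<close> to a function \<open>h\<close> with \<open>f = h \<circ> T -
  h\<close> (\<open>coboundary_from_base\<close>). Conversely, for a coboundary the normalized sums tend to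
  \<open>0\<close> in law.
\<close>

section \<open>Birkhoff sums and the ergodic theorem\<close>

locale pmp = prob_space M for M :: "'a measure" +
  fixes T :: "'a \<Rightarrow> 'a"
  assumes T_meas [measurable]: "T \<in> measurable M M" and T_inv: "distr M M T = M"
begin

lemma iterate_measurable [measurable]: "(T ^^ n) \<in> measurable M M"
  by (induction n) (auto simp: id_def intro: measurable_comp[OF _ T_meas])

lemma iterate_space: "x \<in> space M \<Longrightarrow> (T ^^ n) x \<in> space M"
  using measurable_space[OF iterate_measurable] by blast

lemma distr_iterate: "distr M M (T ^^ n) = M"
proof (induction n)
  case (Suc n)
  have "distr M M (T ^^ Suc n) = distr (distr M M (T ^^ n)) M T"
    by (subst distr_distr) auto
  also have "\<dots> = M" by (simp only: Suc T_inv)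
  finally show ?case .
qed (simp add: distr_id2)

lemma integral_iterate:
  fixes g :: "'a \<Rightarrow> 'b :: {banach, second_countable_topology}"
  assumes [measurable]: "g \<in> borel_measurable M"
  shows "(\<integral>x. g ((T ^^ n) x) \<partial>M) = (\<integral>x. g x \<partial>M)"
  by (subst integral_distr[symmetric, of "T ^^ n" M M]) (auto simp: distr_iterate)

lemma integrable_iterate:
  fixes g :: "'a \<Rightarrow> 'b :: {banach, second_countable_topology}"
  assumes "integrable M g"
  shows "integrable M (\<lambda>x. g ((T ^^ n) x))"
  using integrable_distr[of "T ^^ n" M M g] assms by (auto simp: distr_iterate)

lemma AE_iterate:
  assumes "AE x in M. P x"
  shows "AE x in M. P ((T ^^ n) x)"
  using AE_distrD[of "T ^^ n" M M P] assms unfolding distr_iterate by auto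

definition birkhoff_sum :: "('a \<Rightarrow> 'b :: comm_monoid_add) \<Rightarrow> nat \<Rightarrow> 'a \<Rightarrow> 'b" where
  "birkhoff_sum f n x = (\<Sum>i<n. f ((T ^^ i) x))"

lemma birkhoff_sum_0 [simp]: "birkhoff_sum f 0 x = 0"
  by (simp add: birkhoff_sum_def)

lemma birkhoff_sum_Suc: "birkhoff_sum f (Suc n) x = f x + birkhoff_sum f n (T x)"
  unfolding birkhoff_sum_def by (subst sum.lessThan_Suc_shift) (simp add: funpow_swap1)

lemma birkhoff_sum_add:
  "birkhoff_sum f (m + n) x = birkhoff_sum f m x + birkhoff_sum f n ((T ^^ m) x)"
  by (induction m arbitrary: x) (auto simp: birkhoff_sum_Suc funpow_swap1 add.assoc)

lemma birkhoff_sum_measurable [measurable]: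
  fixes f :: "'a \<Rightarrow> real"
  assumes [measurable]: "f \<in> borel_measurable M"
  shows "birkhoff_sum f n \<in> borel_measurable M"
  unfolding birkhoff_sum_def by measurable

lemma birkhoff_sum_integrable:
  fixes f :: "'a \<Rightarrow> real"
  assumes "integrable M f"
  shows "integrable M (birkhoff_sum f n)"
  unfolding birkhoff_sum_def by (intro Bochner_Integration.integrable_sum integrable_iterate assms)

lemma birkhoff_sum_abs_integral_le:
  fixes f :: "'a \<Rightarrow> real"
  assumes f: "integrable M f"
  shows "(\<integral>x. \<bar>birkhoff_sum f n x\<bar> \<partial>M) \<le> n * (\<integral>x. \<bar>f x\<bar> \<partial>M)"
proof -
  have "(\<integral>x. \<bar>birkhoff_sum f n x\<bar> \<partial>M) \<le> (\<integral>x. (\<Sum>i<n. \<bar>f ((T ^^ i) x)\<bar>) \<partial>M)"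
    unfolding birkhoff_sum_def
    by (intro integral_mono integrable_abs Bochner_Integration.integrable_sum integrable_iterate f sum_abs)
  also have "\<dots> = (\<Sum>i<n. \<integral>x. \<bar>f ((T ^^ i) x)\<bar> \<partial>M)"
    by (intro Bochner_Integration.integral_sum integrable_abs integrable_iterate f)
  also have "\<dots> = n * (\<integral>x. \<bar>f x\<bar> \<partial>M)"
    using integral_iterate[of "\<lambda>x. \<bar>f x\<bar>"] f by simp
  finally show ?thesis .
qed

text \<open>\<open>running_max f n\<close> is \<open>max 0 (S\<^sub>1, \<dots>, S\<^sub>n)\<close> for the Birkhoff sums \<open>S\<^sub>k\<close> of \<open>f\<close>. The recursion is the form
in which Garsia's proof of the maximal ergodic theorem uses it.\<close>

primrec running_max :: "('a \<Rightarrow> real) \<Rightarrow> nat \<Rightarrow> 'a \<Rightarrow> real" where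
  "running_max f 0 = (\<lambda>x. 0)"
| "running_max f (Suc n) = (\<lambda>x. max 0 (f x + running_max f n (T x)))"

lemma running_max_nonneg: "0 \<le> running_max f n x"
  by (cases n) auto

lemma running_max_mono: "running_max f n x \<le> running_max f (Suc n) x"
proof (induction n arbitrary: x)
  case (Suc n)
  show ?case using Suc[of "T x"] by (subst (1 2) running_max.simps) (auto simp: max_def)
qed auto

lemma birkhoff_sum_le_running_max:
  fixes f :: "'a \<Rightarrow> real"
  shows "k \<le> n \<Longrightarrow> birkhoff_sum f k x \<le> running_max f n x"
proof (induction n arbitrary: k x)
  case (Suc n)
  show ?case
  proof (cases k)
    case (Suc j)
    then show ?thesis using Suc.IH[of j "T x"] Suc.prems by (simp add: birkhoff_sum_Suc)
  qed auto
qed auto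

lemma running_max_integrable:
  fixes f :: "'a \<Rightarrow> real"
  assumes f: "integrable M f"
  shows "integrable M (running_max f n)"
proof (induction n)
  case (Suc n)
  then have "integrable M (\<lambda>x. running_max f n (T x))"
    using integrable_iterate[of "running_max f n" 1] by simp
  then show ?case using f by (auto intro!: integrable_max)
qed simp

text \<open>Where the running maximum \<open>M\<^sub>n\<close> is positive, \<open>f = M\<^sub>n - M\<^sub>n\<^sub>-\<^sub>1 \<circ> T \<ge> M\<^sub>n - M\<^sub>n \<circ> T\<close>; elsewhere \<open>M\<^sub>n - M\<^sub>n \<circ> T \<le> 0\<close>. Hence
the integral of \<open>f\<close> over \<open>M\<^sub>n > 0\<close> is at least \<open>\<integral> M\<^sub>n - M\<^sub>n \<circ> T = 0\<close>, and these sets exhaust the space.\<close>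

lemma maximal_ergodic:
  fixes f :: "'a \<Rightarrow> real"
  assumes f: "integrable M f" and pos: "AE x in M. \<exists>n. 0 < birkhoff_sum f n x"
  shows "0 \<le> (\<integral>x. f x \<partial>M)"
proof -
  note [measurable] = borel_measurable_integrable[OF f]
  have [measurable]: "running_max f n \<in> borel_measurable M" for n
    using running_max_integrable[OF f] by auto
  let ?E = "\<lambda>n. {x \<in> space M. 0 < running_max f n x}"
  let ?h = "\<lambda>n x. f x * indicator (?E n) x"
  have int: "integrable M (?h n)" for n
    using f by (intro integrable_real_mult_indicator) auto
  have "0 \<le> (\<integral>x. ?h (Suc n) x \<partial>M)" for n
  proof -
    have *: "(\<integral>x. running_max f (Suc n) (T x) \<partial>M) = (\<integral>x. running_max f (Suc n) x \<partial>M)"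
      using integral_iterate[of "running_max f (Suc n)" 1] by simp
    have "0 = (\<integral>x. running_max f (Suc n) x - running_max f (Suc n) (T x) \<partial>M)"
      using * running_max_integrable[OF f, of "Suc n"]
        integrable_iterate[OF running_max_integrable[OF f, of "Suc n"], of 1]
      by (subst Bochner_Integration.integral_diff) (auto simp del: running_max.simps)
    also have "\<dots> \<le> (\<integral>x. ?h (Suc n) x \<partial>M)"
    proof (rule integral_mono[OF _ int])
      show "integrable M (\<lambda>x. running_max f (Suc n) x - running_max f (Suc n) (T x))"
        using running_max_integrable[OF f, of "Suc n"]
          integrable_iterate[OF running_max_integrable[OF f, of "Suc n"], of 1]
        by (auto simp del: running_max.simps)
      fix x assume x: "x \<in> space M"
      show "running_max f (Suc n) x - running_max f (Suc n) (T x) \<le> ?h (Suc n) x"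
      proof (cases "0 < running_max f (Suc n) x")
        case True
        then have "running_max f (Suc n) x = f x + running_max f n (T x)"
          by (simp add: max_def split: if_splits)
        then show ?thesis using True x running_max_mono[of f n "T x"]
          by (simp del: running_max.simps)
      next
        case False
        then show ?thesis using running_max_nonneg[of f "Suc n" x] running_max_nonneg[of f "Suc n" "T x"]
          by (simp del: running_max.simps)
      qed
    qed
    finally show ?thesis .
  qed
  moreover have "(\<lambda>n. \<integral>x. ?h (Suc n) x \<partial>M) \<longlonglongrightarrow> (\<integral>x. f x \<partial>M)"
  proof (rule integral_dominated_convergence[where w = "\<lambda>x. \<bar>f x\<bar>"])
    show "AE x in M. (\<lambda>n. ?h (Suc n) x) \<longlonglongrightarrow> f x"
      using pos AE_space
    proof eventually_elim
      fix x assume "\<exists>n. 0 < birkhoff_sum f n x" and x: "x \<in> space M"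
      then obtain n where n: "0 < birkhoff_sum f n x" by auto
      have "?h (Suc k) x = f x" if "k \<ge> n" for k
        using birkhoff_sum_le_running_max[of n "Suc k" f x] n that x
        by (simp del: running_max.simps)
      then show "(\<lambda>n. ?h (Suc n) x) \<longlonglongrightarrow> f x"
        by (intro tendsto_eventually) (auto simp: eventually_sequentially)
    qed
    show "AE x in M. norm (?h (Suc n) x) \<le> \<bar>f x\<bar>" for n
      by (intro AE_I2) (auto simp: indicator_def simp del: running_max.simps)
  qed (use f in \<open>auto simp del: running_max.simps\<close>)
  ultimately show ?thesis by (intro LIMSEQ_le_const) auto
qed

lemma integrable_bounded:
  fixes g :: "'a \<Rightarrow> 'b :: {banach, second_countable_topology}"
  assumes "g \<in> borel_measurable M" "\<And>x. x \<in> space M \<Longrightarrow> norm (g x) \<le> B"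
  shows "integrable M g"
  using assms by (intro integrable_const_bound[of _ B]) auto

end

locale ergodic_pmp = pmp +
  assumes ergodic: "\<And>A. A \<in> sets M \<Longrightarrow> T -` A \<inter> space M = A \<Longrightarrow> prob A = 0 \<or> prob A = 1"
begin

text \<open>The set where the Birkhoff sums of \<open>f - e\<close> are unbounded above is invariant. If it had full measure, the
maximal ergodic theorem would give \<open>\<integral> f - e \<ge> 0\<close>; so it is null by ergodicity.\<close>

lemma birkhoff_upper:
  assumes f: "integrable M f" and mean: "(\<integral>x. f x \<partial>M) = 0" and e: "e > (0::real)"
  shows "AE x in M. \<exists>K. \<forall>n. birkhoff_sum f n x \<le> n * e + K"
proof -
  note [measurable] = borel_measurable_integrable[OF f]
  let ?f = "\<lambda>x. f x - e"
  have b: "birkhoff_sum ?f n x = birkhoff_sum f n x - n * e" for n x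
    by (simp add: birkhoff_sum_def sum_subtractf)
  define U where "U = {x \<in> space M. \<forall>K::nat. \<exists>n. birkhoff_sum ?f n x > K}"
  have U: "U \<in> sets M" unfolding U_def by measurable
  have "T x \<in> U \<longleftrightarrow> x \<in> U" if x: "x \<in> space M" for x
  proof
    assume "T x \<in> U"
    then have *: "\<exists>n. birkhoff_sum ?f n (T x) > K" for K :: nat by (auto simp: U_def)
    have "\<exists>n. birkhoff_sum ?f n x > K" for K :: nat
    proof -
      obtain n where "birkhoff_sum ?f n (T x) > K + nat \<lceil>\<bar>?f x\<bar>\<rceil>" using *[of "K + nat \<lceil>\<bar>?f x\<bar>\<rceil>"] by auto
      moreover have "real (nat \<lceil>\<bar>?f x\<bar>\<rceil>) \<ge> \<bar>?f x\<bar>" by (rule real_nat_ceiling_ge)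
      ultimately have "birkhoff_sum ?f (Suc n) x > K" unfolding birkhoff_sum_Suc by linarith
      then show ?thesis by blast
    qed
    then show "x \<in> U" using x by (auto simp: U_def)
  next
    assume "x \<in> U"
    then have *: "\<exists>n. birkhoff_sum ?f n x > K" for K :: nat by (auto simp: U_def)
    have "\<exists>n. birkhoff_sum ?f n (T x) > K" for K :: nat
    proof -
      obtain n where n: "birkhoff_sum ?f n x > K + nat \<lceil>\<bar>?f x\<bar>\<rceil>" using *[of "K + nat \<lceil>\<bar>?f x\<bar>\<rceil>"] by auto
      have "n \<noteq> 0"
      proof
        assume "n = 0"
        with n have "real K + real (nat \<lceil>\<bar>?f x\<bar>\<rceil>) < 0" by (simp only: birkhoff_sum_0 of_nat_add)
        then show False by linarith
      qed
      then obtain m where m: "n = Suc m" by (cases n) auto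
      have "real (nat \<lceil>\<bar>?f x\<bar>\<rceil>) \<ge> \<bar>?f x\<bar>" by (rule real_nat_ceiling_ge)
      then have "birkhoff_sum ?f m (T x) > K" using n unfolding m birkhoff_sum_Suc by linarith
      then show ?thesis by blast
    qed
    then show "T x \<in> U" using x measurable_space[OF T_meas x] by (auto simp: U_def)
  qed
  then have "T -` U \<inter> space M = U" using sets.sets_into_space[OF U] by auto
  from ergodic[OF U this] have "prob U = 0"
  proof
    assume "prob U = 1"
    then have "AE x in M. x \<in> U" using U by (simp add: AE_prob_1)
    then have "AE x in M. \<exists>n. 0 < birkhoff_sum ?f n x"
    proof eventually_elim
      fix x assume "x \<in> U"
      then have "\<exists>n. real 0 < birkhoff_sum ?f n x" unfolding U_def by blast
      then show "\<exists>n. 0 < birkhoff_sum ?f n x" by simp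
    qed
    then have "0 \<le> (\<integral>x. ?f x \<partial>M)" using f by (intro maximal_ergodic) auto
    then show ?thesis using mean f e prob_space by simp
  qed
  then have "U \<in> null_sets M" using U by (simp add: null_sets_def emeasure_eq_measure)
  then have "AE x in M. x \<notin> U" by (rule AE_not_in)
  then show ?thesis using AE_space
  proof eventually_elim
    fix x assume "x \<notin> U" "x \<in> space M"
    then obtain K :: nat where "\<forall>n. birkhoff_sum ?f n x \<le> K" unfolding U_def by (auto simp: not_less)
    then show "\<exists>K. \<forall>n. birkhoff_sum f n x \<le> n * e + K" unfolding b by (intro exI[of _ "real K"]) (auto simp: algebra_simps)
  qed
qed

lemma birkhoff_AE:
  assumes f: "integrable M f" and mean: "(\<integral>x. f x \<partial>M) = 0"
  shows "AE x in M. (\<lambda>n. birkhoff_sum f n x / n) \<longlonglongrightarrow> (0::real)"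
proof -
  have "AE x in M. \<forall>k::nat. (\<exists>K. \<forall>n. birkhoff_sum f n x \<le> n * (1 / Suc k) + K) \<and>
      (\<exists>K. \<forall>n. birkhoff_sum (\<lambda>x. - f x) n x \<le> n * (1 / Suc k) + K)"
    unfolding AE_all_countable using f mean
    by (intro allI AE_conjI birkhoff_upper) auto
  then show ?thesis
  proof eventually_elim
    fix x
    assume H: "\<forall>k::nat. (\<exists>K. \<forall>n. birkhoff_sum f n x \<le> n * (1 / Suc k) + K) \<and>
      (\<exists>K. \<forall>n. birkhoff_sum (\<lambda>x. - f x) n x \<le> n * (1 / Suc k) + K)"
    have neg: "birkhoff_sum (\<lambda>x. - f x) n x = - birkhoff_sum f n x" for n
      by (simp add: birkhoff_sum_def sum_negf)
    show "(\<lambda>n. birkhoff_sum f n x / n) \<longlonglongrightarrow> 0"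
    proof (rule LIMSEQ_I)
      fix r :: real assume r: "r > 0"
      obtain k where k: "1 / real (Suc k) < r / 2"
        using nat_approx_posE[of "r/2"] r by (auto simp: field_simps)
      obtain K1 K2 where K: "\<And>n. birkhoff_sum f n x \<le> n * (1 / Suc k) + K1"
          "\<And>n. - birkhoff_sum f n x \<le> n * (1 / Suc k) + K2"
        using H neg by metis
      define K where "K = max \<bar>K1\<bar> \<bar>K2\<bar>"
      have ab: "\<bar>birkhoff_sum f n x\<bar> \<le> n * (1 / Suc k) + K" for n
        using K[of n] unfolding K_def by linarith
      have K0: "0 \<le> K" by (simp add: K_def)
      obtain N :: nat where "K < real N * (r / 2)" using reals_Archimedean3[of "r/2"] r by auto
      moreover from this K0 have "N > 0" by (auto intro!: Nat.gr0I)
      ultimately have N: "N > 0" "K / N < r / 2"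
        by (auto simp: pos_divide_less_eq mult.commute)
      show "\<exists>no. \<forall>n\<ge>no. norm (birkhoff_sum f n x / n - 0) < r"
      proof (intro exI allI impI)
        fix n assume n: "n \<ge> N"
        have "\<bar>birkhoff_sum f n x\<bar> / n \<le> 1 / Suc k + K / n"
        proof -
          have "\<bar>birkhoff_sum f n x\<bar> / n \<le> (n * (1 / Suc k) + K) / n"
            by (rule divide_right_mono[OF ab]) simp
          also have "\<dots> = 1 / Suc k + K / n" using n N by (simp add: add_divide_distrib)
          finally show ?thesis .
        qed
        also have "K / n \<le> K / N" using n N K0 by (intro divide_left_mono) auto
        finally have "\<bar>birkhoff_sum f n x\<bar> / n < r" using k N(2) by linarith
        then show "norm (birkhoff_sum f n x / n - 0) < r" by simp
      qed
    qed
  qed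
qed

lemma mean_ergodic_bounded:
  assumes [measurable]: "f \<in> borel_measurable M" and B: "\<And>x. x \<in> space M \<Longrightarrow> \<bar>f x\<bar> \<le> B"
  shows "(\<lambda>n. \<integral>x. \<bar>birkhoff_sum f n x / n - (\<integral>x. f x \<partial>M)\<bar> \<partial>M) \<longlonglongrightarrow> (0::real)"
proof -
  have f: "integrable M f" by (rule integrable_bounded[of _ B]) (use B in auto)
  define c where "c = (\<integral>x. f x \<partial>M)"
  let ?f = "\<lambda>x. f x - c"
  have "AE x in M. (\<lambda>n. birkhoff_sum ?f n x / n) \<longlonglongrightarrow> 0"
    using f by (intro birkhoff_AE) (auto simp: c_def prob_space)
  then have ae: "AE x in M. (\<lambda>n. \<bar>birkhoff_sum f n x / n - c\<bar>) \<longlonglongrightarrow> 0"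
  proof eventually_elim
    fix x assume a: "(\<lambda>n. birkhoff_sum ?f n x / n) \<longlonglongrightarrow> 0"
    have "\<forall>\<^sub>F n in sequentially. birkhoff_sum ?f n x / n = birkhoff_sum f n x / n - c"
      using eventually_gt_at_top[of 0]
      by eventually_elim (auto simp: birkhoff_sum_def sum_subtractf field_simps)
    from Lim_transform_eventually[OF a this] show "(\<lambda>n. \<bar>birkhoff_sum f n x / n - c\<bar>) \<longlonglongrightarrow> 0"
      by (rule tendsto_rabs_zero)
  qed
  have bd: "\<bar>birkhoff_sum f n x\<bar> \<le> n * B" if "x \<in> space M" for n x
    unfolding birkhoff_sum_def
    by (rule order.trans[OF sum_abs])
      (use B iterate_space[OF that] in \<open>auto intro!: sum_bounded_above[where A = "{..<n}", simplified]\<close>)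
  have "(\<lambda>n. \<integral>x. \<bar>birkhoff_sum f n x / n - c\<bar> \<partial>M) \<longlonglongrightarrow> (\<integral>x. 0 \<partial>M)"
  proof (rule integral_dominated_convergence[where w = "\<lambda>x. \<bar>B\<bar> + \<bar>c\<bar>"])
    show "AE x in M. norm \<bar>birkhoff_sum f n x / n - c\<bar> \<le> \<bar>B\<bar> + \<bar>c\<bar>" for n
    proof (rule AE_I2)
      fix x assume x: "x \<in> space M"
      have "\<bar>birkhoff_sum f n x / n\<bar> \<le> \<bar>B\<bar>"
      proof (cases "n = 0")
        case False
        have "real n * B \<le> real n * \<bar>B\<bar>" by (intro mult_left_mono) auto
        with bd[OF x, of n] have "\<bar>birkhoff_sum f n x\<bar> \<le> \<bar>B\<bar> * n" by (simp add: mult.commute)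
        then show ?thesis using False by (simp add: field_simps)
      qed simp
      then show "norm \<bar>birkhoff_sum f n x / n - c\<bar> \<le> \<bar>B\<bar> + \<bar>c\<bar>"
        unfolding real_norm_def by linarith
    qed
  qed (use ae in auto)
  then show ?thesis by (simp add: c_def)
qed

text \<open>The pointwise theorem gives convergence in \<open>L\<^sup>1\<close> for bounded functions by dominated convergence; a general
\<open>f\<close> is truncated, since averaging does not increase the \<open>L\<^sup>1\<close> norm.\<close>

lemma mean_ergodic:
  assumes f: "integrable M f"
  shows "(\<lambda>n. \<integral>x. \<bar>birkhoff_sum f n x / n - (\<integral>x. f x \<partial>M)\<bar> \<partial>M) \<longlonglongrightarrow> (0::real)"
proof (rule LIMSEQ_I)
  note [measurable] = borel_measurable_integrable[OF f]
  fix r :: real assume r: "r > 0"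
  let ?g = "\<lambda>k::nat. \<lambda>x. if \<bar>f x\<bar> \<le> k then f x else 0"
  have "(\<lambda>k. \<integral>x. \<bar>f x - ?g k x\<bar> \<partial>M) \<longlonglongrightarrow> (\<integral>x. 0 \<partial>M)"
  proof (rule integral_dominated_convergence[where w = "\<lambda>x. \<bar>f x\<bar>"])
    show "AE x in M. (\<lambda>k. \<bar>f x - ?g k x\<bar>) \<longlonglongrightarrow> 0"
    proof (rule AE_I2)
      fix x
      have "\<bar>f x - ?g k x\<bar> = 0" if "k \<ge> nat \<lceil>\<bar>f x\<bar>\<rceil>" for k
        using that real_nat_ceiling_ge[of "\<bar>f x\<bar>"] by auto
      then show "(\<lambda>k. \<bar>f x - ?g k x\<bar>) \<longlonglongrightarrow> 0"
        unfolding tendsto_iff eventually_sequentially by (metis dist_self)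
    qed
  qed (use f in auto)
  then have "\<forall>\<^sub>F k in sequentially. (\<integral>x. \<bar>f x - ?g k x\<bar> \<partial>M) < r / 3"
    using r by (intro order_tendstoD(2)) auto
  then obtain k where k: "(\<integral>x. \<bar>f x - ?g k x\<bar> \<partial>M) < r / 3"
    by (auto simp: eventually_sequentially)
  let ?g = "?g k"
  have g: "integrable M ?g" by (rule integrable_bounded[of _ k]) auto
  define cf cg where "cf = (\<integral>x. f x \<partial>M)" and "cg = (\<integral>x. ?g x \<partial>M)"
  have c: "\<bar>cg - cf\<bar> < r / 3"
  proof -
    have "\<bar>cg - cf\<bar> = \<bar>\<integral>x. f x - ?g x \<partial>M\<bar>" using f g by (simp add: cf_def cg_def)
    also have "\<dots> \<le> (\<integral>x. \<bar>f x - ?g x\<bar> \<partial>M)" by (rule integral_abs_bound)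
    finally show ?thesis using k by simp
  qed
  have "(\<lambda>n. \<integral>x. \<bar>birkhoff_sum ?g n x / n - cg\<bar> \<partial>M) \<longlonglongrightarrow> 0"
    unfolding cg_def by (rule mean_ergodic_bounded[of _ k]) auto
  then have "\<forall>\<^sub>F n in sequentially. (\<integral>x. \<bar>birkhoff_sum ?g n x / n - cg\<bar> \<partial>M) < r / 3"
    using r by (intro order_tendstoD(2)) auto
  then have "\<forall>\<^sub>F n in sequentially. (\<integral>x. \<bar>birkhoff_sum f n x / n - cf\<bar> \<partial>M) < r"
    using eventually_gt_at_top[of 0]
  proof eventually_elim
    fix n :: nat assume n: "(\<integral>x. \<bar>birkhoff_sum ?g n x / n - cg\<bar> \<partial>M) < r / 3" "n > 0"
    note [simp] = birkhoff_sum_integrable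
    have tri: "a = b + d \<Longrightarrow> \<bar>a - c1\<bar> \<le> \<bar>b\<bar> + \<bar>d - c2\<bar> + \<bar>c2 - c1\<bar>" for a b d c1 c2 :: real
      by linarith
    have d: "birkhoff_sum f n x - birkhoff_sum ?g n x = birkhoff_sum (\<lambda>x. f x - ?g x) n x" for x
      by (simp add: birkhoff_sum_def sum_subtractf)
    have "(\<integral>x. \<bar>birkhoff_sum f n x / n - cf\<bar> \<partial>M) \<le>
      (\<integral>x. \<bar>birkhoff_sum (\<lambda>x. f x - ?g x) n x\<bar> / n + \<bar>birkhoff_sum ?g n x / n - cg\<bar> + \<bar>cg - cf\<bar> \<partial>M)"
    proof (rule integral_mono)
      fix x
      have "birkhoff_sum f n x / n = birkhoff_sum (\<lambda>x. f x - ?g x) n x / n + birkhoff_sum ?g n x / n"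
        unfolding d[symmetric] by (simp add: diff_divide_distrib)
      then show "\<bar>birkhoff_sum f n x / n - cf\<bar> \<le> \<bar>birkhoff_sum (\<lambda>x. f x - ?g x) n x\<bar> / n + \<bar>birkhoff_sum ?g n x / n - cg\<bar> + \<bar>cg - cf\<bar>"
        using tri[of "birkhoff_sum f n x / n" "birkhoff_sum (\<lambda>x. f x - ?g x) n x / n"
            "birkhoff_sum ?g n x / n" cf cg] by (simp only: abs_divide abs_of_nat)
    qed (use f g in auto)
    also have "\<dots> = (\<integral>x. \<bar>birkhoff_sum (\<lambda>x. f x - ?g x) n x\<bar> \<partial>M) / n
        + (\<integral>x. \<bar>birkhoff_sum ?g n x / n - cg\<bar> \<partial>M) + \<bar>cg - cf\<bar>"
      using f g by (simp add: prob_space)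
    also have "(\<integral>x. \<bar>birkhoff_sum (\<lambda>x. f x - ?g x) n x\<bar> \<partial>M) / n \<le> (\<integral>x. \<bar>f x - ?g x\<bar> \<partial>M)"
      using birkhoff_sum_abs_integral_le[of "\<lambda>x. f x - ?g x" n] f g n by (simp add: field_simps)
    finally show "(\<integral>x. \<bar>birkhoff_sum f n x / n - cf\<bar> \<partial>M) < r" using n k c by simp
  qed
  then show "\<exists>no. \<forall>n\<ge>no. norm ((\<integral>x. \<bar>birkhoff_sum f n x / n - (\<integral>x. f x \<partial>M)\<bar> \<partial>M) - 0) < r"
    by (auto simp: cf_def eventually_sequentially)
qed

end

context pmp begin

section \<open>Characteristic functions of Birkhoff sums\<close>

text \<open>In terms of conditional expectations: \<open>E[\<psi> | T\<^sup>-\<^sup>1 \<B>] = 0\<close>. Thus the \<open>\<psi> \<circ> T\<^sup>n\<close> are martingale differences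
for the decreasing filtration \<open>T\<^sup>-\<^sup>n \<B>\<close>.\<close>

definition reverse_martingale_difference :: "('a \<Rightarrow> real) \<Rightarrow> bool" where
  "reverse_martingale_difference \<psi> \<longleftrightarrow> \<psi> \<in> borel_measurable M \<and> integrable M (\<lambda>x. (\<psi> x)\<^sup>2) \<and>
    (\<forall>g B. g \<in> borel_measurable M \<longrightarrow> (\<forall>x\<in>space M. \<bar>g x\<bar> \<le> B) \<longrightarrow> (\<integral>x. \<psi> x * g (T x) \<partial>M) = 0)"

lemma reverse_martingale_difference_real:
  assumes psi: "reverse_martingale_difference \<psi>" and [measurable]: "g \<in> borel_measurable M"
    and int: "integrable M (\<lambda>x. \<psi> x * g (T x))"
  shows "(\<integral>x. \<psi> x * g (T x) \<partial>M) = (0::real)"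
proof -
  have [measurable]: "\<psi> \<in> borel_measurable M" using psi by (simp add: reverse_martingale_difference_def)
  let ?g = "\<lambda>k::nat. \<lambda>x. if \<bar>g x\<bar> \<le> k then g x else 0"
  have "(\<lambda>k. \<integral>x. \<psi> x * ?g k (T x) \<partial>M) \<longlonglongrightarrow> (\<integral>x. \<psi> x * g (T x) \<partial>M)"
  proof (rule integral_dominated_convergence[where w = "\<lambda>x. \<bar>\<psi> x * g (T x)\<bar>"])
    show "AE x in M. (\<lambda>k. \<psi> x * ?g k (T x)) \<longlonglongrightarrow> \<psi> x * g (T x)"
    proof (rule AE_I2)
      fix x
      have "\<psi> x * ?g k (T x) = \<psi> x * g (T x)" if "k \<ge> nat \<lceil>\<bar>g (T x)\<bar>\<rceil>" for k
        using that real_nat_ceiling_ge[of "\<bar>g (T x)\<bar>"] by auto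
      then show "(\<lambda>k. \<psi> x * ?g k (T x)) \<longlonglongrightarrow> \<psi> x * g (T x)"
        unfolding tendsto_iff eventually_sequentially by (metis dist_self)
    qed
  qed (use int in auto)
  moreover have "(\<integral>x. \<psi> x * ?g k (T x) \<partial>M) = 0" for k
  proof -
    have "?g k \<in> borel_measurable M" by measurable
    moreover have "\<forall>x\<in>space M. \<bar>?g k x\<bar> \<le> k" by auto
    ultimately show ?thesis using psi unfolding reverse_martingale_difference_def by blast
  qed
  ultimately show ?thesis by (simp add: LIMSEQ_const_iff)
qed

lemma reverse_martingale_difference_complex:
  fixes g :: "'a \<Rightarrow> complex"
  assumes psi: "reverse_martingale_difference \<psi>" and [measurable]: "g \<in> borel_measurable M"
    and int: "integrable M (\<lambda>x. \<psi> x *\<^sub>R g (T x))"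
  shows "(\<integral>x. \<psi> x *\<^sub>R g (T x) \<partial>M) = 0"
proof (rule complex_eqI)
  have "integrable M (\<lambda>x. \<psi> x * Re (g (T x)))" "integrable M (\<lambda>x. \<psi> x * Im (g (T x)))"
    using integrable_Re[OF int] integrable_Im[OF int] by auto
  then show "Re (\<integral>x. \<psi> x *\<^sub>R g (T x) \<partial>M) = Re 0" "Im (\<integral>x. \<psi> x *\<^sub>R g (T x) \<partial>M) = Im 0"
    using integral_Re[OF int] integral_Im[OF int]
      reverse_martingale_difference_real[OF psi, of "\<lambda>x. Re (g x)"]
      reverse_martingale_difference_real[OF psi, of "\<lambda>x. Im (g x)"] by auto
qed

lemma square_integrable_imp_integrable':
  fixes u :: "'a \<Rightarrow> real"
  assumes [measurable]: "u \<in> borel_measurable M" and u: "integrable M (\<lambda>x. (u x)\<^sup>2)"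
  shows "integrable M u"
  using u by (rule square_integrable_imp_integrable[rotated]) simp

lemma integrable_prod_square:
  fixes u v :: "'a \<Rightarrow> real"
  assumes [measurable]: "u \<in> borel_measurable M" "v \<in> borel_measurable M"
    and u: "integrable M (\<lambda>x. (u x)\<^sup>2)" and v: "integrable M (\<lambda>x. (v x)\<^sup>2)"
  shows "integrable M (\<lambda>x. u x * v x)"
proof (rule Bochner_Integration.integrable_bound)
  show "integrable M (\<lambda>x. (u x)\<^sup>2 + (v x)\<^sup>2)" using u v by auto
  have "\<bar>a * b\<bar> \<le> a\<^sup>2 + b\<^sup>2" for a b :: real
  proof -
    have "2 * (\<bar>a\<bar> * \<bar>b\<bar>) \<le> a\<^sup>2 + b\<^sup>2" using sum_squares_bound[of "\<bar>a\<bar>" "\<bar>b\<bar>"] by simp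
    moreover have "0 \<le> \<bar>a\<bar> * \<bar>b\<bar>" by simp
    ultimately show ?thesis unfolding abs_mult by linarith
  qed
  then show "AE x in M. norm (u x * v x) \<le> norm ((u x)\<^sup>2 + (v x)\<^sup>2)"
    by (intro AE_I2) simp
qed simp

lemma integrable_sum_square:
  fixes u v :: "'a \<Rightarrow> real"
  assumes [measurable]: "u \<in> borel_measurable M" "v \<in> borel_measurable M"
    and u: "integrable M (\<lambda>x. (u x)\<^sup>2)" and v: "integrable M (\<lambda>x. (v x)\<^sup>2)"
  shows "integrable M (\<lambda>x. (u x + v x)\<^sup>2)"
  unfolding power2_sum using u v integrable_prod_square[OF assms]
  by (auto simp: mult.assoc)

lemma birkhoff_sum_square_integrable:
  fixes \<psi> :: "'a \<Rightarrow> real"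
  assumes [measurable]: "\<psi> \<in> borel_measurable M" and "integrable M (\<lambda>x. (\<psi> x)\<^sup>2)"
  shows "integrable M (\<lambda>x. (birkhoff_sum \<psi> n x)\<^sup>2)"
proof (induction n)
  case (Suc n)
  then show ?case unfolding birkhoff_sum_Suc
    using assms(2) integrable_iterate[OF Suc, of 1] by (intro integrable_sum_square) auto
qed simp

lemma integrable_scaleR_bounded:
  fixes u :: "'a \<Rightarrow> real" and H :: "'a \<Rightarrow> complex"
  assumes u: "integrable M u" and [measurable]: "H \<in> borel_measurable M"
    and H: "\<And>x. x \<in> space M \<Longrightarrow> norm (H x) \<le> 1"
  shows "integrable M (\<lambda>x. u x *\<^sub>R H x)"
proof (rule Bochner_Integration.integrable_bound[OF u])
  show "AE x in M. norm (u x *\<^sub>R H x) \<le> norm (u x)"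
    using H by (intro AE_I2) (auto intro: mult_left_le)
qed (use u in auto)

text \<open>The first and the second moment of a block of length \<open>L\<close>, tested against a function of the future after the block.
Each term \<open>\<psi> \<circ> T\<^sup>i\<close> is orthogonal to functions of later times, so the mean vanishes and, in the second moment,
only the diagonal terms survive.\<close>

lemma block_first_moment:
  fixes H :: "'a \<Rightarrow> complex"
  assumes psi: "reverse_martingale_difference \<psi>" and [measurable]: "H \<in> borel_measurable M"
    and H: "\<And>x. x \<in> space M \<Longrightarrow> norm (H x) \<le> 1"
  shows "(\<integral>x. birkhoff_sum \<psi> L x *\<^sub>R H ((T ^^ L) x) \<partial>M) = 0"
proof (induction L)
  case (Suc L)
  have [measurable]: "\<psi> \<in> borel_measurable M" and psi2: "integrable M (\<lambda>x. (\<psi> x)\<^sup>2)"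
    using psi by (auto simp: reverse_martingale_difference_def)
  have psi1: "integrable M \<psi>" using psi2 by (rule square_integrable_imp_integrable'[rotated]) simp
  let ?h = "\<lambda>x. H ((T ^^ L) x)"
  have h: "norm (?h x) \<le> 1" if "x \<in> space M" for x using H iterate_space that by auto
  have hT: "norm (?h (T x)) \<le> 1" if "x \<in> space M" for x using h measurable_space[OF T_meas that] by auto
  have i1: "integrable M (\<lambda>x. \<psi> x *\<^sub>R ?h (T x))"
    using hT by (intro integrable_scaleR_bounded psi1) auto
  have i2: "integrable M (\<lambda>x. birkhoff_sum \<psi> L x *\<^sub>R ?h x)"
    using h by (intro integrable_scaleR_bounded birkhoff_sum_integrable psi1) auto
  have "(\<integral>x. birkhoff_sum \<psi> (Suc L) x *\<^sub>R H ((T ^^ Suc L) x) \<partial>M)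
     = (\<integral>x. \<psi> x *\<^sub>R ?h (T x) + birkhoff_sum \<psi> L (T x) *\<^sub>R ?h (T x) \<partial>M)"
    by (simp add: birkhoff_sum_Suc scaleR_add_left funpow_swap1)
  also have "\<dots> = (\<integral>x. \<psi> x *\<^sub>R ?h (T x) \<partial>M) + (\<integral>x. birkhoff_sum \<psi> L (T x) *\<^sub>R ?h (T x) \<partial>M)"
    using i1 integrable_iterate[OF i2, of 1] by (intro Bochner_Integration.integral_add) auto
  also have "(\<integral>x. \<psi> x *\<^sub>R ?h (T x) \<partial>M) = 0"
    using i1 by (intro reverse_martingale_difference_complex psi) auto
  also have "(\<integral>x. birkhoff_sum \<psi> L (T x) *\<^sub>R ?h (T x) \<partial>M) = 0"
    using integral_iterate[of "\<lambda>x. birkhoff_sum \<psi> L x *\<^sub>R ?h x" 1] Suc by simp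
  finally show ?case by simp
qed simp

lemma block_second_moment:
  fixes H :: "'a \<Rightarrow> complex"
  assumes psi: "reverse_martingale_difference \<psi>" and [measurable]: "H \<in> borel_measurable M"
    and H: "\<And>x. x \<in> space M \<Longrightarrow> norm (H x) \<le> 1"
  shows "(\<integral>x. (birkhoff_sum \<psi> L x)\<^sup>2 *\<^sub>R H ((T ^^ L) x) \<partial>M)
       = (\<integral>x. birkhoff_sum (\<lambda>x. (\<psi> x)\<^sup>2) L x *\<^sub>R H ((T ^^ L) x) \<partial>M)"
proof (induction L)
  case (Suc L)
  have [measurable]: "\<psi> \<in> borel_measurable M" and psi2: "integrable M (\<lambda>x. (\<psi> x)\<^sup>2)"
    using psi by (auto simp: reverse_martingale_difference_def)
  let ?h = "\<lambda>x. H ((T ^^ L) x)" and ?S = "birkhoff_sum \<psi> L" and ?Q = "birkhoff_sum (\<lambda>x. (\<psi> x)\<^sup>2)"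
  have h: "norm (?h x) \<le> 1" if "x \<in> space M" for x using H iterate_space that by auto
  have hT: "norm (?h (T x)) \<le> 1" if "x \<in> space M" for x using h measurable_space[OF T_meas that] by auto
  have S2: "integrable M (\<lambda>x. (?S x)\<^sup>2)" using psi2 by (intro birkhoff_sum_square_integrable) auto
  have S2T: "integrable M (\<lambda>x. (?S (T x))\<^sup>2)" using integrable_iterate[OF S2, of 1] by simp
  have i1: "integrable M (\<lambda>x. (\<psi> x)\<^sup>2 *\<^sub>R ?h (T x))"
    using hT psi2 by (intro integrable_scaleR_bounded) auto
  have i2: "integrable M (\<lambda>x. \<psi> x *\<^sub>R (?S (T x) *\<^sub>R ?h (T x)))"
    unfolding scaleR_scaleR using hT psi2 S2T
    by (intro integrable_scaleR_bounded integrable_prod_square) auto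
  have i3: "integrable M (\<lambda>x. (?S x)\<^sup>2 *\<^sub>R ?h x)"
    using h by (intro integrable_scaleR_bounded S2) auto
  have i3T: "integrable M (\<lambda>x. (?S (T x))\<^sup>2 *\<^sub>R ?h (T x))"
    using integrable_iterate[OF i3, of 1] by simp
  have i4: "integrable M (\<lambda>x. ?Q L x *\<^sub>R ?h x)"
    using h psi2 by (intro integrable_scaleR_bounded birkhoff_sum_integrable) auto
  have i4T: "integrable M (\<lambda>x. ?Q L (T x) *\<^sub>R ?h (T x))"
    using integrable_iterate[OF i4, of 1] by simp
  have "(\<integral>x. (birkhoff_sum \<psi> (Suc L) x)\<^sup>2 *\<^sub>R H ((T ^^ Suc L) x) \<partial>M)
     = (\<integral>x. (\<psi> x)\<^sup>2 *\<^sub>R ?h (T x) + 2 *\<^sub>R (\<psi> x *\<^sub>R (?S (T x) *\<^sub>R ?h (T x))) + (?S (T x))\<^sup>2 *\<^sub>R ?h (T x) \<partial>M)"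
    by (simp add: birkhoff_sum_Suc power2_sum scaleR_add_left funpow_swap1 algebra_simps)
  also have "\<dots> = (\<integral>x. (\<psi> x)\<^sup>2 *\<^sub>R ?h (T x) \<partial>M) + 2 *\<^sub>R (\<integral>x. \<psi> x *\<^sub>R (?S (T x) *\<^sub>R ?h (T x)) \<partial>M)
      + (\<integral>x. (?S (T x))\<^sup>2 *\<^sub>R ?h (T x) \<partial>M)"
    by (subst Bochner_Integration.integral_add,
      (intro Bochner_Integration.integrable_add integrable_scaleR_right i1 i2 i3T)+)+
      (simp only: integral_scaleR_right)
  also have "(\<integral>x. \<psi> x *\<^sub>R (?S (T x) *\<^sub>R ?h (T x)) \<partial>M) = 0"
    using i2 by (intro reverse_martingale_difference_complex[where g = "\<lambda>x. ?S x *\<^sub>R ?h x"] psi) auto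
  also have "(\<integral>x. (?S (T x))\<^sup>2 *\<^sub>R ?h (T x) \<partial>M) = (\<integral>x. (?S x)\<^sup>2 *\<^sub>R ?h x \<partial>M)"
    using integral_iterate[of "\<lambda>x. (?S x)\<^sup>2 *\<^sub>R ?h x" 1] by simp
  also have "\<dots> = (\<integral>x. ?Q L (T x) *\<^sub>R ?h (T x) \<partial>M)"
    unfolding Suc using integral_iterate[of "\<lambda>x. ?Q L x *\<^sub>R ?h x" 1] by simp
  also have "(\<integral>x. (\<psi> x)\<^sup>2 *\<^sub>R ?h (T x) \<partial>M) + 2 *\<^sub>R 0 + (\<integral>x. ?Q L (T x) *\<^sub>R ?h (T x) \<partial>M)
     = (\<integral>x. ?Q (Suc L) x *\<^sub>R H ((T ^^ Suc L) x) \<partial>M)"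
    using i1 i4T by (simp add: birkhoff_sum_Suc scaleR_add_left funpow_swap1)
  finally show ?case .
qed simp

lemma exp_minus_approx: "0 \<le> x \<Longrightarrow> \<bar>1 - x - exp (- x)\<bar> \<le> x\<^sup>2 / 2" for x :: real
proof -
  assume x: "0 \<le> x"
  have "1 - x \<le> exp (- x)" using exp_ge_add_one_self[of "-x"] by simp
  moreover have "exp (- x) \<le> 1 - x + x\<^sup>2 / 2"
  proof -
    let ?f = "\<lambda>x. 1 - x + x\<^sup>2 / 2 - exp (- x) :: real"
    have "?f 0 \<le> ?f x"
    proof (rule DERIV_nonneg_imp_nondecreasing[OF x])
      fix y :: real assume "0 \<le> y" "y \<le> x"
      have "(?f has_real_derivative (- 1 + y + exp (- y))) (at y)"
        by (auto intro!: derivative_eq_intros)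
      moreover have "0 \<le> - 1 + y + exp (- y)" using exp_ge_add_one_self[of "-y"] by simp
      ultimately show "\<exists>z. (?f has_real_derivative z) (at y) \<and> 0 \<le> z" by blast
    qed
    then show ?thesis by simp
  qed
  ultimately show ?thesis by simp
qed

definition cf :: "('a \<Rightarrow> real) \<Rightarrow> real \<Rightarrow> nat \<Rightarrow> complex" where
  "cf \<psi> s m = (\<integral>x. iexp (s * birkhoff_sum \<psi> m x) \<partial>M)"

definition taylor_error :: "('a \<Rightarrow> real) \<Rightarrow> real \<Rightarrow> real" where
  "taylor_error B s = (\<integral>x. norm (iexp (s * B x) - (1 + \<i> * of_real (s * B x) - of_real ((s * B x)\<^sup>2) / 2)) \<partial>M)"

lemma iexp_taylor2:
  "norm (iexp y - (1 + \<i> * of_real y - of_real (y\<^sup>2) / 2)) \<le> y\<^sup>2"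
  "norm (iexp y - (1 + \<i> * of_real y - of_real (y\<^sup>2) / 2)) \<le> \<bar>y\<bar> ^ 3"
proof -
  have *: "(\<Sum>k\<le>2. (\<i> * of_real y)^k / fact k) = 1 + \<i> * of_real y - of_real (y\<^sup>2) / 2"
    by (simp add: numeral_2_eq_2 fact_numeral power_mult_distrib)
  show "norm (iexp y - (1 + \<i> * of_real y - of_real (y\<^sup>2) / 2)) \<le> y\<^sup>2"
    using iexp_approx2[of y 2] unfolding * by (simp add: fact_numeral)
  have "norm (iexp y - (1 + \<i> * of_real y - of_real (y\<^sup>2) / 2)) \<le> \<bar>y\<bar> ^ 3 / 6"
    using iexp_approx1[of y 2] unfolding * by (simp add: fact_numeral numeral_3_eq_3)
  also have "\<dots> \<le> \<bar>y\<bar> ^ 3" by simp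
  finally show "norm (iexp y - (1 + \<i> * of_real y - of_real (y\<^sup>2) / 2)) \<le> \<bar>y\<bar> ^ 3" .
qed

lemma taylor_error_small:
  assumes [measurable]: "B \<in> borel_measurable M" and B: "integrable M (\<lambda>x. (B x)\<^sup>2)"
  shows "(\<lambda>n. n * taylor_error B (t / sqrt n)) \<longlonglongrightarrow> 0"
proof -
  let ?R = "\<lambda>y. norm (iexp y - (1 + \<i> * of_real y - of_real (y\<^sup>2) / 2))"
  have "(\<lambda>n. \<integral>x. n * ?R (t / sqrt n * B x) \<partial>M) \<longlonglongrightarrow> (\<integral>x. 0 \<partial>M)"
  proof (rule integral_dominated_convergence[where w = "\<lambda>x. t\<^sup>2 * (B x)\<^sup>2"])
    show "AE x in M. (\<lambda>n. n * ?R (t / sqrt n * B x)) \<longlonglongrightarrow> 0"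
    proof (rule AE_I2)
      fix x
      have lim: "(\<lambda>n. \<bar>t * B x\<bar> ^ 3 / sqrt n) \<longlonglongrightarrow> 0"
        by (intro tendsto_divide_0[OF tendsto_const] filterlim_at_top_imp_at_infinity
          filterlim_compose[OF sqrt_at_top filterlim_real_sequentially])
      show "(\<lambda>n. n * ?R (t / sqrt n * B x)) \<longlonglongrightarrow> 0"
      proof (rule tendsto_sandwich[OF _ _ tendsto_const lim])
        show "\<forall>\<^sub>F n in sequentially. n * ?R (t / sqrt n * B x) \<le> \<bar>t * B x\<bar> ^ 3 / sqrt n"
          using eventually_gt_at_top[of 0]
        proof eventually_elim
          fix n :: nat assume n: "n > 0"
          have "n * ?R (t / sqrt n * B x) \<le> n * \<bar>t / sqrt n * B x\<bar> ^ 3"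
            by (intro mult_left_mono iexp_taylor2(2)) auto
          also have "\<dots> = \<bar>t * B x\<bar> ^ 3 * (n / sqrt n ^ 3)"
            by (simp add: power_divide power_mult_distrib abs_mult)
          also have "n / sqrt n ^ 3 = 1 / sqrt n"
            using n by (simp add: numeral_3_eq_3 field_simps)
          finally show "n * ?R (t / sqrt n * B x) \<le> \<bar>t * B x\<bar> ^ 3 / sqrt n" by simp
        qed
      qed auto
    qed
    show "AE x in M. norm (n * ?R (t / sqrt n * B x)) \<le> t\<^sup>2 * (B x)\<^sup>2" for n :: nat
    proof (rule AE_I2)
      fix x
      have "n * ?R (t / sqrt n * B x) \<le> n * (t / sqrt n * B x)\<^sup>2"
        by (intro mult_left_mono iexp_taylor2(1)) auto
      also have "\<dots> \<le> t\<^sup>2 * (B x)\<^sup>2"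
        by (cases "n = 0") (auto simp: power_divide power_mult_distrib)
      finally show "norm (n * ?R (t / sqrt n * B x)) \<le> t\<^sup>2 * (B x)\<^sup>2" by simp
    qed
  qed (use B in auto)
  then show ?thesis unfolding taylor_error_def by simp
qed

text \<open>Expand the exponential of the first block to second order. By the two moment lemmas the linear term
disappears and the quadratic term becomes the integral of the sum of squares \<open>Q\<close> over the block, which is replaced
by its mean \<open>L v\<close>; the last summand is the cost of writing \<open>1 - x\<close> as \<open>exp (- x)\<close>.\<close>

lemma cf_block:
  assumes psi: "reverse_martingale_difference \<psi>" and v: "v = (\<integral>x. (\<psi> x)\<^sup>2 \<partial>M)"
  shows "norm (cf \<psi> s (L + m) - of_real (exp (- (s\<^sup>2 * L * v / 2))) * cf \<psi> s m)
    \<le> taylor_error (birkhoff_sum \<psi> L) s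
      + s\<^sup>2 / 2 * (\<integral>x. \<bar>birkhoff_sum (\<lambda>x. (\<psi> x)\<^sup>2) L x - L * v\<bar> \<partial>M) + (s\<^sup>2 * L * v / 2)\<^sup>2 / 2"
proof -
  have [measurable]: "\<psi> \<in> borel_measurable M" and psi2: "integrable M (\<lambda>x. (\<psi> x)\<^sup>2)"
    using psi by (auto simp: reverse_martingale_difference_def)
  have psi1: "integrable M \<psi>" using psi2 by (rule square_integrable_imp_integrable'[rotated]) simp
  define H where "H = (\<lambda>x. iexp (s * birkhoff_sum \<psi> m x))"
  define h where "h = (\<lambda>x. H ((T ^^ L) x))"
  define B where "B = birkhoff_sum \<psi> L"
  define Q where "Q = birkhoff_sum (\<lambda>x. (\<psi> x)\<^sup>2) L"
  define x0 where "x0 = s\<^sup>2 * L * v / 2"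
  have v0: "0 \<le> v" unfolding v by simp
  then have x0: "0 \<le> x0" by (simp add: x0_def)
  have [measurable]: "H \<in> borel_measurable M" "h \<in> borel_measurable M"
    "B \<in> borel_measurable M" "Q \<in> borel_measurable M"
    unfolding H_def h_def B_def Q_def by measurable
  have H1: "norm (H x) \<le> 1" and h1: "norm (h x) = 1" for x by (auto simp: H_def h_def)
  have B1: "integrable M B" unfolding B_def by (intro birkhoff_sum_integrable psi1)
  have B2: "integrable M (\<lambda>x. (B x)\<^sup>2)" unfolding B_def by (intro birkhoff_sum_square_integrable psi2) auto
  have Q1: "integrable M Q" unfolding Q_def by (intro birkhoff_sum_integrable psi2)
  have ih: "integrable M h" by (rule integrable_bounded[of _ 1]) (auto simp: h1)
  have iB: "integrable M (\<lambda>x. B x *\<^sub>R h x)" "integrable M (\<lambda>x. (B x)\<^sup>2 *\<^sub>R h x)" "integrable M (\<lambda>x. Q x *\<^sub>R h x)"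
    using B1 B2 Q1 h1 by (auto intro!: integrable_scaleR_bounded)
  have cfh: "(\<integral>x. h x \<partial>M) = cf \<psi> s m"
    unfolding h_def cf_def H_def by (rule integral_iterate) measurable
  define p where "p = (\<lambda>x. h x + (\<i> * of_real s) * (B x *\<^sub>R h x) - of_real (s\<^sup>2 / 2) * ((B x)\<^sup>2 *\<^sub>R h x))"
  have ip: "integrable M p" unfolding p_def
    by (intro Bochner_Integration.integrable_diff Bochner_Integration.integrable_add
        integrable_mult_right ih iB)
  have p: "(\<integral>x. p x \<partial>M) = cf \<psi> s m - of_real (s\<^sup>2 / 2) * (\<integral>x. Q x *\<^sub>R h x \<partial>M)"
  proof -
    have "(\<integral>x. p x \<partial>M) = (\<integral>x. h x \<partial>M) + (\<i> * of_real s) * (\<integral>x. B x *\<^sub>R h x \<partial>M)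
        - of_real (s\<^sup>2 / 2) * (\<integral>x. (B x)\<^sup>2 *\<^sub>R h x \<partial>M)"
      unfolding p_def
      by (subst Bochner_Integration.integral_diff Bochner_Integration.integral_add,
        (intro Bochner_Integration.integrable_add integrable_mult_right ih iB)+)+
        (simp only: integral_mult_right_zero)
    also have "(\<integral>x. B x *\<^sub>R h x \<partial>M) = 0"
      unfolding B_def h_def using H1 by (intro block_first_moment psi) auto
    also have "(\<integral>x. (B x)\<^sup>2 *\<^sub>R h x \<partial>M) = (\<integral>x. Q x *\<^sub>R h x \<partial>M)"
      unfolding B_def h_def Q_def using H1 by (intro block_second_moment psi) auto
    finally show ?thesis by (simp add: cfh)
  qed
  have ie: "integrable M (\<lambda>x. iexp (s * birkhoff_sum \<psi> (L + m) x))"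
    by (rule integrable_bounded[of _ 1]) auto
  have 1: "norm (cf \<psi> s (L + m) - (\<integral>x. p x \<partial>M)) \<le> taylor_error B s"
  proof -
    have "cf \<psi> s (L + m) - (\<integral>x. p x \<partial>M) = (\<integral>x. iexp (s * birkhoff_sum \<psi> (L + m) x) - p x \<partial>M)"
      unfolding cf_def using ie ip by simp
    also have "\<dots> = (\<integral>x. (iexp (s * B x) - (1 + \<i> * of_real (s * B x) - of_real ((s * B x)\<^sup>2) / 2)) * h x \<partial>M)"
    proof (intro Bochner_Integration.integral_cong refl)
      fix x
      have "iexp (s * birkhoff_sum \<psi> (L + m) x) = iexp (s * B x) * h x"
        by (simp add: birkhoff_sum_add h_def H_def B_def exp_add[symmetric] distrib_left)
      moreover have "p x = (1 + \<i> * of_real (s * B x) - of_real ((s * B x)\<^sup>2) / 2) * h x"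
        by (simp add: p_def scaleR_conv_of_real power_mult_distrib left_diff_distrib distrib_right mult.assoc)
      ultimately show "iexp (s * birkhoff_sum \<psi> (L + m) x) - p x
          = (iexp (s * B x) - (1 + \<i> * of_real (s * B x) - of_real ((s * B x)\<^sup>2) / 2)) * h x"
        by (simp only: left_diff_distrib)
    qed
    finally have "norm (cf \<psi> s (L + m) - (\<integral>x. p x \<partial>M))
      = norm (\<integral>x. (iexp (s * B x) - (1 + \<i> * of_real (s * B x) - of_real ((s * B x)\<^sup>2) / 2)) * h x \<partial>M)"
      by (rule arg_cong)
    also have "\<dots> \<le> (\<integral>x. norm ((iexp (s * B x) - (1 + \<i> * of_real (s * B x) - of_real ((s * B x)\<^sup>2) / 2)) * h x) \<partial>M)"
      by (rule integral_norm_bound)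
    also have "\<dots> = taylor_error B s" by (simp only: norm_mult h1 mult_1_right taylor_error_def)
    finally show ?thesis .
  qed
  have 2: "norm ((\<integral>x. p x \<partial>M) - of_real (1 - x0) * cf \<psi> s m) \<le> s\<^sup>2 / 2 * (\<integral>x. \<bar>Q x - L * v\<bar> \<partial>M)"
  proof -
    have "(\<integral>x. p x \<partial>M) - of_real (1 - x0) * cf \<psi> s m
        = - (of_real (s\<^sup>2 / 2) * ((\<integral>x. Q x *\<^sub>R h x \<partial>M) - of_real (L * v) * (\<integral>x. h x \<partial>M)))"
      unfolding p cfh x0_def by (simp add: algebra_simps)
    also have "(\<integral>x. Q x *\<^sub>R h x \<partial>M) - of_real (L * v) * (\<integral>x. h x \<partial>M) = (\<integral>x. (Q x - L * v) *\<^sub>R h x \<partial>M)"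
      by (subst scaleR_diff_left, subst Bochner_Integration.integral_diff)
        (use iB(3) ih in \<open>auto simp: scaleR_conv_of_real\<close>)
    finally have "norm ((\<integral>x. p x \<partial>M) - of_real (1 - x0) * cf \<psi> s m) = s\<^sup>2 / 2 * norm (\<integral>x. (Q x - L * v) *\<^sub>R h x \<partial>M)"
      by (simp only: norm_minus_cancel norm_mult norm_of_real abs_of_nonneg[of "s\<^sup>2 / 2"] zero_le_divide_iff
          zero_le_power2 zero_le_numeral simp_thms)
    also have "norm (\<integral>x. (Q x - L * v) *\<^sub>R h x \<partial>M) \<le> (\<integral>x. norm ((Q x - L * v) *\<^sub>R h x) \<partial>M)"
      by (rule integral_norm_bound)
    also have "\<dots> = (\<integral>x. \<bar>Q x - L * v\<bar> \<partial>M)"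
      by (simp only: norm_scaleR h1 mult_1_right)
    finally show ?thesis by (simp add: mult_left_mono)
  qed
  have cf1: "norm (cf \<psi> s m) \<le> 1"
  proof -
    have "norm (cf \<psi> s m) \<le> (\<integral>x. norm (iexp (s * birkhoff_sum \<psi> m x)) \<partial>M)"
      unfolding cf_def by (rule integral_norm_bound)
    then show ?thesis by (simp add: prob_space)
  qed
  have 3: "norm (of_real (1 - x0) * cf \<psi> s m - of_real (exp (- x0)) * cf \<psi> s m) \<le> x0\<^sup>2 / 2"
  proof -
    have "of_real (1 - x0) * cf \<psi> s m - of_real (exp (- x0)) * cf \<psi> s m
        = of_real (1 - x0 - exp (- x0)) * cf \<psi> s m" by (simp add: algebra_simps)
    then have "norm (of_real (1 - x0) * cf \<psi> s m - of_real (exp (- x0)) * cf \<psi> s m)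
        = \<bar>1 - x0 - exp (- x0)\<bar> * norm (cf \<psi> s m)" by (simp only: norm_mult norm_of_real)
    also have "\<dots> \<le> x0\<^sup>2 / 2 * 1" by (intro mult_mono exp_minus_approx x0 cf1) auto
    finally show ?thesis by simp
  qed
  have "cf \<psi> s (L + m) - of_real (exp (- x0)) * cf \<psi> s m = (cf \<psi> s (L + m) - (\<integral>x. p x \<partial>M))
     + ((\<integral>x. p x \<partial>M) - of_real (1 - x0) * cf \<psi> s m) + (of_real (1 - x0) * cf \<psi> s m - of_real (exp (- x0)) * cf \<psi> s m)"
    by simp
  note arg_cong[OF this, of norm]
  also have "norm \<dots> \<le> taylor_error B s + s\<^sup>2 / 2 * (\<integral>x. \<bar>Q x - L * v\<bar> \<partial>M) + x0\<^sup>2 / 2"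
    by (intro norm_triangle_le add_mono 1 2 3)
  finally show ?thesis by (simp add: B_def Q_def x0_def)
qed

lemma cf_blocks:
  assumes psi: "reverse_martingale_difference \<psi>" and v: "v = (\<integral>x. (\<psi> x)\<^sup>2 \<partial>M)"
  shows "norm (cf \<psi> s (q * L) - of_real (exp (- (s\<^sup>2 * L * v / 2) * q)))
    \<le> q * (taylor_error (birkhoff_sum \<psi> L) s
      + s\<^sup>2 / 2 * (\<integral>x. \<bar>birkhoff_sum (\<lambda>x. (\<psi> x)\<^sup>2) L x - L * v\<bar> \<partial>M) + (s\<^sup>2 * L * v / 2)\<^sup>2 / 2)"
    (is "_ \<le> real q * ?E")
proof (induction q)
  case 0 then show ?case by (simp add: cf_def prob_space)
next
  case (Suc q)
  define x0 where "x0 = s\<^sup>2 * L * v / 2"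
  have x0: "0 \<le> x0" unfolding x0_def v by simp
  have e: "exp (- x0 * Suc q) = exp (- x0) * exp (- x0 * q)"
    by (simp add: exp_add[symmetric] algebra_simps)
  have "cf \<psi> s (Suc q * L) - of_real (exp (- x0 * Suc q)) =
      (cf \<psi> s (L + q * L) - of_real (exp (- x0)) * cf \<psi> s (q * L))
     + of_real (exp (- x0)) * (cf \<psi> s (q * L) - of_real (exp (- x0 * q)))"
    unfolding e by (simp add: algebra_simps)
  note arg_cong[OF this, of norm]
  also have "norm \<dots> \<le> ?E + 1 * (q * ?E)"
  proof (intro norm_triangle_le add_mono)
    show "norm (cf \<psi> s (L + q * L) - of_real (exp (- x0)) * cf \<psi> s (q * L)) \<le> ?E"
      using cf_block[OF psi v] by (simp add: x0_def)
    have "norm (of_real (exp (- x0)) :: complex) \<le> 1" using x0 by simp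
    then show "norm (of_real (exp (- x0)) * (cf \<psi> s (q * L) - of_real (exp (- x0 * q)))) \<le> 1 * (q * ?E)"
      unfolding norm_mult using Suc by (intro mult_mono) (auto simp: x0_def)
  qed
  also have "\<dots> = Suc q * ?E" by (simp only: of_nat_Suc distrib_right mult_1)
  finally show ?case by (simp add: x0_def)
qed

lemma iexp_diff_le: "norm (iexp a - iexp b) \<le> \<bar>a - b\<bar>"
proof -
  have "iexp a - iexp b = iexp b * (iexp (a - b) - 1)"
    by (simp add: algebra_simps exp_add[symmetric])
  then have "norm (iexp a - iexp b) = norm (iexp (a - b) - 1)" by (simp add: norm_mult)
  also have "\<dots> \<le> \<bar>a - b\<bar>" using iexp_approx1[of "a - b" 0] by simp
  finally show ?thesis .
qed

lemma cf_remainder: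
  assumes psi: "integrable M \<psi>"
  shows "norm (cf \<psi> s (r + m) - cf \<psi> s m) \<le> \<bar>s\<bar> * (r * (\<integral>x. \<bar>\<psi> x\<bar> \<partial>M))"
proof -
  note [measurable] = borel_measurable_integrable[OF psi]
  have "cf \<psi> s m = (\<integral>x. iexp (s * birkhoff_sum \<psi> m ((T ^^ r) x)) \<partial>M)"
    unfolding cf_def by (rule integral_iterate[symmetric]) measurable
  then have "cf \<psi> s (r + m) - cf \<psi> s m
     = (\<integral>x. iexp (s * birkhoff_sum \<psi> (r + m) x) - iexp (s * birkhoff_sum \<psi> m ((T ^^ r) x)) \<partial>M)"
    unfolding cf_def
    by (subst Bochner_Integration.integral_diff) (auto intro!: integrable_bounded[of _ 1])
  note arg_cong[OF this, of norm]
  also have "norm \<dots> \<le> (\<integral>x. norm (iexp (s * birkhoff_sum \<psi> (r + m) x) - iexp (s * birkhoff_sum \<psi> m ((T ^^ r) x))) \<partial>M)"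
    by (rule integral_norm_bound)
  also have "\<dots> \<le> (\<integral>x. \<bar>s\<bar> * \<bar>birkhoff_sum \<psi> r x\<bar> \<partial>M)"
  proof (rule integral_mono)
    fix x
    have "s * birkhoff_sum \<psi> (r + m) x - s * birkhoff_sum \<psi> m ((T ^^ r) x) = s * birkhoff_sum \<psi> r x"
      by (simp add: birkhoff_sum_add distrib_left)
    then show "norm (iexp (s * birkhoff_sum \<psi> (r + m) x) - iexp (s * birkhoff_sum \<psi> m ((T ^^ r) x))) \<le> \<bar>s\<bar> * \<bar>birkhoff_sum \<psi> r x\<bar>"
      using iexp_diff_le[of "s * birkhoff_sum \<psi> (r + m) x" "s * birkhoff_sum \<psi> m ((T ^^ r) x)"]
      by (simp only: abs_mult)
  next
    show "integrable M (\<lambda>x. norm (iexp (s * birkhoff_sum \<psi> (r + m) x) - iexp (s * birkhoff_sum \<psi> m ((T ^^ r) x))))"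
      by (rule integrable_bounded[of _ 2]) (auto intro!: norm_triangle_le_diff)
  qed (use birkhoff_sum_integrable[OF psi] in auto)
  also have "\<dots> = \<bar>s\<bar> * (\<integral>x. \<bar>birkhoff_sum \<psi> r x\<bar> \<partial>M)" by simp
  also have "\<dots> \<le> \<bar>s\<bar> * (r * (\<integral>x. \<bar>\<psi> x\<bar> \<partial>M))"
    by (intro mult_left_mono birkhoff_sum_abs_integral_le psi) auto
  finally show ?thesis .
qed

end

text \<open>The central limit theorem for stationary ergodic reverse martingale differences, for characteristic functions.
Cut \<open>[0, n)\<close> into blocks of a fixed length \<open>L\<close>. For \<open>s = t / sqrt n\<close> the Taylor errors of all blocks together tend
to \<open>0\<close> as \<open>n \<rightarrow> \<infinity>\<close> by dominated convergence, and the replacement of the sums of squares costs at most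
\<open>t\<^sup>2 / 2\<close> times the \<open>L\<^sup>1\<close> distance of \<open>Q\<^sub>L / L\<close> from its mean, which the mean ergodic theorem makes small by
the choice of \<open>L\<close>.\<close>

lemma (in ergodic_pmp) cf_limit:
  assumes psi: "reverse_martingale_difference \<psi>" and v: "v = (\<integral>x. (\<psi> x)\<^sup>2 \<partial>M)"
  shows "(\<lambda>n. cf \<psi> (t / sqrt n) n) \<longlonglongrightarrow> of_real (exp (- (t\<^sup>2 * v / 2)))"
proof -
  have [measurable]: "\<psi> \<in> borel_measurable M" and psi2: "integrable M (\<lambda>x. (\<psi> x)\<^sup>2)"
    using psi by (auto simp: reverse_martingale_difference_def)
  have psi1: "integrable M \<psi>" using psi2 by (rule square_integrable_imp_integrable'[rotated]) simp
  have v0: "0 \<le> v" unfolding v by simp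
  define Q where "Q = birkhoff_sum (\<lambda>x. (\<psi> x)\<^sup>2)"
  define e where "e = (\<lambda>L::nat. \<integral>x. \<bar>Q L x / L - v\<bar> \<partial>M)"
  define A where "A = (\<integral>x. \<bar>\<psi> x\<bar> \<partial>M)"
  have e0: "e \<longlonglongrightarrow> 0" unfolding e_def Q_def v by (rule mean_ergodic[OF psi2])
  show ?thesis
  proof (rule LIMSEQ_I)
    fix r :: real assume r: "r > 0"
    have "(\<lambda>L. t\<^sup>2 / 2 * e L) \<longlonglongrightarrow> t\<^sup>2 / 2 * 0" by (intro tendsto_intros e0)
    then have "(\<lambda>L. t\<^sup>2 / 2 * e L) \<longlonglongrightarrow> 0" by (simp only: mult_zero_right)
    then have "\<forall>\<^sub>F L in sequentially. t\<^sup>2 / 2 * e L < r / 2"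
      by (rule order_tendstoD(2)) (use r in simp)
    then have "\<forall>\<^sub>F L in sequentially. L > 0 \<and> t\<^sup>2 / 2 * e L < r / 2"
      using eventually_gt_at_top[of 0] by eventually_elim auto
    from eventually_happens[OF this] obtain L :: nat where L: "L > 0" "t\<^sup>2 / 2 * e L < r / 2"
      by auto
    have Le: "(\<integral>x. \<bar>Q L x - L * v\<bar> \<partial>M) = L * e L"
    proof -
      have "L * e L = (\<integral>x. L * \<bar>Q L x / L - v\<bar> \<partial>M)" by (simp add: e_def)
      also have "\<dots> = (\<integral>x. \<bar>Q L x - L * v\<bar> \<partial>M)"
      proof (intro Bochner_Integration.integral_cong refl)
        fix x
        have "Q L x - L * v = L * (Q L x / L - v)" using L(1) by (simp add: right_diff_distrib)
        then show "L * \<bar>Q L x / L - v\<bar> = \<bar>Q L x - L * v\<bar>" by (simp only: abs_mult abs_of_nat)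
      qed
      finally show ?thesis ..
    qed
    define q where "q = (\<lambda>n. n div L)"
    define bound where "bound = (\<lambda>n::nat. \<bar>t\<bar> * (L * A) / sqrt n + n * taylor_error (birkhoff_sum \<psi> L) (t / sqrt n)
       + t ^ 4 * L * v\<^sup>2 / (8 * real n) + \<bar>exp (- (t\<^sup>2 * v / 2) * (L * q n / n)) - exp (- (t\<^sup>2 * v / 2))\<bar>)"
    have sq: "(\<lambda>n. 1 / sqrt (real n)) \<longlonglongrightarrow> 0"
      by (intro tendsto_divide_0[OF tendsto_const] filterlim_at_top_imp_at_infinity
          filterlim_compose[OF sqrt_at_top filterlim_real_sequentially])
    have qn: "(\<lambda>n. L * q n / n) \<longlonglongrightarrow> (1::real)"
    proof (rule tendsto_sandwich)
      show "\<forall>\<^sub>F n in sequentially. 1 - L * (1 / n) \<le> L * q n / n"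
        using eventually_gt_at_top[of 0]
      proof eventually_elim
        fix n :: nat assume n: "n > 0"
        have "n = L * q n + n mod L" by (simp add: q_def)
        also have "\<dots> \<le> L * q n + L" using L(1) by (intro add_left_mono less_imp_le) simp
        finally have "real n \<le> real (L * q n + L)" by (simp only: of_nat_le_iff)
        then have "real n \<le> L * q n + L" by simp
        then have "(n - real L) / n \<le> (L * q n) / n" by (intro divide_right_mono) auto
        then show "1 - L * (1 / n) \<le> L * q n / n" using n by (simp add: diff_divide_distrib)
      qed
      show "\<forall>\<^sub>F n in sequentially. L * q n / n \<le> (1::real)"
        using eventually_gt_at_top[of 0]
      proof eventually_elim
        fix n :: nat assume n: "n > 0"
        have "L * q n \<le> n" unfolding q_def by simp
        then have "real (L * q n) \<le> n" by (simp only: of_nat_le_iff)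
        then show "L * q n / n \<le> (1::real)" using n by (simp add: field_simps)
      qed
      have "(\<lambda>n. 1 - L * (1 / real n)) \<longlonglongrightarrow> 1 - real L * 0" by (intro tendsto_intros lim_1_over_n)
      then show "(\<lambda>n. 1 - L * (1 / real n)) \<longlonglongrightarrow> 1" by simp
    qed auto
    have "bound \<longlonglongrightarrow> \<bar>t\<bar> * (L * A) * 0 + 0 + t ^ 4 * L * v\<^sup>2 / 8 * 0
       + \<bar>exp (- (t\<^sup>2 * v / 2) * 1) - exp (- (t\<^sup>2 * v / 2))\<bar>"
      unfolding bound_def
    proof (intro tendsto_add)
      show "(\<lambda>n. \<bar>t\<bar> * (L * A) / sqrt (real n)) \<longlonglongrightarrow> \<bar>t\<bar> * (L * A) * 0"
        using tendsto_mult[OF tendsto_const[of "\<bar>t\<bar> * (L * A)"] sq] by simp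
      show "(\<lambda>n. n * taylor_error (birkhoff_sum \<psi> L) (t / sqrt n)) \<longlonglongrightarrow> 0"
        by (rule taylor_error_small) (auto intro!: birkhoff_sum_square_integrable psi2)
      show "(\<lambda>n. t ^ 4 * L * v\<^sup>2 / (8 * real n)) \<longlonglongrightarrow> t ^ 4 * L * v\<^sup>2 / 8 * 0"
        using tendsto_mult[OF tendsto_const[of "t ^ 4 * L * v\<^sup>2 / 8"] lim_1_over_n] by simp
      show "(\<lambda>n. \<bar>exp (- (t\<^sup>2 * v / 2) * (L * q n / n)) - exp (- (t\<^sup>2 * v / 2))\<bar>)
         \<longlonglongrightarrow> \<bar>exp (- (t\<^sup>2 * v / 2) * 1) - exp (- (t\<^sup>2 * v / 2))\<bar>"
        by (intro tendsto_intros qn)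
    qed
    then have "bound \<longlonglongrightarrow> 0" by simp
    then have "\<forall>\<^sub>F n in sequentially. bound n < r / 2" by (rule order_tendstoD(2)) (use r in simp)
    then have "\<forall>\<^sub>F n in sequentially. norm (cf \<psi> (t / sqrt n) n - of_real (exp (- (t\<^sup>2 * v / 2)))) < r"
      using eventually_gt_at_top[of 0]
    proof eventually_elim
      fix n :: nat assume bn: "bound n < r / 2" and n: "n > 0"
      define s where "s = t / sqrt n"
      have s2: "s\<^sup>2 = t\<^sup>2 / n" using n by (simp add: s_def power_divide)
      define k where "k = n mod L"
      have nk: "n = k + q n * L" by (simp add: k_def q_def)
      have kL: "real k \<le> L" using L(1) by (simp add: k_def less_imp_le)
      have qL: "real (q n) * L \<le> n" using nk by (metis le_add2 of_nat_le_iff of_nat_mult)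
      have qn: "real (q n) \<le> n" using nk L(1) by (simp add: q_def)
      have A0: "0 \<le> A" by (simp add: A_def)
      have e0': "0 \<le> e L" by (simp add: e_def)
      have te: "0 \<le> taylor_error (birkhoff_sum \<psi> L) s" by (simp add: taylor_error_def)
      have 1: "norm (cf \<psi> s n - cf \<psi> s (q n * L)) \<le> \<bar>t\<bar> * (L * A) / sqrt n"
      proof -
        have "norm (cf \<psi> s n - cf \<psi> s (q n * L)) \<le> \<bar>s\<bar> * (k * A)"
          using cf_remainder[OF psi1, of s k "q n * L"] nk by (simp add: A_def)
        also have "\<dots> \<le> \<bar>s\<bar> * (L * A)" by (intro mult_left_mono mult_right_mono kL A0) auto
        also have "\<dots> = \<bar>t\<bar> * (L * A) / sqrt n" by (simp add: s_def)
        finally show ?thesis .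
      qed
      have 2: "norm (cf \<psi> s (q n * L) - of_real (exp (- (s\<^sup>2 * L * v / 2) * q n)))
         \<le> n * taylor_error (birkhoff_sum \<psi> L) s + t\<^sup>2 / 2 * e L + t ^ 4 * L * v\<^sup>2 / (8 * real n)"
      proof -
        have "norm (cf \<psi> s (q n * L) - of_real (exp (- (s\<^sup>2 * L * v / 2) * q n)))
          \<le> q n * (taylor_error (birkhoff_sum \<psi> L) s + s\<^sup>2 / 2 * (L * e L) + (s\<^sup>2 * L * v / 2)\<^sup>2 / 2)"
          using cf_blocks[OF psi v, of s "q n" L] Le by (simp add: Q_def)
        also have "\<dots> = q n * taylor_error (birkhoff_sum \<psi> L) s + (q n * L) * (t\<^sup>2 / n / 2 * e L)
          + (q n * L) * ((t\<^sup>2 / n)\<^sup>2 * L * v\<^sup>2 / 8)"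
          unfolding s2 by (simp add: power2_eq_square field_simps)
        also have "\<dots> \<le> n * taylor_error (birkhoff_sum \<psi> L) s + n * (t\<^sup>2 / n / 2 * e L)
          + n * ((t\<^sup>2 / n)\<^sup>2 * L * v\<^sup>2 / 8)"
          using qL qn te e0' by (intro add_mono mult_right_mono) auto
        also have "\<dots> = n * taylor_error (birkhoff_sum \<psi> L) s + t\<^sup>2 / 2 * e L + t ^ 4 * L * v\<^sup>2 / (8 * real n)"
          using n by (simp add: field_simps power2_eq_square power4_eq_xxxx)
        finally show ?thesis .
      qed
      have 3: "norm (of_real (exp (- (s\<^sup>2 * L * v / 2) * q n)) - of_real (exp (- (t\<^sup>2 * v / 2))) :: complex)
         = \<bar>exp (- (t\<^sup>2 * v / 2) * (L * q n / n)) - exp (- (t\<^sup>2 * v / 2))\<bar>"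
      proof -
        have "- (s\<^sup>2 * L * v / 2) * q n = - (t\<^sup>2 * v / 2) * (L * q n / n)" unfolding s2 by (simp add: mult_ac)
        then show ?thesis by (simp only: of_real_diff[symmetric] norm_of_real)
      qed
      have "cf \<psi> s n - of_real (exp (- (t\<^sup>2 * v / 2))) = (cf \<psi> s n - cf \<psi> s (q n * L))
         + (cf \<psi> s (q n * L) - of_real (exp (- (s\<^sup>2 * L * v / 2) * q n)))
         + (of_real (exp (- (s\<^sup>2 * L * v / 2) * q n)) - of_real (exp (- (t\<^sup>2 * v / 2))))" by simp
      note arg_cong[OF this, of norm]
      also have "norm \<dots> \<le> \<bar>t\<bar> * (L * A) / sqrt n
         + (n * taylor_error (birkhoff_sum \<psi> L) s + t\<^sup>2 / 2 * e L + t ^ 4 * L * v\<^sup>2 / (8 * real n))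
         + \<bar>exp (- (t\<^sup>2 * v / 2) * (L * q n / n)) - exp (- (t\<^sup>2 * v / 2))\<bar>"
        by (intro norm_triangle_le add_mono 1 2) (simp only: 3 order_refl)
      also have "\<dots> = bound n + t\<^sup>2 / 2 * e L" by (simp add: bound_def s_def)
      also have "\<dots> < r" using bn L(2) by simp
      finally show "norm (cf \<psi> (t / sqrt n) n - of_real (exp (- (t\<^sup>2 * v / 2)))) < r" by (simp add: s_def)
    qed
    then show "\<exists>no. \<forall>n\<ge>no. norm (cf \<psi> (t / sqrt n) n - of_real (exp (- (t\<^sup>2 * v / 2)))) < r"
      by (auto simp: eventually_sequentially)
  qed
qed

context pmp begin

text \<open>The sums of \<open>f\<close> and \<open>\<psi>\<close> differ by \<open>\<xi> \<circ> T\<^sup>n - \<xi>\<close>. Both terms have the law of \<open>\<xi>\<close>, so they vanish in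
probability after division by \<open>sqrt n\<close>, for any measurable \<open>\<xi>\<close>.\<close>

lemma cf_coboundary:
  assumes [measurable]: "f \<in> borel_measurable M" "\<psi> \<in> borel_measurable M" "\<xi> \<in> borel_measurable M"
    and cob: "AE x in M. f x = \<psi> x + \<xi> (T x) - \<xi> x"
  shows "(\<lambda>n. cf f (t / sqrt n) n - cf \<psi> (t / sqrt n) n) \<longlonglongrightarrow> 0"
proof -
  have ae: "AE x in M. \<forall>i::nat. f ((T ^^ i) x) = \<psi> ((T ^^ i) x) + \<xi> ((T ^^ Suc i) x) - \<xi> ((T ^^ i) x)"
    unfolding AE_all_countable using AE_iterate[OF cob] by simp
  have bd: "norm (cf f s n - cf \<psi> s n) \<le> 2 * (\<integral>x. min 2 \<bar>s * \<xi> x\<bar> \<partial>M)" for s n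
  proof -
    have i: "integrable M (\<lambda>x. min 2 \<bar>s * \<xi> x\<bar>)" by (rule integrable_bounded[of _ 2]) auto
    have "cf f s n - cf \<psi> s n = (\<integral>x. iexp (s * birkhoff_sum f n x) - iexp (s * birkhoff_sum \<psi> n x) \<partial>M)"
      unfolding cf_def
      by (subst Bochner_Integration.integral_diff) (auto intro!: integrable_bounded[of _ 1])
    note arg_cong[OF this, of norm]
    also have "norm \<dots> \<le> (\<integral>x. norm (iexp (s * birkhoff_sum f n x) - iexp (s * birkhoff_sum \<psi> n x)) \<partial>M)"
      by (rule integral_norm_bound)
    also have "\<dots> \<le> (\<integral>x. min 2 \<bar>s * \<xi> ((T ^^ n) x)\<bar> + min 2 \<bar>s * \<xi> x\<bar> \<partial>M)"
    proof (rule integral_mono_AE)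
      show "integrable M (\<lambda>x. norm (iexp (s * birkhoff_sum f n x) - iexp (s * birkhoff_sum \<psi> n x)))"
        by (rule integrable_bounded[of _ 2]) (auto intro!: norm_triangle_le_diff)
      show "integrable M (\<lambda>x. min 2 \<bar>s * \<xi> ((T ^^ n) x)\<bar> + min 2 \<bar>s * \<xi> x\<bar>)"
        using integrable_iterate[OF i] i by auto
      show "AE x in M. norm (iexp (s * birkhoff_sum f n x) - iexp (s * birkhoff_sum \<psi> n x))
          \<le> min 2 \<bar>s * \<xi> ((T ^^ n) x)\<bar> + min 2 \<bar>s * \<xi> x\<bar>"
        using ae
      proof eventually_elim
        fix x assume H: "\<forall>i::nat. f ((T ^^ i) x) = \<psi> ((T ^^ i) x) + \<xi> ((T ^^ Suc i) x) - \<xi> ((T ^^ i) x)"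
        have "birkhoff_sum f n x - birkhoff_sum \<psi> n x = (\<Sum>i<n. \<xi> ((T ^^ Suc i) x) - \<xi> ((T ^^ i) x))"
          unfolding birkhoff_sum_def sum_subtractf[symmetric] using H by (intro sum.cong) auto
        also have "\<dots> = \<xi> ((T ^^ n) x) - \<xi> x"
          by (subst sum_lessThan_telescope) simp
        finally have d: "s * birkhoff_sum f n x - s * birkhoff_sum \<psi> n x = s * \<xi> ((T ^^ n) x) - s * \<xi> x"
          by (metis right_diff_distrib)
        have "norm (iexp (s * birkhoff_sum f n x) - iexp (s * birkhoff_sum \<psi> n x)) \<le> \<bar>s * \<xi> ((T ^^ n) x) - s * \<xi> x\<bar>"
          using iexp_diff_le[of "s * birkhoff_sum f n x" "s * birkhoff_sum \<psi> n x"] d by simp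
        moreover have "norm (iexp (s * birkhoff_sum f n x) - iexp (s * birkhoff_sum \<psi> n x)) \<le> 2"
          by (rule norm_triangle_le_diff) simp
        ultimately show "norm (iexp (s * birkhoff_sum f n x) - iexp (s * birkhoff_sum \<psi> n x))
          \<le> min 2 \<bar>s * \<xi> ((T ^^ n) x)\<bar> + min 2 \<bar>s * \<xi> x\<bar>"
          by (simp add: min_def abs_if split: if_splits)
      qed
    qed
    also have "\<dots> = (\<integral>x. min 2 \<bar>s * \<xi> ((T ^^ n) x)\<bar> \<partial>M) + (\<integral>x. min 2 \<bar>s * \<xi> x\<bar> \<partial>M)"
      using integrable_iterate[OF i] i by (intro Bochner_Integration.integral_add) auto
    also have "(\<integral>x. min 2 \<bar>s * \<xi> ((T ^^ n) x)\<bar> \<partial>M) = (\<integral>x. min 2 \<bar>s * \<xi> x\<bar> \<partial>M)"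
      by (rule integral_iterate[where g = "\<lambda>x. min 2 \<bar>s * \<xi> x\<bar>"]) measurable
    finally show ?thesis by simp
  qed
  have "(\<lambda>n. \<integral>x. min 2 \<bar>t / sqrt n * \<xi> x\<bar> \<partial>M) \<longlonglongrightarrow> (\<integral>x. 0 \<partial>M)"
  proof (rule integral_dominated_convergence[where w = "\<lambda>x. 2"])
    show "AE x in M. (\<lambda>n. min 2 \<bar>t / sqrt n * \<xi> x\<bar>) \<longlonglongrightarrow> 0"
    proof (rule AE_I2)
      fix x
      have "(\<lambda>n. t * \<xi> x / sqrt (real n)) \<longlonglongrightarrow> 0"
        by (intro tendsto_divide_0[OF tendsto_const] filterlim_at_top_imp_at_infinity
            filterlim_compose[OF sqrt_at_top filterlim_real_sequentially])
      then have "(\<lambda>n. min 2 \<bar>t * \<xi> x / sqrt (real n)\<bar>) \<longlonglongrightarrow> min 2 \<bar>0\<bar>"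
        by (intro tendsto_intros)
      then show "(\<lambda>n. min 2 \<bar>t / sqrt n * \<xi> x\<bar>) \<longlonglongrightarrow> 0" by simp
    qed
  qed auto
  then have "(\<lambda>n. 2 * (\<integral>x. min 2 \<bar>t / sqrt n * \<xi> x\<bar> \<partial>M)) \<longlonglongrightarrow> 2 * 0"
    by (intro tendsto_intros) simp
  then have "(\<lambda>n. 2 * (\<integral>x. min 2 \<bar>t / sqrt n * \<xi> x\<bar> \<partial>M)) \<longlonglongrightarrow> 0" by simp
  then show ?thesis by (rule Lim_null_comparison[rotated]) (intro always_eventually allI bd)
qed

lemma char_birkhoff_sum:
  assumes [measurable]: "f \<in> borel_measurable M"
  shows "char (distr M borel (\<lambda>x. birkhoff_sum f n x / sqrt n)) t = cf f (t / sqrt n) n"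
  unfolding char_def cf_def by (subst integral_distr) auto

end

lemma centered_normal_char:
  assumes "0 \<le> v"
  shows "real_distribution (centered_normal v)" "char (centered_normal v) t = of_real (exp (- (t\<^sup>2 * v / 2)))"
proof -
  have "real_distribution (centered_normal v) \<and> char (centered_normal v) t = of_real (exp (- (t\<^sup>2 * v / 2)))"
  proof (cases "v = 0")
    case True
    have "prob_space (return borel (0::real))" by (rule prob_space_return) simp
    then show ?thesis using True
      by (auto simp: centered_normal_def real_distribution_def real_distribution_axioms_def char_def integral_return)
  next
    case False
    define s where "s = sqrt v"
    have s: "0 < s" "s\<^sup>2 = v" using False assms by (auto simp: s_def)
    interpret N: prob_space "density lborel (normal_density 0 s)" by (rule prob_space_normal_density[OF s(1)])
    interpret S: real_distribution std_normal_distribution by (rule real_dist_normal_dist)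
    have "distributed std_normal_distribution lborel (\<lambda>x. x) std_normal_density"
      unfolding distributed_def by (auto simp: distr_id2)
    then have "distributed std_normal_distribution lborel (\<lambda>x. 0 + s * x) (normal_density (0 + s * 0) (\<bar>s\<bar> * 1))"
      using s by (intro S.normal_density_affine) auto
    then have eq: "density lborel (normal_density 0 s) = distr std_normal_distribution borel (\<lambda>x. s * x)"
      using s by (simp add: distributed_def cong: distr_cong)
    have "char (centered_normal v) t = char std_normal_distribution (s * t)"
      using False unfolding centered_normal_def s_def[symmetric] eq char_def
      by (simp add: integral_distr mult_ac)
    also have "\<dots> = of_real (exp (- (t\<^sup>2 * v / 2)))"
      unfolding char_std_normal_distribution using s by (simp add: power_mult_distrib mult.commute flip: exp_of_real)
    finally show ?thesis using False N.prob_space_axioms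
      by (auto simp: centered_normal_def s_def[symmetric] real_distribution_def real_distribution_axioms_def)
  qed
  then show "real_distribution (centered_normal v)" "char (centered_normal v) t = of_real (exp (- (t\<^sup>2 * v / 2)))"
    by auto
qed

section \<open>Inverse branches of Gibbs-Markov maps\<close>

definition same_itinerary :: "('a \<Rightarrow> 'a) \<Rightarrow> 'a set set \<Rightarrow> nat \<Rightarrow> 'a \<Rightarrow> 'a \<Rightarrow> bool" where
  "same_itinerary F \<delta> n x y \<longleftrightarrow> (\<forall>i<n. \<exists>d\<in>\<delta>. (F ^^ i) x \<in> d \<and> (F ^^ i) y \<in> d)"

text \<open>A Gibbs-Markov map \<open>F\<close> with invariant measure \<open>N\<close>: \<open>\<delta>\<close> is a Markov partition with images of measure at least
\<open>\<eta>\<close>, and \<open>G\<close> is the inverse of the jacobian, with \<open>\<theta>\<close>-Hoelder logarithm. Separation times enter only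
through \<open>same_itinerary\<close>. The Markov property and the distortion bound hold at every point, so that
transferred functions can be compared pointwise.\<close>

locale gibbs_markov = finite_measure N for N :: "'a measure" +
  fixes F :: "'a \<Rightarrow> 'a" and \<delta> :: "'a set set" and G :: "'a \<Rightarrow> real" and \<theta> C \<eta> :: real
  assumes part_countable: "countable \<delta>"
    and part_sets: "\<And>d. d \<in> \<delta> \<Longrightarrow> d \<in> sets N"
    and part_disjoint: "\<And>d d'. d \<in> \<delta> \<Longrightarrow> d' \<in> \<delta> \<Longrightarrow> d \<inter> d' \<noteq> {} \<Longrightarrow> d = d'"
    and part_cover: "\<Union>\<delta> = space N"
    and part_pos: "\<And>d. d \<in> \<delta> \<Longrightarrow> 0 < measure N d"
    and F_meas [measurable]: "F \<in> measurable N N"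
    and F_inv: "distr N N F = N"
    and F_inj: "\<And>d. d \<in> \<delta> \<Longrightarrow> inj_on F d"
    and F_image: "\<And>d A. d \<in> \<delta> \<Longrightarrow> A \<in> sets N \<Longrightarrow> A \<subseteq> d \<Longrightarrow> F ` A \<in> sets N"
    and markov: "\<And>d d'. d \<in> \<delta> \<Longrightarrow> d' \<in> \<delta> \<Longrightarrow> F ` d \<inter> d' \<noteq> {} \<Longrightarrow> d' \<subseteq> F ` d"
    and eta_pos: "0 < \<eta>" and big_images: "\<And>d. d \<in> \<delta> \<Longrightarrow> \<eta> \<le> measure N (F ` d)"
    and G_meas [measurable]: "G \<in> borel_measurable N"
    and G_pos: "\<And>x. x \<in> space N \<Longrightarrow> 0 < G x"
    and jacobian: "\<And>d A. d \<in> \<delta> \<Longrightarrow> A \<in> sets N \<Longrightarrow> A \<subseteq> d \<Longrightarrow>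
      emeasure N A = (\<integral>\<^sup>+x. ennreal (G (inv_into d F x)) * indicator (F ` A) x \<partial>N)"
    and theta_pos: "0 < \<theta>" and theta_less: "\<theta> < 1" and C_nonneg: "0 \<le> C"
    and distortion: "\<And>n x y. 1 \<le> n \<Longrightarrow> same_itinerary F \<delta> n x y \<Longrightarrow> \<bar>ln (G x) - ln (G y)\<bar> \<le> C * \<theta> ^ n"
    and cylinder_approx: "\<And>A e. A \<in> sets N \<Longrightarrow> 0 < e \<Longrightarrow> \<exists>n B. B \<in> sets N \<and>
      (\<forall>x y. same_itinerary F \<delta> n x y \<longrightarrow> (x \<in> B \<longleftrightarrow> y \<in> B)) \<and> measure N (sym_diff A B) < e"
    and irreducible: "\<And>d d'. d \<in> \<delta> \<Longrightarrow> d' \<in> \<delta> \<Longrightarrow> \<exists>x\<in>d. \<exists>n. (F ^^ n) x \<in> d'"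
begin

abbreviation same :: "nat \<Rightarrow> 'a \<Rightarrow> 'a \<Rightarrow> bool" where "same \<equiv> same_itinerary F \<delta>"

lemma same_sym: "same n x y \<Longrightarrow> same n y x"
  unfolding same_itinerary_def by blast

lemma same_mono: "same n x y \<Longrightarrow> m \<le> n \<Longrightarrow> same m x y"
  unfolding same_itinerary_def by auto

lemma same_cell: "same n x y \<Longrightarrow> 1 \<le> n \<Longrightarrow> \<exists>d\<in>\<delta>. x \<in> d \<and> y \<in> d"
proof -
  assume "same n x y" "1 \<le> n"
  then have "\<exists>d\<in>\<delta>. (F ^^ 0) x \<in> d \<and> (F ^^ 0) y \<in> d"
    unfolding same_itinerary_def by (metis less_eq_Suc_le One_nat_def)
  then show ?thesis by simp
qed

lemma cell_in_space: "d \<in> \<delta> \<Longrightarrow> x \<in> d \<Longrightarrow> x \<in> space N"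
  using part_cover by auto

lemma same_space: "same n x y \<Longrightarrow> 1 \<le> n \<Longrightarrow> x \<in> space N \<and> y \<in> space N"
  using same_cell cell_in_space by blast

lemma F_space: "x \<in> space N \<Longrightarrow> F x \<in> space N"
  using measurable_space[OF F_meas] .

lemma Fn_space: "x \<in> space N \<Longrightarrow> (F ^^ n) x \<in> space N"
  by (induction n) (auto intro: F_space)

lemma same_refl: "x \<in> space N \<Longrightarrow> same n x x"
  unfolding same_itinerary_def using Fn_space part_cover by (metis UnionE)

lemma same_Suc: "same (Suc n) x y \<longleftrightarrow> (\<exists>d\<in>\<delta>. x \<in> d \<and> y \<in> d) \<and> same n (F x) (F y)"
  unfolding same_itinerary_def All_less_Suc2 by (simp add: funpow_swap1)

lemma same_F: "same (Suc n) x y \<Longrightarrow> same n (F x) (F y)"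
  by (simp add: same_Suc)

lemma image_sets: "d \<in> \<delta> \<Longrightarrow> F ` d \<in> sets N"
  using F_image part_sets by blast

definition branch :: "'a set \<Rightarrow> 'a \<Rightarrow> 'a" where "branch d = inv_into d F"

lemma branch_in: "x \<in> F ` d \<Longrightarrow> branch d x \<in> d"
  unfolding branch_def by (rule inv_into_into)

lemma F_branch: "x \<in> F ` d \<Longrightarrow> F (branch d x) = x"
  unfolding branch_def by (rule f_inv_into_f)

lemma branch_F: "d \<in> \<delta> \<Longrightarrow> x \<in> d \<Longrightarrow> branch d (F x) = x"
  unfolding branch_def by (rule inv_into_f_f[OF F_inj])

lemma branch_space: "d \<in> \<delta> \<Longrightarrow> x \<in> F ` d \<Longrightarrow> branch d x \<in> space N"
  using branch_in cell_in_space by blast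

text \<open>By the Markov property the image of a cell is a union of cells, so points of a common cell have the same
inverse branches, and applying one prolongs the common itinerary.\<close>

lemma same_branch:
  assumes "same n x y" "1 \<le> n" "d \<in> \<delta>" "x \<in> F ` d"
  shows "y \<in> F ` d" "same (Suc n) (branch d x) (branch d y)"
proof -
  obtain d' where d': "d' \<in> \<delta>" "x \<in> d'" "y \<in> d'" using same_cell assms by blast
  then have "d' \<subseteq> F ` d" using markov assms by blast
  then show y: "y \<in> F ` d" using d' by blast
  show "same (Suc n) (branch d x) (branch d y)"
    unfolding same_Suc using branch_in F_branch y assms by auto
qed

lemma same_branch_mem: "same n x y \<Longrightarrow> 1 \<le> n \<Longrightarrow> d \<in> \<delta> \<Longrightarrow> x \<in> F ` d \<longleftrightarrow> y \<in> F ` d"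
  using same_branch(1) same_sym by blast

lemma branch_measurable:
  assumes d: "d \<in> \<delta>" shows "branch d \<in> measurable (restrict_space N (F ` d)) N"
proof (rule measurableI)
  fix x assume "x \<in> space (restrict_space N (F ` d))"
  then show "branch d x \<in> space N" using branch_space[OF d] by (auto simp: space_restrict_space)
next
  fix A assume A: "A \<in> sets N"
  have "branch d -` A \<inter> space (restrict_space N (F ` d)) = F ` (A \<inter> d)"
    using branch_in[of _ d] F_branch[of _ d] branch_F[OF d] cell_in_space[OF d] F_space
    by (auto simp: space_restrict_space)
  moreover have "F ` (A \<inter> d) \<in> sets (restrict_space N (F ` d))"
    using A d part_sets image_sets[OF d] by (subst sets_restrict_space_iff) (auto intro!: F_image[OF d])
  ultimately show "branch d -` A \<inter> space (restrict_space N (F ` d)) \<in> sets (restrict_space N (F ` d))" by simp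
qed

definition weight :: "'a set \<Rightarrow> 'a \<Rightarrow> real" where
  "weight d x = (if x \<in> F ` d then G (branch d x) else 0)"

lemma weight_nonneg: "d \<in> \<delta> \<Longrightarrow> 0 \<le> weight d x"
  using G_pos[OF branch_space] by (auto simp: weight_def less_imp_le)

lemma weight_comp_measurable:
  assumes d: "d \<in> \<delta>" and v [measurable]: "v \<in> borel_measurable N"
  shows "(\<lambda>x. weight d x * v (branch d x) :: real) \<in> borel_measurable N"
proof -
  have [measurable]: "branch d \<in> measurable (restrict_space N (F ` d)) N" by (rule branch_measurable[OF d])
  have "(\<lambda>x. G (branch d x) * v (branch d x)) \<in> borel_measurable (restrict_space N (F ` d))"
    by measurable
  then have "(\<lambda>x. G (branch d x) * v (branch d x) * indicator (F ` d) x) \<in> borel_measurable N"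
    using image_sets[OF d] by (subst (asm) borel_measurable_restrict_space_iff) (auto simp: mult.commute)
  also have "(\<lambda>x. G (branch d x) * v (branch d x) * indicator (F ` d) x) = (\<lambda>x. weight d x * v (branch d x))"
    by (auto simp: weight_def)
  finally show ?thesis .
qed

lemma weight_measurable: "d \<in> \<delta> \<Longrightarrow> weight d \<in> borel_measurable N"
  using weight_comp_measurable[of d "\<lambda>_. 1"] by simp

lemma change_of_variables:
  assumes d: "d \<in> \<delta>" and u [measurable]: "u \<in> borel_measurable N"
  shows "(\<integral>\<^sup>+x. ennreal (weight d x) * u (branch d x) \<partial>N) = (\<integral>\<^sup>+x. indicator d x * u x \<partial>N)"
proof -
  let ?R = "restrict_space N (F ` d)"
  note [measurable] = branch_measurable[OF d] image_sets[OF d] part_sets[OF d]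
  define K where "K = distr (density ?R (\<lambda>x. ennreal (G (branch d x)))) N (branch d)"
  have "K = density N (indicator d)"
  proof (rule measure_eqI)
    fix A assume "A \<in> sets K"
    then have A [measurable]: "A \<in> sets N" by (simp add: K_def)
    have "emeasure K A = (\<integral>\<^sup>+x. ennreal (G (branch d x)) * indicator (branch d -` A \<inter> space ?R) x \<partial>?R)"
      unfolding K_def by (subst emeasure_distr, simp, simp, subst emeasure_density)
        (use measurable_sets[OF branch_measurable[OF d] A] in auto)
    also have "\<dots> = (\<integral>\<^sup>+x. ennreal (G (branch d x)) * indicator (branch d -` A \<inter> space ?R) x * indicator (F ` d) x \<partial>N)"
      by (subst nn_integral_restrict_space) (auto intro: image_sets[OF d])
    also have "\<dots> = (\<integral>\<^sup>+x. ennreal (G (inv_into d F x)) * indicator (F ` (A \<inter> d)) x \<partial>N)"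
    proof (intro nn_integral_cong)
      fix x assume x: "x \<in> space N"
      have "x \<in> F ` (A \<inter> d) \<longleftrightarrow> x \<in> F ` d \<and> branch d x \<in> A"
        using branch_in[of x d] F_branch[of x d] branch_F[OF d] by (auto intro!: image_eqI[of x F "branch d x"])
      then show "ennreal (G (branch d x)) * indicator (branch d -` A \<inter> space ?R) x * indicator (F ` d) x
          = ennreal (G (inv_into d F x)) * indicator (F ` (A \<inter> d)) x"
        using x by (auto simp: indicator_def space_restrict_space branch_def)
    qed
    also have "\<dots> = emeasure N (A \<inter> d)" by (rule jacobian[symmetric]) (auto simp: d)
    also have "\<dots> = (\<integral>\<^sup>+x. indicator (A \<inter> d) x \<partial>N)" by (rule nn_integral_indicator[symmetric]) simp
    also have "\<dots> = (\<integral>\<^sup>+x. indicator d x * indicator A x \<partial>N)"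
      by (intro nn_integral_cong) (auto simp: indicator_def)
    also have "\<dots> = emeasure (density N (indicator d)) A"
      by (rule emeasure_density[symmetric]) auto
    finally show "emeasure K A = emeasure (density N (indicator d)) A" .
  qed (simp add: K_def)
  then have "(\<integral>\<^sup>+x. u x \<partial>K) = (\<integral>\<^sup>+x. indicator d x * u x \<partial>N)"
    by (simp add: nn_integral_density)
  moreover have "(\<integral>\<^sup>+x. u x \<partial>K) = (\<integral>\<^sup>+x. ennreal (G (branch d x)) * u (branch d x) \<partial>?R)"
    unfolding K_def by (simp add: nn_integral_distr nn_integral_density)
  moreover have "\<dots> = (\<integral>\<^sup>+x. ennreal (G (branch d x)) * u (branch d x) * indicator (F ` d) x \<partial>N)"
    by (subst nn_integral_restrict_space) (auto intro: image_sets[OF d])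
  moreover have "\<dots> = (\<integral>\<^sup>+x. ennreal (weight d x) * u (branch d x) \<partial>N)"
    by (intro nn_integral_cong) (auto simp: weight_def)
  ultimately show ?thesis by simp
qed

lemma exp_bound_of_ln: "0 < a \<Longrightarrow> 0 < b \<Longrightarrow> \<bar>ln a - ln b\<bar> \<le> c \<Longrightarrow> a \<le> exp c * b" for a b c :: real
proof -
  assume ab: "0 < a" "0 < b" and "\<bar>ln a - ln b\<bar> \<le> c"
  then have "exp (ln a) \<le> exp (c + ln b)" unfolding exp_le_cancel_iff by linarith
  then show ?thesis using ab by (simp add: exp_add)
qed

lemma weight_ratio:
  assumes "same n x y" "1 \<le> n" "d \<in> \<delta>"
  shows "weight d x \<le> exp (C * \<theta> ^ Suc n) * weight d y"
proof (cases "x \<in> F ` d")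
  case True
  note b = same_branch[OF assms True]
  have "G (branch d x) \<le> exp (C * \<theta> ^ Suc n) * G (branch d y)"
    using b True assms by (intro exp_bound_of_ln G_pos branch_space distortion) auto
  then show ?thesis using True b by (simp add: weight_def)
next
  case False
  then show ?thesis using weight_nonneg[OF assms(3), of y] by (simp add: weight_def)
qed

definition c0 :: real where "c0 = exp (C * \<theta>) / \<eta>"

lemma c0_pos: "0 < c0"
  using eta_pos by (simp add: c0_def)

text \<open>By bounded distortion the weight is comparable, on the image \<open>F d\<close>, with its mean value \<open>N d / N (F d)\<close>; the
denominator is at least \<open>\<eta>\<close>. This is where big images enter.\<close>

lemma weight_le:
  assumes d: "d \<in> \<delta>" shows "weight d x \<le> c0 * measure N d"
proof (cases "x \<in> F ` d")
  case True
  have "ennreal (exp (- (C * \<theta>)) * weight d x) * emeasure N (F ` d)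
      = (\<integral>\<^sup>+y. ennreal (exp (- (C * \<theta>)) * weight d x) * indicator (F ` d) y \<partial>N)"
    using image_sets[OF d] by (simp add: nn_integral_cmult_indicator)
  also have "\<dots> \<le> (\<integral>\<^sup>+y. ennreal (G (inv_into d F y)) * indicator (F ` d) y \<partial>N)"
  proof (intro nn_integral_mono)
    fix y
    show "ennreal (exp (- (C * \<theta>)) * weight d x) * indicator (F ` d) y \<le> ennreal (G (inv_into d F y)) * indicator (F ` d) y"
    proof (cases "y \<in> F ` d")
      case y: True
      have "same 1 (branch d x) (branch d y)"
        using branch_in True y d by (auto simp: same_itinerary_def)
      then have "G (branch d x) \<le> exp (C * \<theta>) * G (branch d y)"
        using distortion[of 1 "branch d x" "branch d y"] True y d
        by (intro exp_bound_of_ln G_pos branch_space) auto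
      then have "exp (- (C * \<theta>)) * G (branch d x) \<le> G (branch d y)"
        by (simp add: exp_minus field_simps)
      then show ?thesis using y True by (simp add: weight_def branch_def ennreal_leI)
    qed simp
  qed
  also have "\<dots> = emeasure N d" by (rule jacobian[symmetric]) (auto simp: d part_sets)
  finally have up: "exp (- (C * \<theta>)) * weight d x * measure N (F ` d) \<le> measure N d"
    using weight_nonneg[OF d, of x] by (simp add: emeasure_eq_measure ennreal_mult''[symmetric])
  have "exp (- (C * \<theta>)) * weight d x * \<eta> \<le> exp (- (C * \<theta>)) * weight d x * measure N (F ` d)"
    using weight_nonneg[OF d, of x] big_images[OF d] by (intro mult_left_mono) auto
  from this up have "exp (- (C * \<theta>)) * weight d x * \<eta> \<le> measure N d" by (rule order_trans)
  then show ?thesis using eta_pos by (simp add: c0_def exp_minus field_simps)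
next
  case False
  then show ?thesis using c0_pos by (simp add: weight_def)
qed

lemma image_null_iff:
  assumes d: "d \<in> \<delta>" and A: "A \<in> sets N" "A \<subseteq> d"
  shows "emeasure N (F ` A) = 0 \<longleftrightarrow> emeasure N A = 0"
proof -
  note FA [measurable] = F_image[OF d A]
  have m: "(\<lambda>x. ennreal (G (inv_into d F x)) * indicator (F ` A) x) \<in> borel_measurable N"
  proof -
    have "(\<lambda>x. ennreal (weight d x) * indicator (F ` A) x) \<in> borel_measurable N"
      using weight_measurable[OF d] by measurable
    also have "(\<lambda>x. ennreal (weight d x) * indicator (F ` A) x) = (\<lambda>x. ennreal (G (inv_into d F x)) * indicator (F ` A) x)"
      using A by (auto simp: weight_def branch_def indicator_def fun_eq_iff)
    finally show ?thesis .
  qed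
  have "emeasure N A = 0 \<longleftrightarrow> (AE x in N. ennreal (G (inv_into d F x)) * indicator (F ` A) x = 0)"
    unfolding jacobian[OF d A] using m by (rule nn_integral_0_iff_AE)
  also have "\<dots> \<longleftrightarrow> (AE x in N. x \<notin> F ` A)"
  proof (rule AE_cong)
    fix x
    have "0 < G (inv_into d F x)" if "x \<in> F ` A"
      using G_pos[OF branch_space[OF d, of x]] that A by (auto simp: branch_def)
    then show "ennreal (G (inv_into d F x)) * indicator (F ` A) x = 0 \<longleftrightarrow> x \<notin> F ` A"
      by (auto simp: indicator_def)
  qed
  also have "\<dots> \<longleftrightarrow> F ` A \<in> null_sets N"
    using FA sets.sets_into_space[OF FA] by (subst AE_iff_null_sets) auto
  finally show ?thesis using FA by auto
qed

section \<open>The transfer operator\<close>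

text \<open>The transfer operator. The integral over \<open>count_space \<delta>\<close> is the sum over the inverse branches if it converges
absolutely, and \<open>0\<close> otherwise.\<close>

definition P :: "('a \<Rightarrow> real) \<Rightarrow> 'a \<Rightarrow> real" where
  "P v x = (\<integral>d. weight d x * v (branch d x) \<partial>count_space \<delta>)"

definition P_summable :: "('a \<Rightarrow> real) \<Rightarrow> bool" where
  "P_summable v \<longleftrightarrow> (\<forall>x\<in>space N. integrable (count_space \<delta>) (\<lambda>d. weight d x * v (branch d x)))"

lemma emeasure_sum_cells:
  assumes "u \<in> borel_measurable N"
  shows "(\<integral>\<^sup>+d. (\<integral>\<^sup>+x. indicator d x * u x \<partial>N) \<partial>count_space \<delta>) = (\<integral>\<^sup>+x. u x \<partial>N)"
proof -
  have "(\<integral>\<^sup>+d. (\<integral>\<^sup>+x. indicator d x * u x \<partial>N) \<partial>count_space \<delta>)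
      = (\<integral>\<^sup>+d. emeasure (density N u) d \<partial>count_space \<delta>)"
    using assms part_sets by (intro nn_integral_cong) (auto simp: emeasure_density mult.commute)
  also have "\<dots> = emeasure (density N u) (\<Union>d\<in>\<delta>. d)"
    using part_sets part_countable part_disjoint
    by (intro emeasure_UN_countable[symmetric]) (auto simp: disjoint_family_on_def)
  also have "\<dots> = (\<integral>\<^sup>+x. u x \<partial>N)"
    using assms by (simp add: part_cover emeasure_density nn_integral_set_ennreal[symmetric] cong: nn_integral_cong)
  finally show ?thesis .
qed

lemma cells_summable: "integrable (count_space \<delta>) (\<lambda>d. measure N d)"
proof (rule integrableI_bounded)
  have "(\<integral>\<^sup>+d. ennreal (norm (measure N d)) \<partial>count_space \<delta>) = (\<integral>\<^sup>+d. (\<integral>\<^sup>+x. indicator d x * 1 \<partial>N) \<partial>count_space \<delta>)"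
    using part_sets by (intro nn_integral_cong) (auto simp: emeasure_eq_measure)
  also have "\<dots> = emeasure N (space N)" by (subst emeasure_sum_cells) auto
  also have "\<dots> < \<infinity>" by (simp add: emeasure_eq_measure)
  finally show "(\<integral>\<^sup>+d. ennreal (norm (measure N d)) \<partial>count_space \<delta>) < \<infinity>" .
qed simp

lemma P_summable_bounded:
  assumes v: "\<And>x. x \<in> space N \<Longrightarrow> \<bar>v x\<bar> \<le> K" shows "P_summable v"
  unfolding P_summable_def
proof
  fix x assume x: "x \<in> space N"
  show "integrable (count_space \<delta>) (\<lambda>d. weight d x * v (branch d x))"
  proof (rule Bochner_Integration.integrable_bound)
    show "integrable (count_space \<delta>) (\<lambda>d. c0 * \<bar>K\<bar> * measure N d)"
      using cells_summable by simp
    show "AE d in count_space \<delta>. norm (weight d x * v (branch d x)) \<le> norm (c0 * \<bar>K\<bar> * measure N d)"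
    proof (rule AE_I2)
      fix d assume "d \<in> space (count_space \<delta>)"
      then have d: "d \<in> \<delta>" by simp
      have "\<bar>weight d x * v (branch d x)\<bar> \<le> c0 * measure N d * \<bar>K\<bar>"
      proof (cases "x \<in> F ` d")
        case True
        then show ?thesis unfolding abs_mult
          using weight_le[OF d, of x] weight_nonneg[OF d, of x] c0_pos v[OF branch_space[OF d True]]
          by (intro mult_mono) auto
      qed (use c0_pos in \<open>auto simp: weight_def\<close>)
      then show "norm (weight d x * v (branch d x)) \<le> norm (c0 * \<bar>K\<bar> * measure N d)"
        using c0_pos by (simp add: abs_mult mult_ac)
    qed
  qed simp
qed

lemma P_measurable:
  assumes [measurable]: "v \<in> borel_measurable N" shows "P v \<in> borel_measurable N"
proof -
  interpret cs: sigma_finite_measure "count_space \<delta>" by (rule sigma_finite_measure_count_space_countable[OF part_countable])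
  have "(\<lambda>(d, x). weight d x * v (branch d x)) \<in> borel_measurable (count_space \<delta> \<Otimes>\<^sub>M N)"
    using part_countable weight_comp_measurable[OF _ assms]
    by (intro measurable_pair_measure_countable1) auto
  from measurable_compose[OF measurable_pair_swap' this]
  have "(\<lambda>(x, d). weight d x * v (branch d x)) \<in> borel_measurable (N \<Otimes>\<^sub>M count_space \<delta>)"
    by (simp add: case_prod_beta' cong: measurable_cong)
  then show ?thesis unfolding P_def by (rule cs.borel_measurable_lebesgue_integral)
qed

lemma P_add:
  "P_summable v \<Longrightarrow> P_summable u \<Longrightarrow> x \<in> space N \<Longrightarrow> P (\<lambda>x. v x + u x) x = P v x + P u x"
  by (simp add: P_def P_summable_def distrib_left)

lemma P_diff:
  "P_summable v \<Longrightarrow> P_summable u \<Longrightarrow> x \<in> space N \<Longrightarrow> P (\<lambda>x. v x - u x) x = P v x - P u x"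
  by (simp add: P_def P_summable_def right_diff_distrib)

lemma P_cmult: "P (\<lambda>x. c * v x) x = c * P v x"
  unfolding P_def by (subst Bochner_Integration.integral_mult_right_zero[symmetric])
    (simp add: mult_ac)

lemma P_summable_mono:
  assumes "P_summable u" "\<And>x. x \<in> space N \<Longrightarrow> \<bar>v x\<bar> \<le> u x" shows "P_summable v"
  unfolding P_summable_def
proof
  fix x assume x: "x \<in> space N"
  show "integrable (count_space \<delta>) (\<lambda>d. weight d x * v (branch d x))"
  proof (rule Bochner_Integration.integrable_bound)
    show "integrable (count_space \<delta>) (\<lambda>d. weight d x * u (branch d x))"
      using assms x by (auto simp: P_summable_def)
    show "AE d in count_space \<delta>. norm (weight d x * v (branch d x)) \<le> norm (weight d x * u (branch d x))"
    proof (rule AE_I2)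
      fix d assume "d \<in> space (count_space \<delta>)"
      then have d: "d \<in> \<delta>" by simp
      show "norm (weight d x * v (branch d x)) \<le> norm (weight d x * u (branch d x))"
      proof (cases "x \<in> F ` d")
        case True
        from assms(2)[OF branch_space[OF d True]] show ?thesis
          by (auto simp: abs_mult intro!: mult_left_mono)
      qed (simp add: weight_def)
    qed
  qed simp
qed

lemma P_mono:
  assumes "P_summable u" "P_summable v" "x \<in> space N" "\<And>x. x \<in> space N \<Longrightarrow> v x \<le> u x" shows "P v x \<le> P u x"
  unfolding P_def
proof (rule integral_mono)
  fix d assume "d \<in> space (count_space \<delta>)"
  then have d: "d \<in> \<delta>" by simp
  show "weight d x * v (branch d x) \<le> weight d x * u (branch d x)"
  proof (cases "x \<in> F ` d")
    case True
    from assms(4)[OF branch_space[OF d True]] show ?thesis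
      using weight_nonneg[OF d] by (auto intro!: mult_left_mono)
  qed (simp add: weight_def)
qed (use assms in \<open>auto simp: P_summable_def\<close>)

lemma P_cong: "(\<And>x. x \<in> space N \<Longrightarrow> u x = v x) \<Longrightarrow> P u x = P v x"
  unfolding P_def
  by (intro Bochner_Integration.integral_cong) (auto simp: weight_def branch_space)

lemma P_comp_F: "P (\<lambda>y. v y * g (F y)) x = P v x * g x"
proof -
  have "P (\<lambda>y. v y * g (F y)) x = (\<integral>d. weight d x * v (branch d x) * g x \<partial>count_space \<delta>)"
    unfolding P_def by (intro Bochner_Integration.integral_cong) (auto simp: weight_def F_branch)
  then show ?thesis unfolding P_def by simp
qed

lemma nn_transfer:
  assumes [measurable]: "u \<in> borel_measurable N"
  shows "(\<integral>\<^sup>+x. (\<integral>\<^sup>+d. ennreal (weight d x) * u (branch d x) \<partial>count_space \<delta>) \<partial>N) = (\<integral>\<^sup>+x. u x \<partial>N)"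
proof -
  interpret pair_sigma_finite "count_space \<delta>" N
    by (intro pair_sigma_finite.intro sigma_finite_measure_count_space_countable part_countable sigma_finite_measure_axioms)
  have m: "(\<lambda>x. ennreal (weight d x) * u (branch d x)) \<in> borel_measurable N" if d: "d \<in> \<delta>" for d
  proof -
    have [measurable]: "branch d \<in> measurable (restrict_space N (F ` d)) N" by (rule branch_measurable[OF d])
    have "(\<lambda>x. ennreal (G (branch d x)) * u (branch d x)) \<in> borel_measurable (restrict_space N (F ` d))"
      by measurable
    then have "(\<lambda>x. ennreal (G (branch d x)) * u (branch d x) * indicator (F ` d) x) \<in> borel_measurable N"
      using image_sets[OF d] by (subst (asm) borel_measurable_restrict_space_iff_ennreal) auto
    also have "(\<lambda>x. ennreal (G (branch d x)) * u (branch d x) * indicator (F ` d) x) = (\<lambda>x. ennreal (weight d x) * u (branch d x))"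
      by (auto simp: weight_def)
    finally show ?thesis .
  qed
  have "(\<integral>\<^sup>+x. (\<integral>\<^sup>+d. ennreal (weight d x) * u (branch d x) \<partial>count_space \<delta>) \<partial>N)
      = (\<integral>\<^sup>+d. (\<integral>\<^sup>+x. ennreal (weight d x) * u (branch d x) \<partial>N) \<partial>count_space \<delta>)"
    using part_countable m by (intro Fubini' measurable_pair_measure_countable1) auto
  also have "\<dots> = (\<integral>\<^sup>+d. (\<integral>\<^sup>+x. indicator d x * u x \<partial>N) \<partial>count_space \<delta>)"
    by (intro nn_integral_cong change_of_variables) auto
  finally show ?thesis using emeasure_sum_cells[OF assms] by simp
qed

lemma ennreal_P:
  assumes "P_summable v" "x \<in> space N" "\<And>x. x \<in> space N \<Longrightarrow> 0 \<le> v x"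
  shows "ennreal (P v x) = (\<integral>\<^sup>+d. ennreal (weight d x) * ennreal (v (branch d x)) \<partial>count_space \<delta>)"
proof -
  have nn: "0 \<le> weight d x * v (branch d x)" if "d \<in> \<delta>" for d
    using weight_nonneg[OF that, of x] assms(3)[OF branch_space[OF that, of x]]
    by (cases "x \<in> F ` d") (auto simp: weight_def)
  have "ennreal (P v x) = (\<integral>\<^sup>+d. ennreal (weight d x * v (branch d x)) \<partial>count_space \<delta>)"
    unfolding P_def using assms nn
    by (intro nn_integral_eq_integral[symmetric]) (auto simp: P_summable_def AE_count_space)
  also have "\<dots> = (\<integral>\<^sup>+d. ennreal (weight d x) * ennreal (v (branch d x)) \<partial>count_space \<delta>)"
    using weight_nonneg by (intro nn_integral_cong) (auto simp: ennreal_mult')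
  finally show ?thesis .
qed

lemma P_nonneg: "P_summable v \<Longrightarrow> x \<in> space N \<Longrightarrow> (\<And>x. x \<in> space N \<Longrightarrow> 0 \<le> v x) \<Longrightarrow> 0 \<le> P v x"
  using P_mono[of v "\<lambda>_. 0" x] P_summable_bounded[of "\<lambda>_. 0" 0] by (simp add: P_def)

lemma P_integral_nonneg:
  assumes "P_summable v" "integrable N v" "\<And>x. x \<in> space N \<Longrightarrow> 0 \<le> v x"
  shows "integrable N (P v)" "(\<integral>x. P v x \<partial>N) = (\<integral>x. v x \<partial>N)"
proof -
  note [measurable] = borel_measurable_integrable[OF assms(2)]
  have [measurable]: "P v \<in> borel_measurable N" by (rule P_measurable) measurable
  have e: "(\<integral>\<^sup>+x. ennreal (P v x) \<partial>N) = (\<integral>\<^sup>+x. ennreal (v x) \<partial>N)"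
    using nn_transfer[of "\<lambda>x. ennreal (v x)"] ennreal_P[OF assms(1) _ assms(3)]
    by (simp cong: nn_integral_cong)
  have "(\<integral>\<^sup>+x. ennreal (norm (P v x)) \<partial>N) = (\<integral>\<^sup>+x. ennreal (P v x) \<partial>N)"
    using P_nonneg assms by (intro nn_integral_cong) auto
  also have "\<dots> < \<infinity>" unfolding e using assms(2,3)
    by (subst nn_integral_eq_integral) (auto simp: AE_I2)
  finally show "integrable N (P v)" by (intro integrableI_bounded) auto
  have "(\<integral>x. P v x \<partial>N) = enn2real (\<integral>\<^sup>+x. ennreal (P v x) \<partial>N)"
    using P_nonneg assms by (intro integral_eq_nn_integral) (auto intro: AE_I2)
  also have "\<dots> = (\<integral>x. v x \<partial>N)" unfolding e
    using assms by (intro integral_eq_nn_integral[symmetric]) (auto intro: AE_I2)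
  finally show "(\<integral>x. P v x \<partial>N) = (\<integral>x. v x \<partial>N)" .
qed

lemma P_integral:
  assumes v: "P_summable v" "integrable N v"
  shows "integrable N (P v)" "(\<integral>x. P v x \<partial>N) = (\<integral>x. v x \<partial>N)"
proof -
  let ?p = "\<lambda>x. max 0 (v x)" and ?m = "\<lambda>x. max 0 (- v x)"
  have abs: "P_summable (\<lambda>x. \<bar>v x\<bar>)"
    unfolding P_summable_def
  proof
    fix x assume x: "x \<in> space N"
    have "integrable (count_space \<delta>) (\<lambda>d. \<bar>weight d x * v (branch d x)\<bar>)"
      using v x by (auto simp: P_summable_def)
    then show "integrable (count_space \<delta>) (\<lambda>d. weight d x * \<bar>v (branch d x)\<bar>)"
      by (rule Bochner_Integration.integrable_cong[THEN iffD1, rotated 2]) (auto simp: abs_mult weight_nonneg)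
  qed
  have s: "P_summable ?p" "P_summable ?m" by (auto intro!: P_summable_mono[OF abs])
  have i: "integrable N ?p" "integrable N ?m" using v by auto
  have d: "P v x = P ?p x - P ?m x" if "x \<in> space N" for x
    using P_diff[OF s that] by (subst P_cong[of v "\<lambda>x. ?p x - ?m x"]) auto
  show "integrable N (P v)"
    using P_integral_nonneg(1)[OF s(1) i(1)] P_integral_nonneg(1)[OF s(2) i(2)] d
    by (subst Bochner_Integration.integrable_cong[OF refl, of _ _ "\<lambda>x. P ?p x - P ?m x"]) auto
  have "(\<integral>x. P v x \<partial>N) = (\<integral>x. P ?p x - P ?m x \<partial>N)" using d by (intro Bochner_Integration.integral_cong) auto
  also have "\<dots> = (\<integral>x. ?p x \<partial>N) - (\<integral>x. ?m x \<partial>N)"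
    using P_integral_nonneg[OF s(1) i(1)] P_integral_nonneg[OF s(2) i(2)] by simp
  also have "\<dots> = (\<integral>x. ?p x - ?m x \<partial>N)" using i by simp
  also have "\<dots> = (\<integral>x. v x \<partial>N)" by (intro Bochner_Integration.integral_cong) auto
  finally show "(\<integral>x. P v x \<partial>N) = (\<integral>x. v x \<partial>N)" .
qed

text \<open>\<open>P\<close> is the adjoint of composition with \<open>F\<close>: apply \<open>\<integral> P h = \<integral> h\<close> to \<open>h = v \<cdot> (g \<circ> F)\<close>.\<close>

lemma P_dual:
  assumes v: "P_summable v" "integrable N v" and g: "g \<in> borel_measurable N" "\<And>x. x \<in> space N \<Longrightarrow> \<bar>g x\<bar> \<le> B"
  shows "(\<integral>x. P v x * g x \<partial>N) = (\<integral>x. v x * g (F x) \<partial>N)"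
proof -
  note [measurable] = g(1) borel_measurable_integrable[OF v(2)]
  have gF: "\<bar>v x * g (F x)\<bar> \<le> \<bar>B * v x\<bar>" if "x \<in> space N" for x
    using g(2)[OF F_space[OF that]] by (auto simp: abs_mult mult.commute[of B] intro!: mult_left_mono)
  have 1: "P_summable (\<lambda>x. v x * g (F x))" unfolding P_summable_def
  proof
    fix x assume x: "x \<in> space N"
    have "integrable (count_space \<delta>) (\<lambda>d. weight d x * v (branch d x) * g x)"
      using v x by (auto simp: P_summable_def)
    then show "integrable (count_space \<delta>) (\<lambda>d. weight d x * (v (branch d x) * g (F (branch d x))))"
      by (rule Bochner_Integration.integrable_cong[THEN iffD1, rotated 2]) (auto simp: weight_def F_branch)
  qed
  have 2: "integrable N (\<lambda>x. v x * g (F x))"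
    by (rule Bochner_Integration.integrable_bound[of _ "\<lambda>x. B * v x"]) (use v gF in \<open>auto intro!: AE_I2\<close>)
  show ?thesis using P_integral(2)[OF 1 2] unfolding P_comp_F .
qed

end

context gibbs_markov begin

section \<open>Distortion of transferred functions\<close>

definition cyl :: "nat \<Rightarrow> 'a \<Rightarrow> 'a set" where "cyl n x = {y \<in> space N. same n x y}"

lemma cyl_Suc:
  assumes d: "d \<in> \<delta>" "x \<in> d"
  shows "cyl (Suc n) x = d \<inter> (F -` cyl n (F x) \<inter> space N)"
proof -
  have "(\<exists>d'\<in>\<delta>. x \<in> d' \<and> y \<in> d') \<longleftrightarrow> y \<in> d" for y
    using d part_disjoint by blast
  then show ?thesis using F_space cell_in_space[OF d(1)] by (auto simp: cyl_def same_Suc)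
qed

lemma cyl_positive:
  "x \<in> space N \<Longrightarrow> cyl (Suc n) x \<in> sets N \<and> emeasure N (cyl (Suc n) x) \<noteq> 0"
proof (induction n arbitrary: x)
  case 0
  then obtain d where d: "d \<in> \<delta>" "x \<in> d" using part_cover by auto
  have "cyl 0 (F x) = space N" by (auto simp: cyl_def same_itinerary_def)
  then have "cyl (Suc 0) x = d" using cyl_Suc[OF d, of 0] F_space cell_in_space[OF d(1)] by auto
  then show ?case using part_sets[OF d(1)] part_pos[OF d(1)] by (auto simp: emeasure_eq_measure)
next
  case (Suc n)
  then obtain d where d: "d \<in> \<delta>" "x \<in> d" using part_cover by auto
  define B where "B = cyl (Suc n) (F x)"
  have B: "B \<in> sets N" "emeasure N B \<noteq> 0" using Suc.IH[OF F_space[OF Suc.prems]] by (auto simp: B_def)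
  define A where "A = d \<inter> (F -` B \<inter> space N)"
  have A: "A \<in> sets N" "A \<subseteq> d" using B part_sets[OF d(1)] by (auto simp: A_def)
  have "B \<subseteq> F ` d"
  proof
    fix y assume "y \<in> B"
    then have "same (Suc n) (F x) y" by (simp add: B_def cyl_def)
    then show "y \<in> F ` d" using same_branch(1)[of "Suc n" "F x" y d] d by auto
  qed
  then have "F ` A = B" using cell_in_space[OF d(1)] by (auto simp: A_def)
  then have "emeasure N A \<noteq> 0" using image_null_iff[OF d(1) A] B by simp
  then show ?case using cyl_Suc[OF d, of "Suc n"] A by (simp add: A_def B_def)
qed

text \<open>Every point is approximated by points of a given full set in the sense of itineraries. This upgrades identities from
almost everywhere to everywhere for functions that are regular with respect to itineraries.\<close>

lemma AE_cyl:
  assumes ae: "AE y in N. Q y" and x: "x \<in> space N"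
  shows "\<exists>y\<in>space N. same (Suc n) x y \<and> Q y"
proof (rule ccontr)
  assume "\<not> ?thesis"
  then have sub: "cyl (Suc n) x \<subseteq> {y \<in> space N. \<not> Q y}" by (auto simp: cyl_def)
  obtain Z where Z: "{y \<in> space N. \<not> Q y} \<subseteq> Z" "emeasure N Z = 0" "Z \<in> sets N"
    using ae by (elim AE_E)
  have "emeasure N (cyl (Suc n) x) \<le> emeasure N Z" using sub Z by (intro emeasure_mono) auto
  then show False using cyl_positive[OF x, of n] Z by simp
qed

lemma integral_F:
  fixes g :: "'a \<Rightarrow> real"
  assumes [measurable]: "g \<in> borel_measurable N"
  shows "(\<integral>x. g (F x) \<partial>N) = (\<integral>x. g x \<partial>N)"
  by (subst integral_distr[symmetric, of F N N]) (auto simp: F_inv)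

lemma integrable_F:
  fixes g :: "'a \<Rightarrow> real"
  assumes "integrable N g"
  shows "integrable N (\<lambda>x. g (F x))"
  using integrable_distr[of F N N g] assms by (auto simp: F_inv)

lemma integrable_bdd:
  fixes g :: "'a \<Rightarrow> real"
  assumes "g \<in> borel_measurable N" "\<And>x. x \<in> space N \<Longrightarrow> \<bar>g x\<bar> \<le> B"
  shows "integrable N g"
  using assms by (intro integrable_const_bound[of _ B]) auto

text \<open>Nonnegative functions whose oscillation on cylinders of length \<open>n\<close> is bounded multiplicatively by \<open>K\<close>.\<close>

definition reg :: "nat \<Rightarrow> real \<Rightarrow> ('a \<Rightarrow> real) \<Rightarrow> bool" where
  "reg n K u \<longleftrightarrow> u \<in> borel_measurable N \<and> (\<forall>x\<in>space N. 0 \<le> u x) \<and> (\<forall>x y. same n x y \<longrightarrow> x \<in> space N \<longrightarrow> y \<in> space N \<longrightarrow> u x \<le> K * u y)"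

lemma reg_weaken: "reg n K u \<Longrightarrow> K \<le> K' \<Longrightarrow> reg n K' u"
  unfolding reg_def by (meson mult_right_mono order_trans)

lemma reg_P:
  assumes u: "reg (Suc n) K u" "P_summable u" and n: "1 \<le> n" and K: "0 \<le> K"
  shows "reg n (K * exp (C * \<theta> ^ Suc n)) (P u)"
  unfolding reg_def
proof (intro conjI ballI allI impI)
  show "P u \<in> borel_measurable N" using u by (intro P_measurable) (simp add: reg_def)
  show "0 \<le> P u x" if "x \<in> space N" for x using u that by (intro P_nonneg) (auto simp: reg_def)
  fix x y assume s: "same n x y" and x: "x \<in> space N" and y: "y \<in> space N"
  have "P u x \<le> (\<integral>d. K * exp (C * \<theta> ^ Suc n) * (weight d y * u (branch d y)) \<partial>count_space \<delta>)"
    unfolding P_def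
  proof (rule integral_mono)
    fix d assume "d \<in> space (count_space \<delta>)" then have d: "d \<in> \<delta>" by simp
    show "weight d x * u (branch d x) \<le> K * exp (C * \<theta> ^ Suc n) * (weight d y * u (branch d y))"
    proof (cases "x \<in> F ` d")
      case True
      note b = same_branch[OF s n d True]
      have "u (branch d x) \<le> K * u (branch d y)" "0 \<le> u (branch d x)"
        using u b branch_space[OF d] True by (auto simp: reg_def)
      then have "weight d x * u (branch d x) \<le> (exp (C * \<theta> ^ Suc n) * weight d y) * (K * u (branch d y))"
        using weight_ratio[OF s n d] weight_nonneg[OF d] by (intro mult_mono) auto
      then show ?thesis by (simp add: mult_ac)
    next
      case False
      then have "y \<notin> F ` d" using same_branch_mem[OF s n d] by simp
      then show ?thesis using False by (simp add: weight_def)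
    qed
  qed (use u x y in \<open>auto simp: P_summable_def\<close>)
  also have "\<dots> = K * exp (C * \<theta> ^ Suc n) * P u y" unfolding P_def by simp
  finally show "P u x \<le> K * exp (C * \<theta> ^ Suc n) * P u y" .
qed

lemma one_summable: "P_summable (\<lambda>_. c)"
  by (rule P_summable_bounded[of _ "\<bar>c\<bar>"]) simp

lemma theta_power_tendsto: "(\<lambda>n. \<theta> ^ n) \<longlonglongrightarrow> 0"
  using theta_pos theta_less by (intro LIMSEQ_power_zero) auto

text \<open>Duality shows that \<open>P 1 = 1\<close> almost everywhere, as \<open>N\<close> is invariant. By bounded distortion \<open>P 1\<close> varies at most by
the factor \<open>exp (C \<theta>\<^sup>n\<^sup>+\<^sup>1)\<close> on cylinders of length \<open>n\<close>, so the identity extends to every point.\<close>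

lemma P_one: assumes x: "x \<in> space N" shows "P (\<lambda>_. 1) x = 1"
proof -
  let ?u = "P (\<lambda>_. 1)"
  have [measurable]: "?u \<in> borel_measurable N" by (intro P_measurable) simp
  have iu: "integrable N ?u" by (intro P_integral(1) one_summable) simp
  have sg: "sgn \<in> borel_measurable (borel :: real measure)" by measurable
  \<comment> \<open>Testing against the sign of \<open>P 1 - 1\<close> computes the \<open>L\<^sup>1\<close> norm of \<open>P 1 - 1\<close>.\<close>
  let ?g = "\<lambda>x. sgn (?u x - 1)"
  have [measurable]: "?g \<in> borel_measurable N" by measurable
  have g1: "\<bar>?g x\<bar> \<le> 1" for x by (simp add: sgn_if)
  have "(\<integral>x. ?u x * ?g x \<partial>N) = (\<integral>x. ?g x \<partial>N)"
    using P_dual[OF one_summable, of 1 ?g 1] g1 integral_F[of ?g] by simp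
  moreover have ig: "integrable N ?g" by (rule integrable_bdd[of _ 1]) (use g1 in auto)
  moreover have iug: "integrable N (\<lambda>x. ?u x * ?g x)"
    by (rule Bochner_Integration.integrable_bound[OF iu]) (use g1 in \<open>auto simp: abs_mult intro!: AE_I2 mult_left_le\<close>)
  ultimately have "(\<integral>x. ?u x * ?g x - ?g x \<partial>N) = 0" by simp
  also have "(\<lambda>x. ?u x * ?g x - ?g x) = (\<lambda>x. \<bar>?u x - 1\<bar>)"
    by (auto simp: sgn_if fun_eq_iff)
  finally have "(\<integral>x. \<bar>?u x - 1\<bar> \<partial>N) = 0" .
  then have "AE x in N. \<bar>?u x - 1\<bar> = 0"
    using iu by (subst (asm) integral_nonneg_eq_0_iff_AE) auto
  then have ae: "AE x in N. ?u x = 1" by eventually_elim simp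
  have r: "reg n (exp (C * \<theta> ^ Suc n)) ?u" if "1 \<le> n" for n
    using reg_P[of n 1 "\<lambda>_. 1"] that one_summable by (simp add: reg_def)
  have lim: "(\<lambda>n. exp (C * \<theta> ^ Suc (Suc n))) \<longlonglongrightarrow> 1"
  proof -
    have "(\<lambda>n. exp (C * \<theta> ^ (n + 2))) \<longlonglongrightarrow> exp (C * 0)"
      by (rule tendsto_exp[OF tendsto_mult[OF tendsto_const
        LIMSEQ_ignore_initial_segment[OF theta_power_tendsto, of 2]]])
    then show ?thesis by simp
  qed
  have "?u x \<le> exp (C * \<theta> ^ Suc (Suc n)) \<and> 1 \<le> exp (C * \<theta> ^ Suc (Suc n)) * ?u x" for n
  proof -
    obtain y where y: "y \<in> space N" "same (Suc n) x y" "?u y = 1" using AE_cyl[OF ae x] by blast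
    have "?u x \<le> exp (C * \<theta> ^ Suc (Suc n)) * ?u y" "?u y \<le> exp (C * \<theta> ^ Suc (Suc n)) * ?u x"
      using r[of "Suc n", simplified] y(1,2) x same_sym[OF y(2)] unfolding reg_def by simp_all
    then show ?thesis using y by simp
  qed
  then have "?u x \<le> 1" "1 \<le> 1 * ?u x"
    using LIMSEQ_le_const[OF lim, of "?u x"] LIMSEQ_le_const[OF tendsto_mult[OF lim tendsto_const[of "?u x"]], of 1] by auto
  then show ?thesis by simp
qed

lemma P_const: "x \<in> space N \<Longrightarrow> P (\<lambda>_. c) x = c"
  using P_cmult[of c "\<lambda>_. 1" x] P_one by simp

definition bdd :: "real \<Rightarrow> ('a \<Rightarrow> real) \<Rightarrow> bool" where
  "bdd K v \<longleftrightarrow> v \<in> borel_measurable N \<and> (\<forall>x\<in>space N. \<bar>v x\<bar> \<le> K)"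

lemma bdd_summable: "bdd K v \<Longrightarrow> P_summable v"
  by (rule P_summable_bounded[of _ K]) (simp add: bdd_def)

lemma bdd_integrable: "bdd K v \<Longrightarrow> integrable N v"
  by (rule integrable_bdd[of _ K]) (simp_all add: bdd_def)

lemma bdd_P: "bdd K v \<Longrightarrow> bdd K (P v)"
  unfolding bdd_def
proof (intro conjI ballI)
  assume v: "v \<in> borel_measurable N \<and> (\<forall>x\<in>space N. \<bar>v x\<bar> \<le> K)"
  then show "P v \<in> borel_measurable N" by (intro P_measurable) simp
  fix x assume x: "x \<in> space N"
  have s: "P_summable v" using v by (intro bdd_summable[of K]) (simp add: bdd_def)
  have "P v x \<le> P (\<lambda>_. K) x" "P (\<lambda>_. - K) x \<le> P v x"
    using v x s one_summable by (auto intro!: P_mono simp: abs_le_iff minus_le_iff)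
  then show "\<bar>P v x\<bar> \<le> K" using P_const[OF x] by auto
qed

lemma bdd_iter: "bdd K v \<Longrightarrow> bdd K ((P ^^ n) v)"
  by (induction n) (auto intro: bdd_P)

lemma integral_P_iter: "bdd K v \<Longrightarrow> (\<integral>x. (P ^^ n) v x \<partial>N) = (\<integral>x. v x \<partial>N)"
proof (induction n)
  case (Suc n)
  have "bdd K ((P ^^ n) v)" using Suc by (intro bdd_iter)
  then show ?case using Suc P_integral(2)[of "(P ^^ n) v"] bdd_summable bdd_integrable by auto
qed simp

lemma P_iter_diff:
  "bdd K v \<Longrightarrow> bdd L u \<Longrightarrow> x \<in> space N \<Longrightarrow> (P ^^ n) (\<lambda>x. v x - u x) x = (P ^^ n) v x - (P ^^ n) u x"
proof (induction n arbitrary: x)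
  case (Suc n)
  have "(P ^^ Suc n) (\<lambda>x. v x - u x) x = P (\<lambda>x. (P ^^ n) v x - (P ^^ n) u x) x"
    using Suc by (auto intro: P_cong)
  also have "\<dots> = P ((P ^^ n) v) x - P ((P ^^ n) u) x"
    using Suc.prems by (intro P_diff bdd_summable bdd_iter) auto
  finally show ?case by simp
qed simp

lemma P_iter_abs_le:
  assumes "bdd K v" "bdd L u" "\<And>x. x \<in> space N \<Longrightarrow> \<bar>v x\<bar> \<le> u x" "x \<in> space N"
  shows "\<bar>(P ^^ n) v x\<bar> \<le> (P ^^ n) u x"
  using assms(4)
proof (induction n arbitrary: x)
  case (Suc n)
  note s = bdd_summable[OF bdd_iter[OF assms(1), of n]] bdd_summable[OF bdd_iter[OF assms(2), of n]]
  have "P (\<lambda>x. - (P ^^ n) v x) x \<le> P ((P ^^ n) u) x" "P ((P ^^ n) v) x \<le> P ((P ^^ n) u) x"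
    using Suc s P_summable_mono[OF s(2), of "\<lambda>x. - (P ^^ n) v x"] by (auto intro!: P_mono simp: abs_le_iff)
  moreover have "P (\<lambda>x. - (P ^^ n) v x) x = - P ((P ^^ n) v) x"
    using P_cmult[of "-1" "(P ^^ n) v" x] by simp
  ultimately show ?case by simp
qed (use assms in auto)

text \<open>Bounds the accumulated distortion of inverse branches of arbitrarily high iterates.\<close>

definition E :: real where "E = exp (C / (1 - \<theta>))"

lemma E_pos: "0 < E" and E_ge_1: "1 \<le> E"
  using C_nonneg theta_less by (auto simp: E_def)

lemma theta_sum_le: "(\<Sum>j<n. \<theta> ^ j) \<le> 1 / (1 - \<theta>)"
proof -
  have "(\<Sum>j<n. \<theta> ^ j) = (1 - \<theta> ^ n) / (1 - \<theta>)"
    using theta_less by (subst sum_gp_strict) auto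
  also have "\<dots> \<le> 1 / (1 - \<theta>)"
    using theta_less theta_pos by (intro divide_right_mono) auto
  finally show ?thesis .
qed

text \<open>Each application of \<open>P\<close> to a function that is regular on cylinders of length \<open>j + 1\<close> costs a factor
\<open>exp (C \<theta>\<^sup>j\<^sup>+\<^sup>1)\<close>, and the geometric series keeps the product below \<open>E\<close> no matter how large \<open>n\<close> is.\<close>

lemma reg_iter:
  assumes "reg (Suc n) K u" "bdd B u" "0 \<le> K"
  shows "reg 1 (K * E) ((P ^^ n) u)"
proof -
  have "reg 1 (K * exp (C * (\<Sum>j<n. \<theta> ^ Suc (Suc j)))) ((P ^^ n) u)"
    using assms
  proof (induction n arbitrary: K u)
    case (Suc n)
    have "reg (Suc n) (K * exp (C * \<theta> ^ Suc (Suc n))) (P u)"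
      using Suc.prems by (intro reg_P bdd_summable[of B]) auto
    then have "reg 1 (K * exp (C * \<theta> ^ Suc (Suc n)) * exp (C * (\<Sum>j<n. \<theta> ^ Suc (Suc j)))) ((P ^^ n) (P u))"
      using Suc.prems by (intro Suc.IH bdd_P) auto
    then show ?case
      by (simp add: funpow_swap1 mult.assoc exp_add[symmetric] distrib_left add_ac)
  qed simp
  then show ?thesis
  proof (rule reg_weaken)
    have "(\<Sum>j<n. \<theta> ^ Suc (Suc j)) \<le> (\<Sum>j<n. \<theta> ^ j)"
      using theta_pos theta_less by (intro sum_mono power_decreasing) auto
    also have "\<dots> \<le> 1 / (1 - \<theta>)" by (rule theta_sum_le)
    finally have "C * (\<Sum>j<n. \<theta> ^ Suc (Suc j)) \<le> C * (1 / (1 - \<theta>))" using C_nonneg by (intro mult_left_mono)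
    then show "K * exp (C * (\<Sum>j<n. \<theta> ^ Suc (Suc j))) \<le> K * E"
      unfolding E_def using assms(3) by (intro mult_left_mono) auto
  qed
qed

lemma cells_integral:
  fixes u :: "'a \<Rightarrow> real"
  assumes u: "integrable N u" "\<And>x. x \<in> space N \<Longrightarrow> 0 \<le> u x"
  shows "integrable (count_space \<delta>) (\<lambda>d. \<integral>x. indicator d x * u x \<partial>N)"
    and "(\<integral>d. (\<integral>x. indicator d x * u x \<partial>N) \<partial>count_space \<delta>) = (\<integral>x. u x \<partial>N)"
proof -
  note [measurable] = borel_measurable_integrable[OF u(1)]
  have i: "integrable N (\<lambda>x. indicator d x * u x)" if "d \<in> \<delta>" for d
    using integrable_real_mult_indicator[OF part_sets[OF that] u(1)] by (simp add: mult.commute)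
  have e: "ennreal (\<integral>x. indicator d x * u x \<partial>N) = (\<integral>\<^sup>+x. indicator d x * ennreal (u x) \<partial>N)" if "d \<in> \<delta>" for d
    using i[OF that] u(2)
    by (subst nn_integral_eq_integral[symmetric])
      (auto intro!: AE_I2 nn_integral_cong simp: indicator_def)
  have "(\<integral>\<^sup>+d. ennreal (\<integral>x. indicator d x * u x \<partial>N) \<partial>count_space \<delta>) = (\<integral>\<^sup>+d. (\<integral>\<^sup>+x. indicator d x * ennreal (u x) \<partial>N) \<partial>count_space \<delta>)"
    by (intro nn_integral_cong) (simp add: e)
  also have "\<dots> = (\<integral>\<^sup>+x. ennreal (u x) \<partial>N)" by (rule emeasure_sum_cells) measurable
  also have "\<dots> = ennreal (\<integral>x. u x \<partial>N)" using u by (intro nn_integral_eq_integral) (auto intro: AE_I2)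
  finally have s: "(\<integral>\<^sup>+d. ennreal (\<integral>x. indicator d x * u x \<partial>N) \<partial>count_space \<delta>) = ennreal (\<integral>x. u x \<partial>N)" .
  have nn: "0 \<le> (\<integral>x. indicator d x * u x \<partial>N)" for d
    using u(2) by (intro integral_nonneg_AE AE_I2) auto
  show "integrable (count_space \<delta>) (\<lambda>d. \<integral>x. indicator d x * u x \<partial>N)"
    using s nn by (intro integrableI_bounded) auto
  show "(\<integral>d. (\<integral>x. indicator d x * u x \<partial>N) \<partial>count_space \<delta>) = (\<integral>x. u x \<partial>N)"
    using s nn u by (subst integral_eq_nn_integral) (auto intro: integral_nonneg_AE AE_I2)
qed

lemma weight_cell_mean:
  assumes d: "d \<in> \<delta>" and x: "x \<in> F ` d" and u: "integrable N u" and L: "0 \<le> L"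
    and le: "\<And>y. y \<in> d \<Longrightarrow> a \<le> K * u y + L" and a: "0 \<le> (a :: real)"
  shows "weight d x * a \<le> c0 * (K * (\<integral>y. indicator d y * u y \<partial>N) + measure N d * L)"
proof -
  have i: "integrable N (\<lambda>x. indicator d x * u x)"
    using integrable_real_mult_indicator[OF part_sets[OF d] u] by (simp add: mult.commute)
  have id: "integrable N (indicator d :: 'a \<Rightarrow> real)"
    using part_sets[OF d] by (simp add: emeasure_eq_measure)
  have "measure N d * a = (\<integral>y. indicator d y * a \<partial>N)" using id part_sets[OF d] by simp
  also have "\<dots> \<le> (\<integral>y. K * (indicator d y * u y) + indicator d y * L \<partial>N)"
  proof (rule integral_mono)
    show "integrable N (\<lambda>y. indicator d y * a)" using id by simp
    show "integrable N (\<lambda>y. K * (indicator d y * u y) + indicator d y * L)" using i id by simp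
    show "indicator d y * a \<le> K * (indicator d y * u y) + indicator d y * L" for y
      using le by (cases "y \<in> d") auto
  qed
  also have "\<dots> = K * (\<integral>y. indicator d y * u y \<partial>N) + measure N d * L"
    using i id part_sets[OF d] by simp
  finally have "c0 * (measure N d * a) \<le> c0 * (K * (\<integral>y. indicator d y * u y \<partial>N) + measure N d * L)"
    using c0_pos by (intro mult_left_mono) auto
  moreover have "weight d x * a \<le> c0 * (measure N d * a)"
    using mult_right_mono[OF weight_le[OF d, of x] a] by (simp add: mult_ac)
  ultimately show ?thesis by linarith
qed

lemma same_1: "d \<in> \<delta> \<Longrightarrow> x \<in> d \<Longrightarrow> y \<in> d \<Longrightarrow> same 1 x y"
  by (auto simp: same_itinerary_def)

text \<open>A function that is regular on cells is dominated on each cell by its mean there; summing over the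
branches bounds the supremum of \<open>P u\<close> by the integral of \<open>u\<close>.\<close>

lemma reg_sup:
  assumes u: "reg 1 K u" "bdd B u" and x: "x \<in> space N"
  shows "P u x \<le> c0 * K * (\<integral>x. u x \<partial>N)"
proof -
  have iu: "integrable N u" and nn: "\<And>x. x \<in> space N \<Longrightarrow> 0 \<le> u x"
    using u bdd_integrable by (auto simp: reg_def)
  note ci = cells_integral[OF iu nn]
  have K: "0 \<le> c0 * K * (\<integral>y. indicator d y * u y \<partial>N)" if "d \<in> \<delta>" for d
  proof -
    have "measure N d > 0" using part_pos that by simp
    then obtain y where y: "y \<in> d" by fastforce
    have nnd: "0 \<le> (\<integral>y. indicator d y * u y \<partial>N)" using nn by (intro integral_nonneg_AE AE_I2) auto
    show ?thesis
    proof (cases "0 \<le> K")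
      case False
      have "u y = 0" if "y \<in> d" for y
      proof -
        have "u y \<le> K * u y" "0 \<le> u y"
          using u same_1[OF \<open>d \<in> \<delta>\<close> that that] cell_in_space[OF \<open>d \<in> \<delta>\<close> that] by (auto simp: reg_def)
        then show ?thesis using False mult_nonpos_nonneg[of K "u y"] by linarith
      qed
      then have "(\<lambda>y. indicator d y * u y) = (\<lambda>y. 0)" by (auto simp: indicator_def)
      then show ?thesis by simp
    qed (use nnd c0_pos in auto)
  qed
  have "P u x \<le> (\<integral>d. c0 * K * (\<integral>y. indicator d y * u y \<partial>N) \<partial>count_space \<delta>)"
    unfolding P_def
  proof (rule integral_mono)
    show "integrable (count_space \<delta>) (\<lambda>d. weight d x * u (branch d x))"
      using bdd_summable[OF u(2)] x by (simp add: P_summable_def)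
    show "integrable (count_space \<delta>) (\<lambda>d. c0 * K * (\<integral>y. indicator d y * u y \<partial>N))"
      using ci by simp
    fix d assume "d \<in> space (count_space \<delta>)" then have d: "d \<in> \<delta>" by simp
    show "weight d x * u (branch d x) \<le> c0 * K * (\<integral>y. indicator d y * u y \<partial>N)"
    proof (cases "x \<in> F ` d")
      case True
      have "u (branch d x) \<le> K * u y + 0" if "y \<in> d" for y
        using u same_1[OF d branch_in[OF True] that] branch_space[OF d True] cell_in_space[OF d that]
        by (simp add: reg_def)
      from weight_cell_mean[OF d True iu order_refl this] show ?thesis
        using nn[OF branch_space[OF d True]] by simp
    qed (use K[OF d] in \<open>simp add: weight_def\<close>)
  qed
  also have "\<dots> = c0 * K * (\<integral>x. u x \<partial>N)" using ci by simp
  finally show ?thesis .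
qed

section \<open>Ergodicity of Gibbs-Markov maps\<close>

text \<open>Approximate \<open>A\<close> by a union \<open>B\<close> of cylinders of length \<open>n\<close>. The transferred indicator \<open>h = P\<^sup>n 1\<^sub>B\<close> varies at most
by the factor \<open>E\<close> on each cell, independently of \<open>n\<close>, but it is \<open>L\<^sup>1\<close>-close to \<open>P\<^sup>n 1\<^sub>A = 1\<^sub>A\<close>. A cell that both
\<open>A\<close> and its complement charge would force \<open>h \<ge> 1/2\<close> somewhere and \<open>h < 1/(2 E)\<close> somewhere else in it.\<close>

lemma invariant_cell_dichotomy:
  assumes A: "A \<in> sets N" and inv: "F -` A \<inter> space N = A" and d: "d \<in> \<delta>"
  shows "measure N (d \<inter> A) = 0 \<or> measure N (d - A) = 0"
proof (rule ccontr)
  assume "\<not> ?thesis"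
  then have pos: "0 < measure N (d \<inter> A)" "0 < measure N (d - A)"
    using measure_nonneg[of N] by (auto simp: less_le)
  \<comment> \<open>Chosen such that an \<open>L\<^sup>1\<close> error below \<open>e\<close> excludes \<open>h < 1/2\<close> on all of \<open>d \<inter> A\<close>
    as well as \<open>h \<ge> 1/(2 E)\<close> on all of \<open>d - A\<close>.\<close>
  define e where "e = min (measure N (d \<inter> A) / 2) (measure N (d - A) / (2 * E))"
  have e: "0 < e" using pos E_pos by (simp add: e_def)
  obtain n B where B: "B \<in> sets N" "\<And>x y. same n x y \<Longrightarrow> x \<in> B \<longleftrightarrow> y \<in> B" "measure N (sym_diff A B) < e"
    using cylinder_approx[OF A e] by blast
  let ?A = "indicator A :: 'a \<Rightarrow> real" and ?B = "indicator B :: 'a \<Rightarrow> real"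
  note [measurable] = A B(1) part_sets[OF d]
  have bA: "bdd 1 ?A" and bB: "bdd 1 ?B" by (auto simp: bdd_def indicator_def)
  define h where "h = (P ^^ n) ?B"
  have bh: "bdd 1 h" unfolding h_def by (rule bdd_iter[OF bB])
  have "reg (Suc n) 1 ?B" unfolding reg_def
    using B(2) same_mono[of "Suc n" _ _ n] by (auto simp: indicator_def)
  then have rh: "reg 1 E h" unfolding h_def using reg_iter[of n 1 ?B 1] bB by simp
  have PA: "(P ^^ k) ?A x = ?A x" if "x \<in> space N" for k x using that
  proof (induction k arbitrary: x)
    case (Suc k)
    have "(P ^^ Suc k) ?A x = P ?A x" using Suc by (auto intro: P_cong)
    also have "\<dots> = P (\<lambda>y. 1 * ?A (F y)) x" using inv by (intro P_cong) (auto simp: indicator_def)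
    also have "\<dots> = ?A x" using P_comp_F[of "\<lambda>_. 1" ?A x] P_one[OF Suc.prems] by simp
    finally show ?case .
  qed simp
  have dist: "(\<integral>x. \<bar>h x - ?A x\<bar> \<partial>N) < e"
  proof -
    let ?S = "indicator (sym_diff A B) :: 'a \<Rightarrow> real"
    have bS: "bdd 1 ?S" by (auto simp: bdd_def indicator_def)
    have bD: "bdd 1 (\<lambda>x. ?B x - ?A x)" by (auto simp: bdd_def indicator_def)
    have le: "\<bar>h x - ?A x\<bar> \<le> (P ^^ n) ?S x" if "x \<in> space N" for x
    proof -
      have "h x - ?A x = (P ^^ n) (\<lambda>x. ?B x - ?A x) x"
        using P_iter_diff[OF bB bA that, of n] PA[OF that] by (simp add: h_def)
      then show ?thesis using P_iter_abs_le[OF bD bS _ that, of n] by (auto simp: indicator_def)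
    qed
    have "(\<integral>x. \<bar>h x - ?A x\<bar> \<partial>N) \<le> (\<integral>x. (P ^^ n) ?S x \<partial>N)"
      using le bdd_integrable[OF bdd_iter[OF bS]] bdd_integrable[OF bh] bdd_integrable[OF bA]
      by (intro integral_mono) auto
    also have "\<dots> = measure N (sym_diff A B)"
      using integral_P_iter[OF bS] by simp
    finally show ?thesis using B(3) by simp
  qed
  have int: "integrable N (\<lambda>x. \<bar>h x - ?A x\<bar>)" using bdd_integrable[OF bh] bdd_integrable[OF bA] by auto
  have lower: "c * measure N Z \<le> (\<integral>x. \<bar>h x - ?A x\<bar> \<partial>N)"
    if Z: "Z \<in> sets N" and c: "\<And>x. x \<in> Z \<Longrightarrow> c \<le> \<bar>h x - ?A x\<bar>" for c Z
  proof -
    have iZ: "integrable N (indicator Z :: 'a \<Rightarrow> real)" using Z by (simp add: emeasure_eq_measure)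
    have "c * measure N Z = (\<integral>x. c * indicator Z x \<partial>N)" using Z by simp
    also have "\<dots> \<le> (\<integral>x. \<bar>h x - ?A x\<bar> \<partial>N)"
    proof (rule integral_mono)
      show "integrable N (\<lambda>x. c * indicator Z x)" using iZ by simp
      show "c * indicator Z x \<le> \<bar>h x - ?A x\<bar>" for x using c by (cases "x \<in> Z") auto
    qed (rule int)
    finally show ?thesis .
  qed
  have "\<exists>y\<in>d \<inter> A. 1 / 2 \<le> h y"
  proof (rule ccontr)
    assume "\<not> ?thesis"
    then have "1 / 2 * measure N (d \<inter> A) \<le> (\<integral>x. \<bar>h x - ?A x\<bar> \<partial>N)"
    proof (intro lower)
      fix x assume x: "x \<in> d \<inter> A"
      then have "h x < 1 / 2" using \<open>\<not> (\<exists>y\<in>d \<inter> A. 1 / 2 \<le> h y)\<close> by (auto simp: not_le)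
      then have "1 / 2 \<le> \<bar>h x - 1\<bar>" by linarith
      then show "1 / 2 \<le> \<bar>h x - ?A x\<bar>" using x by simp
    qed simp
    then show False using dist by (simp add: e_def)
  qed
  then obtain y where y: "y \<in> d" "y \<in> A" "1 / 2 \<le> h y" by auto
  have "\<exists>x\<in>d - A. h x < 1 / (2 * E)"
  proof (rule ccontr)
    assume "\<not> ?thesis"
    then have "1 / (2 * E) * measure N (d - A) \<le> (\<integral>x. \<bar>h x - ?A x\<bar> \<partial>N)"
    proof (intro lower)
      fix x assume x: "x \<in> d - A"
      then have "1 / (2 * E) \<le> h x" using \<open>\<not> (\<exists>x\<in>d - A. h x < 1 / (2 * E))\<close> by (auto simp: not_less)
      then have "1 / (2 * E) \<le> \<bar>h x\<bar>" by linarith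
      then show "1 / (2 * E) \<le> \<bar>h x - ?A x\<bar>" using x by simp
    qed simp
    then show False using dist by (simp add: e_def)
  qed
  then obtain x where x: "x \<in> d" "h x < 1 / (2 * E)" by auto
  have "h y \<le> E * h x"
    using rh same_1[OF d y(1) x(1)] cell_in_space[OF d] y x by (auto simp: reg_def)
  also have "\<dots> < E * (1 / (2 * E))" using x(2) E_pos by (intro mult_strict_left_mono)
  also have "\<dots> = 1 / 2" using E_pos by simp
  finally show False using y(3) by simp
qed

text \<open>A cell that is full for \<open>A\<close> passes this property on to every cell that its image meets, as \<open>F\<close> and its branches
preserve null sets; irreducibility spreads it to all cells.\<close>

lemma ergodic:
  assumes A: "A \<in> sets N" and inv: "F -` A \<inter> space N = A"
  shows "A \<in> null_sets N \<or> space N - A \<in> null_sets N"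
proof (cases "A \<in> null_sets N")
  case False
  note [measurable] = A
  have "\<exists>d\<in>\<delta>. measure N (d \<inter> A) \<noteq> 0"
  proof (rule ccontr)
    assume "\<not> ?thesis"
    then have "d \<inter> A \<in> null_sets N" if "d \<in> \<delta>" for d
      using that part_sets[OF that] by (auto simp: null_sets_def emeasure_eq_measure)
    then have "(\<Union>d\<in>\<delta>. d \<inter> A) \<in> null_sets N" using part_countable by (intro null_sets_UN') auto
    also have "(\<Union>d\<in>\<delta>. d \<inter> A) = A" using part_cover sets.sets_into_space[OF A] by auto
    finally show False using False by simp
  qed
  then obtain d0 where d0: "d0 \<in> \<delta>" "measure N (d0 \<inter> A) \<noteq> 0" by auto
  have full0: "measure N (d0 - A) = 0" using invariant_cell_dichotomy[OF A inv d0(1)] d0 by simp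
  have step: "measure N (d' - A) = 0"
    if d: "d \<in> \<delta>" "measure N (d - A) = 0" and d': "d' \<in> \<delta>" and x: "x \<in> d" "F x \<in> d'" for d d' x
  proof -
    have dA: "d - A \<in> sets N" "d - A \<subseteq> d" using part_sets[OF d(1)] by auto
    have null: "F ` (d - A) \<in> null_sets N"
      using image_null_iff[OF d(1) dA] F_image[OF d(1) dA] d(2) by (auto simp: null_sets_def emeasure_eq_measure)
    have sub: "d' - A \<subseteq> F ` (d - A)"
    proof
      fix y assume y: "y \<in> d' - A"
      have "d' \<subseteq> F ` d" using markov[OF d(1) d'] x by blast
      then obtain z where z: "z \<in> d" "y = F z" using y by auto
      then have "z \<notin> A" using inv y cell_in_space[OF d(1) z(1)] by auto
      then show "y \<in> F ` (d - A)" using z by auto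
    qed
    have "d' - A \<in> sets N" using part_sets[OF d'] by simp
    then have "d' - A \<in> null_sets N" by (rule null_sets_subset[OF null _ sub])
    then show ?thesis by (simp add: null_sets_def measure_def)
  qed
  have orbit: "\<exists>d\<in>\<delta>. (F ^^ n) x \<in> d \<and> measure N (d - A) = 0" if x: "x \<in> d0" for n x
  proof (induction n)
    case 0 then show ?case using x d0 full0 by auto
  next
    case (Suc n)
    then obtain d where d: "d \<in> \<delta>" "(F ^^ n) x \<in> d" "measure N (d - A) = 0" by auto
    have "F ((F ^^ n) x) \<in> space N" using d cell_in_space F_space by blast
    then obtain d' where "d' \<in> \<delta>" "F ((F ^^ n) x) \<in> d'" using part_cover by auto
    then show ?case using step[OF d(1,3) _ d(2)] by auto
  qed
  have full: "measure N (d - A) = 0" if d: "d \<in> \<delta>" for d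
  proof -
    obtain x n where x: "x \<in> d0" "(F ^^ n) x \<in> d" using irreducible[OF d0(1) d] by auto
    obtain d' where "d' \<in> \<delta>" "(F ^^ n) x \<in> d'" "measure N (d' - A) = 0" using orbit[OF x(1)] by auto
    then show ?thesis using part_disjoint[OF d, of d'] x by auto
  qed
  have "(\<Union>d\<in>\<delta>. d - A) \<in> null_sets N"
    using part_countable full part_sets by (intro null_sets_UN') (auto simp: null_sets_def emeasure_eq_measure)
  also have "(\<Union>d\<in>\<delta>. d - A) = space N - A" using part_cover by auto
  finally show ?thesis by simp
qed simp

end

context gibbs_markov begin

section \<open>The Poisson equation on Hoelder functions\<close>

text \<open>The ball of the Hoelder space with supremum at most \<open>K\<close> and seminorm at most \<open>D\<close>. Two points
are compared only if they have a positive separation time.\<close>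

definition hol :: "real \<Rightarrow> real \<Rightarrow> ('a \<Rightarrow> real) \<Rightarrow> bool" where
  "hol K D v \<longleftrightarrow> bdd K v \<and> (\<forall>n\<ge>1. \<forall>x y. same n x y \<longrightarrow> \<bar>v x - v y\<bar> \<le> D * \<theta> ^ n)"

lemma hol_bdd: "hol K D v \<Longrightarrow> bdd K v"
  by (simp add: hol_def)

lemma holD: "hol K D v \<Longrightarrow> same n x y \<Longrightarrow> 1 \<le> n \<Longrightarrow> \<bar>v x - v y\<bar> \<le> D * \<theta> ^ n"
  unfolding hol_def by blast

lemma hol_abs: "hol K D v \<Longrightarrow> x \<in> space N \<Longrightarrow> \<bar>v x\<bar> \<le> K"
  by (simp add: hol_def bdd_def)

lemma hol_measurable: "hol K D v \<Longrightarrow> v \<in> borel_measurable N"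
  by (simp add: hol_def bdd_def)

lemma hol_mono:
  assumes "hol K D v" "K \<le> K'" "D \<le> D'" shows "hol K' D' v"
proof -
  have "\<bar>v x - v y\<bar> \<le> D' * \<theta> ^ n" if "same n x y" "1 \<le> n" for n x y
    using order_trans[OF holD[OF assms(1) that] mult_right_mono[OF assms(3), of "\<theta> ^ n"]] theta_pos by simp
  then show ?thesis using assms by (fastforce simp: hol_def bdd_def)
qed

lemma hol_add:
  assumes v: "hol K D v" and u: "hol K' D' u" shows "hol (K + K') (D + D') (\<lambda>x. v x + u x)"
  unfolding hol_def bdd_def
proof (intro conjI ballI allI impI)
  show "(\<lambda>x. v x + u x) \<in> borel_measurable N"
    using hol_measurable[OF v] hol_measurable[OF u] by measurable
  show "\<bar>v x + u x\<bar> \<le> K + K'" if "x \<in> space N" for x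
    using hol_abs[OF v that] hol_abs[OF u that] by linarith
  show "\<bar>(v x + u x) - (v y + u y)\<bar> \<le> (D + D') * \<theta> ^ n" if "1 \<le> n" "same n x y" for n x y
    using holD[OF v that(2,1)] holD[OF u that(2,1)] unfolding distrib_right by linarith
qed

lemma hol_cmult:
  assumes v: "hol K D v" shows "hol (\<bar>c\<bar> * K) (\<bar>c\<bar> * D) (\<lambda>x. c * v x)"
  unfolding hol_def bdd_def
proof (intro conjI ballI allI impI)
  show "(\<lambda>x. c * v x) \<in> borel_measurable N"
    using hol_measurable[OF v] by measurable
  show "\<bar>c * v x\<bar> \<le> \<bar>c\<bar> * K" if "x \<in> space N" for x
    using hol_abs[OF v that] by (simp add: abs_mult mult_left_mono)
  show "\<bar>c * v x - c * v y\<bar> \<le> \<bar>c\<bar> * D * \<theta> ^ n" if "1 \<le> n" "same n x y" for n x y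
    using mult_left_mono[OF holD[OF v that(2,1)], of "\<bar>c\<bar>"]
    by (simp add: abs_mult[symmetric] right_diff_distrib mult.assoc)
qed

lemma hol_diff:
  "hol K D v \<Longrightarrow> hol K' D' u \<Longrightarrow> hol (K + K') (D + D') (\<lambda>x. v x - u x)"
  using hol_add[of K D v K' D' "\<lambda>x. - u x"] hol_cmult[of K' D' u "-1"] by simp

definition C1 :: real where "C1 = C * exp C"

lemma C1_nonneg: "0 \<le> C1"
  using C_nonneg by (simp add: C1_def)

lemma weight_diff:
  assumes s: "same n x y" and n: "1 \<le> n" and d: "d \<in> \<delta>"
  shows "\<bar>weight d x - weight d y\<bar> \<le> C1 * \<theta> ^ n * weight d x"
proof -
  define a where "a = C * \<theta> ^ Suc n"
  have a0: "0 \<le> a" using C_nonneg theta_pos by (simp add: a_def)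
  have t1: "\<theta> ^ Suc n \<le> \<theta> ^ n" "\<theta> ^ Suc n \<le> 1"
    using theta_pos theta_less by (auto intro!: power_decreasing power_le_one mult_le_one)
  have aC: "a \<le> C" "a \<le> C * \<theta> ^ n" using t1 C_nonneg by (auto simp: a_def intro: mult_left_mono mult_left_le)
  have wy: "weight d y \<le> exp a * weight d x" and wx: "weight d x \<le> exp a * weight d y"
    using weight_ratio[OF s n d] weight_ratio[OF same_sym[OF s] n d] by (simp_all add: a_def)
  have w0: "0 \<le> weight d x" using weight_nonneg[OF d] .
  have e1: "exp a - 1 \<le> a * exp a"
  proof -
    have "1 - a \<le> exp (- a)" using exp_ge_add_one_self[of "- a"] by simp
    then have "exp a * (1 - a) \<le> exp a * exp (- a)" by (intro mult_left_mono) auto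
    also have "exp a * exp (- a) = 1" by (simp add: exp_minus)
    finally show ?thesis by (simp add: right_diff_distrib mult.commute)
  qed
  have "a * exp a \<le> (C * \<theta> ^ n) * exp C" using aC a0 by (intro mult_mono) auto
  then have e2: "exp a - 1 \<le> C1 * \<theta> ^ n" using e1 by (simp add: C1_def mult_ac)
  have "weight d y - weight d x \<le> (exp a - 1) * weight d x" using wy by (simp add: left_diff_distrib)
  moreover have "weight d x - weight d y \<le> (exp a - 1) * weight d x"
  proof -
    have "exp (- a) * weight d x \<le> weight d y" using wx by (simp add: exp_minus field_simps)
    moreover have "1 - exp (- a) \<le> exp a - 1"
    proof -
      have "1 + a \<le> exp a" "1 - a \<le> exp (- a)" using exp_ge_add_one_self[of a] exp_ge_add_one_self[of "- a"] by auto
      then show ?thesis by linarith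
    qed
    then have "(1 - exp (- a)) * weight d x \<le> (exp a - 1) * weight d x" using w0 by (rule mult_right_mono)
    ultimately show ?thesis by (simp add: left_diff_distrib)
  qed
  moreover have "(exp a - 1) * weight d x \<le> C1 * \<theta> ^ n * weight d x" using e2 w0 by (rule mult_right_mono)
  ultimately show ?thesis by (simp add: abs_le_iff)
qed

text \<open>The basic two-point estimate: compare \<open>P v x\<close> and \<open>P v y\<close> branch by branch. \<open>A\<close> bounds the contribution of the
distortion of the weights and \<open>B\<close> that of the oscillation of \<open>v\<close>. Keeping both as summable families
of cell-dependent constants covers bounded Hoelder functions as well as those with unbounded
local Hoelder constants.\<close>

lemma P_diff_le:
  assumes s: "same n x y" and n: "1 \<le> n" and v: "P_summable v" and x: "x \<in> space N" and y: "y \<in> space N"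
    and A: "integrable (count_space \<delta>) A" "\<And>d. d \<in> \<delta> \<Longrightarrow> 0 \<le> A d"
      "\<And>d. d \<in> \<delta> \<Longrightarrow> x \<in> F ` d \<Longrightarrow> weight d x * \<bar>v (branch d x)\<bar> \<le> A d"
    and B: "integrable (count_space \<delta>) B" "\<And>d. d \<in> \<delta> \<Longrightarrow> 0 \<le> B d"
      "\<And>d. d \<in> \<delta> \<Longrightarrow> x \<in> F ` d \<Longrightarrow> weight d y * \<bar>v (branch d x) - v (branch d y)\<bar> \<le> B d * \<theta> ^ Suc n"
  shows "\<bar>P v x - P v y\<bar> \<le> (C1 * (\<integral>d. A d \<partial>count_space \<delta>) + \<theta> * (\<integral>d. B d \<partial>count_space \<delta>)) * \<theta> ^ n"
proof -
  have i: "integrable (count_space \<delta>) (\<lambda>d. weight d x * v (branch d x))"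
    "integrable (count_space \<delta>) (\<lambda>d. weight d y * v (branch d y))"
    using v x y by (auto simp: P_summable_def)
  have "P v x - P v y = (\<integral>d. weight d x * v (branch d x) - weight d y * v (branch d y) \<partial>count_space \<delta>)"
    unfolding P_def using i by simp
  then have "\<bar>P v x - P v y\<bar> \<le> (\<integral>d. \<bar>weight d x * v (branch d x) - weight d y * v (branch d y)\<bar> \<partial>count_space \<delta>)"
    using integral_abs_bound[of "count_space \<delta>" "\<lambda>d. weight d x * v (branch d x) - weight d y * v (branch d y)"] by simp
  also have "\<dots> \<le> (\<integral>d. C1 * \<theta> ^ n * A d + \<theta> ^ Suc n * B d \<partial>count_space \<delta>)"
  proof (rule integral_mono)
    show "integrable (count_space \<delta>) (\<lambda>d. \<bar>weight d x * v (branch d x) - weight d y * v (branch d y)\<bar>)"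
      using i by auto
    show "integrable (count_space \<delta>) (\<lambda>d. C1 * \<theta> ^ n * A d + \<theta> ^ Suc n * B d)"
      using A B by auto
    fix d assume "d \<in> space (count_space \<delta>)" then have d: "d \<in> \<delta>" by simp
    show "\<bar>weight d x * v (branch d x) - weight d y * v (branch d y)\<bar> \<le> C1 * \<theta> ^ n * A d + \<theta> ^ Suc n * B d"
    proof (cases "x \<in> F ` d")
      case True
      have "weight d x * v (branch d x) - weight d y * v (branch d y)
        = (weight d x - weight d y) * v (branch d x) + weight d y * (v (branch d x) - v (branch d y))"
        by (simp add: algebra_simps)
      then have "\<bar>weight d x * v (branch d x) - weight d y * v (branch d y)\<bar>
        \<le> \<bar>weight d x - weight d y\<bar> * \<bar>v (branch d x)\<bar> + weight d y * \<bar>v (branch d x) - v (branch d y)\<bar>"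
        using abs_triangle_ineq[of "(weight d x - weight d y) * v (branch d x)" "weight d y * (v (branch d x) - v (branch d y))"]
          weight_nonneg[OF d, of y] by (simp add: abs_mult)
      also have "\<bar>weight d x - weight d y\<bar> * \<bar>v (branch d x)\<bar> \<le> C1 * \<theta> ^ n * weight d x * \<bar>v (branch d x)\<bar>"
        by (intro mult_right_mono weight_diff[OF s n d]) auto
      also have "\<dots> = C1 * \<theta> ^ n * (weight d x * \<bar>v (branch d x)\<bar>)" by simp
      also have "\<dots> \<le> C1 * \<theta> ^ n * A d"
        using A(3)[OF d True] C1_nonneg theta_pos by (intro mult_left_mono) auto
      finally show ?thesis using B(3)[OF d True] by (simp add: mult.commute)
    next
      case False
      then have "y \<notin> F ` d" using same_branch_mem[OF s n d] by simp
      then show ?thesis using False A(2)[OF d] B(2)[OF d] C1_nonneg theta_pos by (simp add: weight_def)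
    qed
  qed
  also have "\<dots> = (C1 * (\<integral>d. A d \<partial>count_space \<delta>) + \<theta> * (\<integral>d. B d \<partial>count_space \<delta>)) * \<theta> ^ n"
    using A(1) B(1) by (simp add: algebra_simps)
  finally show ?thesis .
qed

lemma weight_sum: "x \<in> space N \<Longrightarrow> integrable (count_space \<delta>) (\<lambda>d. weight d x) \<and> (\<integral>d. weight d x \<partial>count_space \<delta>) = 1"
  using one_summable[of 1] P_one[of x] by (auto simp: P_summable_def P_def)

lemma lasota_yorke:
  assumes v: "hol K D v" shows "hol K (\<theta> * D + C1 * K) (P v)"
  unfolding hol_def
proof (intro conjI allI impI)
  show "bdd K (P v)" by (rule bdd_P[OF hol_bdd[OF v]])
  fix n x y assume n: "1 \<le> n" and s: "same n x y"
  have x: "x \<in> space N" and y: "y \<in> space N" using same_space[OF s n] by auto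
  have K0: "0 \<le> K" using hol_abs[OF v x] by linarith
  have D0: "0 \<le> D" using holD[OF v same_refl[OF x], of 1] theta_pos by (simp add: zero_le_mult_iff)
  have "\<bar>P v x - P v y\<bar> \<le> (C1 * (\<integral>d. K * weight d x \<partial>count_space \<delta>) + \<theta> * (\<integral>d. D * weight d y \<partial>count_space \<delta>)) * \<theta> ^ n"
  proof (rule P_diff_le[OF s n bdd_summable[OF hol_bdd[OF v]] x y])
    fix d assume d: "d \<in> \<delta>" and xd: "x \<in> F ` d"
    note b = same_branch[OF s n d xd]
    show "weight d x * \<bar>v (branch d x)\<bar> \<le> K * weight d x"
      using hol_abs[OF v branch_space[OF d xd]] weight_nonneg[OF d, of x]
      by (subst mult.commute[of K]) (intro mult_left_mono)
    show "weight d y * \<bar>v (branch d x) - v (branch d y)\<bar> \<le> D * weight d y * \<theta> ^ Suc n"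
      using mult_left_mono[OF holD[OF v b(2)] weight_nonneg[OF d, of y]] by (simp add: mult_ac)
  qed (use weight_sum[OF x] weight_sum[OF y] weight_nonneg K0 D0 in auto)
  also have "\<dots> = (\<theta> * D + C1 * K) * \<theta> ^ n" using weight_sum[OF x] weight_sum[OF y] by simp
  finally show "\<bar>P v x - P v y\<bar> \<le> (\<theta> * D + C1 * K) * \<theta> ^ n" .
qed

text \<open>Since \<open>v = P v + (v - P v)\<close>, a seminorm \<open>D\<close> of \<open>v\<close> improves to \<open>\<theta> D + C1 K + e\<close> by the Lasota-Yorke
inequality; iterating gives the fixed point of this contraction.\<close>

lemma hol_from_difference:
  assumes v: "hol K D v" and vd: "hol K' e (\<lambda>x. v x - P v x)"
  shows "hol K ((C1 * K + e) / (1 - \<theta>)) v"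
proof -
  have step: "hol K (\<theta> * D' + (C1 * K + e)) v" if "hol K D' v" for D'
  proof -
    have "\<bar>v x - v y\<bar> \<le> (\<theta> * D' + (C1 * K + e)) * \<theta> ^ n" if s: "same n x y" and n: "1 \<le> n" for n x y
      using holD[OF vd s n] holD[OF lasota_yorke[OF \<open>hol K D' v\<close>] s n] by (simp add: distrib_right)
    then show ?thesis using hol_bdd[OF v] by (simp add: hol_def)
  qed
  define X where "X = (C1 * K + e) / (1 - \<theta>)"
  have X: "\<theta> * X + (C1 * K + e) = X" using theta_less by (simp add: X_def field_simps)
  have it: "hol K (X + \<theta> ^ k * (D - X)) v" for k
  proof (induction k)
    case (Suc k)
    have "\<theta> * (X + \<theta> ^ k * (D - X)) + (C1 * K + e) = (\<theta> * X + (C1 * K + e)) + \<theta> ^ Suc k * (D - X)"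
      by (simp add: distrib_left)
    then show ?case using step[OF Suc] unfolding X by simp
  qed (use v in simp)
  have "\<bar>v x - v y\<bar> \<le> X * \<theta> ^ n" if s: "same n x y" and n: "1 \<le> n" for n x y
  proof (rule LIMSEQ_le_const)
    have "(\<lambda>k. (X + \<theta> ^ k * (D - X)) * \<theta> ^ n) \<longlonglongrightarrow> (X + 0 * (D - X)) * \<theta> ^ n"
      by (intro tendsto_mult tendsto_add tendsto_const theta_power_tendsto)
    then show "(\<lambda>k. (X + \<theta> ^ k * (D - X)) * \<theta> ^ n) \<longlonglongrightarrow> X * \<theta> ^ n" by simp
  qed (use holD[OF it s n] in auto)
  then show ?thesis using hol_bdd[OF v] by (simp add: hol_def X_def)
qed

text \<open>There are countably many itineraries of each finite length; choose one point for each.\<close>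

lemma countable_skeleton:
  obtains Q where "countable Q" "Q \<subseteq> space N" "\<And>n x. x \<in> space N \<Longrightarrow> \<exists>q\<in>Q. same n x q"
proof -
  define cell where "cell = (\<lambda>x. THE d. d \<in> \<delta> \<and> x \<in> d)"
  have cell: "cell x = d" if "d \<in> \<delta>" "x \<in> d" for d x
    unfolding cell_def using that part_disjoint by (intro the_equality) auto
  have cell_mem: "cell x \<in> \<delta> \<and> x \<in> cell x" if "x \<in> space N" for x
    using that part_cover cell by auto
  define code where "code = (\<lambda>n x. map (\<lambda>i. cell ((F ^^ i) x)) [0..<n])"
  have "countable (code n ` space N)" for n
  proof (rule countable_subset)
    show "code n ` space N \<subseteq> lists \<delta>" using cell_mem Fn_space by (auto simp: code_def)
    show "countable (lists \<delta>)" by (rule countable_lists[OF part_countable])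
  qed
  then have cQ: "countable (\<Union>n. inv_into (space N) (code n) ` code n ` space N)" by auto
  have "\<exists>q\<in>(\<Union>n. inv_into (space N) (code n) ` code n ` space N). same n x q" if x: "x \<in> space N" for n x
  proof
    let ?q = "inv_into (space N) (code n) (code n x)"
    show "?q \<in> (\<Union>n. inv_into (space N) (code n) ` code n ` space N)" using x by blast
    have q: "?q \<in> space N" "code n ?q = code n x" using x by (auto intro: inv_into_into f_inv_into_f)
    have "cell ((F ^^ i) ?q) = cell ((F ^^ i) x)" if "i < n" for i
    proof -
      have "code n ?q ! i = code n x ! i" using q by simp
      then show ?thesis using that by (simp add: code_def)
    qed
    then show "same n x ?q" unfolding same_itinerary_def
      using cell_mem[OF Fn_space[OF x]] cell_mem[OF Fn_space[OF q(1)]] by metis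
  qed
  then show ?thesis using cQ by (intro that[of "\<Union>n. inv_into (space N) (code n) ` code n ` space N"]) (auto intro: inv_into_into)
qed

text \<open>An Arzela-Ascoli argument: a diagonal subsequence converges on a countable skeleton, and the uniform Hoelder bound
carries the convergence to every point.\<close>

lemma hol_compact:
  assumes v: "\<And>j. hol K D (v j)"
  obtains r u where "strict_mono (r :: nat \<Rightarrow> nat)" "hol K D u" "\<And>x. x \<in> space N \<Longrightarrow> (\<lambda>j. v (r j) x) \<longlonglongrightarrow> u x"
proof -
  obtain Q where Q: "countable Q" "Q \<subseteq> space N" "\<And>n x. x \<in> space N \<Longrightarrow> \<exists>q\<in>Q. same n x q"
    by (rule countable_skeleton) blast
  have nb: "\<And>j x. x \<in> Q \<Longrightarrow> norm (v j x) \<le> K" using hol_abs[OF v] Q(2) by auto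
  obtain r :: "nat \<Rightarrow> nat" where r: "strict_mono r" "\<And>x. x \<in> Q \<Longrightarrow> \<exists>l. (\<lambda>n. v (r n) x) \<longlonglongrightarrow> l"
    by (rule function_convergent_subsequence[of Q v K, OF Q(1) nb]) auto
  have conv: "convergent (\<lambda>j. v (r j) x)" if x: "x \<in> space N" for x
  proof -
    have "Cauchy (\<lambda>j. v (r j) x)"
    proof (rule CauchyI)
      fix e :: real assume e: "0 < e"
      have "(\<lambda>n. D * \<theta> ^ n) \<longlonglongrightarrow> D * 0" by (intro tendsto_mult tendsto_const theta_power_tendsto)
      then have "(\<lambda>n. D * \<theta> ^ n) \<longlonglongrightarrow> 0" by simp
      then have "\<forall>\<^sub>F n in sequentially. D * \<theta> ^ n < e / 3" by (rule order_tendstoD) (use e in simp)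
      then have "\<forall>\<^sub>F n in sequentially. D * \<theta> ^ n < e / 3 \<and> 1 \<le> n"
        using eventually_ge_at_top[of 1] by eventually_elim auto
      from eventually_happens[OF this] obtain n :: nat where n: "D * \<theta> ^ n < e / 3" "1 \<le> n" by auto
      obtain q where q: "q \<in> Q" "same n x q" using Q(3)[OF x] by blast
      have close: "\<bar>v (r j) x - v (r j) q\<bar> < e / 3" for j using holD[OF v q(2) n(2), of "r j"] n(1) by linarith
      have "Cauchy (\<lambda>j. v (r j) q)" using r(2)[OF q(1)] LIMSEQ_imp_Cauchy by blast
      then obtain M where M: "\<And>m k. m \<ge> M \<Longrightarrow> k \<ge> M \<Longrightarrow> norm (v (r m) q - v (r k) q) < e / 3"
        using CauchyD[of _ "e / 3"] e by (metis divide_pos_pos zero_less_numeral)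
      show "\<exists>M. \<forall>m\<ge>M. \<forall>k\<ge>M. norm (v (r m) x - v (r k) x) < e"
      proof (intro exI[of _ M] allI impI)
        fix m k assume "m \<ge> M" "k \<ge> M"
        then have "\<bar>v (r m) q - v (r k) q\<bar> < e / 3" using M by (metis real_norm_def)
        then show "norm (v (r m) x - v (r k) x) < e" using close[of m] close[of k] unfolding real_norm_def by linarith
      qed
    qed
    then show ?thesis by (simp add: Cauchy_convergent)
  qed
  define u where "u = (\<lambda>x. if x \<in> space N then lim (\<lambda>j. v (r j) x) else 0)"
  have u: "(\<lambda>j. v (r j) x) \<longlonglongrightarrow> u x" if "x \<in> space N" for x
    using conv[OF that] that by (simp add: u_def convergent_LIMSEQ_iff)
  have "hol K D u" unfolding hol_def bdd_def
  proof (intro conjI ballI allI impI)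
    show "u \<in> borel_measurable N"
      using hol_measurable[OF v] u by (rule borel_measurable_LIMSEQ_real[rotated])
    show "\<bar>u x\<bar> \<le> K" if "x \<in> space N" for x
      by (rule LIMSEQ_le_const2[OF tendsto_rabs[OF u[OF that]]]) (use hol_abs[OF v that] in auto)
    show "\<bar>u x - u y\<bar> \<le> D * \<theta> ^ n" if n: "1 \<le> n" and s: "same n x y" for n x y
    proof -
      have "x \<in> space N" "y \<in> space N" using same_space[OF s n] by auto
      from tendsto_rabs[OF tendsto_diff[OF u[OF this(1)] u[OF this(2)]]]
      show ?thesis by (rule LIMSEQ_le_const2) (use holD[OF v s n] in auto)
    qed
  qed
  then show ?thesis using r(1) u by (intro that) auto
qed

lemma P_tendsto:
  assumes v: "\<And>j. bdd K (v j)" and lim: "\<And>x. x \<in> space N \<Longrightarrow> (\<lambda>j. v j x) \<longlonglongrightarrow> u x" and x: "x \<in> space N"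
  shows "(\<lambda>j. P (v j) x) \<longlonglongrightarrow> P u x"
  unfolding P_def
proof (rule integral_dominated_convergence[where w = "\<lambda>d. weight d x * K"])
  show "integrable (count_space \<delta>) (\<lambda>d. weight d x * K)" using weight_sum[OF x] by simp
  show "AE d in count_space \<delta>. (\<lambda>j. weight d x * v j (branch d x)) \<longlonglongrightarrow> weight d x * u (branch d x)"
  proof (rule AE_I2)
    fix d assume "d \<in> space (count_space \<delta>)"
    then show "(\<lambda>j. weight d x * v j (branch d x)) \<longlonglongrightarrow> weight d x * u (branch d x)"
      using lim[OF branch_space, of d x] by (cases "x \<in> F ` d") (auto simp: weight_def intro: tendsto_mult)
  qed
  show "AE d in count_space \<delta>. norm (weight d x * v j (branch d x)) \<le> weight d x * K" for j
  proof (rule AE_I2)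
    fix d assume "d \<in> space (count_space \<delta>)"
    then have d: "d \<in> \<delta>" by simp
    show "norm (weight d x * v j (branch d x)) \<le> weight d x * K"
      using weight_nonneg[OF d, of x] v[of j] branch_space[OF d, of x]
      by (cases "x \<in> F ` d") (auto simp: weight_def bdd_def abs_mult intro!: mult_left_mono)
  qed
qed auto

text \<open>\<open>\<integral> (v \<circ> F - v)\<^sup>2 = 2 \<integral> v\<^sup>2 - 2 \<integral> v \<cdot> (v \<circ> F)\<close> by invariance, and the last integral is \<open>\<integral> P v \<cdot> v = \<integral> v\<^sup>2\<close>. So
\<open>v \<circ> F = v\<close> almost everywhere, hence everywhere by regularity.\<close>

lemma fixed_point_invariant:
  assumes v: "hol K D v" and fp: "\<And>x. x \<in> space N \<Longrightarrow> P v x = v x" and x: "x \<in> space N"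
  shows "v (F x) = v x"
proof -
  note [measurable] = hol_measurable[OF v]
  have K: "\<bar>v x\<bar> \<le> K" if "x \<in> space N" for x using hol_abs[OF v that] .
  have KK: "\<bar>v x * v y\<bar> \<le> K * K" if "x \<in> space N" "y \<in> space N" for x y
    unfolding abs_mult by (rule mult_mono) (use K that abs_ge_zero[of "v x"] order_trans[OF abs_ge_zero K] in auto)
  have i2: "integrable N (\<lambda>x. v x * v x)"
  proof (rule integrable_bdd[of _ "K * K"])
    show "\<bar>v x * v x\<bar> \<le> K * K" if "x \<in> space N" for x by (rule KK[OF that that])
  qed measurable
  have i3: "integrable N (\<lambda>x. v x * v (F x))" by (rule integrable_bdd[of _ "K * K"]) (use KK F_space in auto)
  have c: "(\<integral>x. v x * v (F x) \<partial>N) = (\<integral>x. v x * v x \<partial>N)"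
    using P_dual[OF bdd_summable[OF hol_bdd[OF v]] bdd_integrable[OF hol_bdd[OF v]], of v K] K fp
    by (simp cong: Bochner_Integration.integral_cong)
  have d: "(\<integral>x. v (F x) * v (F x) \<partial>N) = (\<integral>x. v x * v x \<partial>N)"
    by (rule integral_F[of "\<lambda>x. v x * v x"]) measurable
  have i1: "integrable N (\<lambda>x. v (F x) * v (F x))" by (rule integrable_F[OF i2])
  have sq: "(\<lambda>x. (v (F x) - v x)\<^sup>2) = (\<lambda>x. v (F x) * v (F x) - 2 * (v x * v (F x)) + v x * v x)"
    by (auto simp: power2_eq_square algebra_simps)
  then have "(\<integral>x. (v (F x) - v x)\<^sup>2 \<partial>N) = (\<integral>x. v (F x) * v (F x) - 2 * (v x * v (F x)) + v x * v x \<partial>N)"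
    by simp
  also have "\<dots> = (\<integral>x. v (F x) * v (F x) \<partial>N) - 2 * (\<integral>x. v x * v (F x) \<partial>N) + (\<integral>x. v x * v x \<partial>N)"
    using i1 i2 i3 by simp
  finally have z: "(\<integral>x. (v (F x) - v x)\<^sup>2 \<partial>N) = 0" using c d by simp
  have "integrable N (\<lambda>x. (v (F x) - v x)\<^sup>2)"
    unfolding sq using i1 i2 i3 by simp
  then have "AE x in N. (v (F x) - v x)\<^sup>2 = 0" using z by (subst (asm) integral_nonneg_eq_0_iff_AE) auto
  then have ae: "AE x in N. v (F x) = v x" by eventually_elim simp
  have "\<bar>v (F x) - v x\<bar> \<le> 2 * \<bar>D\<bar> * \<theta> ^ Suc n" for n
  proof -
    obtain y where y: "y \<in> space N" "same (Suc (Suc n)) x y" "v (F y) = v y" using AE_cyl[OF ae x] by blast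
    have s1: "same (Suc n) (F x) (F y)" using y same_F by blast
    have s2: "same (Suc n) x y" using same_mono[OF y(2)] by simp
    have "\<bar>v (F x) - v (F y)\<bar> \<le> D * \<theta> ^ Suc n" "\<bar>v x - v y\<bar> \<le> D * \<theta> ^ Suc n"
      using holD[OF v s1] holD[OF v s2] by auto
    moreover have "D * \<theta> ^ Suc n \<le> \<bar>D\<bar> * \<theta> ^ Suc n" using theta_pos by (intro mult_right_mono) auto
    ultimately show ?thesis using y by linarith
  qed
  moreover have "(\<lambda>n. 2 * \<bar>D\<bar> * \<theta> ^ Suc n) \<longlonglongrightarrow> 2 * \<bar>D\<bar> * 0"
    by (intro tendsto_mult tendsto_const LIMSEQ_Suc theta_power_tendsto)
  ultimately have "\<bar>v (F x) - v x\<bar> \<le> 2 * \<bar>D\<bar> * 0" by (intro LIMSEQ_le_const) auto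
  then show ?thesis by simp
qed

lemma fixed_point_zero:
  assumes v: "hol K D v" and fp: "\<And>x. x \<in> space N \<Longrightarrow> P v x = v x" and mean: "(\<integral>x. v x \<partial>N) = 0"
  shows "AE x in N. v x = 0"
proof -
  note [measurable] = hol_measurable[OF v]
  have iv: "integrable N v" by (rule bdd_integrable[OF hol_bdd[OF v]])
  have main: "AE x in N. \<not> 0 < s * v x" if s: "s = 1 \<or> s = - 1" for s :: real
  proof -
    define A where "A = {x \<in> space N. 0 < s * v x}"
    have A [measurable]: "A \<in> sets N" unfolding A_def by measurable
    have inv: "F -` A \<inter> space N = A"
      using fixed_point_invariant[OF v fp] F_space by (auto simp: A_def)
    have "A \<in> null_sets N"
    proof (rule ccontr)
      assume nA: "A \<notin> null_sets N"
      with ergodic[OF A inv] have "space N - A \<in> null_sets N" by blast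
      then have "AE x in N. x \<notin> space N - A" by (rule AE_not_in)
      then have pos: "AE x in N. 0 < s * v x" using AE_space by eventually_elim (auto simp: A_def)
      have i: "integrable N (\<lambda>x. s * v x)" using iv by simp
      have "(\<integral>x. s * v x \<partial>N) = 0" using mean by simp
      moreover have "AE x in N. 0 \<le> s * v x" using pos by eventually_elim simp
      ultimately have "AE x in N. s * v x = 0" using integral_nonneg_eq_0_iff_AE[OF i] by simp
      with pos have "AE x in N. False" by eventually_elim simp
      then have "space N \<in> null_sets N" by (subst AE_iff_null_sets) auto
      then have "A \<in> null_sets N" by (rule null_sets_subset[OF _ A sets.sets_into_space[OF A]])
      then show False using nA by simp
    qed
    then have "AE x in N. x \<notin> A" by (rule AE_not_in)
    then show ?thesis using AE_space by eventually_elim (auto simp: A_def)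
  qed
  have "AE x in N. \<not> 0 < v x" "AE x in N. \<not> 0 < - v x" using main[of 1] main[of "-1"] by simp_all
  then show ?thesis by eventually_elim auto
qed

lemma hol_iter:
  assumes w: "hol K D w" and D: "C1 * K / (1 - \<theta>) \<le> D" shows "hol K D ((P ^^ n) w)"
proof (induction n)
  case (Suc n)
  have "C1 * K \<le> D * (1 - \<theta>)" using D theta_less by (simp add: pos_divide_le_eq)
  then have "\<theta> * D + C1 * K \<le> D" by (simp add: algebra_simps)
  then show ?case using hol_mono[OF lasota_yorke[OF Suc] order_refl] by simp
qed (simp add: w)

text \<open>The function \<open>\<bar>v\<bar> + D \<theta>\<^sup>n\<close> oscillates at most by the factor \<open>2\<close> on cylinders of length \<open>n\<close>, so after
\<open>n\<close> applications of \<open>P\<close> its supremum is controlled by its integral.\<close>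

lemma sup_le_L1:
  assumes v: "hol 1 D v" and n: "1 \<le> n" and x: "x \<in> space N"
  shows "\<bar>(P ^^ n) v x\<bar> \<le> 2 * c0 * E * ((\<integral>x. \<bar>v x\<bar> \<partial>N) + D * \<theta> ^ n * measure N (space N))"
proof -
  obtain k where k: "n = Suc k" using n by (cases n) auto
  have D0: "0 \<le> D" using holD[OF v same_refl[OF x], of 1] theta_pos by (simp add: zero_le_mult_iff)
  define u where "u = (\<lambda>x. \<bar>v x\<bar> + D * \<theta> ^ n)"
  have [measurable]: "v \<in> borel_measurable N" by (rule hol_measurable[OF v])
  have bu: "bdd (1 + D * \<theta> ^ n) u" unfolding u_def bdd_def
    using hol_abs[OF v] D0 theta_pos by (auto simp: abs_of_nonneg)
  have ru: "reg (Suc k) 2 u" unfolding reg_def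
  proof (intro conjI allI impI ballI)
    show "u \<in> borel_measurable N" unfolding u_def by measurable
    show "0 \<le> u x" for x using D0 theta_pos by (simp add: u_def)
    show "u x \<le> 2 * u y" if "same (Suc k) x y" for x y
      using holD[OF v that] D0 theta_pos unfolding u_def k by (auto simp: abs_le_iff)
  qed
  have r1: "reg 1 (2 * E) ((P ^^ k) u)" using reg_iter[OF ru bu] by simp
  have "\<bar>(P ^^ n) v x\<bar> \<le> (P ^^ n) u x"
    using D0 theta_pos by (intro P_iter_abs_le[OF hol_bdd[OF v] bu _ x]) (auto simp: u_def)
  also have "\<dots> = P ((P ^^ k) u) x" by (simp add: k)
  also have "\<dots> \<le> c0 * (2 * E) * (\<integral>x. (P ^^ k) u x \<partial>N)" by (rule reg_sup[OF r1 bdd_iter[OF bu] x])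
  also have "(\<integral>x. (P ^^ k) u x \<partial>N) = (\<integral>x. u x \<partial>N)" by (rule integral_P_iter[OF bu])
  also have "\<dots> = (\<integral>x. \<bar>v x\<bar> \<partial>N) + D * \<theta> ^ n * measure N (space N)"
    unfolding u_def using bdd_integrable[OF hol_bdd[OF v]] by simp
  finally show ?thesis by (simp add: mult_ac)
qed

lemma telescope_sup:
  assumes v: "bdd K v" and e: "\<And>x. x \<in> space N \<Longrightarrow> \<bar>v x - P v x\<bar> \<le> e" and x: "x \<in> space N"
  shows "\<bar>v x - (P ^^ n) v x\<bar> \<le> n * e"
proof -
  have [measurable]: "v \<in> borel_measurable N" "P v \<in> borel_measurable N"
    using v P_measurable by (auto simp: bdd_def)
  have bd: "bdd e (\<lambda>x. v x - P v x)" using e by (simp add: bdd_def)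
  have "v x - (P ^^ n) v x = (\<Sum>k<n. (P ^^ k) (\<lambda>x. v x - P v x) x)"
  proof (induction n)
    case (Suc n)
    have "(P ^^ n) (\<lambda>x. v x - P v x) x = (P ^^ n) v x - (P ^^ Suc n) v x"
      using P_iter_diff[OF v bdd_P[OF v] x, of n] by (simp add: funpow_swap1)
    then show ?case using Suc by simp
  qed simp
  also have "\<bar>\<dots>\<bar> \<le> (\<Sum>k<n. \<bar>(P ^^ k) (\<lambda>x. v x - P v x) x\<bar>)" by (rule sum_abs)
  also have "\<dots> \<le> (\<Sum>k<n. e)"
    using bdd_iter[OF bd] x by (intro sum_mono) (auto simp: bdd_def)
  finally show ?thesis by simp
qed

text \<open>On mean zero functions \<open>1 - P\<close> is bounded below. Otherwise there are Hoelder functions \<open>u\<^sub>j\<close> with supremum about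
\<open>1\<close>, mean \<open>0\<close> and \<open>u\<^sub>j - P u\<^sub>j \<rightarrow> 0\<close>, with uniform seminorms. A limit is a fixed point of mean \<open>0\<close>, hence it
vanishes almost everywhere by ergodicity. But for fixed \<open>n\<close> the function \<open>u\<^sub>j\<close> is uniformly close to \<open>P\<^sup>n u\<^sub>j\<close>, whose
supremum is controlled by the \<open>L\<^sup>1\<close> norm of \<open>u\<^sub>j\<close>; so these norms stay away from \<open>0\<close>, a contradiction.\<close>

lemma apriori_bound:
  obtains A where "0 \<le> A" "\<And>v B D e. hol B D v \<Longrightarrow> (\<integral>x. v x \<partial>N) = 0 \<Longrightarrow> hol e e (\<lambda>x. v x - P v x) \<Longrightarrow>
    (\<forall>x\<in>space N. \<bar>v x\<bar> \<le> A * e)"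
proof (rule ccontr)
  assume no: "\<not> thesis"
  note concl = that
  define bad where "bad = (\<lambda>A v. \<exists>B D e. hol B D v \<and> (\<integral>x. v x \<partial>N) = 0 \<and> hol e e (\<lambda>x. v x - P v x) \<and>
    (\<exists>x\<in>space N. A * e < \<bar>v x\<bar>))"
  have "\<exists>v. bad A v" if "0 \<le> A" for A
  proof (rule ccontr)
    assume "\<not> (\<exists>v. bad A v)"
    then have "\<And>v B D e. hol B D v \<Longrightarrow> (\<integral>x. v x \<partial>N) = 0 \<Longrightarrow> hol e e (\<lambda>x. v x - P v x) \<Longrightarrow>
      (\<forall>x\<in>space N. \<bar>v x\<bar> \<le> A * e)" unfolding bad_def by (meson not_le)
    with concl[OF \<open>0 \<le> A\<close>] no show False by blast
  qed
  then have "\<forall>j::nat. \<exists>v. bad (real (Suc j)) v" by simp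
  then obtain v where v: "\<And>j::nat. bad (real (Suc j)) (v j)" by metis
  define X where "X = C1 + 1"
  define D' where "D' = X / (1 - \<theta>)"
  have D'0: "0 \<le> D'" using C1_nonneg theta_less by (simp add: D'_def X_def)
  have "\<exists>u. hol 1 D' u \<and> (\<integral>x. u x \<partial>N) = 0 \<and> (\<forall>x\<in>space N. \<bar>u x - P u x\<bar> \<le> 1 / Suc j) \<and> (\<exists>x\<in>space N. 1 / 2 \<le> \<bar>u x\<bar>)" for j
  proof -
    obtain B D e x0 where w: "hol B D (v j)" "(\<integral>x. v j x \<partial>N) = 0" "hol e e (\<lambda>x. v j x - P (v j) x)"
      and x0: "x0 \<in> space N" "real (Suc j) * e < \<bar>v j x0\<bar>"
      using v[of j] unfolding bad_def by blast
    have e0: "0 \<le> e" using hol_abs[OF w(3) x0(1)] by linarith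
    define s where "s = (SUP x\<in>space N. \<bar>v j x\<bar>)"
    have bdda: "bdd_above ((\<lambda>x. \<bar>v j x\<bar>) ` space N)"
      using hol_abs[OF w(1)] by (intro bdd_aboveI[of _ B]) auto
    have vs: "\<bar>v j x\<bar> \<le> s" if "x \<in> space N" for x
      unfolding s_def by (rule cSUP_upper[OF that bdda])
    have s0: "real (Suc j) * e < s" using x0 vs[OF x0(1)] by linarith
    then have spos: "0 < s" using e0 by (meson le_less_trans mult_nonneg_nonneg of_nat_0_le_iff)
    have es: "e / s \<le> 1 / Suc j" using s0 spos by (simp add: field_simps)
    have "s / 2 < s" using spos by simp
    then obtain x1 where x1: "x1 \<in> space N" "s / 2 < \<bar>v j x1\<bar>"
      unfolding s_def using x0(1) less_cSUP_iff[OF _ bdda] by (metis empty_iff)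
    \<comment> \<open>Normalizing by the supremum \<open>s\<close> makes the defect \<open>e / s\<close> at most \<open>1 / (j + 1)\<close>.\<close>
    define u where "u = (\<lambda>x. (1 / s) * v j x)"
    have u1: "hol (\<bar>1 / s\<bar> * B) (\<bar>1 / s\<bar> * D) u" unfolding u_def by (rule hol_cmult[OF w(1)])
    have ub: "\<bar>u x\<bar> \<le> 1" if "x \<in> space N" for x using vs[OF that] spos by (simp add: u_def abs_mult)
    then have u2: "hol 1 (\<bar>1 / s\<bar> * D) u" using u1 by (simp add: hol_def bdd_def)
    have diff: "u x - P u x = (1 / s) * (v j x - P (v j) x)" for x
      unfolding u_def P_cmult by (simp only: right_diff_distrib)
    have "hol (\<bar>1 / s\<bar> * e) (\<bar>1 / s\<bar> * e) (\<lambda>x. u x - P u x)"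
      unfolding diff by (rule hol_cmult[OF w(3)])
    then have ud: "hol (e / s) (e / s) (\<lambda>x. u x - P u x)" using spos by simp
    have "hol 1 ((C1 * 1 + e / s) / (1 - \<theta>)) u" by (rule hol_from_difference[OF u2 ud])
    moreover have "(C1 * 1 + e / s) / (1 - \<theta>) \<le> D'"
    proof -
      have "1 / real (Suc j) \<le> 1" by simp
      then have "e / s \<le> 1" using es by linarith
      then show ?thesis using theta_less unfolding D'_def X_def by (intro divide_right_mono) auto
    qed
    ultimately have "hol 1 D' u" by (rule hol_mono[OF _ order_refl])
    moreover have "(\<integral>x. u x \<partial>N) = 0" unfolding u_def using w(2) by simp
    moreover have "\<bar>u x - P u x\<bar> \<le> 1 / Suc j" if "x \<in> space N" for x
      using hol_abs[OF ud that] es by linarith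
    moreover have "1 / 2 \<le> \<bar>u x1\<bar>" using x1(2) spos by (simp add: u_def abs_mult field_simps)
    ultimately show ?thesis using x1(1) by blast
  qed
  then obtain u where u: "\<And>j::nat. hol 1 D' (u j)" "\<And>j. (\<integral>x. u j x \<partial>N) = 0"
    "\<And>j x. x \<in> space N \<Longrightarrow> \<bar>u j x - P (u j) x\<bar> \<le> 1 / Suc j" "\<And>j. \<exists>x\<in>space N. 1 / 2 \<le> \<bar>u j x\<bar>"
    by metis
  define K1 where "K1 = 2 * c0 * E"
  have K1: "0 < K1" using c0_pos E_pos by (simp add: K1_def)
  have "(\<lambda>n. K1 * D' * measure N (space N) * \<theta> ^ n) \<longlonglongrightarrow> K1 * D' * measure N (space N) * 0"
    by (intro tendsto_mult tendsto_const theta_power_tendsto)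
  then have "(\<lambda>n. K1 * D' * measure N (space N) * \<theta> ^ n) \<longlonglongrightarrow> 0" by simp
  then have "\<forall>\<^sub>F n in sequentially. K1 * D' * measure N (space N) * \<theta> ^ n < 1 / 8"
    by (rule order_tendstoD) simp
  then have "\<forall>\<^sub>F n in sequentially. K1 * D' * measure N (space N) * \<theta> ^ n < 1 / 8 \<and> 1 \<le> n"
    using eventually_ge_at_top[of 1] by eventually_elim auto
  from eventually_happens[OF this] obtain n :: nat where n: "K1 * D' * measure N (space N) * \<theta> ^ n < 1 / 8" "1 \<le> n"
    by auto
  have L1: "1 / (4 * K1) \<le> (\<integral>x. \<bar>u j x\<bar> \<partial>N)" if j: "8 * n \<le> Suc j" for j
  proof -
    obtain x where x: "x \<in> space N" "1 / 2 \<le> \<bar>u j x\<bar>" using u(4) by blast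
    have "\<bar>u j x - (P ^^ n) (u j) x\<bar> \<le> n * (1 / Suc j)"
      by (rule telescope_sup[OF hol_bdd[OF u(1)] u(3) x(1)])
    also have "\<dots> \<le> 1 / 8"
    proof -
      have "8 * real n \<le> real (Suc j)" using j by (metis of_nat_le_iff of_nat_mult of_nat_numeral)
      then show ?thesis by (simp add: field_simps)
    qed
    finally have a: "\<bar>u j x - (P ^^ n) (u j) x\<bar> \<le> 1 / 8" .
    have "\<bar>(P ^^ n) (u j) x\<bar> \<le> K1 * ((\<integral>x. \<bar>u j x\<bar> \<partial>N) + D' * \<theta> ^ n * measure N (space N))"
      unfolding K1_def by (rule sup_le_L1[OF u(1) n(2) x(1)])
    also have "\<dots> = K1 * (\<integral>x. \<bar>u j x\<bar> \<partial>N) + K1 * D' * measure N (space N) * \<theta> ^ n" by (simp add: algebra_simps)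
    finally have "1 / 4 \<le> K1 * (\<integral>x. \<bar>u j x\<bar> \<partial>N)" using a n(1) x(2) by linarith
    then show ?thesis using K1 by (simp add: field_simps)
  qed
  obtain r w where r: "strict_mono (r :: nat \<Rightarrow> nat)" and w: "hol 1 D' w"
    and lim: "\<And>x. x \<in> space N \<Longrightarrow> (\<lambda>j. u (r j) x) \<longlonglongrightarrow> w x"
    by (rule hol_compact[of 1 D' u, OF u(1)]) blast
  have [measurable]: "u j \<in> borel_measurable N" "w \<in> borel_measurable N" for j
    using hol_measurable[OF u(1)] hol_measurable[OF w] by auto
  have fixw: "P w x = w x" if x: "x \<in> space N" for x
  proof -
    have "(\<lambda>j. u (r j) x - P (u (r j)) x) \<longlonglongrightarrow> w x - P w x"
      using lim P_tendsto[OF hol_bdd[OF u(1)] lim x] x by (intro tendsto_diff) auto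
    moreover have "(\<lambda>j. u (r j) x - P (u (r j)) x) \<longlonglongrightarrow> 0"
    proof (rule Lim_null_comparison)
      show "\<forall>\<^sub>F j in sequentially. norm (u (r j) x - P (u (r j)) x) \<le> 1 / Suc j"
      proof (intro always_eventually allI)
        fix j
        have "1 / real (Suc (r j)) \<le> 1 / real (Suc j)"
          using seq_suble[OF r, of j] by (intro divide_left_mono) auto
        then show "norm (u (r j) x - P (u (r j)) x) \<le> 1 / Suc j" using u(3)[OF x, of "r j"] unfolding real_norm_def by linarith
      qed
      show "(\<lambda>j. 1 / real (Suc j)) \<longlonglongrightarrow> 0" using LIMSEQ_Suc[OF lim_1_over_n] by simp
    qed
    ultimately show ?thesis using LIMSEQ_unique by fastforce
  qed
  have "(\<lambda>j. \<integral>x. u (r j) x \<partial>N) \<longlonglongrightarrow> (\<integral>x. w x \<partial>N)"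
    by (rule integral_dominated_convergence[where w = "\<lambda>_. 1"])
      (use lim hol_abs[OF u(1)] in \<open>auto intro!: AE_I2\<close>)
  then have wmean: "(\<integral>x. w x \<partial>N) = 0" using u(2) by (simp add: LIMSEQ_const_iff)
  have "AE x in N. w x = 0" by (rule fixed_point_zero[OF w fixw wmean])
  then have w0: "(\<integral>x. \<bar>w x\<bar> \<partial>N) = 0"
    by (subst integral_cong_AE[where g = "\<lambda>_. 0"]) auto
  have wlim: "(\<lambda>j. \<integral>x. \<bar>u (r j) x\<bar> \<partial>N) \<longlonglongrightarrow> (\<integral>x. \<bar>w x\<bar> \<partial>N)"
    by (rule integral_dominated_convergence[where w = "\<lambda>_. 1"])
      (use lim hol_abs[OF u(1)] in \<open>auto intro!: AE_I2 tendsto_rabs\<close>)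
  have wlow: "\<forall>j\<ge>8 * n. 1 / (4 * K1) \<le> (\<integral>x. \<bar>u (r j) x\<bar> \<partial>N)"
  proof (intro allI impI L1)
    fix j assume "8 * n \<le> j"
    then show "8 * n \<le> Suc (r j)" using seq_suble[OF r, of j] by linarith
  qed
  have "1 / (4 * K1) \<le> 0" using LIMSEQ_le_const[OF wlim exI[of _ "8 * n"], OF wlow] w0 by simp
  then show False using K1 by simp
qed

text \<open>The partial sums \<open>S\<^sub>n\<close> of the Neumann series satisfy \<open>S\<^sub>n - P S\<^sub>n = w - P\<^sup>n w\<close>, whose Hoelder norm is bounded in
\<open>n\<close>; the a priori bound therefore bounds \<open>S\<^sub>n\<close>. Since \<open>P\<^sup>n w\<close> need not tend to \<open>0\<close> when \<open>F\<close> has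
periodicity, pass to the averages \<open>V\<^sub>n\<close>, for which the error is \<open>S\<^sub>n\<^sub>+\<^sub>1 / (n + 1)\<close>, and take a limit point.\<close>

lemma poisson_equation:
  assumes w: "hol K D w" and mean: "(\<integral>x. w x \<partial>N) = 0"
  obtains K' D' u where "hol K' D' u" "\<And>x. x \<in> space N \<Longrightarrow> u x - P u x = w x"
proof -
  obtain A where A: "\<And>v B D e. hol B D v \<Longrightarrow> (\<integral>x. v x \<partial>N) = 0 \<Longrightarrow> hol e e (\<lambda>x. v x - P v x) \<Longrightarrow>
    (\<forall>x\<in>space N. \<bar>v x\<bar> \<le> A * e)" by (rule apriori_bound) blast
  define Dw where "Dw = max D (C1 * K / (1 - \<theta>))"
  have w': "hol K Dw w" by (rule hol_mono[OF w]) (auto simp: Dw_def)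
  have wn: "hol K Dw ((P ^^ n) w)" for n by (rule hol_iter[OF w']) (simp add: Dw_def)
  define S where "S = (\<lambda>n x. \<Sum>k<n. (P ^^ k) w x)"
  have S1: "hol (n * K) (n * Dw) (S n)" for n
  proof (induction n)
    case 0 show ?case by (simp add: S_def hol_def bdd_def)
  next
    case (Suc n)
    show ?case using hol_add[OF Suc wn[of n]] by (simp add: S_def algebra_simps)
  qed
  have PS: "P (S n) x = (\<Sum>k<n. (P ^^ Suc k) w x)" if x: "x \<in> space N" for n x
  proof (induction n)
    case 0 show ?case by (simp add: S_def P_def)
  next
    case (Suc n)
    have "P (S (Suc n)) x = P (\<lambda>x. S n x + (P ^^ n) w x) x" by (simp add: S_def)
    also have "\<dots> = P (S n) x + P ((P ^^ n) w) x"
      using bdd_summable[OF hol_bdd[OF S1]] bdd_summable[OF hol_bdd[OF wn]] x by (intro P_add) auto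
    finally show ?case using Suc by simp
  qed
  have Sd: "S n x - P (S n) x = w x - (P ^^ n) w x" if x: "x \<in> space N" for n x
  proof -
    have "S n x - P (S n) x = - (\<Sum>k<n. (P ^^ Suc k) w x - (P ^^ k) w x)"
      unfolding PS[OF x] by (simp add: S_def sum_subtractf)
    also have "\<dots> = w x - (P ^^ n) w x" by (subst sum_lessThan_telescope) simp
    finally show ?thesis .
  qed
  have hol_cong: "hol a b u \<Longrightarrow> u' \<in> borel_measurable N \<Longrightarrow> (\<And>x. x \<in> space N \<Longrightarrow> u' x = u x) \<Longrightarrow> hol a b u'" for a b u u'
    unfolding hol_def bdd_def using same_space by (metis (no_types, lifting))
  define e where "e = 2 * max K Dw"
  have Sd_hol: "hol e e (\<lambda>x. S n x - P (S n) x)" for n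
  proof (rule hol_cong)
    show "hol e e (\<lambda>x. w x - (P ^^ n) w x)"
      by (rule hol_mono[OF hol_diff[OF w' wn]]) (auto simp: e_def)
    show "(\<lambda>x. S n x - P (S n) x) \<in> borel_measurable N"
      using hol_measurable[OF S1[of n]] P_measurable[OF hol_measurable[OF S1[of n]]] by measurable
  qed (use Sd in auto)
  have Smean: "(\<integral>x. S n x \<partial>N) = 0" for n
  proof -
    have "(\<integral>x. S n x \<partial>N) = (\<Sum>k<n. \<integral>x. (P ^^ k) w x \<partial>N)"
      unfolding S_def by (rule Bochner_Integration.integral_sum) (rule bdd_integrable[OF hol_bdd[OF wn]])
    then show ?thesis using integral_P_iter[OF hol_bdd[OF w]] mean by simp
  qed
  define K' where "K' = A * e"
  define D' where "D' = (C1 * K' + e) / (1 - \<theta>)"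
  have S2: "hol K' D' (S n)" for n
  proof -
    have "\<forall>x\<in>space N. \<bar>S n x\<bar> \<le> K'" unfolding K'_def by (rule A[OF S1 Smean Sd_hol])
    then have "hol K' (n * Dw) (S n)" using S1[of n] by (simp add: hol_def bdd_def)
    then show ?thesis unfolding D'_def by (rule hol_from_difference[OF _ Sd_hol])
  qed
  define V where "V = (\<lambda>n x. (1 / Suc n) * (\<Sum>k<Suc n. S k x))"
  have sumS: "hol (n * K') (n * D') (\<lambda>x. \<Sum>k<n. S k x)" for n
  proof (induction n)
    case 0 show ?case by (simp add: hol_def bdd_def)
  next
    case (Suc n)
    show ?case using hol_add[OF Suc S2[of n]] by (simp add: algebra_simps)
  qed
  have V1: "hol K' D' (V n)" for n
  proof -
    have "\<bar>1 / real (Suc n)\<bar> * (real (Suc n) * K') = K'" "\<bar>1 / real (Suc n)\<bar> * (real (Suc n) * D') = D'" by simp_all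
    then show ?thesis using hol_cmult[OF sumS[of "Suc n"], of "1 / Suc n"] unfolding V_def by simp
  qed
  have PsumS: "P (\<lambda>x. \<Sum>k<n. S k x) x = (\<Sum>k<n. P (S k) x)" if x: "x \<in> space N" for n x
  proof (induction n)
    case 0 show ?case by (simp add: P_def)
  next
    case (Suc n)
    have "P (\<lambda>x. \<Sum>k<Suc n. S k x) x = P (\<lambda>x. (\<Sum>k<n. S k x) + S n x) x" by simp
    also have "\<dots> = P (\<lambda>x. \<Sum>k<n. S k x) x + P (S n) x"
      using bdd_summable[OF hol_bdd[OF sumS]] bdd_summable[OF hol_bdd[OF S2]] x by (intro P_add) auto
    finally show ?case using Suc by simp
  qed
  have Vd: "V n x - P (V n) x = w x - (1 / Suc n) * S (Suc n) x" if x: "x \<in> space N" for n x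
  proof -
    have "V n x - P (V n) x = (1 / Suc n) * (\<Sum>k<Suc n. S k x - P (S k) x)"
      unfolding V_def P_cmult PsumS[OF x] sum_subtractf by (simp only: right_diff_distrib)
    also have "(\<Sum>k<Suc n. S k x - P (S k) x) = (\<Sum>k<Suc n. w x - (P ^^ k) w x)" using Sd[OF x] by simp
    also have "\<dots> = Suc n * w x - S (Suc n) x" unfolding S_def sum_subtractf by simp
    also have "(1 / Suc n) * (Suc n * w x - S (Suc n) x) = w x - (1 / Suc n) * S (Suc n) x"
      by (simp add: right_diff_distrib)
    finally show ?thesis .
  qed
  obtain r u where r: "strict_mono (r :: nat \<Rightarrow> nat)" and u: "hol K' D' u"
    and lim: "\<And>x. x \<in> space N \<Longrightarrow> (\<lambda>j. V (r j) x) \<longlonglongrightarrow> u x"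
    by (rule hol_compact[of K' D' V, OF V1]) blast
  have "u x - P u x = w x" if x: "x \<in> space N" for x
  proof -
    have 1: "(\<lambda>j. V (r j) x - P (V (r j)) x) \<longlonglongrightarrow> u x - P u x"
      using lim P_tendsto[OF hol_bdd[OF V1] lim x] x by (intro tendsto_diff) auto
    have "(\<lambda>n. (1 / Suc n) * S (Suc n) x) \<longlonglongrightarrow> 0"
    proof (rule Lim_null_comparison)
      show "\<forall>\<^sub>F n in sequentially. norm ((1 / Suc n) * S (Suc n) x) \<le> K' * (1 / Suc n)"
      proof (intro always_eventually allI)
        fix n
        have "\<bar>S (Suc n) x\<bar> * (1 / Suc n) \<le> K' * (1 / Suc n)"
          using hol_abs[OF S2 x] by (intro mult_right_mono) auto
        then show "norm ((1 / Suc n) * S (Suc n) x) \<le> K' * (1 / Suc n)" by (simp add: abs_mult)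
      qed
      have "(\<lambda>n. K' * (1 / real (Suc n))) \<longlonglongrightarrow> K' * 0"
        by (intro tendsto_mult tendsto_const LIMSEQ_Suc[OF lim_1_over_n])
      then show "(\<lambda>n. K' * (1 / real (Suc n))) \<longlonglongrightarrow> 0" by simp
    qed
    then have "(\<lambda>n. w x - (1 / Suc n) * S (Suc n) x) \<longlonglongrightarrow> w x - 0" by (intro tendsto_diff tendsto_const)
    then have "(\<lambda>n. V n x - P (V n) x) \<longlonglongrightarrow> w x" using Vd[OF x] by simp
    from LIMSEQ_subseq_LIMSEQ[OF this r] have "(\<lambda>j. V (r j) x - P (V (r j)) x) \<longlonglongrightarrow> w x" by (simp add: comp_def)
    with 1 show ?thesis by (rule LIMSEQ_unique)
  qed
  then show ?thesis using u that by blast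
qed

section \<open>Gordin decomposition for Gibbs-Markov maps\<close>

text \<open>On a cell \<open>d\<close> the value of \<open>f\<close> is within \<open>Dd d\<close> of its mean, and the weight of the branch is at most
\<open>c0 N d\<close>. So \<open>P\<close> sums local Hoelder constants against the measure and produces a bounded Hoelder function.\<close>

lemma locally_regular_transfer:
  assumes f: "integrable N f"
    and Dd: "integrable (count_space \<delta>) (\<lambda>d. measure N d * Dd d)" "\<And>d. d \<in> \<delta> \<Longrightarrow> 0 \<le> Dd d"
    and reg: "\<And>d n x y. d \<in> \<delta> \<Longrightarrow> x \<in> d \<Longrightarrow> 1 \<le> n \<Longrightarrow> same n x y \<Longrightarrow> \<bar>f x - f y\<bar> \<le> Dd d * \<theta> ^ n"
  shows "P_summable f" "\<exists>K D. hol K D (P f)"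
proof -
  define Q where "Q = (\<lambda>d. c0 * (1 * (\<integral>y. indicator d y * \<bar>f y\<bar> \<partial>N) + measure N d * Dd d))"
  have iQ: "integrable (count_space \<delta>) Q"
    unfolding Q_def using cells_integral(1)[of "\<lambda>x. \<bar>f x\<bar>"] f Dd by auto
  have Q0: "0 \<le> Q d" if "d \<in> \<delta>" for d
    unfolding Q_def using c0_pos Dd(2)[OF that] by (auto intro!: mult_nonneg_nonneg add_nonneg_nonneg integral_nonneg_AE)
  have wQ: "weight d x * \<bar>f (branch d x)\<bar> \<le> Q d" if d: "d \<in> \<delta>" and x: "x \<in> F ` d" for d x
    unfolding Q_def
  proof (rule weight_cell_mean[OF d x])
    fix y assume y: "y \<in> d"
    have "\<bar>f (branch d x) - f y\<bar> \<le> Dd d * \<theta> ^ 1"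
      using reg[OF d branch_in[OF x] order_refl same_1[OF d branch_in[OF x] y]] .
    moreover have "Dd d * \<theta> ^ 1 \<le> Dd d" using Dd(2)[OF d] theta_pos theta_less by (simp add: mult_left_le)
    ultimately show "\<bar>f (branch d x)\<bar> \<le> 1 * \<bar>f y\<bar> + Dd d" by linarith
  qed (use f Dd(2)[OF d] in auto)
  show s: "P_summable f" unfolding P_summable_def
  proof
    fix x assume x: "x \<in> space N"
    show "integrable (count_space \<delta>) (\<lambda>d. weight d x * f (branch d x))"
    proof (rule Bochner_Integration.integrable_bound[OF iQ])
      show "AE d in count_space \<delta>. norm (weight d x * f (branch d x)) \<le> norm (Q d)"
      proof (rule AE_I2)
        fix d assume "d \<in> space (count_space \<delta>)" then have d: "d \<in> \<delta>" by simp
        show "norm (weight d x * f (branch d x)) \<le> norm (Q d)"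
          using wQ[OF d, of x] Q0[OF d] weight_nonneg[OF d, of x]
          by (cases "x \<in> F ` d") (auto simp: abs_mult weight_def)
      qed
    qed simp
  qed
  have fm: "f \<in> borel_measurable N" using f by auto
  define K where "K = (\<integral>d. Q d \<partial>count_space \<delta>)"
  define D where "D = C1 * K + \<theta> * (\<integral>d. c0 * (measure N d * Dd d) \<partial>count_space \<delta>)"
  have "hol K D (P f)" unfolding hol_def bdd_def
  proof (intro conjI ballI allI impI)
    show "P f \<in> borel_measurable N" by (rule P_measurable[OF fm])
    fix x assume x: "x \<in> space N"
    have i: "integrable (count_space \<delta>) (\<lambda>d. weight d x * f (branch d x))" using s x by (simp add: P_summable_def)
    have "\<bar>P f x\<bar> \<le> (\<integral>d. \<bar>weight d x * f (branch d x)\<bar> \<partial>count_space \<delta>)"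
      unfolding P_def by (rule integral_abs_bound)
    also have "\<dots> \<le> K" unfolding K_def
    proof (rule integral_mono[OF _ iQ])
      fix d assume "d \<in> space (count_space \<delta>)" then have d: "d \<in> \<delta>" by simp
      show "\<bar>weight d x * f (branch d x)\<bar> \<le> Q d"
        using wQ[OF d, of x] Q0[OF d] weight_nonneg[OF d, of x]
        by (cases "x \<in> F ` d") (auto simp: abs_mult weight_def)
    qed (use i in simp)
    finally show "\<bar>P f x\<bar> \<le> K" .
  next
    fix n x y assume n: "(1::nat) \<le> n" and st: "same n x y"
    have x: "x \<in> space N" and y: "y \<in> space N" using same_space[OF st n] by auto
    show "\<bar>P f x - P f y\<bar> \<le> D * \<theta> ^ n" unfolding D_def K_def
    proof (rule P_diff_le[OF st n s x y iQ Q0 wQ])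
      show "integrable (count_space \<delta>) (\<lambda>d. c0 * (measure N d * Dd d))" using Dd(1) by simp
      fix d assume d: "d \<in> \<delta>"
      show "0 \<le> c0 * (measure N d * Dd d)" using c0_pos Dd(2)[OF d] by simp
      assume xd: "x \<in> F ` d"
      have "weight d y * \<bar>f (branch d x) - f (branch d y)\<bar> \<le> (c0 * measure N d) * (Dd d * \<theta> ^ Suc n)"
        using reg[OF d branch_in[OF xd] _ same_branch(2)[OF st n d xd]] c0_pos
        by (intro mult_mono weight_le[OF d]) auto
      then show "weight d y * \<bar>f (branch d x) - f (branch d y)\<bar> \<le> c0 * (measure N d * Dd d) * \<theta> ^ Suc n"
        by (simp add: mult_ac)
    qed
  qed
  then show "\<exists>K D. hol K D (P f)" by blast
qed

text \<open>Solve \<open>u - P u = P f\<close> and put \<open>\<psi> = f + u - u \<circ> F\<close>. Since \<open>P (u \<circ> F) = u\<close>, this gives \<open>P \<psi> = 0\<close>, which is by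
duality the orthogonality of \<open>\<psi>\<close> to all \<open>g \<circ> F\<close>.\<close>

theorem gordin_decomposition:
  assumes f: "integrable N f" "(\<integral>x. f x \<partial>N) = 0" "integrable N (\<lambda>x. (f x)\<^sup>2)"
    and Dd: "integrable (count_space \<delta>) (\<lambda>d. measure N d * Dd d)" "\<And>d. d \<in> \<delta> \<Longrightarrow> 0 \<le> Dd d"
    and reg: "\<And>d n x y. d \<in> \<delta> \<Longrightarrow> x \<in> d \<Longrightarrow> 1 \<le> n \<Longrightarrow> same n x y \<Longrightarrow> \<bar>f x - f y\<bar> \<le> Dd d * \<theta> ^ n"
  obtains u \<psi> where "u \<in> borel_measurable N" "\<psi> \<in> borel_measurable N" "integrable N (\<lambda>x. (\<psi> x)\<^sup>2)"
    "\<And>x. x \<in> space N \<Longrightarrow> f x = \<psi> x + u (F x) - u x"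
    "\<And>g B. g \<in> borel_measurable N \<Longrightarrow> (\<And>x. x \<in> space N \<Longrightarrow> \<bar>g x\<bar> \<le> B) \<Longrightarrow> (\<integral>x. \<psi> x * g (F x) \<partial>N) = 0"
proof -
  note tr = locally_regular_transfer[OF f(1) Dd reg]
  obtain K D where w: "hol K D (P f)" using tr(2) by blast
  have wmean: "(\<integral>x. P f x \<partial>N) = 0" using P_integral(2)[OF tr(1) f(1)] f(2) by simp
  obtain K' D' u where u: "hol K' D' u" "\<And>x. x \<in> space N \<Longrightarrow> u x - P u x = P f x"
    by (rule poisson_equation[OF w wmean]) blast
  define \<psi> where "\<psi> = (\<lambda>x. f x + (u x - u (F x)))"
  have um [measurable]: "u \<in> borel_measurable N" by (rule hol_measurable[OF u(1)])
  have fm [measurable]: "f \<in> borel_measurable N" using f(1) by auto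
  have pm [measurable]: "\<psi> \<in> borel_measurable N" unfolding \<psi>_def by measurable
  have ub: "\<bar>u x - u (F x)\<bar> \<le> 2 * K'" if "x \<in> space N" for x
    using hol_abs[OF u(1) that] hol_abs[OF u(1) F_space[OF that]] by linarith
  have "integrable N (\<lambda>x. (\<psi> x)\<^sup>2)"
  proof (rule Bochner_Integration.integrable_bound)
    show "integrable N (\<lambda>x. 2 * (f x)\<^sup>2 + 2 * (2 * K')\<^sup>2)" using f(3) by simp
    show "AE x in N. norm ((\<psi> x)\<^sup>2) \<le> norm (2 * (f x)\<^sup>2 + 2 * (2 * K')\<^sup>2)"
    proof (rule AE_I2)
      fix x assume x: "x \<in> space N"
      have "(u x - u (F x))\<^sup>2 \<le> (2 * K')\<^sup>2"
        using ub[OF x] by (metis abs_ge_zero order_trans power2_abs power_mono)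
      moreover have "(\<psi> x)\<^sup>2 \<le> 2 * (f x)\<^sup>2 + 2 * (u x - u (F x))\<^sup>2"
        using sum_squares_bound[of "f x" "u x - u (F x)"] by (simp add: \<psi>_def power2_sum)
      ultimately show "norm ((\<psi> x)\<^sup>2) \<le> norm (2 * (f x)\<^sup>2 + 2 * (2 * K')\<^sup>2)" by simp
    qed
  qed simp
  moreover have "(\<integral>x. \<psi> x * g (F x) \<partial>N) = 0"
    if [measurable]: "g \<in> borel_measurable N" and gB: "\<And>x. x \<in> space N \<Longrightarrow> \<bar>g x\<bar> \<le> B" for g B
  proof -
    have gF: "\<bar>g (F x)\<bar> \<le> B" if "x \<in> space N" for x using gB[OF F_space[OF that]] .
    have mult: "integrable N (\<lambda>x. v x * h x)" if v: "integrable N v" and [measurable]: "h \<in> borel_measurable N"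
      and h: "\<And>x. x \<in> space N \<Longrightarrow> \<bar>h x\<bar> \<le> B" for v h :: "'a \<Rightarrow> real"
    proof (rule Bochner_Integration.integrable_bound)
      show "integrable N (\<lambda>x. B * v x)" using v by simp
      show "AE x in N. norm (v x * h x) \<le> norm (B * v x)"
      proof (rule AE_I2)
        fix x assume "x \<in> space N"
        then have "\<bar>h x\<bar> \<le> \<bar>B\<bar>" using h by fastforce
        then have "\<bar>h x\<bar> * \<bar>v x\<bar> \<le> \<bar>B\<bar> * \<bar>v x\<bar>" by (rule mult_right_mono) simp
        then show "norm (v x * h x) \<le> norm (B * v x)" by (simp add: abs_mult mult.commute)
      qed
    qed (use v in measurable)
    have iu: "integrable N u" by (rule bdd_integrable[OF hol_bdd[OF u(1)]])
    have su: "P_summable u" by (rule bdd_summable[OF hol_bdd[OF u(1)]])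
    have iuF: "integrable N (\<lambda>x. u (F x))" by (rule integrable_F[OF iu])
    have gFm: "(\<lambda>x. g (F x)) \<in> borel_measurable N" by measurable
    have "(\<integral>x. \<psi> x * g (F x) \<partial>N) = (\<integral>x. f x * g (F x) + (u x * g (F x) - u (F x) * g (F x)) \<partial>N)"
      by (intro Bochner_Integration.integral_cong) (auto simp: \<psi>_def algebra_simps)
    also have "\<dots> = (\<integral>x. f x * g (F x) \<partial>N) + ((\<integral>x. u x * g (F x) \<partial>N) - (\<integral>x. u (F x) * g (F x) \<partial>N))"
      using mult[OF f(1) gFm gF] mult[OF iu gFm gF] mult[OF iuF gFm gF] by simp
    also have "(\<integral>x. f x * g (F x) \<partial>N) = (\<integral>x. P f x * g x \<partial>N)"
      by (rule P_dual[OF tr(1) f(1) _ gB, symmetric]) auto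
    also have "(\<integral>x. u x * g (F x) \<partial>N) = (\<integral>x. P u x * g x \<partial>N)"
      by (rule P_dual[OF su iu _ gB, symmetric]) auto
    also have "(\<integral>x. u (F x) * g (F x) \<partial>N) = (\<integral>x. u x * g x \<partial>N)"
      by (rule integral_F[of "\<lambda>x. u x * g x"]) measurable
    also have "(\<integral>x. P f x * g x \<partial>N) + ((\<integral>x. P u x * g x \<partial>N) - (\<integral>x. u x * g x \<partial>N))
        = (\<integral>x. P f x * g x + (P u x * g x - u x * g x) \<partial>N)"
      using mult[OF P_integral(1)[OF tr(1) f(1)] \<open>g \<in> borel_measurable N\<close> gB]
        mult[OF P_integral(1)[OF su iu] \<open>g \<in> borel_measurable N\<close> gB] mult[OF iu \<open>g \<in> borel_measurable N\<close> gB] by simp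
    also have "\<dots> = (\<integral>x. 0 \<partial>N)"
    proof (intro Bochner_Integration.integral_cong refl)
      fix x assume "x \<in> space N"
      from u(2)[OF this] show "P f x * g x + (P u x * g x - u x * g x) = 0" by (simp flip: u(2) add: algebra_simps)
    qed
    finally show ?thesis by simp
  qed
  moreover have "f x = \<psi> x + u (F x) - u x" for x by (simp add: \<psi>_def)
  ultimately show ?thesis using um pm that by blast
qed

end

section \<open>Towers\<close>

text \<open>The Kakutani tower over \<open>F\<close>: the point \<open>(y, i)\<close> with \<open>i < \<phi> y\<close> climbs one floor at a time, and from the top
floor it returns to \<open>(F y, 0)\<close>.\<close>

locale tower = finite_measure N for N :: "'a measure" +
  fixes F :: "'a \<Rightarrow> 'a" and \<phi> :: "'a \<Rightarrow> nat"
  assumes base_meas [measurable]: "F \<in> measurable N N"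
    and base_inv: "distr N N F = N"
    and height_meas [measurable]: "\<phi> \<in> measurable N (count_space UNIV)"
    and height_pos: "\<And>y. y \<in> space N \<Longrightarrow> 1 \<le> \<phi> y"
    and total_height: "(\<integral>\<^sup>+y. of_nat (\<phi> y) \<partial>N) = 1"
    and base_ergodic: "\<And>A. A \<in> sets N \<Longrightarrow> F -` A \<inter> space N = A \<Longrightarrow> A \<in> null_sets N \<or> space N - A \<in> null_sets N"
begin

abbreviation prod_space :: "('a \<times> nat) measure" where
  "prod_space \<equiv> N \<Otimes>\<^sub>M count_space UNIV"

definition floors :: "('a \<times> nat) set" where
  "floors = {p \<in> space prod_space. snd p < \<phi> (fst p)}"

definition \<Delta> :: "('a \<times> nat) measure" where
  "\<Delta> = restrict_space prod_space floors"

definition up :: "'a \<times> nat \<Rightarrow> 'a \<times> nat" where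
  "up p = (if Suc (snd p) < \<phi> (fst p) then (fst p, Suc (snd p)) else (F (fst p), 0))"

lemma sigma_count: "sigma_finite_measure (count_space (UNIV :: nat set))"
  by (rule sigma_finite_measure_count_space)

lemma pair_sf: "pair_sigma_finite N (count_space (UNIV :: nat set))"
  by (intro pair_sigma_finite.intro sigma_finite_measure_axioms sigma_count)

lemma height_borel: "\<phi> \<in> borel_measurable N"
  using measurable_compose[OF height_meas, of "\<lambda>x. x" borel] by simp

lemma level_borel: "(\<lambda>p. snd p) \<in> borel_measurable prod_space" "(\<lambda>p. \<phi> (fst p)) \<in> borel_measurable prod_space"
proof -
  have "(\<lambda>x. x) \<in> measurable (count_space UNIV) (borel :: nat measure)" by simp
  from measurable_compose[OF measurable_snd this] show "(\<lambda>p. snd p) \<in> borel_measurable prod_space" .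
  show "(\<lambda>p. \<phi> (fst p)) \<in> borel_measurable prod_space"
    by (rule measurable_compose[OF measurable_fst height_borel])
qed

lemmas [measurable] = level_borel

lemma floors_sets [measurable]: "floors \<in> sets prod_space"
  unfolding floors_def by measurable

lemma space_\<Delta>: "p \<in> space \<Delta> \<longleftrightarrow> fst p \<in> space N \<and> snd p < \<phi> (fst p)"
  unfolding \<Delta>_def floors_def by (cases p) (auto simp: space_restrict_space space_pair_measure)

lemma sets_\<Delta>: "A \<in> sets \<Delta> \<longleftrightarrow> A \<in> sets prod_space \<and> A \<subseteq> floors"
  unfolding \<Delta>_def by (subst sets_restrict_space_iff) auto

lemma floors_iff: "p \<in> floors \<longleftrightarrow> fst p \<in> space N \<and> snd p < \<phi> (fst p)"
  unfolding floors_def by (cases p) (auto simp: space_pair_measure)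

lemma emeasure_\<Delta>:
  assumes A: "A \<in> sets \<Delta>"
  shows "emeasure \<Delta> A = (\<integral>\<^sup>+y. (\<integral>\<^sup>+i. indicator A (y, i) \<partial>count_space UNIV) \<partial>N)"
proof -
  interpret sigma_finite_measure "count_space (UNIV :: nat set)" by (rule sigma_count)
  have "emeasure \<Delta> A = emeasure prod_space A"
    using A unfolding sets_\<Delta> unfolding \<Delta>_def by (subst emeasure_restrict_space) auto
  also have "\<dots> = (\<integral>\<^sup>+y. (\<integral>\<^sup>+i. indicator A (y, i) \<partial>count_space UNIV) \<partial>N)"
    using A by (intro emeasure_pair_measure) (simp add: sets_\<Delta>)
  finally show ?thesis .
qed

lemma measurable_to_\<Delta>:
  "h \<in> measurable X prod_space \<Longrightarrow> (\<And>x. x \<in> space X \<Longrightarrow> h x \<in> floors) \<Longrightarrow> h \<in> measurable X \<Delta>"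
  unfolding \<Delta>_def by (rule measurable_restrict_space2) auto

lemma measurable_from_\<Delta>: "h \<in> measurable prod_space X \<Longrightarrow> h \<in> measurable \<Delta> X"
  unfolding \<Delta>_def by (rule measurable_restrict_space1)

lemma up_measurable [measurable]: "up \<in> measurable \<Delta> \<Delta>"
proof (rule measurable_to_\<Delta>)
  have "up \<in> measurable prod_space prod_space" unfolding up_def by measurable
  then show "up \<in> measurable \<Delta> prod_space" by (rule measurable_from_\<Delta>)
  show "up p \<in> floors" if "p \<in> space \<Delta>" for p
    using that height_pos[OF measurable_space[OF base_meas], of "fst p"] measurable_space[OF base_meas, of "fst p"]
    by (auto simp: space_\<Delta> floors_iff up_def)
qed

lemma base_embedding [measurable]: "(\<lambda>y. (y, 0)) \<in> measurable N \<Delta>"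
proof (rule measurable_to_\<Delta>)
  show "(\<lambda>y. (y, 0)) \<in> measurable N prod_space" by measurable
  show "(y, 0) \<in> floors" if "y \<in> space N" for y
    using that height_pos[OF that] by (simp add: floors_iff)
qed

lemma nn_nat_shift: "(\<integral>\<^sup>+i. f i \<partial>count_space UNIV) = f 0 + (\<integral>\<^sup>+i. f (Suc i) \<partial>count_space UNIV)"
  for f :: "nat \<Rightarrow> ennreal"
  unfolding nn_integral_count_space_nat using suminf_offset[of f 1] by (simp add: add.commute)

lemma indicator_section_measurable:
  assumes [measurable]: "A \<in> sets prod_space"
  shows "(\<lambda>y. \<integral>\<^sup>+i. indicator A (y, Suc i) \<partial>count_space UNIV :: ennreal) \<in> borel_measurable N"
    "(\<lambda>y. indicator A (y, 0) :: ennreal) \<in> borel_measurable N"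
proof -
  interpret sigma_finite_measure "count_space (UNIV :: nat set)" by (rule sigma_count)
  have "(\<lambda>(y, i). indicator A (y, Suc i) :: ennreal) \<in> borel_measurable prod_space" by measurable
  then show "(\<lambda>y. \<integral>\<^sup>+i. indicator A (y, Suc i) \<partial>count_space UNIV :: ennreal) \<in> borel_measurable N"
    by (rule borel_measurable_nn_integral[of "\<lambda>y i. indicator A (y, Suc i)"])
  show "(\<lambda>y. indicator A (y, 0) :: ennreal) \<in> borel_measurable N" by measurable
qed

text \<open>In each column the preimage of \<open>A\<close> consists of the points below the positive floors of \<open>A\<close> and of the
top point if \<open>(F y, 0)\<close> belongs to \<open>A\<close>; the invariance of \<open>N\<close> handles the latter.\<close>

lemma up_invariant: "distr \<Delta> \<Delta> up = \<Delta>"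
proof (rule measure_eqI)
  fix A assume "A \<in> sets (distr \<Delta> \<Delta> up)"
  then have A: "A \<in> sets \<Delta>" by simp
  then have A' [measurable]: "A \<in> sets prod_space" "A \<subseteq> floors" by (auto simp: sets_\<Delta>)
  let ?R = "\<lambda>y. \<integral>\<^sup>+i. indicator A (y, Suc i) \<partial>count_space UNIV"
  note m [measurable] = indicator_section_measurable[OF A'(1)]
  have pre: "up -` A \<inter> space \<Delta> \<in> sets \<Delta>" using A by measurable
  have "emeasure (distr \<Delta> \<Delta> up) A = emeasure \<Delta> (up -` A \<inter> space \<Delta>)" by (rule emeasure_distr) (auto simp: A)
  also have "\<dots> = (\<integral>\<^sup>+y. (\<integral>\<^sup>+i. indicator (up -` A \<inter> space \<Delta>) (y, i) \<partial>count_space UNIV) \<partial>N)" by (rule emeasure_\<Delta>[OF pre])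
  also have "\<dots> = (\<integral>\<^sup>+y. ?R y + indicator A (F y, 0) \<partial>N)"
  proof (rule nn_integral_cong)
    fix y assume y: "y \<in> space N"
    have "(\<integral>\<^sup>+i. indicator (up -` A \<inter> space \<Delta>) (y, i) \<partial>count_space UNIV)
        = (\<integral>\<^sup>+i. indicator A (y, Suc i) + indicator A (F y, 0) * indicator {\<phi> y - 1} i \<partial>count_space UNIV)"
    proof (rule nn_integral_cong)
      fix i
      have "(y, Suc i) \<notin> A" if "\<not> Suc i < \<phi> y" using that A'(2) by (auto simp: floors_iff dest!: subsetD)
      then show "indicator (up -` A \<inter> space \<Delta>) (y, i) = (indicator A (y, Suc i) + indicator A (F y, 0) * indicator {\<phi> y - 1} i :: ennreal)"
        using y height_pos[OF y] by (auto simp: indicator_def space_\<Delta> up_def)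
    qed
    also have "\<dots> = ?R y + (\<integral>\<^sup>+i. indicator A (F y, 0) * indicator {\<phi> y - 1} i \<partial>count_space UNIV)"
      by (rule nn_integral_add) auto
    also have "(\<integral>\<^sup>+i. indicator A (F y, 0) * indicator {\<phi> y - 1} i \<partial>count_space UNIV) = (indicator A (F y, 0) :: ennreal)"
      by (simp add: nn_integral_cmult_indicator)
    finally show "(\<integral>\<^sup>+i. indicator (up -` A \<inter> space \<Delta>) (y, i) \<partial>count_space UNIV) = ?R y + indicator A (F y, 0)" .
  qed
  also have "\<dots> = (\<integral>\<^sup>+y. ?R y \<partial>N) + (\<integral>\<^sup>+y. indicator A (F y, 0) \<partial>N)"
    by (rule nn_integral_add) (use measurable_compose[OF base_meas m(2)] in measurable)
  also have "(\<integral>\<^sup>+y. indicator A (F y, 0) \<partial>N) = (\<integral>\<^sup>+y. indicator A (y, 0) \<partial>distr N N F)"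
    by (rule nn_integral_distr[symmetric]) (use m in auto)
  also have "(\<integral>\<^sup>+y. ?R y \<partial>N) + (\<integral>\<^sup>+y. indicator A (y, 0) \<partial>distr N N F) = (\<integral>\<^sup>+y. indicator A (y, 0) + ?R y \<partial>N)"
    unfolding base_inv by (subst nn_integral_add) (auto simp: add.commute)
  also have "\<dots> = emeasure \<Delta> A" unfolding emeasure_\<Delta>[OF A] by (subst nn_nat_shift) simp
  finally show "emeasure (distr \<Delta> \<Delta> up) A = emeasure \<Delta> A" .
qed simp

lemma \<Delta>_prob: "prob_space \<Delta>"
proof
  have top: "space \<Delta> \<in> sets \<Delta>" by simp
  have "emeasure \<Delta> (space \<Delta>) = (\<integral>\<^sup>+y. (\<integral>\<^sup>+i. indicator (space \<Delta>) (y, i) \<partial>count_space UNIV) \<partial>N)" by (rule emeasure_\<Delta>[OF top])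
  also have "\<dots> = (\<integral>\<^sup>+y. of_nat (\<phi> y) \<partial>N)"
  proof (rule nn_integral_cong)
    fix y assume y: "y \<in> space N"
    have "(\<integral>\<^sup>+i. indicator (space \<Delta>) (y, i) \<partial>count_space UNIV) = (\<integral>\<^sup>+i. indicator {..<\<phi> y} i \<partial>count_space UNIV)"
      using y by (intro nn_integral_cong) (auto simp: indicator_def space_\<Delta>)
    then show "(\<integral>\<^sup>+i. indicator (space \<Delta>) (y, i) \<partial>count_space UNIV) = of_nat (\<phi> y)" by simp
  qed
  finally show "emeasure \<Delta> (space \<Delta>) = 1" using total_height by simp
qed

sublocale pmp \<Delta> up
  by (intro pmp.intro \<Delta>_prob pmp_axioms.intro up_measurable up_invariant)

lemma null_column:
  assumes A: "A \<in> sets \<Delta>" and B: "B \<in> null_sets N" and sub: "\<And>y i. (y, i) \<in> A \<Longrightarrow> y \<in> B"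
  shows "A \<in> null_sets \<Delta>"
proof -
  have "emeasure \<Delta> A = (\<integral>\<^sup>+y. (\<integral>\<^sup>+i. indicator A (y, i) \<partial>count_space UNIV) \<partial>N)" by (rule emeasure_\<Delta>[OF A])
  also have "\<dots> = (\<integral>\<^sup>+y. 0 \<partial>N)"
  proof (rule nn_integral_cong_AE)
    show "AE y in N. (\<integral>\<^sup>+i. indicator A (y, i) \<partial>count_space UNIV) = (0 :: ennreal)"
      using AE_not_in[OF B]
    proof eventually_elim
      fix y assume "y \<notin> B"
      then have "(y, i) \<notin> A" for i using sub by blast
      then show "(\<integral>\<^sup>+i. indicator A (y, i) \<partial>count_space UNIV) = (0 :: ennreal)" by simp
    qed
  qed
  finally show ?thesis using A by auto
qed

text \<open>An invariant set of the tower is a union of columns, over an invariant set of the base.\<close>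

sublocale ergodic_pmp \<Delta> up
proof
  fix A assume A: "A \<in> sets \<Delta>" and inv: "up -` A \<inter> space \<Delta> = A"
  have iA: "p \<in> A \<longleftrightarrow> up p \<in> A" if "p \<in> space \<Delta>" for p using inv that by blast
  define B where "B = (\<lambda>y. (y, 0::nat)) -` A \<inter> space N"
  have B: "B \<in> sets N" unfolding B_def using A by measurable
  have level: "(y, i) \<in> A \<longleftrightarrow> y \<in> B" if "y \<in> space N" "i < \<phi> y" for y i
    using that(2)
  proof (induction i)
    case 0 then show ?case using that(1) by (simp add: B_def)
  next
    case (Suc i)
    then show ?case using iA[of "(y, i)"] that(1) by (simp add: space_\<Delta> up_def)
  qed
  have "F -` B \<inter> space N = B"
  proof (intro set_eqI)
    fix y
    show "y \<in> F -` B \<inter> space N \<longleftrightarrow> y \<in> B"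
    proof (cases "y \<in> space N")
      case True
      have top: "\<phi> y - 1 < \<phi> y" using height_pos[OF True] by simp
      have "(y, \<phi> y - 1) \<in> A \<longleftrightarrow> (F y, 0) \<in> A"
        using iA[of "(y, \<phi> y - 1)"] True top by (simp add: space_\<Delta> up_def)
      then show ?thesis using level[OF True top] True measurable_space[OF base_meas True] by (simp add: B_def)
    qed (auto simp: B_def)
  qed
  from base_ergodic[OF B this] show "prob A = 0 \<or> prob A = 1"
  proof
    assume "B \<in> null_sets N"
    then have "A \<in> null_sets \<Delta>"
      by (rule null_column[OF A]) (use level sets.sets_into_space[OF A] space_\<Delta> in fastforce)
    then show ?thesis by (simp add: null_sets_def emeasure_eq_measure)
  next
    assume "space N - B \<in> null_sets N"
    then have "space \<Delta> - A \<in> null_sets \<Delta>"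
      by (rule null_column[OF sets.compl_sets[OF A]]) (use level space_\<Delta> in fastforce)
    then have "prob (space \<Delta> - A) = 0" by (simp add: null_sets_def emeasure_eq_measure)
    then show ?thesis using prob_compl[OF A] by simp
  qed
qed

text \<open>The top floor: the only points from which \<open>up\<close> applies \<open>F\<close>. It carries a copy of the base.\<close>

definition roof :: "('a \<times> nat) set" where
  "roof = {p \<in> space \<Delta>. Suc (snd p) = \<phi> (fst p)}"

lemma roof_sets [measurable]: "roof \<in> sets \<Delta>"
proof -
  have [measurable]: "(\<lambda>p. real (snd p)) \<in> borel_measurable \<Delta>" "(\<lambda>p. real (\<phi> (fst p))) \<in> borel_measurable \<Delta>"
  proof -
    have r: "real \<in> measurable (count_space UNIV) borel" by simp
    show "(\<lambda>p. real (snd p)) \<in> borel_measurable \<Delta>"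
      by (rule measurable_from_\<Delta>[OF measurable_compose[OF measurable_snd r]])
    show "(\<lambda>p. real (\<phi> (fst p))) \<in> borel_measurable \<Delta>"
      by (rule measurable_from_\<Delta>[OF measurable_compose[OF measurable_compose[OF measurable_fst height_meas] r]])
  qed
  have "roof = {p \<in> space \<Delta>. real (snd p) + 1 = real (\<phi> (fst p))}" unfolding roof_def by auto
  also have "\<dots> \<in> sets \<Delta>" by measurable
  finally show ?thesis .
qed

definition to_roof :: "'a \<Rightarrow> 'a \<times> nat" where "to_roof y = (y, \<phi> y - 1)"

lemma to_roof_measurable [measurable]: "to_roof \<in> measurable N \<Delta>"
proof (rule measurable_to_\<Delta>)
  show "to_roof \<in> measurable N prod_space" unfolding to_roof_def by measurable
  show "to_roof y \<in> floors" if "y \<in> space N" for y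
    using that height_pos[OF that] by (simp add: floors_iff to_roof_def)
qed

lemma distr_to_roof: "distr N \<Delta> to_roof = density \<Delta> (indicator roof)"
proof (rule measure_eqI)
  fix A assume "A \<in> sets (distr N \<Delta> to_roof)"
  then have A [measurable]: "A \<in> sets \<Delta>" by simp
  have AR: "A \<inter> roof \<in> sets \<Delta>" by measurable
  have pre: "to_roof -` A \<inter> space N \<in> sets N" by measurable
  have "emeasure (density \<Delta> (indicator roof)) A = (\<integral>\<^sup>+p. indicator roof p * indicator A p \<partial>\<Delta>)"
    by (rule emeasure_density) auto
  also have "\<dots> = (\<integral>\<^sup>+p. indicator (A \<inter> roof) p \<partial>\<Delta>)"
    by (intro nn_integral_cong) (auto simp: indicator_def)
  also have "\<dots> = emeasure \<Delta> (A \<inter> roof)" by simp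
  also have "\<dots> = (\<integral>\<^sup>+y. (\<integral>\<^sup>+i. indicator (A \<inter> roof) (y, i) \<partial>count_space UNIV) \<partial>N)" by (rule emeasure_\<Delta>[OF AR])
  also have "\<dots> = (\<integral>\<^sup>+y. indicator (to_roof -` A \<inter> space N) y \<partial>N)"
  proof (rule nn_integral_cong)
    fix y assume y: "y \<in> space N"
    have "(\<integral>\<^sup>+i. indicator (A \<inter> roof) (y, i) \<partial>count_space UNIV) = (\<integral>\<^sup>+i. indicator A (to_roof y) * indicator {\<phi> y - 1} i \<partial>count_space UNIV)"
      using y height_pos[OF y] by (intro nn_integral_cong) (auto simp: indicator_def roof_def to_roof_def space_\<Delta>)
    also have "\<dots> = (indicator A (to_roof y) :: ennreal)"
      by (simp add: nn_integral_cmult_indicator)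
    finally show "(\<integral>\<^sup>+i. indicator (A \<inter> roof) (y, i) \<partial>count_space UNIV) = indicator (to_roof -` A \<inter> space N) y"
      using y by (simp add: indicator_def)
  qed
  also have "\<dots> = emeasure (distr N \<Delta> to_roof) A"
    using pre by (simp add: emeasure_distr)
  finally show "emeasure (distr N \<Delta> to_roof) A = emeasure (density \<Delta> (indicator roof)) A" by simp
qed simp

lemma roof_integral:
  fixes h :: "'a \<times> nat \<Rightarrow> real"
  assumes [measurable]: "h \<in> borel_measurable \<Delta>"
  shows "(\<integral>p. indicator roof p * h p \<partial>\<Delta>) = (\<integral>y. h (to_roof y) \<partial>N)"
    "integrable \<Delta> (\<lambda>p. indicator roof p * h p) \<longleftrightarrow> integrable N (\<lambda>y. h (to_roof y))"
proof -
  have d: "density \<Delta> (indicator roof) = density \<Delta> (\<lambda>p. ennreal (indicator roof p))"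
    by (simp add: ennreal_indicator)
  have "(\<integral>y. h (to_roof y) \<partial>N) = (\<integral>p. h p \<partial>distr N \<Delta> to_roof)" by (rule integral_distr[symmetric]) auto
  also have "\<dots> = (\<integral>p. indicator roof p * h p \<partial>\<Delta>)"
    unfolding distr_to_roof d by (subst integral_density) auto
  finally show "(\<integral>p. indicator roof p * h p \<partial>\<Delta>) = (\<integral>y. h (to_roof y) \<partial>N)" ..
  have "integrable N (\<lambda>y. h (to_roof y)) \<longleftrightarrow> integrable (distr N \<Delta> to_roof) h"
    by (rule integrable_distr_eq[symmetric]) auto
  also have "\<dots> \<longleftrightarrow> integrable \<Delta> (\<lambda>p. indicator roof p * h p)"
    unfolding distr_to_roof d by (subst integrable_density) auto
  finally show "integrable \<Delta> (\<lambda>p. indicator roof p * h p) \<longleftrightarrow> integrable N (\<lambda>y. h (to_roof y))" ..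
qed

text \<open>A reverse martingale difference \<open>\<psi>\<close> of the base, placed on the roof and extended by \<open>0\<close>, has the same property on
the tower: \<open>g \<circ> up\<close> is on the roof the function \<open>g (F y, 0)\<close> of \<open>F y\<close>. So the martingale part needs no change
of time.\<close>

lemma reverse_martingale_on_roof:
  assumes [measurable]: "\<psi> \<in> borel_measurable N" and psi2: "integrable N (\<lambda>y. (\<psi> y)\<^sup>2)"
    and orth: "\<And>g B. g \<in> borel_measurable N \<Longrightarrow> (\<And>x. x \<in> space N \<Longrightarrow> \<bar>g x\<bar> \<le> B) \<Longrightarrow> (\<integral>x. \<psi> x * g (F x) \<partial>N) = 0"
  shows "reverse_martingale_difference (\<lambda>p. indicator roof p * \<psi> (fst p))"
    "(\<integral>p. (indicator roof p * \<psi> (fst p))\<^sup>2 \<partial>\<Delta>) = (\<integral>y. (\<psi> y)\<^sup>2 \<partial>N)"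
proof -
  have [measurable]: "(\<lambda>p. \<psi> (fst p)) \<in> borel_measurable \<Delta>"
    by (rule measurable_from_\<Delta>) measurable
  have sq: "(indicator roof p * \<psi> (fst p))\<^sup>2 = indicator roof p * (\<psi> (fst p))\<^sup>2" for p
    by (simp add: indicator_def)
  show "(\<integral>p. (indicator roof p * \<psi> (fst p))\<^sup>2 \<partial>\<Delta>) = (\<integral>y. (\<psi> y)\<^sup>2 \<partial>N)"
    unfolding sq by (subst roof_integral) (auto simp: to_roof_def)
  show "reverse_martingale_difference (\<lambda>p. indicator roof p * \<psi> (fst p))"
    unfolding reverse_martingale_difference_def
  proof (intro conjI allI impI)
    show "(\<lambda>p. indicator roof p * \<psi> (fst p)) \<in> borel_measurable \<Delta>" by measurable
    show "integrable \<Delta> (\<lambda>p. (indicator roof p * \<psi> (fst p))\<^sup>2)"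
      unfolding sq using psi2 by (subst roof_integral(2)) (auto simp: to_roof_def)
    fix g :: "'a \<times> nat \<Rightarrow> real" and B
    assume [measurable]: "g \<in> borel_measurable \<Delta>" and B: "\<forall>x\<in>space \<Delta>. \<bar>g x\<bar> \<le> B"
    have "(\<integral>p. indicator roof p * \<psi> (fst p) * g (up p) \<partial>\<Delta>) = (\<integral>p. indicator roof p * (\<psi> (fst p) * g (up p)) \<partial>\<Delta>)"
      by (simp add: mult.assoc)
    also have "\<dots> = (\<integral>y. \<psi> (fst (to_roof y)) * g (up (to_roof y)) \<partial>N)"
      by (rule roof_integral) measurable
    also have "\<dots> = (\<integral>y. \<psi> y * g (F y, 0) \<partial>N)"
      using height_pos by (intro Bochner_Integration.integral_cong) (auto simp: to_roof_def up_def)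
    also have "\<dots> = 0"
    proof (rule orth[of "\<lambda>y. g (y, 0)" B])
      show "(\<lambda>y. g (y, 0)) \<in> borel_measurable N" by measurable
      show "\<bar>g (y, 0)\<bar> \<le> B" if "y \<in> space N" for y
        using B height_pos[OF that] that by (auto simp: space_\<Delta>)
    qed
    finally show "(\<integral>p. indicator roof p * \<psi> (fst p) * g (up p) \<partial>\<Delta>) = 0" .
  qed
qed

lemma column_integral:
  fixes h :: "'a \<times> nat \<Rightarrow> real"
  assumes h: "integrable \<Delta> h"
  shows "integrable N (\<lambda>y. \<Sum>i<\<phi> y. h (y, i))" "(\<integral>y. (\<Sum>i<\<phi> y. h (y, i)) \<partial>N) = (\<integral>p. h p \<partial>\<Delta>)"
proof -
  interpret PS: pair_sigma_finite N "count_space (UNIV :: nat set)" by (rule pair_sf)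
  let ?h = "\<lambda>p. indicator floors p *\<^sub>R h p"
  have i: "integrable prod_space ?h"
    using h unfolding \<Delta>_def by (subst (asm) integrable_restrict_space) auto
  have e: "(\<integral>p. h p \<partial>\<Delta>) = (\<integral>p. ?h p \<partial>prod_space)"
    unfolding \<Delta>_def by (subst integral_restrict_space) auto
  have inner: "(\<integral>i. ?h (y, i) \<partial>count_space UNIV) = (\<Sum>i<\<phi> y. h (y, i))" if "y \<in> space N" for y
  proof -
    have "(\<integral>i. ?h (y, i) \<partial>count_space UNIV) = (\<Sum>i | i \<in> UNIV \<and> ?h (y, i) \<noteq> 0. ?h (y, i))"
      by (rule lebesgue_integral_count_space_finite_support)
        (rule finite_subset[of _ "{..<\<phi> y}"], auto simp: floors_iff indicator_def split: if_splits)
    also have "\<dots> = (\<Sum>i<\<phi> y. h (y, i))"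
      using that by (intro sum.mono_neutral_cong_left) (auto simp: floors_iff indicator_def)
    finally show ?thesis .
  qed
  show "integrable N (\<lambda>y. \<Sum>i<\<phi> y. h (y, i))"
    using PS.integrable_fst'[OF i] inner by (subst (asm) Bochner_Integration.integrable_cong[OF refl inner]) auto
  show "(\<integral>y. (\<Sum>i<\<phi> y. h (y, i)) \<partial>N) = (\<integral>p. h p \<partial>\<Delta>)"
    unfolding e PS.integral_fst'[OF i, symmetric] using inner by (intro Bochner_Integration.integral_cong) auto
qed

end

section \<open>Return times and Kac's formula\<close>

text \<open>Connects \<open>infsum\<close>, in which the image measure and the class \<open>I\<close> are expressed, with nonnegative integrals, for
which Fubini and monotone convergence apply.\<close>

lemma infsum_eq_nn_integral_count_space:
  fixes f :: "'a \<Rightarrow> ennreal"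
  assumes "countable A"
  shows "infsum f A = (\<integral>\<^sup>+x. f x \<partial>count_space A)"
proof (cases "finite A")
  case False
  define g where "g = from_nat_into A"
  have g: "bij_betw g UNIV A" unfolding g_def using bij_betw_from_nat_into[OF assms False] .
  have sup: "infsum f A = (SUP X\<in>{X. finite X \<and> X \<subseteq> A}. sum f X)"
    by (rule nonneg_infsum_complete) simp
  have eq: "(\<integral>\<^sup>+x. f x \<partial>count_space A) = (SUP n. \<Sum>i<n. f (g i))"
    unfolding nn_integral_bij_count_space[OF g, symmetric] nn_integral_count_space_nat
    by (rule suminf_eq_SUP)
  show ?thesis
  proof (rule antisym)
    show "infsum f A \<le> (\<integral>\<^sup>+x. f x \<partial>count_space A)" unfolding sup
    proof (rule SUP_least)
      fix X assume "X \<in> {X. finite X \<and> X \<subseteq> A}"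
      then have X: "finite X" "X \<subseteq> A" by auto
      have "sum f X = (\<integral>\<^sup>+x. f x \<partial>count_space X)" using X by (simp add: nn_integral_count_space_finite)
      also have "\<dots> = (\<integral>\<^sup>+x. f x * indicator X x \<partial>count_space A)"
        using X by (simp add: nn_integral_count_space_indicator[of X] nn_integral_count_space_indicator[of A])
          (auto intro!: nn_integral_cong simp: indicator_def)
      also have "\<dots> \<le> (\<integral>\<^sup>+x. f x \<partial>count_space A)"
        by (intro nn_integral_mono) (auto simp: indicator_def)
      finally show "sum f X \<le> (\<integral>\<^sup>+x. f x \<partial>count_space A)" .
    qed
    show "(\<integral>\<^sup>+x. f x \<partial>count_space A) \<le> infsum f A" unfolding eq
    proof (rule SUP_least)
      fix n
      have inj: "inj_on g {..<n}" using g by (auto simp: bij_betw_def intro: inj_on_subset)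
      have "(\<Sum>i<n. f (g i)) = sum f (g ` {..<n})" by (simp add: sum.reindex[OF inj])
      also have "\<dots> \<le> infsum f A" unfolding sup
        using g by (intro SUP_upper) (auto simp: bij_betw_def)
      finally show "(\<Sum>i<n. f (g i)) \<le> infsum f A" .
    qed
  qed
qed (simp add: nn_integral_count_space_finite)

lemma (in finite_measure) countable_disjoint_positive:
  assumes A: "A \<subseteq> sets M" "disjoint A" "\<And>a. a \<in> A \<Longrightarrow> 0 < emeasure M a"
  shows "countable A"
proof -
  have fin: "finite {a \<in> A. measure M a > 1 / Suc n}" for n
  proof (rule ccontr)
    assume inf: "infinite {a \<in> A. measure M a > 1 / Suc n}"
    obtain k :: nat where k: "measure M (space M) * Suc n < k" using reals_Archimedean2 by blast
    obtain S where S: "S \<subseteq> {a \<in> A. measure M a > 1 / Suc n}" "finite S" "card S = k"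
      using infinite_arbitrarily_large[OF inf] by blast
    have "real k * (1 / Suc n) = (\<Sum>a\<in>S. 1 / Suc n)" using S by simp
    also have "\<dots> \<le> (\<Sum>a\<in>S. measure M a)" using S by (intro sum_mono) auto
    also have "\<dots> = measure M (\<Union>a\<in>S. a)"
    proof (rule finite_measure_finite_Union[symmetric])
      show "disjoint_family_on (\<lambda>a. a) S"
        using A(2) S(1) unfolding disjoint_family_on_def disjoint_def by blast
    qed (use A S in auto)
    also have "\<dots> \<le> measure M (space M)" by (rule bounded_measure)
    finally show False using k by (simp add: field_simps)
  qed
  have "A \<subseteq> (\<Union>n. {a \<in> A. measure M a > 1 / Suc n})"
  proof
    fix a assume a: "a \<in> A"
    then have "0 < measure M a" using A(3)[OF a] by (simp add: emeasure_eq_measure)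
    then obtain n where "1 / real (Suc n) < measure M a" using nat_approx_posE by blast
    then show "a \<in> (\<Union>n. {a \<in> A. measure M a > 1 / Suc n})" using a by auto
  qed
  moreover have "countable (\<Union>n. {a \<in> A. measure M a > 1 / Suc n})" using fin by (intro countable_UN) (auto intro: countable_finite)
  ultimately show ?thesis by (rule countable_subset)
qed

lemma return_time_eq_iff:
  "1 \<le> n \<Longrightarrow> return_time T Y x = n \<longleftrightarrow> (T ^^ n) x \<in> Y \<and> (\<forall>i\<in>{1..<n}. (T ^^ i) x \<notin> Y)"
proof
  assume n: "1 \<le> n" and r: "return_time T Y x = n"
  then have ex: "\<exists>n\<ge>1. (T ^^ n) x \<in> Y" by (auto simp: return_time_def split: if_splits)
  then have L: "n = (LEAST n. 1 \<le> n \<and> (T ^^ n) x \<in> Y)" using r by (auto simp: return_time_def)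
  have "1 \<le> n \<and> (T ^^ n) x \<in> Y" unfolding L by (rule LeastI_ex[OF ex])
  moreover have "(T ^^ i) x \<notin> Y" if "i \<in> {1..<n}" for i
    using not_less_Least[of i "\<lambda>n. 1 \<le> n \<and> (T ^^ n) x \<in> Y"] that L by auto
  ultimately show "(T ^^ n) x \<in> Y \<and> (\<forall>i\<in>{1..<n}. (T ^^ i) x \<notin> Y)" by auto
next
  assume n: "1 \<le> n" and r: "(T ^^ n) x \<in> Y \<and> (\<forall>i\<in>{1..<n}. (T ^^ i) x \<notin> Y)"
  have "(LEAST n. 1 \<le> n \<and> (T ^^ n) x \<in> Y) = n"
    using r n by (intro Least_equality) (auto simp: not_less[symmetric])
  then show "return_time T Y x = n" using n r by (auto simp: return_time_def)
qed

lemma return_time_pos_iff: "1 \<le> return_time T Y x \<longleftrightarrow> (\<exists>n\<ge>1. (T ^^ n) x \<in> Y)"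
proof
  assume "1 \<le> return_time T Y x"
  then show "\<exists>n\<ge>1. (T ^^ n) x \<in> Y" by (auto simp: return_time_def split: if_splits)
next
  assume ex: "\<exists>n\<ge>1. (T ^^ n) x \<in> Y"
  then have "1 \<le> (LEAST n. 1 \<le> n \<and> (T ^^ n) x \<in> Y)"
    using LeastI_ex[OF ex] by blast
  then show "1 \<le> return_time T Y x" using ex by (auto simp: return_time_def)
qed

lemma return_time_le: "1 \<le> n \<Longrightarrow> (T ^^ n) x \<in> Y \<Longrightarrow> 1 \<le> return_time T Y x \<and> return_time T Y x \<le> n"
  using return_time_pos_iff[of T Y x] return_time_eq_iff[of "return_time T Y x" T Y x]
  by (metis atLeastLessThan_iff not_le)

lemma induced_map_in: "1 \<le> return_time T Y x \<Longrightarrow> induced_map T Y x \<in> Y"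
  using return_time_eq_iff[of "return_time T Y x" T Y x] by (simp add: induced_map_def)

lemma before_return: "1 \<le> i \<Longrightarrow> i < return_time T Y x \<Longrightarrow> (T ^^ i) x \<notin> Y"
  using return_time_eq_iff[of "return_time T Y x" T Y x] by auto

lemma visits_are_induced_iterates:
  assumes "(T ^^ n) x \<in> Y"
  shows "x \<in> Y \<Longrightarrow> \<exists>k. (induced_map T Y ^^ k) x = (T ^^ n) x"
  using assms
proof (induction n arbitrary: x rule: less_induct)
  case (less n)
  show ?case
  proof (cases "n = 0")
    case True then show ?thesis by (intro exI[of _ 0]) simp
  next
    case False
    define r where "r = return_time T Y x"
    have r: "1 \<le> r" "r \<le> n" using return_time_le[of n T x Y] less.prems False by (auto simp: r_def)
    have e: "(T ^^ (n - r)) (induced_map T Y x) = (T ^^ n) x"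
      using r by (simp add: induced_map_def r_def[symmetric] funpow_add[symmetric, THEN fun_cong, unfolded comp_def])
    have "induced_map T Y x \<in> Y" using r by (intro induced_map_in) (simp add: r_def)
    then obtain k where "(induced_map T Y ^^ k) (induced_map T Y x) = (T ^^ (n - r)) (induced_map T Y x)"
      using less.IH[of "n - r" "induced_map T Y x"] r less.prems e by auto
    then show ?thesis using e by (intro exI[of _ "Suc k"]) (simp add: funpow_swap1)
  qed
qed

context pmp begin

lemma emeasure_preimage: "A \<in> sets M \<Longrightarrow> emeasure M ((T ^^ n) -` A \<inter> space M) = emeasure M A"
  using emeasure_distr[of "T ^^ n" M M A] by (simp add: distr_iterate)

lemma return_time_measurable [measurable]:
  assumes [measurable]: "Y \<in> sets M"
  shows "return_time T Y \<in> measurable M (count_space UNIV)"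
proof (rule measurableI)
  fix A :: "nat set"
  have pos: "return_time T Y -` {n} \<inter> space M \<in> sets M" if n: "1 \<le> n" for n
  proof -
    have "return_time T Y -` {n} \<inter> space M = {x \<in> space M. (T ^^ n) x \<in> Y \<and> (\<forall>i\<in>{1..<n}. (T ^^ i) x \<notin> Y)}"
      using return_time_eq_iff[OF n, of T Y] unfolding set_eq_iff Int_iff vimage_singleton_eq mem_Collect_eq by blast
    also have "\<dots> \<in> sets M" by measurable
    finally show ?thesis .
  qed
  have "return_time T Y -` {0} \<inter> space M = space M - (\<Union>n\<in>{1..}. return_time T Y -` {n} \<inter> space M)" by auto
  also have "\<dots> \<in> sets M" using pos by (intro sets.Diff sets.top sets.countable_UN'') auto
  finally have all: "return_time T Y -` {n} \<inter> space M \<in> sets M" for n using pos by (cases n) auto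
  have "return_time T Y -` A \<inter> space M = (\<Union>n\<in>A. return_time T Y -` {n} \<inter> space M)" by auto
  also have "\<dots> \<in> sets M" using all by (intro sets.countable_UN'') auto
  finally show "return_time T Y -` A \<inter> space M \<in> sets M" .
qed simp

lemma induced_map_measurable [measurable]:
  assumes [measurable]: "Y \<in> sets M"
  shows "induced_map T Y \<in> measurable M M"
  unfolding induced_map_def
  by (rule measurable_compose_countable[OF iterate_measurable return_time_measurable[OF assms]])

text \<open>Let \<open>W n\<close> be the measure of the points that avoid \<open>Y\<close> at times below \<open>n\<close> and are in \<open>B\<close> at time \<open>n\<close>. By invariance \<open>W n\<close>
splits according to whether one step earlier the point was in \<open>Y\<close>: \<open>W n = V n + W (n + 1)\<close>. As almost every point
hits \<open>Y\<close>, \<open>W n \<rightarrow> 0\<close> and the sum telescopes.\<close>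

lemma first_entrance_series:
  assumes [measurable]: "Y \<in> sets M" "B \<in> sets M" and hits: "AE x in M. \<exists>n. (T ^^ n) x \<in> Y"
  shows "emeasure M B = (\<Sum>n. emeasure M {x \<in> space M. x \<in> Y \<and> (\<forall>i\<in>{1..n}. (T ^^ i) x \<notin> Y) \<and> (T ^^ Suc n) x \<in> B})"
proof -
  define H where "H = (\<lambda>n. {x \<in> space M. \<forall>i<n. (T ^^ i) x \<notin> Y})"
  define W where "W = (\<lambda>n. emeasure M {x \<in> space M. (\<forall>i<n. (T ^^ i) x \<notin> Y) \<and> (T ^^ n) x \<in> B})"
  define V where "V = (\<lambda>n. emeasure M {x \<in> space M. x \<in> Y \<and> (\<forall>i\<in>{1..n}. (T ^^ i) x \<notin> Y) \<and> (T ^^ Suc n) x \<in> B})"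
  have [measurable]: "H n \<in> sets M" for n unfolding H_def by measurable
  have step: "W n = V n + W (Suc n)" for n
  proof -
    let ?S = "{x \<in> space M. (\<forall>i<n. (T ^^ i) x \<notin> Y) \<and> (T ^^ n) x \<in> B}"
    let ?A = "{x \<in> space M. x \<in> Y \<and> (\<forall>i\<in>{1..n}. (T ^^ i) x \<notin> Y) \<and> (T ^^ Suc n) x \<in> B}"
    let ?B = "{x \<in> space M. (\<forall>i<Suc n. (T ^^ i) x \<notin> Y) \<and> (T ^^ Suc n) x \<in> B}"
    have pre: "(T ^^ 1) -` ?S \<inter> space M = ?A \<union> ?B"
    proof (intro set_eqI)
      fix x
      have "(\<forall>i\<in>{1..n}. (T ^^ i) x \<notin> Y) \<longleftrightarrow> (\<forall>i<n. (T ^^ i) (T x) \<notin> Y)"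
        unfolding image_Suc_lessThan[symmetric] by (auto simp: funpow_swap1)
      moreover have "(\<forall>i<Suc n. (T ^^ i) x \<notin> Y) \<longleftrightarrow> x \<notin> Y \<and> (\<forall>i<n. (T ^^ i) (T x) \<notin> Y)"
        by (simp add: All_less_Suc2 funpow_swap1)
      moreover have "(T ^^ Suc n) x = (T ^^ n) (T x)" "(T ^^ 1) x = T x" by (simp_all add: funpow_swap1)
      ultimately show "x \<in> (T ^^ 1) -` ?S \<inter> space M \<longleftrightarrow> x \<in> ?A \<union> ?B"
        unfolding Int_iff Un_iff vimage_eq mem_Collect_eq using measurable_space[OF T_meas, of x] by metis
    qed
    have "W n = emeasure M ((T ^^ 1) -` ?S \<inter> space M)"
      unfolding W_def by (rule emeasure_preimage[symmetric]) measurable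
    also have "\<dots> = emeasure M (?A \<union> ?B)" unfolding pre ..
    also have "\<dots> = V n + W (Suc n)" unfolding V_def W_def
      by (rule plus_emeasure[symmetric]) (auto simp: All_less_Suc2)
    finally show ?thesis .
  qed
  have W_sum: "W 0 = (\<Sum>i<n. V i) + W n" for n
  proof (induction n)
    case (Suc n) then show ?case using step[of n] by (simp add: add.assoc)
  qed simp
  have "(\<lambda>n. emeasure M (H n)) \<longlonglongrightarrow> emeasure M (\<Inter>n. H n)"
    by (rule Lim_emeasure_decseq) (auto simp: H_def decseq_def emeasure_eq_measure)
  moreover have "emeasure M (\<Inter>n. H n) = 0"
  proof -
    have "AE x in M. x \<notin> (\<Inter>n. H n)" using hits by eventually_elim (auto simp: H_def)
    then show ?thesis by (subst (asm) AE_iff_null_sets[symmetric]) (auto simp: null_sets_def)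
  qed
  ultimately have H0: "(\<lambda>n. emeasure M (H n)) \<longlonglongrightarrow> 0" by simp
  have W0: "W \<longlonglongrightarrow> 0"
    by (rule tendsto_sandwich[OF _ _ tendsto_const H0]) (auto simp: W_def H_def intro!: always_eventually emeasure_mono)
  have "(\<lambda>n. (\<Sum>i<n. V i) + W n) \<longlonglongrightarrow> suminf V + 0"
    by (intro tendsto_add W0 summable_LIMSEQ) simp
  then have "W 0 = suminf V" unfolding W_sum[symmetric] by (simp add: LIMSEQ_const_iff)
  moreover have "W 0 = emeasure M B" unfolding W_def using sets.sets_into_space[of B M] by (auto intro!: arg_cong[where f = "emeasure M"])
  ultimately show ?thesis by (simp add: V_def)
qed

lemma AE_return:
  assumes "AE x in M. \<exists>n. (T ^^ n) x \<in> Y"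
  shows "AE x in M. 1 \<le> return_time T Y x"
  using AE_iterate[OF assms, of 1]
proof eventually_elim
  fix x assume "\<exists>n. (T ^^ n) ((T ^^ 1) x) \<in> Y"
  then obtain n where "(T ^^ Suc n) x \<in> Y" by (auto simp: funpow_swap1)
  then show "1 \<le> return_time T Y x" unfolding return_time_pos_iff by (intro exI[of _ "Suc n"]) simp
qed

text \<open>For \<open>A \<subseteq> Y\<close> the series of \<open>first_entrance_series\<close> lists the points of \<open>Y\<close> that return to \<open>A\<close>, by return time.\<close>

lemma induced_preserves:
  assumes Y [measurable]: "Y \<in> sets M" and hits: "AE x in M. \<exists>n. (T ^^ n) x \<in> Y"
    and A [measurable]: "A \<in> sets M" "A \<subseteq> Y"
  shows "emeasure M {x \<in> space M. x \<in> Y \<and> 1 \<le> return_time T Y x \<and> induced_map T Y x \<in> A} = emeasure M A"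
proof -
  let ?V = "\<lambda>n. {x \<in> space M. x \<in> Y \<and> (\<forall>i\<in>{1..n}. (T ^^ i) x \<notin> Y) \<and> (T ^^ Suc n) x \<in> A}"
  have V: "?V n = {x \<in> space M. x \<in> Y \<and> return_time T Y x = Suc n \<and> induced_map T Y x \<in> A}" for n
  proof (intro set_eqI)
    fix x
    have "return_time T Y x = Suc n \<longleftrightarrow> (T ^^ Suc n) x \<in> Y \<and> (\<forall>i\<in>{1..n}. (T ^^ i) x \<notin> Y)"
      using return_time_eq_iff[of "Suc n" T Y x] unfolding atLeastLessThanSuc_atLeastAtMost by simp
    moreover have "return_time T Y x = Suc n \<Longrightarrow> induced_map T Y x = (T ^^ Suc n) x"
      by (simp only: induced_map_def)
    ultimately show "x \<in> ?V n \<longleftrightarrow> x \<in> {x \<in> space M. x \<in> Y \<and> return_time T Y x = Suc n \<and> induced_map T Y x \<in> A}"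
      using A(2) by (auto simp del: funpow.simps)
  qed
  have "emeasure M A = (\<Sum>n. emeasure M (?V n))" by (rule first_entrance_series[OF Y A(1) hits])
  also have "\<dots> = emeasure M (\<Union>n. ?V n)"
  proof (rule suminf_emeasure)
    show "disjoint_family ?V" unfolding V disjoint_family_on_def by auto
    show "range ?V \<subseteq> sets M" by auto
  qed
  also have "(\<Union>n. ?V n) = {x \<in> space M. x \<in> Y \<and> 1 \<le> return_time T Y x \<and> induced_map T Y x \<in> A}"
    unfolding V by (auto simp: gr0_conv_Suc Suc_le_eq)
  finally show ?thesis by simp
qed

text \<open>Kac's formula, localized to a set \<open>A\<close>: the floors of the tower over \<open>Y\<close> project onto the space without
overlap. The part of \<open>A\<close> off \<open>Y\<close> is decomposed by \<open>first_entrance_series\<close>, and the part in \<open>Y\<close> is the floor \<open>0\<close>.\<close>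

lemma kac_formula:
  assumes Y [measurable]: "Y \<in> sets M" and hits: "AE x in M. \<exists>n. (T ^^ n) x \<in> Y"
    and A [measurable]: "A \<in> sets M"
  shows "emeasure M A = (\<Sum>n. emeasure M {x \<in> space M. x \<in> Y \<and> n < return_time T Y x \<and> (T ^^ n) x \<in> A})"
proof -
  let ?K = "\<lambda>n. {x \<in> space M. x \<in> Y \<and> n < return_time T Y x \<and> (T ^^ n) x \<in> A}"
  let ?V = "\<lambda>n. {x \<in> space M. x \<in> Y \<and> (\<forall>i\<in>{1..n}. (T ^^ i) x \<notin> Y) \<and> (T ^^ Suc n) x \<in> A - Y}"
  note ret = AE_return[OF hits]
  have K0: "emeasure M (?K 0) = emeasure M (A \<inter> Y)"
  proof (rule emeasure_eq_AE)
    show "AE x in M. x \<in> ?K 0 \<longleftrightarrow> x \<in> A \<inter> Y"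
      using ret AE_space by eventually_elim auto
  qed auto
  have KV: "emeasure M (?V n) = emeasure M (?K (Suc n))" for n
  proof (rule emeasure_eq_AE)
    show "AE x in M. x \<in> ?V n \<longleftrightarrow> x \<in> ?K (Suc n)"
      using ret AE_space
    proof eventually_elim
      fix x assume r: "1 \<le> return_time T Y x" and x: "x \<in> space M"
      have "Suc n < return_time T Y x \<longleftrightarrow> (\<forall>i\<in>{1..Suc n}. (T ^^ i) x \<notin> Y)"
      proof
        assume "Suc n < return_time T Y x"
        then show "\<forall>i\<in>{1..Suc n}. (T ^^ i) x \<notin> Y" using before_return[of _ T Y x] by auto
      next
        assume H: "\<forall>i\<in>{1..Suc n}. (T ^^ i) x \<notin> Y"
        have "(T ^^ return_time T Y x) x \<in> Y" using return_time_eq_iff[OF r, of T Y x] by simp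
        then show "Suc n < return_time T Y x" using H r by (meson atLeastAtMost_iff not_le)
      qed
      moreover have "(\<forall>i\<in>{1..Suc n}. (T ^^ i) x \<notin> Y) \<longleftrightarrow> (\<forall>i\<in>{1..n}. (T ^^ i) x \<notin> Y) \<and> (T ^^ Suc n) x \<notin> Y"
      proof -
        have "{1..Suc n} = insert (Suc n) {1..n}" by auto
        then show ?thesis by (simp only: ball_simps) blast
      qed
      ultimately show "x \<in> ?V n \<longleftrightarrow> x \<in> ?K (Suc n)" using x by auto
    qed
  qed measurable
  have "emeasure M A = emeasure M (A \<inter> Y) + emeasure M (A - Y)"
    by (subst plus_emeasure) (auto simp: Int_Diff_Un)
  also have "emeasure M (A - Y) = (\<Sum>n. emeasure M (?V n))" by (rule first_entrance_series[OF Y _ hits]) measurable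
  also have "\<dots> = (\<Sum>n. emeasure M (?K (Suc n)))" unfolding KV ..
  also have "emeasure M (A \<inter> Y) + (\<Sum>n. emeasure M (?K (Suc n))) = (\<Sum>n. emeasure M (?K n))"
    unfolding K0[symmetric] using suminf_offset[of "\<lambda>n. emeasure M (?K n)" 1] by (simp add: add.commute)
  finally show ?thesis .
qed

end

section \<open>The induced partition\<close>

locale markov_inducing =
  fixes M :: "'a measure" and T :: "'a \<Rightarrow> 'a" and \<alpha> \<gamma> :: "'a set set"
  assumes markov_map: "markov_map M T \<alpha>" and invariant: "probability_preserving M T"
    and mixing: "topologically_mixing T \<alpha>" and sub: "\<gamma> \<subseteq> \<alpha>" and nonempty: "\<gamma> \<noteq> {}"
    and big: "big_image M T \<alpha> \<gamma>"
begin

sublocale pmp M T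
  using invariant by (auto simp: probability_preserving_def pmp_def pmp_axioms_def)

abbreviation Y :: "'a set" where "Y \<equiv> \<Union>\<gamma>"
abbreviation R :: "'a \<Rightarrow> nat" where "R \<equiv> return_time T Y"
abbreviation F :: "'a \<Rightarrow> 'a" where "F \<equiv> induced_map T Y"
abbreviation \<delta> :: "'a set set" where "\<delta> \<equiv> induced_partition T \<alpha> \<gamma>"

lemma \<alpha>_sets: "a \<in> \<alpha> \<Longrightarrow> a \<in> sets M"
  and \<alpha>_cover: "x \<in> space M \<Longrightarrow> \<exists>a\<in>\<alpha>. x \<in> a"
  and \<alpha>_space: "a \<in> \<alpha> \<Longrightarrow> x \<in> a \<Longrightarrow> x \<in> space M"
  and \<alpha>_pos: "a \<in> \<alpha> \<Longrightarrow> 0 < emeasure M a"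
  and T_inj: "a \<in> \<alpha> \<Longrightarrow> inj_on T a"
  using markov_map by (auto simp: markov_map_def measurable_partition_def invertible_on_def)

lemma \<alpha>_disjoint: "a \<in> \<alpha> \<Longrightarrow> b \<in> \<alpha> \<Longrightarrow> x \<in> a \<Longrightarrow> x \<in> b \<Longrightarrow> a = b"
  using markov_map unfolding markov_map_def measurable_partition_def disjoint_def by blast

lemma \<alpha>_countable: "countable \<alpha>"
  using markov_map \<alpha>_pos unfolding markov_map_def measurable_partition_def
  by (intro countable_disjoint_positive) auto

lemma T_image:
  "a \<in> \<alpha> \<Longrightarrow> A \<in> sets M \<Longrightarrow> A \<subseteq> a \<Longrightarrow> T ` A \<in> sets M \<and> (emeasure M (T ` A) = 0 \<longleftrightarrow> emeasure M A = 0)"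
  using markov_map unfolding markov_map_def invertible_on_def by blast

lemma T_image_split: "A \<subseteq> space M \<Longrightarrow> T ` A = (\<Union>a\<in>\<alpha>. T ` (A \<inter> a))"
  using \<alpha>_cover by fastforce

lemma T_image_sets: assumes A: "A \<in> sets M" shows "T ` A \<in> sets M"
proof -
  have "(\<Union>a\<in>\<alpha>. T ` (A \<inter> a)) \<in> sets M"
    using A \<alpha>_sets T_image by (intro sets.countable_UN''[OF \<alpha>_countable]) blast
  then show ?thesis using T_image_split[OF sets.sets_into_space[OF A]] by simp
qed

lemma T_image_null: assumes A: "A \<in> null_sets M" shows "T ` A \<in> null_sets M"
proof -
  have "T ` (A \<inter> a) \<in> null_sets M" if a: "a \<in> \<alpha>" for a
  proof -
    have "A \<inter> a \<in> null_sets M" by (rule null_sets_subset[OF A]) (use A \<alpha>_sets[OF a] in auto)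
    then show ?thesis using T_image[OF a, of "A \<inter> a"] by auto
  qed
  then have "(\<Union>a\<in>\<alpha>. T ` (A \<inter> a)) \<in> null_sets M" by (intro null_sets_UN' \<alpha>_countable)
  then show ?thesis using T_image_split[of A] A sets.sets_into_space[of A M] by auto
qed

lemma image_funpow_Suc: "(T ^^ Suc n) ` A = T ` (T ^^ n) ` A"
  by (simp add: image_image)

lemma Tn_image_sets: "A \<in> sets M \<Longrightarrow> (T ^^ n) ` A \<in> sets M"
proof (induction n)
  case (Suc n) then show ?case unfolding image_funpow_Suc by (intro T_image_sets) auto
qed simp

lemma Tn_image_null: "A \<in> null_sets M \<Longrightarrow> (T ^^ n) ` A \<in> null_sets M"
proof (induction n)
  case (Suc n) then show ?case unfolding image_funpow_Suc by (intro T_image_null) auto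
qed simp

lemma Tn_preimage_null:
  assumes A: "A \<in> null_sets M" shows "(T ^^ n) -` A \<inter> space M \<in> null_sets M"
  using emeasure_preimage[of A n] A measurable_sets[OF iterate_measurable, of A n] by (auto simp: null_sets_def)

lemma Y_sets [measurable]: "Y \<in> sets M"
  using \<alpha>_sets sub countable_subset[OF sub \<alpha>_countable] by (intro sets.countable_Union) auto

lemma mixing_image: "a \<in> \<alpha> \<Longrightarrow> b \<in> \<alpha> \<Longrightarrow> \<exists>n\<ge>1. b \<subseteq> (T ^^ n) ` a"
  using mixing unfolding topologically_mixing_def by (meson max.cobounded1 max.cobounded2)

text \<open>Let \<open>E\<close> be the set of points that never hit \<open>Y\<close>. As \<open>E \<subseteq> T\<^sup>-\<^sup>n E\<close> have equal measure, \<open>T\<^sup>-\<^sup>n E - E\<close> is null, and so is its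
image. Some \<open>T\<^sup>n b\<close> with \<open>b \<subseteq> Y\<close> covers a given cell \<open>c\<close> by mixing; the preimages in \<open>b\<close> of points in \<open>E \<inter> c\<close> lie in
\<open>T\<^sup>-\<^sup>n E - E\<close>, so \<open>E \<inter> c\<close> is null.\<close>

lemma AE_hits: "AE x in M. \<exists>n. (T ^^ n) x \<in> Y"
proof -
  define E where "E = {x \<in> space M. \<forall>n. (T ^^ n) x \<notin> Y}"
  have E [measurable]: "E \<in> sets M" unfolding E_def by measurable
  obtain b where b: "b \<in> \<gamma>" using nonempty by auto
  then have ba: "b \<in> \<alpha>" using sub by auto
  have "E \<inter> c \<in> null_sets M" if c: "c \<in> \<alpha>" for c
  proof -
    obtain n where n: "c \<subseteq> (T ^^ n) ` b" using mixing_image[OF ba c] by auto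
    let ?P = "(T ^^ n) -` E \<inter> space M"
    have P: "?P \<in> sets M" by measurable
    have EP: "E \<subseteq> ?P"
    proof
      fix x assume x: "x \<in> E"
      then have "(T ^^ m) ((T ^^ n) x) \<notin> Y" for m
        unfolding E_def by (auto simp: funpow_add[symmetric, THEN fun_cong, unfolded comp_def])
      then show "x \<in> ?P" using x iterate_space by (auto simp: E_def)
    qed
    have "emeasure M (?P - E) = emeasure M ?P - emeasure M E"
      by (rule emeasure_Diff) (use EP P emeasure_finite in auto)
    then have null: "?P - E \<in> null_sets M" using emeasure_preimage[OF E, of n] P by (auto simp: null_sets_def)
    have "E \<inter> c \<subseteq> (T ^^ n) ` (?P - E)"
    proof
      fix x assume x: "x \<in> E \<inter> c"
      then obtain z where z: "z \<in> b" "x = (T ^^ n) z" using n by auto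
      have "(T ^^ 0) z \<in> Y" using z(1) b by auto
      then have "z \<notin> E" unfolding E_def by blast
      then show "x \<in> (T ^^ n) ` (?P - E)" using z x \<alpha>_space[OF ba z(1)] by auto
    qed
    moreover have "E \<inter> c \<in> sets M" using \<alpha>_sets[OF c] by simp
    ultimately show ?thesis using null_sets_subset[OF Tn_image_null[OF null]] by blast
  qed
  then have "(\<Union>c\<in>\<alpha>. E \<inter> c) \<in> null_sets M" by (intro null_sets_UN' \<alpha>_countable)
  also have "(\<Union>c\<in>\<alpha>. E \<inter> c) = E" using \<alpha>_cover by (auto simp: E_def)
  finally show ?thesis using AE_not_in[of E M] AE_space unfolding E_def by (auto elim: eventually_elim2)
qed

text \<open>The element of \<open>\<delta>\<close> containing a returning point \<open>x\<close>, described without naming the cylinder: the points with the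
same return time and the same \<open>\<alpha>\<close>-itinerary up to it.\<close>

definition cell :: "'a \<Rightarrow> 'a set" where
  "cell x = {y \<in> space M. R y = R x \<and> (\<forall>i<R x. \<exists>a\<in>\<alpha>. (T ^^ i) x \<in> a \<and> (T ^^ i) y \<in> a)}"

lemma cylinder_is_cell:
  assumes a: "a \<in> \<gamma>" and n: "1 \<le> n" and xi: "\<forall>i\<in>{1..<n}. \<xi> i \<in> \<alpha> - \<gamma>"
    and d: "d = {x\<in>a. (\<forall>i\<in>{1..<n}. (T ^^ i) x \<in> \<xi> i) \<and> (T ^^ n) x \<in> Y}" and x: "x \<in> d"
  shows "R x = n" "x \<in> Y" "d = cell x"
proof -
  have notY: "z \<notin> Y" if "z \<in> \<xi> i" "i \<in> {1..<n}" for z i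
    using that xi \<alpha>_disjoint sub by blast
  have R: "R y = n" if "y \<in> d" for y
    using that notY n unfolding return_time_eq_iff[OF n] d by blast
  show "R x = n" by (rule R[OF x])
  show "x \<in> Y" using x a d by auto
  have aa: "a \<in> \<alpha>" using a sub by auto
  show "d = cell x"
  proof (intro set_eqI iffI)
    fix y assume y: "y \<in> d"
    have "\<exists>b\<in>\<alpha>. (T ^^ i) x \<in> b \<and> (T ^^ i) y \<in> b" if i: "i < n" for i
    proof (cases "i = 0")
      case True then show ?thesis using x y aa d by (auto intro: bexI[of _ a])
    next
      case False
      then have "i \<in> {1..<n}" using i by auto
      then show ?thesis using x y xi unfolding d by blast
    qed
    then show "y \<in> cell x" using R[OF x] R[OF y] y aa \<alpha>_space[OF aa] d by (auto simp: cell_def)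
  next
    fix y assume y: "y \<in> cell x"
    have Ry: "R y = n" using y R[OF x] by (simp add: cell_def)
    have it: "\<exists>b\<in>\<alpha>. (T ^^ i) x \<in> b \<and> (T ^^ i) y \<in> b" if "i < n" for i
      using y that R[OF x] by (simp add: cell_def)
    have "y \<in> a" using it[of 0] n x aa \<alpha>_disjoint d by auto
    moreover have "(T ^^ i) y \<in> \<xi> i" if i: "i \<in> {1..<n}" for i
    proof -
      obtain b where b: "b \<in> \<alpha>" "(T ^^ i) x \<in> b" "(T ^^ i) y \<in> b" using it[of i] i by auto
      have "(T ^^ i) x \<in> \<xi> i" "\<xi> i \<in> \<alpha>" using x i xi d by auto
      then have "b = \<xi> i" using b \<alpha>_disjoint by blast
      then show ?thesis using b by simp
    qed
    moreover have "(T ^^ n) y \<in> Y" using return_time_eq_iff[OF n, of T Y y] Ry by simp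
    ultimately show "y \<in> d" unfolding d by blast
  qed
qed

lemma \<delta>_cell:
  assumes d: "d \<in> \<delta>" and x: "x \<in> d"
  shows "x \<in> Y \<and> 1 \<le> R x \<and> d = cell x"
proof -
  obtain a n \<xi> where *: "a \<in> \<gamma>" "1 \<le> n" "\<forall>i\<in>{1..<n}. \<xi> i \<in> \<alpha> - \<gamma>"
    "d = {x\<in>a. (\<forall>i\<in>{1..<n}. (T ^^ i) x \<in> \<xi> i) \<and> (T ^^ n) x \<in> Y}"
    using d unfolding induced_partition_def by blast
  from cylinder_is_cell[OF * x] *(2) show ?thesis by simp
qed

lemma \<delta>_nonempty: "d \<in> \<delta> \<Longrightarrow> d \<noteq> {}"
  by (simp add: induced_partition_def)

lemma Y_space: "x \<in> Y \<Longrightarrow> x \<in> space M"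
  using sub \<alpha>_space by auto

lemma cell_in_\<delta>:
  assumes x: "x \<in> Y" and r: "1 \<le> R x"
  shows "cell x \<in> \<delta>" "x \<in> cell x"
proof -
  have xs: "x \<in> space M" by (rule Y_space[OF x])
  have "\<forall>i. \<exists>a. a \<in> \<alpha> \<and> (T ^^ i) x \<in> a" using \<alpha>_cover[OF iterate_space[OF xs]] by blast
  then obtain \<xi> where xi: "\<And>i. \<xi> i \<in> \<alpha>" "\<And>i. (T ^^ i) x \<in> \<xi> i" by metis
  show "x \<in> cell x" using xs xi unfolding cell_def by blast
  obtain c where c: "c \<in> \<gamma>" "x \<in> c" using x by auto
  have "\<xi> 0 = c" using xi(1)[of 0] xi(2)[of 0] c sub \<alpha>_disjoint[of "\<xi> 0" c x] by auto
  then have 0: "\<xi> 0 \<in> \<gamma>" using c by simp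
  have ng: "\<forall>i\<in>{1..<R x}. \<xi> i \<in> \<alpha> - \<gamma>"
  proof
    fix i assume "i \<in> {1..<R x}"
    then have "(T ^^ i) x \<notin> Y" using before_return[of i T Y x] by auto
    then show "\<xi> i \<in> \<alpha> - \<gamma>" using xi[of i] by auto
  qed
  define d where "d = {y\<in>\<xi> 0. (\<forall>i\<in>{1..<R x}. (T ^^ i) y \<in> \<xi> i) \<and> (T ^^ R x) y \<in> Y}"
  have xd: "x \<in> d" unfolding d_def using xi xi(2)[of 0] return_time_eq_iff[OF r, of T Y x] by auto
  have "d = cell x" by (rule cylinder_is_cell(3)[OF 0 r ng d_def xd])
  moreover have "d \<in> \<delta>" unfolding induced_partition_def mem_Collect_eq
    using xd 0 r ng d_def by blast
  ultimately show "cell x \<in> \<delta>" by simp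
qed

lemma \<delta>_disjoint: "d \<in> \<delta> \<Longrightarrow> d' \<in> \<delta> \<Longrightarrow> x \<in> d \<Longrightarrow> x \<in> d' \<Longrightarrow> d = d'"
  using \<delta>_cell by metis

lemma \<delta>_sets: assumes d: "d \<in> \<delta>" shows "d \<in> sets M"
proof -
  obtain a n \<xi> where a: "a \<in> \<gamma>" and xi: "\<forall>i\<in>{1..<n}. \<xi> i \<in> \<alpha> - \<gamma>"
    and e: "d = {x\<in>a. (\<forall>i\<in>{1..<n}. (T ^^ i) x \<in> \<xi> i) \<and> (T ^^ n) x \<in> Y}"
    using d unfolding induced_partition_def by blast
  have aa [measurable]: "a \<in> sets M" using a sub \<alpha>_sets by auto
  have 1: "{x \<in> space M. \<forall>i\<in>{1..<n}. (T ^^ i) x \<in> \<xi> i} \<in> sets M"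
  proof (rule sets.sets_Collect_finite_All)
    fix i assume "i \<in> {1..<n}"
    then have [measurable]: "\<xi> i \<in> sets M" using xi \<alpha>_sets by auto
    show "{x \<in> space M. (T ^^ i) x \<in> \<xi> i} \<in> sets M" by measurable
  qed simp
  have "d = a \<inter> ({x \<in> space M. \<forall>i\<in>{1..<n}. (T ^^ i) x \<in> \<xi> i} \<inter> {x \<in> space M. (T ^^ n) x \<in> Y})"
    unfolding e using sets.sets_into_space[OF aa] by auto
  also have "\<dots> \<in> sets M" by (intro sets.Int aa 1) measurable
  finally show ?thesis .
qed

lemma itinerary_inj:
  "(\<And>i. i < n \<Longrightarrow> \<exists>a\<in>\<alpha>. (T ^^ i) y \<in> a \<and> (T ^^ i) z \<in> a) \<Longrightarrow> (T ^^ n) y = (T ^^ n) z \<Longrightarrow> y = z"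
proof (induction n)
  case (Suc n)
  obtain a where "a \<in> \<alpha>" "(T ^^ n) y \<in> a" "(T ^^ n) z \<in> a" using Suc.prems(1)[of n] by auto
  then have "(T ^^ n) y = (T ^^ n) z" using T_inj[of a] Suc.prems(2) by (auto dest: inj_onD)
  then show ?case using Suc by auto
qed simp

lemma itinerary_image:
  assumes A: "A \<in> sets M"
  shows "(\<And>i. i < n \<Longrightarrow> \<exists>a\<in>\<alpha>. (T ^^ i) ` A \<subseteq> a) \<Longrightarrow>
    (T ^^ n) ` A \<in> sets M \<and> (emeasure M ((T ^^ n) ` A) = 0 \<longleftrightarrow> emeasure M A = 0)"
proof (induction n)
  case (Suc n)
  have IH: "(T ^^ n) ` A \<in> sets M" "emeasure M ((T ^^ n) ` A) = 0 \<longleftrightarrow> emeasure M A = 0"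
    using Suc by auto
  obtain a where "a \<in> \<alpha>" "(T ^^ n) ` A \<subseteq> a" using Suc.prems[of n] by auto
  from T_image[OF this(1) IH(1) this(2)] IH show ?case unfolding image_funpow_Suc by simp
qed (use A in simp)

lemma \<delta>_itinerary:
  "d \<in> \<delta> \<Longrightarrow> x \<in> d \<Longrightarrow> y \<in> d \<Longrightarrow> R y = R x \<and> (\<forall>i<R x. \<exists>a\<in>\<alpha>. (T ^^ i) x \<in> a \<and> (T ^^ i) y \<in> a)"
  using \<delta>_cell[of d x] by (auto simp: cell_def)

lemma F_on_\<delta>: "d \<in> \<delta> \<Longrightarrow> x \<in> d \<Longrightarrow> A \<subseteq> d \<Longrightarrow> F ` A = (T ^^ R x) ` A"
proof (rule image_cong[OF refl])
  fix y assume "d \<in> \<delta>" "x \<in> d" "A \<subseteq> d" "y \<in> A"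
  then have "R y = R x" using \<delta>_itinerary[of d x y] by blast
  then show "F y = (T ^^ R x) y" by (simp only: induced_map_def)
qed

lemma \<delta>_image_in_cell:
  assumes "d \<in> \<delta>" "x \<in> d" "A \<subseteq> d" "i < R x" shows "\<exists>a\<in>\<alpha>. (T ^^ i) ` A \<subseteq> a"
proof -
  obtain a where a: "a \<in> \<alpha>" "(T ^^ i) x \<in> a" using \<delta>_itinerary[OF assms(1,2,2)] assms(4) by auto
  have "(T ^^ i) y \<in> a" if "y \<in> A" for y
    using \<delta>_itinerary[OF assms(1,2), of y] that assms a \<alpha>_disjoint by blast
  then show ?thesis using a by auto
qed

lemma F_inj_\<delta>: assumes d: "d \<in> \<delta>" shows "inj_on F d"
proof (rule inj_onI)
  fix y z assume yz: "y \<in> d" "z \<in> d" "F y = F z"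
  have e: "R z = R y" "\<And>i. i < R y \<Longrightarrow> \<exists>a\<in>\<alpha>. (T ^^ i) y \<in> a \<and> (T ^^ i) z \<in> a"
    using \<delta>_itinerary[OF d yz(1,2)] by auto
  show "y = z" using yz(3) e(1) by (intro itinerary_inj[OF e(2)]) (auto simp: induced_map_def)
qed

lemma F_image_\<delta>:
  assumes d: "d \<in> \<delta>" and A: "A \<in> sets M" "A \<subseteq> d"
  shows "F ` A \<in> sets M" "emeasure M (F ` A) = 0 \<longleftrightarrow> emeasure M A = 0"
proof -
  obtain x where x: "x \<in> d" using \<delta>_nonempty[OF d] by auto
  have "(T ^^ R x) ` A \<in> sets M \<and> (emeasure M ((T ^^ R x) ` A) = 0 \<longleftrightarrow> emeasure M A = 0)"
    by (rule itinerary_image[OF A(1)]) (rule \<delta>_image_in_cell[OF d x A(2)])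
  then show "F ` A \<in> sets M" "emeasure M (F ` A) = 0 \<longleftrightarrow> emeasure M A = 0"
    using F_on_\<delta>[OF d x A(2)] by auto
qed

text \<open>Elements of the induced partition are only required to be nonempty; they have positive measure because their
images are big and \<open>T\<close> does not charge images of null sets.\<close>

lemma \<delta>_pos: assumes d: "d \<in> \<delta>" shows "0 < emeasure M d"
proof -
  obtain e where "0 < e" "e \<le> measure M (F ` d)" using big d unfolding big_image_def by auto
  then have "emeasure M (F ` d) \<noteq> 0" by (auto simp: measure_def)
  then show ?thesis using F_image_\<delta>(2)[OF d \<delta>_sets[OF d] order_refl] by (simp add: zero_less_iff_neq_zero)
qed

lemma \<delta>_countable: "countable \<delta>"
proof (rule countable_disjoint_positive)
  show "disjoint \<delta>" unfolding disjoint_def using \<delta>_disjoint by blast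
qed (use \<delta>_sets \<delta>_pos in auto)

lemma F_in_Y: "1 \<le> R x \<Longrightarrow> F x \<in> Y"
  by (rule induced_map_in)

section \<open>The Markov property of the induced map\<close>

text \<open>The Markov property of \<open>T\<close>, which holds modulo null sets, in the form in which it is iterated.\<close>

lemma T_full_or_null:
  assumes a: "a \<in> \<alpha>" and b: "b \<in> \<alpha>"
  shows "T ` a \<inter> b \<in> null_sets M \<or> b - T ` a \<in> null_sets M"
proof -
  obtain \<beta> where \<beta>: "\<beta> \<subseteq> \<alpha>" "sym_diff (T ` a) (\<Union>\<beta>) \<in> null_sets M"
    using markov_map a unfolding markov_map_def by blast
  note s = T_image_sets[OF \<alpha>_sets[OF a]] \<alpha>_sets[OF b]
  show ?thesis
  proof (cases "b \<in> \<beta>")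
    case True
    have "b - T ` a \<in> null_sets M" by (rule null_sets_subset[OF \<beta>(2)]) (use s True in auto)
    then show ?thesis ..
  next
    case False
    have "T ` a \<inter> b \<subseteq> sym_diff (T ` a) (\<Union>\<beta>)"
    proof
      fix x assume x: "x \<in> T ` a \<inter> b"
      then have "x \<notin> \<Union>\<beta>" using \<alpha>_disjoint[OF b] \<beta>(1) False by blast
      then show "x \<in> sym_diff (T ` a) (\<Union>\<beta>)" using x by auto
    qed
    then have "T ` a \<inter> b \<in> null_sets M" by (intro null_sets_subset[OF \<beta>(2)]) (use s in auto)
    then show ?thesis ..
  qed
qed

definition T_cylinder :: "nat \<Rightarrow> 'a \<Rightarrow> 'a set" where
  "T_cylinder k x = {y \<in> space M. \<forall>i\<le>k. \<exists>a\<in>\<alpha>. (T ^^ i) x \<in> a \<and> (T ^^ i) y \<in> a}"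

lemma T_cylinder_step:
  assumes a: "a \<in> \<alpha>" "(T ^^ Suc k) x \<in> a"
  shows "T_cylinder (Suc k) x = T_cylinder k x \<inter> ((T ^^ Suc k) -` a \<inter> space M)"
proof -
  have "(\<exists>b\<in>\<alpha>. (T ^^ Suc k) x \<in> b \<and> (T ^^ Suc k) y \<in> b) \<longleftrightarrow> (T ^^ Suc k) y \<in> a" for y
    using a \<alpha>_disjoint by blast
  then show ?thesis unfolding T_cylinder_def le_Suc_eq by (auto simp del: funpow.simps)
qed

lemma T_cylinder_sets: "x \<in> space M \<Longrightarrow> T_cylinder k x \<in> sets M"
proof (induction k)
  case 0
  then obtain a where a: "a \<in> \<alpha>" "x \<in> a" using \<alpha>_cover by auto
  have "T_cylinder 0 x = a" using a \<alpha>_disjoint \<alpha>_space by (auto simp: T_cylinder_def)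
  then show ?case using \<alpha>_sets a by simp
next
  case (Suc k)
  obtain a where a: "a \<in> \<alpha>" "(T ^^ Suc k) x \<in> a" using \<alpha>_cover[OF iterate_space[OF Suc.prems]] by blast
  show ?case unfolding T_cylinder_step[OF a]
    by (rule sets.Int[OF Suc.IH[OF Suc.prems] measurable_sets[OF iterate_measurable \<alpha>_sets[OF a(1)]]])
qed

lemma T_cylinder_image_sub:
  "a \<in> \<alpha> \<Longrightarrow> (T ^^ i) x \<in> a \<Longrightarrow> i \<le> k \<Longrightarrow> (T ^^ i) ` T_cylinder k x \<subseteq> a"
  unfolding T_cylinder_def using \<alpha>_disjoint by blast

text \<open>A cylinder of positive measure is mapped by \<open>T\<^sup>k\<close> onto almost all of its last element. In the induction step the image of the
shorter cylinder fills \<open>b\<close>; as \<open>T b\<close> meets \<open>a\<close> in positive measure, it contains almost all of \<open>a\<close>.\<close>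

lemma T_cylinder_image_full:
  assumes x: "x \<in> space M"
  shows "emeasure M (T_cylinder k x) \<noteq> 0 \<Longrightarrow> a \<in> \<alpha> \<Longrightarrow> (T ^^ k) x \<in> a \<Longrightarrow> a - (T ^^ k) ` T_cylinder k x \<in> null_sets M"
proof (induction k arbitrary: a)
  case 0
  have "T_cylinder 0 x = a" using 0 \<alpha>_disjoint \<alpha>_space by (auto simp: T_cylinder_def)
  then show ?case by simp
next
  case (Suc k)
  obtain b where b: "b \<in> \<alpha>" "(T ^^ k) x \<in> b" using \<alpha>_cover[OF iterate_space[OF x]] by blast
  let ?D = "T_cylinder k x" and ?D' = "T_cylinder (Suc k) x"
  note st = T_cylinder_step[OF Suc.prems(2,3)]
  have D: "?D \<in> sets M" "?D' \<in> sets M" using T_cylinder_sets[OF x] by auto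
  have Dn: "emeasure M ?D \<noteq> 0"
  proof
    assume "emeasure M ?D = 0"
    then have "?D \<in> null_sets M" using D by auto
    then have "?D' \<in> null_sets M" by (rule null_sets_subset) (use D st in auto)
    then show False using Suc.prems(1) by auto
  qed
  have bD: "b - (T ^^ k) ` ?D \<in> null_sets M" by (rule Suc.IH[OF Dn b])
  have DB: "(T ^^ k) ` ?D \<subseteq> b" by (rule T_cylinder_image_sub[OF b order_refl])
  have img: "(T ^^ Suc k) ` ?D' = T ` ((T ^^ k) ` ?D) \<inter> a"
    unfolding st image_funpow_Suc[symmetric] using sets.sets_into_space[OF D(1)] by auto
  have "emeasure M ((T ^^ Suc k) ` ?D') \<noteq> 0"
  proof -
    have "(T ^^ Suc k) ` ?D' \<in> sets M \<and> (emeasure M ((T ^^ Suc k) ` ?D') = 0 \<longleftrightarrow> emeasure M ?D' = 0)"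
    proof (rule itinerary_image[OF D(2)])
      fix i assume i: "i < Suc k"
      obtain c where c: "c \<in> \<alpha>" "(T ^^ i) x \<in> c" using \<alpha>_cover[OF iterate_space[OF x]] by blast
      show "\<exists>a\<in>\<alpha>. (T ^^ i) ` ?D' \<subseteq> a" using T_cylinder_image_sub[OF c, of "Suc k"] i c by auto
    qed
    then show ?thesis using Suc.prems(1) by simp
  qed
  then have "T ` b \<inter> a \<notin> null_sets M"
  proof (rule contrapos_nn)
    assume n: "T ` b \<inter> a \<in> null_sets M"
    have "(T ^^ Suc k) ` ?D' \<in> null_sets M"
      by (rule null_sets_subset[OF n Tn_image_sets[OF D(2)]]) (use img DB in auto)
    then show "emeasure M ((T ^^ Suc k) ` ?D') = 0" by auto
  qed
  then have ab: "a - T ` b \<in> null_sets M" using T_full_or_null[OF b(1) Suc.prems(2)] by blast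
  have un: "(a - T ` b) \<union> T ` (b - (T ^^ k) ` ?D) \<in> null_sets M"
    using ab T_image_null[OF bD] by auto
  show ?case
  proof (rule null_sets_subset[OF un])
    show "a - (T ^^ Suc k) ` ?D' \<in> sets M"
      by (rule sets.Diff[OF \<alpha>_sets[OF Suc.prems(2)] Tn_image_sets[OF D(2)]])
    show "a - (T ^^ Suc k) ` ?D' \<subseteq> (a - T ` b) \<union> T ` (b - (T ^^ k) ` ?D)"
      unfolding img by auto
  qed
qed

text \<open>Up to the return to \<open>Y\<close>, an element of \<open>\<delta>\<close> is a cylinder of \<open>\<alpha>\<close>, whose image under \<open>T\<^sup>n\<^sup>-\<^sup>1\<close> fills an element
\<open>b\<close> of \<open>\<alpha>\<close>. So \<open>F d\<close> agrees with \<open>T b \<inter> Y\<close> modulo null sets.\<close>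

lemma induced_full_or_null:
  assumes d: "d \<in> \<delta>" and a': "a' \<in> \<gamma>"
  shows "F ` d \<inter> a' \<in> null_sets M \<or> a' - F ` d \<in> null_sets M"
proof -
  obtain x where x: "x \<in> d" using \<delta>_nonempty[OF d] by auto
  have xY: "x \<in> Y" "1 \<le> R x" "d = cell x" using \<delta>_cell[OF d x] by auto
  have xs: "x \<in> space M" by (rule Y_space[OF xY(1)])
  obtain k where k: "R x = Suc k" using xY(2) by (cases "R x") auto
  obtain b where b: "b \<in> \<alpha>" "(T ^^ k) x \<in> b" using \<alpha>_cover[OF iterate_space[OF xs]] by blast
  let ?D = "T_cylinder k x"
  have D: "?D \<in> sets M" by (rule T_cylinder_sets[OF xs])
  have dD: "d = ?D \<inter> {y. (T ^^ Suc k) y \<in> Y}"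
  proof (intro set_eqI iffI)
    fix y assume "y \<in> d"
    then show "y \<in> ?D \<inter> {y. (T ^^ Suc k) y \<in> Y}"
      using return_time_eq_iff[of "Suc k" T Y y] k
      unfolding xY(3) cell_def T_cylinder_def by (auto simp: less_Suc_eq_le simp del: funpow.simps)
  next
    fix y assume y: "y \<in> ?D \<inter> {y. (T ^^ Suc k) y \<in> Y}"
    have it: "\<exists>a\<in>\<alpha>. (T ^^ i) x \<in> a \<and> (T ^^ i) y \<in> a" if "i \<le> k" for i
      using y that by (auto simp: T_cylinder_def)
    have "(T ^^ i) y \<notin> Y" if i: "i \<in> {1..<Suc k}" for i
    proof
      assume "(T ^^ i) y \<in> Y"
      then obtain c where c: "c \<in> \<gamma>" "(T ^^ i) y \<in> c" by auto
      obtain a where a: "a \<in> \<alpha>" "(T ^^ i) x \<in> a" "(T ^^ i) y \<in> a" using it[of i] i by auto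
      have "a = c" using a c sub \<alpha>_disjoint by blast
      then have "(T ^^ i) x \<in> Y" using a c by auto
      then show False using before_return[of i T Y x] i k by auto
    qed
    then have "R y = Suc k" using y return_time_eq_iff[of "Suc k" T Y y] by auto
    then show "y \<in> d" unfolding xY(3) cell_def using y k it by (auto simp: T_cylinder_def less_Suc_eq_le)
  qed
  have Fd: "F ` d = T ` ((T ^^ k) ` ?D) \<inter> Y"
    unfolding F_on_\<delta>[OF d x order_refl] k image_funpow_Suc[symmetric] by (subst dD) auto
  have "emeasure M ?D \<noteq> 0"
  proof
    assume "emeasure M ?D = 0"
    then have "?D \<in> null_sets M" using D by auto
    then have "d \<in> null_sets M" by (rule null_sets_subset) (use dD \<delta>_sets[OF d] in auto)
    then show False using \<delta>_pos[OF d] by auto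
  qed
  then have bD: "b - (T ^^ k) ` ?D \<in> null_sets M" by (rule T_cylinder_image_full[OF xs _ b])
  have DB: "(T ^^ k) ` ?D \<subseteq> b" by (rule T_cylinder_image_sub[OF b order_refl])
  have a'\<alpha>: "a' \<in> \<alpha>" using a' sub by auto
  have a'Y: "a' \<subseteq> Y" using a' by auto
  note s = \<alpha>_sets[OF a'\<alpha>] F_image_\<delta>(1)[OF d \<delta>_sets[OF d] order_refl]
  from T_full_or_null[OF b(1) a'\<alpha>] show ?thesis
  proof
    assume n: "T ` b \<inter> a' \<in> null_sets M"
    have "F ` d \<inter> a' \<in> null_sets M"
      by (rule null_sets_subset[OF n]) (use s Fd DB in auto)
    then show ?thesis ..
  next
    assume n: "a' - T ` b \<in> null_sets M"
    have un: "(a' - T ` b) \<union> T ` (b - (T ^^ k) ` ?D) \<in> null_sets M"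
      using n T_image_null[OF bD] by auto
    have "a' - F ` d \<in> null_sets M"
      by (rule null_sets_subset[OF un]) (use s Fd a'Y in auto)
    then show ?thesis ..
  qed
qed

end

context markov_inducing begin

section \<open>The inverse jacobian\<close>

abbreviation MY :: "'a measure" where "MY \<equiv> restrict_space M Y"
abbreviation IM :: "'a measure" where "IM \<equiv> image_measure M T \<alpha> \<gamma>"
abbreviation RN :: "'a \<Rightarrow> ennreal" where "RN \<equiv> RN_deriv IM MY"

lemma sets_MY: "A \<in> sets MY \<longleftrightarrow> A \<in> sets M \<and> A \<subseteq> Y"
  using Y_sets by (subst sets_restrict_space_iff) auto

lemma space_MY: "space MY = Y"
  using sets.sets_into_space[OF Y_sets] by (auto simp: space_restrict_space)

lemma sets_IM: "sets IM = sets MY" and space_IM: "space IM = Y"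
proof -
  have "sets MY \<subseteq> Pow Y" using sets.sets_into_space[of _ MY] space_MY by auto
  then have "sets IM = sigma_sets Y (sets MY)" "space IM = Y"
    unfolding image_measure_def by (simp_all add: space_measure_of_conv)
  moreover have "sigma_sets Y (sets MY) = sets MY" using sets.sigma_sets_eq[of MY] space_MY by simp
  ultimately show "sets IM = sets MY" "space IM = Y" by auto
qed

lemma emeasure_IM:
  assumes A: "A \<in> sets MY"
  shows "emeasure IM A = (\<integral>\<^sup>+d. emeasure M (F ` (A \<inter> d)) \<partial>count_space \<delta>)"
proof -
  let ?\<mu> = "\<lambda>A. (\<Sum>\<^sub>\<infinity>d\<in>\<delta>. emeasure M (F ` (A \<inter> d)))"
  have mu: "?\<mu> A = (\<integral>\<^sup>+d. emeasure M (F ` (A \<inter> d)) \<partial>count_space \<delta>)" for A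
    by (rule infsum_eq_nn_integral_count_space[OF \<delta>_countable])
  have img: "F ` (B \<inter> d) \<in> sets M" if "B \<in> sets MY" "d \<in> \<delta>" for B d
    using that \<delta>_sets[OF that(2)] sets_MY by (intro F_image_\<delta>(1)[OF that(2)]) auto
  have "emeasure IM A = ?\<mu> A"
  proof (rule emeasure_measure_of[OF image_measure_def])
    show "sets (restrict_space M Y) \<subseteq> Pow Y" using sets_MY by auto
    show "positive (sets IM) ?\<mu>" by (auto simp: positive_def)
    show "A \<in> sets IM" using A sets_IM by simp
    show "countably_additive (sets IM) ?\<mu>"
      unfolding countably_additive_def sets_IM
    proof (intro allI impI)
      fix B :: "nat \<Rightarrow> 'a set"
      assume B: "range B \<subseteq> sets MY" "disjoint_family B" "(\<Union>i. B i) \<in> sets MY"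
      have "(\<Sum>i. ?\<mu> (B i)) = (\<integral>\<^sup>+d. (\<Sum>i. emeasure M (F ` (B i \<inter> d))) \<partial>count_space \<delta>)"
        unfolding mu by (rule nn_integral_suminf[symmetric]) simp
      also have "\<dots> = (\<integral>\<^sup>+d. emeasure M (F ` ((\<Union>i. B i) \<inter> d)) \<partial>count_space \<delta>)"
      proof (rule nn_integral_cong)
        fix d assume "d \<in> space (count_space \<delta>)" then have d: "d \<in> \<delta>" by simp
        have "(\<Sum>i. emeasure M (F ` (B i \<inter> d))) = emeasure M (\<Union>i. F ` (B i \<inter> d))"
        proof (rule suminf_emeasure)
          show "range (\<lambda>i. F ` (B i \<inter> d)) \<subseteq> sets M" using img[OF _ d] B(1) by auto
          show "disjoint_family (\<lambda>i. F ` (B i \<inter> d))" unfolding disjoint_family_on_def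
          proof (intro ballI impI)
            fix m n :: nat assume "m \<noteq> n"
            then have "B m \<inter> B n = {}" using B(2) by (auto simp: disjoint_family_on_def)
            then show "F ` (B m \<inter> d) \<inter> F ` (B n \<inter> d) = {}"
              using F_inj_\<delta>[OF d] by (auto dest: inj_onD)
          qed
        qed
        also have "(\<Union>i. F ` (B i \<inter> d)) = F ` ((\<Union>i. B i) \<inter> d)" by auto
        finally show "(\<Sum>i. emeasure M (F ` (B i \<inter> d))) = emeasure M (F ` ((\<Union>i. B i) \<inter> d))" .
      qed
      finally show "(\<Sum>i. ?\<mu> (B i)) = ?\<mu> (\<Union>i. B i)" unfolding mu .
    qed
  qed
  then show ?thesis unfolding mu .
qed

lemma \<delta>_sub_Y: "d \<in> \<delta> \<Longrightarrow> d \<subseteq> Y"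
  using \<delta>_cell by blast

lemma emeasure_IM_cell:
  assumes d: "d \<in> \<delta>" and A: "A \<in> sets M" "A \<subseteq> d"
  shows "emeasure IM A = emeasure M (F ` A)"
proof -
  have "emeasure IM A = (\<integral>\<^sup>+d'. emeasure M (F ` (A \<inter> d')) \<partial>count_space \<delta>)"
    using A \<delta>_sub_Y[OF d] sets_MY by (intro emeasure_IM) auto
  also have "\<dots> = (\<Sum>d'\<in>{d}. emeasure M (F ` (A \<inter> d')))"
  proof (rule nn_integral_count_space')
    fix d' assume d': "d' \<in> \<delta>" "d' \<notin> {d}"
    then have "A \<inter> d' = {}" using A(2) \<delta>_disjoint[OF d d'(1)] by blast
    then show "emeasure M (F ` (A \<inter> d')) = 0" by simp
  qed (use d in auto)
  also have "\<dots> = emeasure M (F ` A)" using A(2) by (simp add: Int_absorb2)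
  finally show ?thesis .
qed

lemma not_returning_null: "Y - \<Union>\<delta> \<in> null_sets M"
proof -
  have "Y - \<Union>\<delta> \<in> sets M"
    by (rule sets.Diff[OF Y_sets sets.countable_Union[OF \<delta>_countable]]) (use \<delta>_sets in blast)
  moreover have "AE x in M. x \<notin> Y - \<Union>\<delta>"
    using AE_return[OF AE_hits] by eventually_elim (use cell_in_\<delta> in blast)
  ultimately show ?thesis using AE_iff_null_sets by blast
qed

text \<open>A set with null images in all cells is null, as the branches are nonsingular and the cells cover almost all of \<open>Y\<close>.\<close>

lemma IM_ac: "absolutely_continuous IM MY"
  unfolding absolutely_continuous_def
proof
  fix A assume A: "A \<in> null_sets IM"
  then have AMY: "A \<in> sets MY" using sets_IM by auto
  then have AM: "A \<in> sets M" "A \<subseteq> Y" using sets_MY by blast+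
  have "(\<integral>\<^sup>+d. emeasure M (F ` (A \<inter> d)) \<partial>count_space \<delta>) = 0"
    using A emeasure_IM[OF AMY] by auto
  then have z: "emeasure M (F ` (A \<inter> d)) = 0" if "d \<in> \<delta>" for d
    using that by (subst (asm) nn_integral_0_iff_AE) (auto simp: AE_count_space)
  have "A \<inter> d \<in> null_sets M" if d: "d \<in> \<delta>" for d
  proof -
    have "A \<inter> d \<in> sets M" using AM \<delta>_sets[OF d] by auto
    then show ?thesis using F_image_\<delta>(2)[OF d, of "A \<inter> d"] z[OF d] by auto
  qed
  then have "(\<Union>d\<in>\<delta>. A \<inter> d) \<in> null_sets M" by (intro null_sets_UN' \<delta>_countable)
  then have "(\<Union>d\<in>\<delta>. A \<inter> d) \<union> (Y - \<Union>\<delta>) \<in> null_sets M" using not_returning_null by auto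
  then have "A \<in> null_sets M" by (rule null_sets_subset) (use AM in auto)
  then show "A \<in> null_sets MY" using AM Y_sets by (subst null_sets_restrict_space) auto
qed

lemma IM_sigma_finite: "sigma_finite_measure IM"
proof
  show "\<exists>A. countable A \<and> A \<subseteq> sets IM \<and> \<Union>A = space IM \<and> (\<forall>a\<in>A. emeasure IM a \<noteq> \<infinity>)"
  proof (intro exI conjI)
    show "countable (insert (Y - \<Union>\<delta>) \<delta>)" using \<delta>_countable by simp
    show "insert (Y - \<Union>\<delta>) \<delta> \<subseteq> sets IM" using \<delta>_sets \<delta>_sub_Y not_returning_null sets_IM sets_MY by auto
    show "\<Union>(insert (Y - \<Union>\<delta>) \<delta>) = space IM" using \<delta>_sub_Y space_IM by auto
    show "\<forall>a\<in>insert (Y - \<Union>\<delta>) \<delta>. emeasure IM a \<noteq> \<infinity>"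
    proof
      fix a assume a: "a \<in> insert (Y - \<Union>\<delta>) \<delta>"
      show "emeasure IM a \<noteq> \<infinity>"
      proof (cases "a \<in> \<delta>")
        case True
        then show ?thesis using emeasure_IM_cell[OF True \<delta>_sets[OF True] order_refl] emeasure_finite by simp
      next
        case False
        then have "a = Y - \<Union>\<delta>" using a by simp
        moreover have "emeasure IM (Y - \<Union>\<delta>) = (\<integral>\<^sup>+d. emeasure M (F ` ((Y - \<Union>\<delta>) \<inter> d)) \<partial>count_space \<delta>)"
          using not_returning_null sets_MY by (intro emeasure_IM) auto
        moreover have "\<dots> = (\<integral>\<^sup>+d. 0 \<partial>count_space \<delta>)"
        proof (rule nn_integral_cong)
          fix d assume "d \<in> space (count_space \<delta>)"
          then have "(Y - \<Union>\<delta>) \<inter> d = {}" by auto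
          then show "emeasure M (F ` ((Y - \<Union>\<delta>) \<inter> d)) = 0" by (simp only: image_empty emeasure_empty)
        qed
        ultimately show ?thesis by simp
      qed
    qed
  qed
qed

lemma density_RN: "density IM RN = MY"
  using sets_IM by (intro sigma_finite_measure.density_RN_deriv IM_sigma_finite IM_ac) simp

lemma RN_measurable: "RN \<in> borel_measurable MY"
  using borel_measurable_RN_deriv[of IM MY] measurable_cong_sets[OF sets_IM refl] by blast

lemma AE_RN: "AE x in MY. 0 < RN x \<and> RN x \<noteq> \<infinity>"
proof -
  interpret MYf: finite_measure MY by (rule finite_measure_restrict_space) (use Y_sets in auto)
  interpret I: sigma_finite_measure IM by (rule IM_sigma_finite)
  have "AE x in IM. RN x \<noteq> \<infinity>"
    by (rule I.RN_deriv_finite[OF MYf.sigma_finite_measure_axioms IM_ac]) (simp add: sets_IM)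
  then have 1: "AE x in MY. RN x \<noteq> \<infinity>"
    using absolutely_continuous_AE[OF _ IM_ac] sets_IM by blast
  have "AE x in density IM RN. 0 < RN x" by (subst AE_density) auto
  then have "AE x in MY. 0 < RN x" unfolding density_RN .
  with 1 show ?thesis by eventually_elim simp
qed

lemma F_measurable [measurable]: "F \<in> measurable M M"
  by (rule induced_map_measurable[OF Y_sets])

text \<open>On a cell \<open>d\<close> the image measure is the pullback of \<open>M\<close> under \<open>F\<close>, i.e. the image of \<open>M\<close> on \<open>F d\<close> under the inverse branch.
Integrating its density \<open>RN\<close> with respect to this image gives the change of variables formula.\<close>

lemma jacobian_RN:
  assumes d: "d \<in> \<delta>" and A: "A \<in> sets M" "A \<subseteq> d"
  shows "emeasure M A = (\<integral>\<^sup>+x. RN (inv_into d F x) * indicator (F ` A) x \<partial>M)"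
proof -
  let ?b = "inv_into d F"
  note dM = \<delta>_sets[OF d] and dY = \<delta>_sub_Y[OF d] and inj = F_inj_\<delta>[OF d]
  have Fd: "F ` d \<in> sets M" by (rule F_image_\<delta>(1)[OF d dM order_refl])
  let ?X = "restrict_space M (F ` d)"
  have spX: "space ?X = F ` d" using sets.sets_into_space[OF Fd] by (auto simp: space_restrict_space)
  have mem: "x \<in> F ` (B \<inter> d) \<longleftrightarrow> x \<in> F ` d \<and> ?b x \<in> B" for x B
  proof
    assume "x \<in> F ` (B \<inter> d)"
    then obtain z where z: "z \<in> B" "z \<in> d" "x = F z" by auto
    then show "x \<in> F ` d \<and> ?b x \<in> B" using inv_into_f_f[OF inj z(2)] by simp
  next
    assume x: "x \<in> F ` d \<and> ?b x \<in> B"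
    then have "?b x \<in> B \<inter> d" using inv_into_into[of x F d] by simp
    moreover have "x = F (?b x)" using x f_inv_into_f[of x F d] by simp
    ultimately show "x \<in> F ` (B \<inter> d)" by (rule rev_image_eqI)
  qed
  have pre: "?b -` B \<inter> F ` d = F ` (B \<inter> d)" if "B \<in> sets MY" for B
    using mem by blast
  have preM: "F ` (B \<inter> d) \<in> sets M" if "B \<in> sets MY" for B
    using that dM sets_MY by (intro F_image_\<delta>(1)[OF d]) auto
  have b: "?b \<in> measurable ?X IM"
  proof (rule measurableI)
    show "?b x \<in> space IM" if "x \<in> space ?X" for x
      using that spX dY space_IM inv_into_into[of x F d] by auto
    show "?b -` B \<inter> space ?X \<in> sets ?X" if "B \<in> sets IM" for B
    proof -
      have B: "B \<in> sets MY" using that sets_IM by simp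
      show ?thesis unfolding spX pre[OF B] using preM[OF B] Fd by (subst sets_restrict_space_iff) auto
    qed
  qed
  have dIM: "d \<in> sets IM" using dM dY sets_IM sets_MY by auto
  have AIM: "A \<in> sets IM" using A dY sets_IM sets_MY by auto
  have K: "distr ?X IM ?b = density IM (indicator d)"
  proof (rule measure_eqI)
    fix B assume "B \<in> sets (distr ?X IM ?b)"
    then have BI: "B \<in> sets IM" by simp
    then have B: "B \<in> sets MY" using sets_IM by simp
    have "emeasure (distr ?X IM ?b) B = emeasure ?X (F ` (B \<inter> d))"
      using b BI spX pre[OF B] by (simp add: emeasure_distr)
    also have "\<dots> = emeasure M (F ` (B \<inter> d))"
      using Fd by (intro emeasure_restrict_space) auto
    also have "\<dots> = emeasure IM (B \<inter> d)"
      using B dM sets_MY by (intro emeasure_IM_cell[OF d, symmetric]) auto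
    also have "\<dots> = (\<integral>\<^sup>+x. indicator (B \<inter> d) x \<partial>IM)" using BI dIM by simp
    also have "\<dots> = (\<integral>\<^sup>+x. indicator d x * indicator B x \<partial>IM)"
      by (intro nn_integral_cong) (auto simp: indicator_def)
    also have "\<dots> = emeasure (density IM (indicator d)) B"
      using BI dIM by (intro emeasure_density[symmetric]) auto
    finally show "emeasure (distr ?X IM ?b) B = emeasure (density IM (indicator d)) B" .
  qed simp
  have RNm: "RN \<in> borel_measurable IM" by (rule borel_measurable_RN_deriv)
  have "emeasure M A = emeasure MY A"
    using A dY Y_sets by (intro emeasure_restrict_space[symmetric]) auto
  also have "\<dots> = (\<integral>\<^sup>+x. RN x * indicator A x \<partial>IM)"
    using emeasure_density[OF RNm AIM] by (simp only: density_RN)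
  also have "\<dots> = (\<integral>\<^sup>+x. indicator d x * (RN x * indicator A x) \<partial>IM)"
    using A(2) by (intro nn_integral_cong) (auto simp: indicator_def)
  also have "\<dots> = (\<integral>\<^sup>+x. RN x * indicator A x \<partial>density IM (indicator d))"
    using dIM RNm AIM by (intro nn_integral_density[symmetric]) auto
  also have "\<dots> = (\<integral>\<^sup>+x. RN (?b x) * indicator A (?b x) \<partial>?X)"
    unfolding K[symmetric] using b RNm AIM by (intro nn_integral_distr) auto
  also have "\<dots> = (\<integral>\<^sup>+x. RN (?b x) * indicator A (?b x) * indicator (F ` d) x \<partial>M)"
    using Fd by (intro nn_integral_restrict_space) auto
  also have "\<dots> = (\<integral>\<^sup>+x. RN (?b x) * indicator (F ` A) x \<partial>M)"
  proof (rule nn_integral_cong)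
    fix x
    have "x \<in> F ` A \<longleftrightarrow> x \<in> F ` d \<and> ?b x \<in> A"
      using mem[of x A] A(2) by (simp add: Int_absorb2)
    then show "RN (?b x) * indicator A (?b x) * indicator (F ` d) x = RN (?b x) * indicator (F ` A) x"
      by (auto simp: indicator_def)
  qed
  finally show ?thesis .
qed

section \<open>Approximation by cylinders\<close>

lemma separation_time_ge:
  assumes n: "1 \<le> n" and s: "same_itinerary F \<delta> n x y"
  shows "x \<in> Y" "y \<in> Y" "enat n \<le> separation_time T \<alpha> \<gamma> x y"
proof -
  have "\<exists>d\<in>\<delta>. (F ^^ 0) x \<in> d \<and> (F ^^ 0) y \<in> d"
    using s n unfolding same_itinerary_def by (metis less_eq_Suc_le One_nat_def)
  then show xy: "x \<in> Y" "y \<in> Y" using \<delta>_sub_Y by auto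
  have "enat n \<le> separation_time_base T \<alpha> \<gamma> x y"
    unfolding separation_time_base_def
  proof (rule Inf_greatest)
    fix z assume "z \<in> enat ` {n. \<not> (\<exists>d\<in>\<delta>. (F ^^ n) x \<in> d \<and> (F ^^ n) y \<in> d)}"
    then obtain m where m: "z = enat m" "\<not> (\<exists>d\<in>\<delta>. (F ^^ m) x \<in> d \<and> (F ^^ m) y \<in> d)" by auto
    then have "\<not> m < n" using s unfolding same_itinerary_def by blast
    then show "enat n \<le> z" using m by simp
  qed
  then show "enat n \<le> separation_time T \<alpha> \<gamma> x y" using xy by (simp add: separation_time_def Let_def)
qed

lemma epower_le:
  assumes "0 < t" "t \<le> r" "r < 1" "enat n \<le> s" shows "epower t s \<le> r ^ n" "0 \<le> epower t s"
proof -
  show "epower t s \<le> r ^ n"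
  proof (cases s)
    case (enat m)
    then have "t ^ m \<le> t ^ n" using assms by (intro power_decreasing) auto
    also have "\<dots> \<le> r ^ n" using assms by (intro power_mono) auto
    finally show ?thesis using enat by (simp add: epower_def)
  qed (use assms in \<open>simp add: epower_def\<close>)
  show "0 \<le> epower t s" using assms by (cases s) (auto simp: epower_def)
qed

text \<open>Each step of \<open>F\<close> takes at least one step of \<open>T\<close>, so the first \<open>i + 1\<close> cells of the induced itinerary determine at
least the first \<open>i + 1\<close> elements of the \<open>\<alpha>\<close>-itinerary.\<close>

lemma same_itinerary_same_element:
  "same_itinerary F \<delta> (Suc i) x y \<Longrightarrow> \<exists>a\<in>\<alpha>. (T ^^ i) x \<in> a \<and> (T ^^ i) y \<in> a"
proof (induction i arbitrary: x y rule: less_induct)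
  case (less i)
  have "\<exists>d\<in>\<delta>. (F ^^ 0) x \<in> d \<and> (F ^^ 0) y \<in> d" and sF: "same_itinerary F \<delta> i (F x) (F y)"
    using less.prems unfolding same_itinerary_def All_less_Suc2 by (auto simp: funpow_swap1)
  then obtain d where d: "d \<in> \<delta>" "x \<in> d" "y \<in> d" by auto
  have r: "1 \<le> R x" "R y = R x" using \<delta>_cell[OF d(1,2)] \<delta>_itinerary[OF d] by auto
  show ?case
  proof (cases "i < R x")
    case True then show ?thesis using \<delta>_itinerary[OF d] by auto
  next
    case False
    have shift: "(T ^^ i) z = (T ^^ (i - R x)) (F z)" if "R z = R x" for z
      using False that by (simp add: induced_map_def funpow_add[symmetric, THEN fun_cong, unfolded comp_def])
    have "same_itinerary F \<delta> (Suc (i - R x)) (F x) (F y)"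
      using sF r False unfolding same_itinerary_def by auto
    then show ?thesis using less.IH[of "i - R x" "F x" "F y"] r False shift[of x] shift[of y] by auto
  qed
qed

text \<open>Unions of cylinders of the induced map. The length \<open>n + 1 \<ge> 1\<close> makes sure that points with the same itinerary are in \<open>Y\<close>.\<close>

definition saturated :: "nat \<Rightarrow> 'a set \<Rightarrow> bool" where
  "saturated n B \<longleftrightarrow> (\<forall>x y. same_itinerary F \<delta> (Suc n) x y \<longrightarrow> (x \<in> B \<longleftrightarrow> y \<in> B))"

lemma saturated_mono: "saturated n B \<Longrightarrow> n \<le> m \<Longrightarrow> saturated m B"
  unfolding saturated_def same_itinerary_def by (meson Suc_le_mono less_le_trans)

definition approximable :: "'a set \<Rightarrow> bool" where
  "approximable A \<longleftrightarrow> A \<in> sets M \<and> (\<forall>e>0. \<exists>n B. B \<in> sets M \<and> saturated n B \<and> prob (sym_diff A B) < e)"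

lemma approximable_compl: "approximable A \<Longrightarrow> approximable (space M - A)"
  unfolding approximable_def
proof (elim conjE, intro conjI allI impI)
  fix e :: real assume A: "A \<in> sets M" and H: "\<forall>e>0. \<exists>n B. B \<in> sets M \<and> saturated n B \<and> prob (sym_diff A B) < e" and e: "e > 0"
  then obtain n B where B: "B \<in> sets M" "saturated n B" "prob (sym_diff A B) < e" by blast
  have "saturated n (space M - B)" unfolding saturated_def
  proof (intro allI impI)
    fix x y assume s: "same_itinerary F \<delta> (Suc n) x y"
    then have "x \<in> space M" "y \<in> space M" using separation_time_ge[of "Suc n" x y] Y_space by auto
    then show "x \<in> space M - B \<longleftrightarrow> y \<in> space M - B" using B(2) s unfolding saturated_def by blast
  qed
  moreover have "sym_diff (space M - A) (space M - B) = sym_diff A B"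
    using A B(1) sets.sets_into_space by blast
  ultimately show "\<exists>n B. B \<in> sets M \<and> saturated n B \<and> prob (sym_diff (space M - A) B) < e"
    using B by (intro exI[of _ n] exI[of _ "space M - B"]) auto
qed auto

lemma approximable_Union:
  assumes A: "\<And>i::nat. approximable (A i)" shows "approximable (\<Union>i. A i)"
  unfolding approximable_def
proof (intro conjI allI impI)
  have As: "A i \<in> sets M" for i using A by (simp add: approximable_def)
  show U: "(\<Union>i. A i) \<in> sets M" using As by auto
  fix e :: real assume e: "e > 0"
  have "(\<lambda>k. prob (\<Union>i<k. A i)) \<longlonglongrightarrow> prob (\<Union>k. \<Union>i<k. A i)"
    using As by (intro finite_Lim_measure_incseq) (auto simp: incseq_def intro: order.strict_trans2)
  also have "(\<Union>k. \<Union>i<k. A i) = (\<Union>i. A i)" by auto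
  finally have "\<forall>\<^sub>F k in sequentially. prob (\<Union>i. A i) - e / 2 < prob (\<Union>i<k. A i)"
    by (rule order_tendstoD) (use e in simp)
  from eventually_happens[OF this] obtain k where k: "prob (\<Union>i. A i) - e / 2 < prob (\<Union>i<k. A i)" by auto
  have "\<forall>i. \<exists>n B. B \<in> sets M \<and> saturated n B \<and> prob (sym_diff (A i) B) < e / (2 * Suc k)"
    using A e unfolding approximable_def by simp
  then obtain n B where B: "\<And>i. B i \<in> sets M" "\<And>i. saturated (n i) (B i)" "\<And>i. prob (sym_diff (A i) (B i)) < e / (2 * Suc k)"
    by metis
  define m where "m = (\<Sum>i<k. n i)"
  define B' where "B' = (\<Union>i<k. B i)"
  have "saturated m (B i)" if "i < k" for i
    using that by (intro saturated_mono[OF B(2)]) (auto simp: m_def intro: member_le_sum)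
  then have sat: "saturated m B'" unfolding saturated_def B'_def by blast
  have B'M: "B' \<in> sets M" unfolding B'_def using B(1) by auto
  have tail: "prob ((\<Union>i. A i) - (\<Union>i<k. A i)) < e / 2"
    using k U As by (subst finite_measure_Diff) auto
  have "sym_diff (\<Union>i. A i) B' \<subseteq> ((\<Union>i. A i) - (\<Union>i<k. A i)) \<union> (\<Union>i<k. sym_diff (A i) (B i))"
    unfolding B'_def by auto
  then have "prob (sym_diff (\<Union>i. A i) B') \<le> prob (((\<Union>i. A i) - (\<Union>i<k. A i)) \<union> (\<Union>i<k. sym_diff (A i) (B i)))"
    using As B(1) by (intro finite_measure_mono) auto
  also have "\<dots> \<le> prob ((\<Union>i. A i) - (\<Union>i<k. A i)) + prob (\<Union>i<k. sym_diff (A i) (B i))"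
    using As B(1) by (intro measure_Un_le) auto
  also have "prob (\<Union>i<k. sym_diff (A i) (B i)) \<le> (\<Sum>i<k. prob (sym_diff (A i) (B i)))"
    using As B(1) by (intro finite_measure_subadditive_finite) auto
  also have "\<dots> \<le> (\<Sum>i<k. e / (2 * Suc k))" using B(3) by (intro sum_mono less_imp_le)
  also have "\<dots> \<le> e / 2" using e by (simp add: field_simps)
  finally have "prob (sym_diff (\<Union>i. A i) B') < e" using tail by simp
  then show "\<exists>n B. B \<in> sets M \<and> saturated n B \<and> prob (sym_diff (\<Union>i. A i) B) < e" using sat B'M by blast
qed

text \<open>Approximability passes to complements and countable unions, and the sets \<open>T\<^sup>-\<^sup>i a\<close> intersected with \<open>Y\<close> are
unions of induced cylinders. The \<open>\<sigma>\<close>-algebra they generate gives all measurable sets after completion.\<close>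

lemma all_approximable: assumes A: "A \<in> sets M" shows "approximable (A \<inter> Y)"
proof -
  let ?G = "{(T ^^ i) -` a \<inter> space M | i a. a \<in> \<alpha>}"
  have G: "?G \<subseteq> sets M" using \<alpha>_sets measurable_sets[OF iterate_measurable] by auto
  define \<Sigma> where "\<Sigma> = measure_of (space M) ?G (emeasure M)"
  have GP: "?G \<subseteq> Pow (space M)" by auto
  have sS: "sets \<Sigma> = sigma_sets (space M) ?G" unfolding \<Sigma>_def by (rule sets_measure_of[OF GP])
  have S_sub: "sets \<Sigma> \<subseteq> sets M" unfolding sS using sets.sigma_sets_subset[OF G] .
  have em: "emeasure \<Sigma> X = emeasure M X" if "X \<in> sets \<Sigma>" for X
  proof (rule emeasure_measure_of[OF \<Sigma>_def GP _ _ that])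
    show "positive (sets \<Sigma>) (emeasure M)" by (auto simp: positive_def)
    show "countably_additive (sets \<Sigma>) (emeasure M)" unfolding countably_additive_def
      using S_sub by (auto intro!: suminf_emeasure)
  qed
  have Yap: "approximable (S \<inter> Y)" if "S \<in> sets \<Sigma>" for S
    using that unfolding sS
  proof (induction rule: sigma_sets.induct)
    case (Basic a)
    then obtain i b where b: "b \<in> \<alpha>" "a = (T ^^ i) -` b \<inter> space M" by auto
    have "saturated i (a \<inter> Y)" unfolding saturated_def
    proof (intro allI impI)
      fix x y assume s: "same_itinerary F \<delta> (Suc i) x y"
      have xy: "x \<in> Y" "y \<in> Y" using separation_time_ge[OF _ s] by auto
      obtain c where "c \<in> \<alpha>" "(T ^^ i) x \<in> c" "(T ^^ i) y \<in> c" using same_itinerary_same_element[OF s] by auto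
      then have "(T ^^ i) x \<in> b \<longleftrightarrow> (T ^^ i) y \<in> b" using b(1) \<alpha>_disjoint by blast
      then show "x \<in> a \<inter> Y \<longleftrightarrow> y \<in> a \<inter> Y" using xy Y_space b(2) by auto
    qed
    moreover have "a \<inter> Y \<in> sets M" by (rule sets.Int[OF subsetD[OF G Basic] Y_sets])
    ultimately show ?case unfolding approximable_def
      by (intro conjI allI impI exI[of _ i] exI[of _ "a \<inter> Y"]) auto
  next
    case Empty
    show ?case unfolding approximable_def
      by (intro conjI allI impI exI[of _ 0] exI[of _ "{}"]) (auto simp: saturated_def)
  next
    case (Compl a)
    have "approximable Y" unfolding approximable_def
    proof (intro conjI allI impI exI[of _ 0] exI[of _ Y])
      show "saturated 0 Y" unfolding saturated_def using separation_time_ge[of "Suc 0"] by auto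
    qed (use Y_sets in auto)
    have U2: "approximable (X \<union> Z)" if "approximable X" "approximable Z" for X Z
    proof -
      have "approximable (\<Union>i::nat. if i = 0 then X else Z)" by (rule approximable_Union) (use that in auto)
      also have "(\<Union>i::nat. if i = 0 then X else Z) = X \<union> Z" by (auto split: if_splits)
      finally show ?thesis .
    qed
    have "approximable (space M - ((a \<inter> Y) \<union> (space M - Y)))"
      by (intro approximable_compl U2 Compl.IH \<open>approximable Y\<close>)
    also have "space M - ((a \<inter> Y) \<union> (space M - Y)) = (space M - a) \<inter> Y" using Y_space by auto
    finally show ?case .
  next
    case (Union a)
    have "approximable (\<Union>i. a i \<inter> Y)" by (rule approximable_Union) (rule Union.IH)
    also have "(\<Union>i. a i \<inter> Y) = (\<Union>i. a i) \<inter> Y" by auto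
    finally show ?case .
  qed
  have "A \<in> sets (completion \<Sigma>)"
    using A markov_map unfolding markov_map_def \<Sigma>_def by auto
  then obtain S Z Z' where SZ: "A = S \<union> Z" "Z \<subseteq> Z'" "Z' \<in> null_sets \<Sigma>" "S \<in> sets \<Sigma>"
    by (elim sets_completionE) auto
  have Z'M: "Z' \<in> null_sets M" using SZ(3) em S_sub by (auto simp: null_sets_def)
  have AM: "A \<inter> Y \<in> sets M" using A Y_sets by auto
  have apS: "approximable (S \<inter> Y)" by (rule Yap[OF SZ(4)])
  show ?thesis unfolding approximable_def
  proof (intro conjI allI impI AM)
    fix e :: real assume "e > 0"
    then obtain n B where B: "B \<in> sets M" "saturated n B" "prob (sym_diff (S \<inter> Y) B) < e"
      using apS unfolding approximable_def by blast
    have SYM: "S \<inter> Y \<in> sets M" using apS by (simp add: approximable_def)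
    have "prob (sym_diff (A \<inter> Y) B) \<le> prob (sym_diff (S \<inter> Y) B \<union> Z')"
      using SZ B(1) SYM Z'M by (intro finite_measure_mono) auto
    also have "\<dots> = prob (sym_diff (S \<inter> Y) B)"
      using B(1) SYM Z'M by (intro measure_Un_null_set) auto
    finally have "prob (sym_diff (A \<inter> Y) B) < e" using B(3) by linarith
    then show "\<exists>n B. B \<in> sets M \<and> saturated n B \<and> prob (sym_diff (A \<inter> Y) B) < e" using B(1,2) by blast
  qed
qed

end

section \<open>The induced map as a Gibbs-Markov map\<close>

text \<open>The hypotheses of the theorem on the induced map, with the Hoelder version \<open>u\<close> of the logarithm of the inverse
jacobian and the constants made explicit.\<close>

locale distorted_inducing = markov_inducing +
  fixes \<theta> C \<eta> :: real and u :: "'a \<Rightarrow> real"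
  assumes theta_pos: "0 < \<theta>" and theta_less: "\<theta> < 1"
    and u_log: "AE x in restrict_space M (\<Union>\<gamma>). u x = ln (inverse_jacobian M T \<alpha> \<gamma> x)"
    and u_holder: "\<And>x y. x \<in> \<Union>\<gamma> \<Longrightarrow> y \<in> \<Union>\<gamma> \<Longrightarrow> 1 \<le> separation_time T \<alpha> \<gamma> x y \<Longrightarrow>
      \<bar>u x - u y\<bar> \<le> C * epower \<theta> (separation_time T \<alpha> \<gamma> x y)"
    and eta_pos: "0 < \<eta>"
    and big_images: "\<And>d. d \<in> induced_partition T \<alpha> \<gamma> \<Longrightarrow> \<eta> \<le> measure M (induced_map T (\<Union>\<gamma>) ` d)"
begin

abbreviation G :: "'a \<Rightarrow> real" where "G \<equiv> inverse_jacobian M T \<alpha> \<gamma>"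

text \<open>A null set containing everything that goes wrong at single points: points of \<open>Y\<close> without return, the parts of images that
contradict the Markov property, and points where the jacobian is degenerate or differs from the exponential of its
Hoelder version.\<close>

definition exceptional :: "'a set \<Rightarrow> bool" where
  "exceptional Z \<longleftrightarrow> Z \<in> null_sets M \<and> Y - \<Union>\<delta> \<subseteq> Z \<and>
    (\<forall>d\<in>\<delta>. \<forall>a\<in>\<gamma>. (F ` d \<inter> a \<in> null_sets M \<longrightarrow> F ` d \<inter> a \<subseteq> Z) \<and> (a - F ` d \<in> null_sets M \<longrightarrow> a - F ` d \<subseteq> Z)) \<and>
    (\<forall>x\<in>Y - Z. 0 < RN x \<and> RN x \<noteq> \<infinity> \<and> u x = ln (G x))"

lemma exceptional_exists: "\<exists>Z. exceptional Z"
proof -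
  have "AE x in MY. 0 < RN x \<and> RN x \<noteq> \<infinity> \<and> u x = ln (G x)"
    using AE_RN u_log by eventually_elim auto
  then have "AE x in M. x \<in> Y \<longrightarrow> 0 < RN x \<and> RN x \<noteq> \<infinity> \<and> u x = ln (G x)"
    using Y_sets by (subst (asm) AE_restrict_space_iff) auto
  then obtain Z1 where Z1: "{x \<in> space M. \<not> (x \<in> Y \<longrightarrow> 0 < RN x \<and> RN x \<noteq> \<infinity> \<and> u x = ln (G x))} \<subseteq> Z1"
    "emeasure M Z1 = 0" "Z1 \<in> sets M"
    by (elim AE_E)
  define X where "X = (\<lambda>d a. (if F ` d \<inter> a \<in> null_sets M then F ` d \<inter> a else {}) \<union> (if a - F ` d \<in> null_sets M then a - F ` d else {}))"
  have Xn: "X d a \<in> null_sets M" for d a unfolding X_def by (intro null_sets.Un) auto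
  have X1: "F ` d \<inter> a \<subseteq> X d a" if "F ` d \<inter> a \<in> null_sets M" for d a
    unfolding X_def if_P[OF that] by (rule Un_upper1)
  have X2: "a - F ` d \<subseteq> X d a" if "a - F ` d \<in> null_sets M" for d a
    unfolding X_def if_P[OF that] by (rule Un_upper2)
  define Z where "Z = (Y - \<Union>\<delta>) \<union> Z1 \<union> (\<Union>d\<in>\<delta>. \<Union>a\<in>\<gamma>. X d a)"
  have c: "countable \<gamma>" using countable_subset[OF sub \<alpha>_countable] .
  have "(\<Union>d\<in>\<delta>. \<Union>a\<in>\<gamma>. X d a) \<in> null_sets M"
    by (intro null_sets_UN' \<delta>_countable c Xn)
  moreover have "Z1 \<in> null_sets M" using Z1 by auto
  ultimately have "Z \<in> null_sets M" unfolding Z_def using not_returning_null by auto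
  moreover have "0 < RN x \<and> RN x \<noteq> \<infinity> \<and> u x = ln (G x)" if "x \<in> Y - Z" for x
    using that Z1(1) Y_space unfolding Z_def by blast
  moreover have "(F ` d \<inter> a \<in> null_sets M \<longrightarrow> F ` d \<inter> a \<subseteq> Z) \<and> (a - F ` d \<in> null_sets M \<longrightarrow> a - F ` d \<subseteq> Z)"
    if da: "d \<in> \<delta>" "a \<in> \<gamma>" for d a
  proof -
    have "X d a \<subseteq> (\<Union>d\<in>\<delta>. \<Union>a\<in>\<gamma>. X d a)" by (rule order_trans[OF UN_upper[OF da(2)] UN_upper[OF da(1)]])
    then have XZ: "X d a \<subseteq> Z" unfolding Z_def by (rule le_supI2)
    show ?thesis
    proof (intro conjI impI)
      show "F ` d \<inter> a \<subseteq> Z" if "F ` d \<inter> a \<in> null_sets M" by (rule order_trans[OF X1[OF that] XZ])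
      show "a - F ` d \<subseteq> Z" if "a - F ` d \<in> null_sets M" by (rule order_trans[OF X2[OF that] XZ])
    qed
  qed
  moreover have "Y - \<Union>\<delta> \<subseteq> Z" unfolding Z_def by (simp add: le_supI1)
  ultimately have "exceptional Z" unfolding exceptional_def by simp
  then show ?thesis ..
qed

definition Z0 :: "'a set" where "Z0 = (SOME Z. exceptional Z)"

lemma Z0: "exceptional Z0"
  unfolding Z0_def using exceptional_exists by (rule someI_ex)

lemma Z0_null: "Z0 \<in> null_sets M"
  and Z0_cells: "Y - \<Union>\<delta> \<subseteq> Z0"
  and Z0_images: "d \<in> \<delta> \<Longrightarrow> a \<in> \<gamma> \<Longrightarrow> F ` d \<inter> a \<in> null_sets M \<Longrightarrow> F ` d \<inter> a \<subseteq> Z0"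
    "d \<in> \<delta> \<Longrightarrow> a \<in> \<gamma> \<Longrightarrow> a - F ` d \<in> null_sets M \<Longrightarrow> a - F ` d \<subseteq> Z0"
  and Z0_good: "x \<in> Y - Z0 \<Longrightarrow> 0 < RN x \<and> RN x \<noteq> \<infinity> \<and> u x = ln (G x)"
proof -
  note e = Z0[unfolded exceptional_def]
  show "Z0 \<in> null_sets M" by (rule conjunct1[OF e])
  show "Y - \<Union>\<delta> \<subseteq> Z0" by (rule conjunct1[OF conjunct2[OF e]])
  note i = conjunct1[OF conjunct2[OF conjunct2[OF e]]]
  show "d \<in> \<delta> \<Longrightarrow> a \<in> \<gamma> \<Longrightarrow> F ` d \<inter> a \<in> null_sets M \<Longrightarrow> F ` d \<inter> a \<subseteq> Z0"
    by (rule mp[OF conjunct1[OF bspec[OF bspec[OF i]]]])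
  show "d \<in> \<delta> \<Longrightarrow> a \<in> \<gamma> \<Longrightarrow> a - F ` d \<in> null_sets M \<Longrightarrow> a - F ` d \<subseteq> Z0"
    by (rule mp[OF conjunct2[OF bspec[OF bspec[OF i]]]])
  show "x \<in> Y - Z0 \<Longrightarrow> 0 < RN x \<and> RN x \<noteq> \<infinity> \<and> u x = ln (G x)"
    by (rule bspec[OF conjunct2[OF conjunct2[OF conjunct2[OF e]]]])
qed

text \<open>The saturation of the exceptional set under images and preimages of \<open>T\<close>, null because \<open>T\<close> is nonsingular in both
directions. Its complement is invariant in both directions, so that the induced map restricts to it without
changing which points are covered by images.\<close>

definition Bad :: "'a set" where
  "Bad = (\<Union>i. \<Union>j. (T ^^ i) -` ((T ^^ j) ` Z0) \<inter> space M)"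

lemma Bad_null: "Bad \<in> null_sets M"
  unfolding Bad_def by (intro null_sets_UN Tn_preimage_null Tn_image_null Z0_null)

lemma Z0_sub_Bad: "Z0 \<subseteq> Bad"
proof
  fix x assume x: "x \<in> Z0"
  have "Z0 \<in> sets M" using Z0_null by auto
  then have "x \<in> (T ^^ 0) -` ((T ^^ 0) ` Z0) \<inter> space M" using x sets.sets_into_space by auto
  then show "x \<in> Bad" unfolding Bad_def by blast
qed

lemma Bad_T: assumes x: "x \<in> space M" shows "T x \<in> Bad \<longleftrightarrow> x \<in> Bad"
proof
  assume "T x \<in> Bad"
  then obtain i j where "(T ^^ i) (T x) \<in> (T ^^ j) ` Z0" unfolding Bad_def by auto
  then have "(T ^^ Suc i) x \<in> (T ^^ j) ` Z0" by (simp add: funpow_swap1)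
  then show "x \<in> Bad" unfolding Bad_def using x by blast
next
  assume "x \<in> Bad"
  then obtain i j where ij: "(T ^^ i) x \<in> (T ^^ j) ` Z0" unfolding Bad_def by auto
  have "\<exists>i j. (T ^^ i) (T x) \<in> (T ^^ j) ` Z0"
  proof (cases i)
    case 0
    then have "T x \<in> (T ^^ Suc j) ` Z0" using ij unfolding image_funpow_Suc by auto
    then show ?thesis by (intro exI[of _ 0] exI[of _ "Suc j"]) (simp del: funpow.simps add: funpow_0)
  next
    case (Suc k)
    then show ?thesis using ij by (intro exI[of _ k] exI[of _ j]) (simp add: funpow_swap1)
  qed
  then show "T x \<in> Bad" unfolding Bad_def using measurable_space[OF T_meas x] by blast
qed

lemma Bad_Tn: "x \<in> space M \<Longrightarrow> (T ^^ n) x \<in> Bad \<longleftrightarrow> x \<in> Bad"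
proof (induction n)
  case (Suc n) then show ?case using Bad_T[OF iterate_space[of x n]] by simp
qed simp

lemma Bad_F: "x \<in> space M \<Longrightarrow> F x \<in> Bad \<longleftrightarrow> x \<in> Bad"
  unfolding induced_map_def by (rule Bad_Tn)

definition Y0 :: "'a set" where "Y0 = Y - Bad"

lemma Y0_sets [measurable]: "Y0 \<in> sets M"
  unfolding Y0_def using Bad_null Y_sets by auto

lemma Y0_space: "x \<in> Y0 \<Longrightarrow> x \<in> space M"
  using Y_space by (auto simp: Y0_def)

lemma Y0_cell: assumes "x \<in> Y0" shows "\<exists>d\<in>\<delta>. x \<in> d"
proof -
  have "x \<in> Y" "x \<notin> Z0" using assms Z0_sub_Bad by (auto simp: Y0_def)
  then have "x \<in> \<Union>\<delta>" using Z0_cells by blast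
  then show ?thesis by simp
qed

lemma Y0_return: "x \<in> Y0 \<Longrightarrow> 1 \<le> R x"
  using Y0_cell \<delta>_cell by blast

lemma Y0_F: "x \<in> Y0 \<Longrightarrow> F x \<in> Y0"
  using F_in_Y[OF Y0_return] Bad_F[OF Y0_space] by (auto simp: Y0_def)

lemma Y0_F_back: "x \<in> Y \<Longrightarrow> F x \<in> Y0 \<Longrightarrow> x \<in> Y0"
  using Bad_F[OF Y_space] by (auto simp: Y0_def)

abbreviation N :: "'a measure" where "N \<equiv> restrict_space M Y0"
abbreviation \<delta>0 :: "'a set set" where "\<delta>0 \<equiv> (\<lambda>d. d \<inter> Y0) ` \<delta>"

lemma \<delta>0_elim:
  assumes "d \<in> \<delta>0" obtains d1 where "d1 \<in> \<delta>" "d = d1 \<inter> Y0"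
  using assms by (rule imageE) (rule that)

lemma sets_N: "A \<in> sets N \<longleftrightarrow> A \<in> sets M \<and> A \<subseteq> Y0"
  using Y0_sets by (subst sets_restrict_space_iff) auto

lemma space_N: "space N = Y0"
  using sets.sets_into_space[OF Y0_sets] by (auto simp: space_restrict_space)

lemma emeasure_N: "A \<subseteq> Y0 \<Longrightarrow> emeasure N A = emeasure M A"
  using Y0_sets by (intro emeasure_restrict_space) auto

lemma measure_N: "A \<subseteq> Y0 \<Longrightarrow> measure N A = measure M A"
  unfolding measure_def using emeasure_N by simp

lemma emeasure_Int_Y0: "A \<in> sets M \<Longrightarrow> emeasure M (A \<inter> Y0) = emeasure M (A \<inter> Y)"
proof -
  assume A: "A \<in> sets M"
  have "A \<inter> Y0 = A \<inter> Y - Bad" by (auto simp: Y0_def)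
  then show ?thesis using emeasure_Diff_null_set[OF Bad_null, of "A \<inter> Y"] A Y_sets by auto
qed

lemma same_\<delta>0: "same_itinerary F \<delta>0 n x y \<Longrightarrow> same_itinerary F \<delta> n x y"
  unfolding same_itinerary_def by blast

lemma F_image_Y0: "d \<in> \<delta> \<Longrightarrow> F ` (d \<inter> Y0) = F ` d \<inter> Y0"
  using Y0_F Y0_F_back \<delta>_sub_Y by blast

lemma Y0_good: "x \<in> Y0 \<Longrightarrow> 0 < RN x \<and> RN x \<noteq> \<infinity> \<and> u x = ln (G x)"
  using Z0_good[of x] Z0_sub_Bad by (auto simp: Y0_def)

lemma G_def': "G x = enn2real (RN x)"
  by (simp add: inverse_jacobian_def)

lemma ennreal_G: "x \<in> Y0 \<Longrightarrow> ennreal (G x) = RN x"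
  using Y0_good[of x] by (simp add: G_def' less_top[symmetric])

lemma G_positive: "x \<in> Y0 \<Longrightarrow> 0 < G x"
  using Y0_good[of x] by (simp add: G_def' enn2real_positive_iff less_top[symmetric])

text \<open>Off \<open>Bad\<close> the Markov property is exact: a meeting in a null set is excluded, and so is a missing null part.\<close>

lemma image_covers_element:
  assumes d: "d \<in> \<delta>" and z: "z \<in> d" "z \<in> Y0" and a: "a \<in> \<gamma>" "F z \<in> a"
  shows "a \<inter> Y0 \<subseteq> F ` (d \<inter> Y0)"
proof -
  have Fz: "F z \<in> Y0" by (rule Y0_F[OF z(2)])
  have "F ` d \<inter> a \<notin> null_sets M"
  proof
    assume "F ` d \<inter> a \<in> null_sets M"
    then have "F ` d \<inter> a \<subseteq> Z0" by (rule Z0_images(1)[OF d a(1)])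
    then show False using z a Fz Z0_sub_Bad by (auto simp: Y0_def)
  qed
  then have "a - F ` d \<in> null_sets M" using induced_full_or_null[OF d a(1)] by blast
  then have "a - F ` d \<subseteq> Z0" by (rule Z0_images(2)[OF d a(1)])
  then have "a \<inter> Y0 \<subseteq> F ` d \<inter> Y0" using Z0_sub_Bad by (auto simp: Y0_def)
  then show ?thesis using F_image_Y0[OF d] by simp
qed

lemma F_measurable_N: "F \<in> measurable N N"
  using measurable_restrict_space1[OF F_measurable, of Y0] Y0_F space_N
  by (intro measurable_restrict_space2) auto

lemma F_invariant_N: "distr N N F = N"
proof (rule measure_eqI)
  fix A assume "A \<in> sets (distr N N F)"
  then have A: "A \<in> sets N" by simp
  then have AM: "A \<in> sets M" "A \<subseteq> Y0" using sets_N by auto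
  have "emeasure (distr N N F) A = emeasure N (F -` A \<inter> Y0)"
    using emeasure_distr[OF F_measurable_N A] space_N by simp
  also have "\<dots> = emeasure M (F -` A \<inter> Y0)" by (rule emeasure_N) auto
  also have "F -` A \<inter> Y0 = {x \<in> space M. x \<in> Y \<and> 1 \<le> R x \<and> F x \<in> A}"
  proof (intro set_eqI iffI)
    fix x assume "x \<in> F -` A \<inter> Y0"
    then have x: "F x \<in> A" "x \<in> Y0" by auto
    then show "x \<in> {x \<in> space M. x \<in> Y \<and> 1 \<le> R x \<and> F x \<in> A}"
      using Y0_return[OF x(2)] Y0_space[OF x(2)] by (simp add: Y0_def)
  next
    fix x assume "x \<in> {x \<in> space M. x \<in> Y \<and> 1 \<le> R x \<and> F x \<in> A}"
    then have x: "x \<in> Y" "F x \<in> A" by auto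
    then have "x \<in> Y0" using AM(2) by (intro Y0_F_back[OF x(1)]) auto
    then show "x \<in> F -` A \<inter> Y0" using x(2) by simp
  qed
  also have "emeasure M \<dots> = emeasure M A"
    by (rule induced_preserves[OF Y_sets AE_hits AM(1)]) (use AM in \<open>auto simp: Y0_def\<close>)
  also have "\<dots> = emeasure N A" by (rule emeasure_N[OF AM(2), symmetric])
  finally show "emeasure (distr N N F) A = emeasure N A" .
qed simp

text \<open>Topological mixing of \<open>T\<close> on elements of \<open>\<alpha>\<close>: the image of \<open>d\<close> covers some \<open>a \<subseteq> Y\<close>, an iterate of which covers the element
containing \<open>d'\<close>; the iterates of \<open>T\<close> that are in \<open>Y\<close> are iterates of \<open>F\<close>.\<close>

lemma irreducible_N:
  assumes d: "d \<in> \<delta>" and d': "d' \<in> \<delta>" "d' \<inter> Y0 \<noteq> {}" and ne: "d \<inter> Y0 \<noteq> {}"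
  shows "\<exists>x\<in>d \<inter> Y0. \<exists>n. (F ^^ n) x \<in> d' \<inter> Y0"
proof -
  obtain z where z: "z \<in> d" "z \<in> Y0" using ne by auto
  have Fz: "F z \<in> Y0" by (rule Y0_F[OF z(2)])
  then obtain a where a: "a \<in> \<gamma>" "F z \<in> a" by (auto simp: Y0_def)
  note cov = image_covers_element[OF d z a]
  obtain w where w: "w \<in> d'" "w \<in> Y0" using d'(2) by auto
  obtain c where c: "c \<in> \<gamma>" "w \<in> c" using w(2) by (auto simp: Y0_def)
  obtain n where n: "c \<subseteq> (T ^^ n) ` a" using mixing_image[of a c] a(1) c(1) sub by auto
  then obtain v where v: "v \<in> a" "w = (T ^^ n) v" using c(2) by auto
  have vY: "v \<in> Y" using v(1) a(1) by auto
  have "v \<in> Y0" using Bad_Tn[OF Y_space[OF vY], of n] w(2) v(2) vY by (auto simp: Y0_def)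
  then obtain x where x: "x \<in> d \<inter> Y0" "v = F x" using cov v(1) by blast
  have "(T ^^ n) v \<in> Y" using w(2) v(2) by (auto simp: Y0_def)
  from visits_are_induced_iterates[OF this vY] obtain k where k: "(F ^^ k) v = w" using v(2) by auto
  have "(F ^^ Suc k) x = w" using k x(2) by (simp add: funpow_swap1)
  then show ?thesis using x(1) w by blast
qed

text \<open>Any Hoelder parameter \<open>t \<ge> \<theta>\<close> is admissible; this is used to reach a common parameter for the distortion
and for the observable.\<close>

lemma gibbs_markov_N:
  assumes t: "\<theta> \<le> t" "t < 1"
  shows "gibbs_markov N F \<delta>0 G t \<bar>C\<bar> \<eta>"
proof (intro gibbs_markov.intro gibbs_markov_axioms.intro)
  show "finite_measure N" by (rule finite_measure_restrict_space) (use Y0_sets in auto)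
  show "countable \<delta>0" using \<delta>_countable by simp
  show "d \<in> sets N" if "d \<in> \<delta>0" for d using that \<delta>_sets sets_N Y0_sets by auto
  show "d = d'" if "d \<in> \<delta>0" "d' \<in> \<delta>0" "d \<inter> d' \<noteq> {}" for d d'
    using that \<delta>_disjoint by blast
  show "\<Union>\<delta>0 = space N" unfolding space_N using Y0_cell by blast
  have pos: "0 < measure N (d \<inter> Y0)" if "d \<in> \<delta>" for d
  proof -
    have "emeasure M (d \<inter> Y0) = emeasure M d"
      using emeasure_Int_Y0[OF \<delta>_sets[OF that]] \<delta>_sub_Y[OF that] by (simp add: Int_absorb2)
    then have "0 < measure M (d \<inter> Y0)" using \<delta>_pos[OF that] by (simp add: emeasure_eq_measure)
    then show ?thesis using measure_N[of "d \<inter> Y0"] by simp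
  qed
  show "0 < measure N d" if "d \<in> \<delta>0" for d using that pos by auto
  show "F \<in> measurable N N" by (rule F_measurable_N)
  show "distr N N F = N" by (rule F_invariant_N)
  show "inj_on F d" if "d \<in> \<delta>0" for d
  proof -
    note prem = that
    obtain d1 where "d1 \<in> \<delta>" "d = d1 \<inter> Y0" using prem by (rule \<delta>0_elim)
    then show ?thesis using inj_on_subset[OF F_inj_\<delta>[of d1], of d] by auto
  qed
  show "F ` A \<in> sets N" if "d \<in> \<delta>0" "A \<in> sets N" "A \<subseteq> d" for d A
  proof -
    note prem = that
    obtain d1 where d1: "d1 \<in> \<delta>" "d = d1 \<inter> Y0" using prem(1) by (rule \<delta>0_elim)
    have "F ` A \<in> sets M" using F_image_\<delta>(1)[OF d1(1)] prem d1 sets_N by auto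
    moreover have "F ` A \<subseteq> Y0" using prem d1 Y0_F by auto
    ultimately show ?thesis using sets_N by auto
  qed
  show "d' \<subseteq> F ` d" if "d \<in> \<delta>0" "d' \<in> \<delta>0" "F ` d \<inter> d' \<noteq> {}" for d d'
  proof -
    note prem = that
    obtain d1 where d1: "d1 \<in> \<delta>" "d = d1 \<inter> Y0" using prem(1) by (rule \<delta>0_elim)
    obtain d2 where d2: "d2 \<in> \<delta>" "d' = d2 \<inter> Y0" using prem(2) by (rule \<delta>0_elim)
    obtain z where z: "z \<in> d1" "z \<in> Y0" "F z \<in> d2" using prem(3) d1 d2 by auto
    obtain a where a: "a \<in> \<gamma>" "F z \<in> a" using Y0_F[OF z(2)] by (auto simp: Y0_def)
    have "d2 \<subseteq> a"
    proof
      fix w assume w: "w \<in> d2"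
      have "1 \<le> R (F z)" using \<delta>_cell[OF d2(1) z(3)] by simp
      then have "\<exists>b\<in>\<alpha>. (T ^^ 0) (F z) \<in> b \<and> (T ^^ 0) w \<in> b"
        using \<delta>_itinerary[OF d2(1) z(3) w] by (metis less_eq_Suc_le One_nat_def)
      then obtain b where b: "b \<in> \<alpha>" "F z \<in> b" "w \<in> b" by auto
      have "a = b" using a b sub by (intro \<alpha>_disjoint[of a b "F z"]) auto
      then show "w \<in> a" using b by simp
    qed
    then show ?thesis using image_covers_element[OF d1(1) z(1,2) a] d1(2) d2(2) by blast
  qed
  show "0 < \<eta>" by (rule eta_pos)
  show "\<eta> \<le> measure N (F ` d)" if "d \<in> \<delta>0" for d
  proof -
    note prem = that
    obtain d1 where d1: "d1 \<in> \<delta>" "d = d1 \<inter> Y0" using prem(1) by (rule \<delta>0_elim)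
    have Fd: "F ` d1 \<in> sets M" by (rule F_image_\<delta>(1)[OF d1(1) \<delta>_sets[OF d1(1)] order_refl])
    have FY: "F ` d1 \<subseteq> Y" using F_in_Y \<delta>_cell[OF d1(1)] by auto
    have "measure N (F ` d) = measure M (F ` d1 \<inter> Y0)"
      unfolding d1(2) F_image_Y0[OF d1(1)] by (rule measure_N) auto
    also have "\<dots> = measure M (F ` d1)"
      unfolding measure_def emeasure_Int_Y0[OF Fd] using FY by (simp add: Int_absorb2)
    finally show ?thesis using big_images[OF d1(1)] by simp
  qed
  show "G \<in> borel_measurable N"
  proof -
    have "G \<in> borel_measurable MY" unfolding G_def' using RN_measurable by measurable
    moreover have "N = restrict_space MY Y0"
    proof -
      have "Y0 \<inter> Y = Y0" by (auto simp: Y0_def)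
      then show ?thesis using restrict_restrict_space[of Y M Y0] Y_sets Y0_sets by (simp add: Int_commute)
    qed
    ultimately show ?thesis by (simp add: measurable_restrict_space1)
  qed
  show "0 < G x" if "x \<in> space N" for x using that space_N G_positive by simp
  show "emeasure N A = (\<integral>\<^sup>+x. ennreal (G (inv_into d F x)) * indicator (F ` A) x \<partial>N)"
    if d: "d \<in> \<delta>0" and A: "A \<in> sets N" "A \<subseteq> d" for d A
  proof -
    obtain d1 where d1: "d1 \<in> \<delta>" "d = d1 \<inter> Y0" using d by (rule \<delta>0_elim)
    have AM: "A \<in> sets M" "A \<subseteq> d1" "A \<subseteq> Y0" using A d1 sets_N by auto
    have "emeasure N A = emeasure M A" by (rule emeasure_N[OF AM(3)])
    also have "\<dots> = (\<integral>\<^sup>+x. RN (inv_into d1 F x) * indicator (F ` A) x \<partial>M)"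
      by (rule jacobian_RN[OF d1(1) AM(1,2)])
    also have "\<dots> = (\<integral>\<^sup>+x. ennreal (G (inv_into d F x)) * indicator (F ` A) x * indicator Y0 x \<partial>M)"
    proof (rule nn_integral_cong)
      fix x
      show "RN (inv_into d1 F x) * indicator (F ` A) x = ennreal (G (inv_into d F x)) * indicator (F ` A) x * indicator Y0 x"
      proof (cases "x \<in> F ` A")
        case True
        then obtain z where z: "z \<in> A" "x = F z" by auto
        have zd: "z \<in> d1" "z \<in> d" "z \<in> Y0" using z AM A by auto
        have "inv_into d1 F x = z" unfolding z(2) by (rule inv_into_f_f[OF F_inj_\<delta>[OF d1(1)] zd(1)])
        moreover have "inv_into d F x = z" unfolding z(2)
          by (rule inv_into_f_f[OF inj_on_subset[OF F_inj_\<delta>[OF d1(1)]] zd(2)]) (use d1 in auto)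
        ultimately show ?thesis using ennreal_G[OF zd(3)] Y0_F[OF zd(3)] z(2) by simp
      qed simp
    qed
    also have "\<dots> = (\<integral>\<^sup>+x. ennreal (G (inv_into d F x)) * indicator (F ` A) x \<partial>N)"
      using Y0_sets by (intro nn_integral_restrict_space[symmetric]) auto
    finally show ?thesis .
  qed
  show "0 < t" using t theta_pos by simp
  show "t < 1" by (rule t(2))
  show "0 \<le> \<bar>C\<bar>" by simp
  show "\<bar>ln (G x) - ln (G y)\<bar> \<le> \<bar>C\<bar> * t ^ n" if n: "1 \<le> n" and s: "same_itinerary F \<delta>0 n x y" for n x y
  proof -
    note sep = separation_time_ge[OF n same_\<delta>0[OF s]]
    have "\<exists>d\<in>\<delta>0. (F ^^ 0) x \<in> d \<and> (F ^^ 0) y \<in> d"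
      using s n unfolding same_itinerary_def by (metis less_eq_Suc_le One_nat_def)
    then have xy: "x \<in> Y0" "y \<in> Y0" by auto
    have "1 \<le> separation_time T \<alpha> \<gamma> x y"
      using sep(3) n by (metis enat_ord_simps(1) one_enat_def order_trans)
    from u_holder[OF sep(1,2) this] have "\<bar>ln (G x) - ln (G y)\<bar> \<le> C * epower \<theta> (separation_time T \<alpha> \<gamma> x y)"
      using Y0_good[OF xy(1)] Y0_good[OF xy(2)] by simp
    also have "\<dots> \<le> \<bar>C\<bar> * epower \<theta> (separation_time T \<alpha> \<gamma> x y)"
      using epower_le(2)[OF theta_pos t sep(3)] by (intro mult_right_mono) auto
    also have "\<dots> \<le> \<bar>C\<bar> * t ^ n"
      using epower_le(1)[OF theta_pos t sep(3)] by (intro mult_left_mono) auto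
    finally show ?thesis .
  qed
  show "\<exists>n B. B \<in> sets N \<and> (\<forall>x y. same_itinerary F \<delta>0 n x y \<longrightarrow> (x \<in> B \<longleftrightarrow> y \<in> B)) \<and> measure N (sym_diff A B) < e"
    if A: "A \<in> sets N" and e: "0 < e" for A e
  proof -
    have AM: "A \<in> sets M" "A \<subseteq> Y0" using A sets_N by auto
    then have "A \<inter> Y = A" by (auto simp: Y0_def)
    then have "approximable A" using all_approximable[OF AM(1)] by simp
    then obtain n B where B: "B \<in> sets M" "saturated n B" "prob (sym_diff A B) < e"
      using e unfolding approximable_def by blast
    have 1: "B \<inter> Y0 \<in> sets N" using B(1) Y0_sets sets_N by auto
    have 2: "x \<in> B \<inter> Y0 \<longleftrightarrow> y \<in> B \<inter> Y0" if s: "same_itinerary F \<delta>0 (Suc n) x y" for x y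
    proof -
      have "\<exists>d\<in>\<delta>0. (F ^^ 0) x \<in> d \<and> (F ^^ 0) y \<in> d"
        using s unfolding same_itinerary_def by blast
      then have "x \<in> Y0" "y \<in> Y0" by auto
      then show ?thesis using B(2) same_\<delta>0[OF s] unfolding saturated_def by blast
    qed
    have "measure N (sym_diff A (B \<inter> Y0)) = prob (sym_diff A (B \<inter> Y0))"
      using AM by (intro measure_N) auto
    also have "\<dots> \<le> prob (sym_diff A B)"
      using AM B(1) Y0_sets by (intro finite_measure_mono) auto
    finally have "measure N (sym_diff A (B \<inter> Y0)) < e" using B(3) by simp
    then show ?thesis using 1 2 by blast
  qed
  show "\<exists>x\<in>d. \<exists>n. (F ^^ n) x \<in> d'" if "d \<in> \<delta>0" "d' \<in> \<delta>0" for d d'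
  proof -
    note prem = that
    obtain d1 where d1: "d1 \<in> \<delta>" "d = d1 \<inter> Y0" using prem(1) by (rule \<delta>0_elim)
    obtain d2 where d2: "d2 \<in> \<delta>" "d' = d2 \<inter> Y0" using prem(2) by (rule \<delta>0_elim)
    have "d1 \<inter> Y0 \<noteq> {}" "d2 \<inter> Y0 \<noteq> {}" using pos[OF d1(1)] pos[OF d2(1)] by auto
    then show ?thesis using irreducible_N[OF d1(1) d2(1)] d1(2) d2(2) by blast
  qed
qed

lemma R_measurable_N: "R \<in> measurable N (count_space UNIV)"
  by (rule measurable_restrict_space1[OF return_time_measurable[OF Y_sets]])

lemma kac_N:
  assumes A: "A \<in> sets M"
  shows "emeasure M A = (\<Sum>n. emeasure N {y \<in> Y0. n < R y \<and> (T ^^ n) y \<in> A})"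
proof -
  have "emeasure M {x \<in> space M. x \<in> Y \<and> n < R x \<and> (T ^^ n) x \<in> A} = emeasure N {y \<in> Y0. n < R y \<and> (T ^^ n) y \<in> A}" for n
  proof -
    note [measurable] = A Y_sets
    let ?D = "{x \<in> space M. n < R x \<and> (T ^^ n) x \<in> A}"
    have D: "?D \<in> sets M"
    proof -
      have [measurable]: "R \<in> measurable M (count_space UNIV)" by (rule return_time_measurable[OF Y_sets])
      have "?D = (R -` {n<..} \<inter> space M) \<inter> ((T ^^ n) -` A \<inter> space M)" by auto
      then show ?thesis using measurable_sets[OF \<open>R \<in> measurable M (count_space UNIV)\<close>, of "{n<..}"]
        measurable_sets[OF iterate_measurable A, of n] by auto
    qed
    have "{x \<in> space M. x \<in> Y \<and> n < R x \<and> (T ^^ n) x \<in> A} = ?D \<inter> Y" by auto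
    moreover have "{y \<in> Y0. n < R y \<and> (T ^^ n) y \<in> A} = ?D \<inter> Y0" using Y0_space by auto
    moreover have "emeasure N (?D \<inter> Y0) = emeasure M (?D \<inter> Y0)" by (rule emeasure_N) auto
    ultimately show ?thesis using emeasure_Int_Y0[OF D] by simp
  qed
  then show ?thesis using kac_formula[OF Y_sets AE_hits A] by simp
qed

lemma tower_N: "tower N F R"
proof (intro tower.intro tower_axioms.intro)
  interpret gibbs_markov N F \<delta>0 G \<theta> "\<bar>C\<bar>" \<eta> by (rule gibbs_markov_N[OF order_refl theta_less])
  show "finite_measure N" by (rule finite_measure_axioms)
  show "F \<in> measurable N N" by (rule F_measurable_N)
  show "distr N N F = N" by (rule F_invariant_N)
  show "R \<in> measurable N (count_space UNIV)" by (rule R_measurable_N)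
  show "1 \<le> R y" if "y \<in> space N" for y using that space_N Y0_return by simp
  show "A \<in> null_sets N \<or> space N - A \<in> null_sets N" if "A \<in> sets N" "F -` A \<inter> space N = A" for A
    using that by (rule ergodic)
  have "(\<integral>\<^sup>+y. of_nat (R y) \<partial>N) = (\<Sum>n. emeasure N {y \<in> space N. n < R y})"
    by (rule nn_integral_nat_function[OF R_measurable_N])
  also have "\<dots> = (\<Sum>n. emeasure N {y \<in> Y0. n < R y \<and> (T ^^ n) y \<in> space M})"
  proof -
    have "{y \<in> space N. n < R y} = {y \<in> Y0. n < R y \<and> (T ^^ n) y \<in> space M}" for n
      using Y0_space iterate_space by (auto simp: space_N)
    then show ?thesis by simp
  qed
  also have "\<dots> = emeasure M (space M)" by (rule kac_N[symmetric]) simp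
  finally show "(\<integral>\<^sup>+y. of_nat (R y) \<partial>N) = 1" by (simp add: emeasure_space_1)
qed

end

section \<open>Gordin decomposition of the induced observable\<close>

lemma epower_nonneg: "0 < t \<Longrightarrow> 0 \<le> epower t s"
  by (cases s) (auto simp: epower_def)

text \<open>The infimum that defines the least Hoelder constant is attained as soon as it is finite. If the separation
time is infinite, the right-hand side is \<open>0\<close>, and any finite admissible constant gives equality of the values.\<close>

lemma holder_const_bound:
  assumes fin: "holder_const T \<alpha> \<gamma> t g d < \<infinity>" and t: "0 < t" and x: "x \<in> d" and y: "y \<in> d"
  shows "\<bar>g x - g y\<bar> \<le> enn2real (holder_const T \<alpha> \<gamma> t g d) * epower t (separation_time T \<alpha> \<gamma> x y)"
proof -
  let ?e = "epower t (separation_time T \<alpha> \<gamma> x y)"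
  let ?S = "{C. \<forall>x\<in>d. \<forall>y\<in>d. ennreal \<bar>g x - g y\<bar> \<le> C * ennreal (epower t (separation_time T \<alpha> \<gamma> x y))}"
  have H: "holder_const T \<alpha> \<gamma> t g d = Inf ?S" by (simp add: holder_const_def)
  have S: "ennreal \<bar>g x - g y\<bar> \<le> C * ennreal ?e" if "C \<in> ?S" for C using that x y by blast
  have e0: "0 \<le> ?e" by (rule epower_nonneg[OF t])
  show ?thesis
  proof (cases "?e = 0")
    case True
    have "?S \<noteq> {}"
    proof
      assume e: "?S = {}"
      have "holder_const T \<alpha> \<gamma> t g d = top" unfolding H e by simp
      then show False using fin by simp
    qed
    then obtain C where "C \<in> ?S" by blast
    from S[OF this] True have "\<bar>g x - g y\<bar> \<le> 0" by simp
    then show ?thesis using True by simp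
  next
    case False
    then have e: "0 < ?e" using e0 by simp
    have "ennreal (\<bar>g x - g y\<bar> / ?e) \<le> C" if C: "C \<in> ?S" for C
    proof (cases C rule: ennreal_cases)
      case (real c)
      have "ennreal \<bar>g x - g y\<bar> \<le> ennreal (c * ?e)" using S[OF C] real e0 by (simp add: ennreal_mult)
      then have "\<bar>g x - g y\<bar> \<le> c * ?e" using real e0 by (subst (asm) ennreal_le_iff) auto
      then show ?thesis using real e by (simp add: field_simps)
    qed simp
    then have "ennreal (\<bar>g x - g y\<bar> / ?e) \<le> holder_const T \<alpha> \<gamma> t g d" unfolding H by (rule Inf_greatest)
    then have "enn2real (ennreal (\<bar>g x - g y\<bar> / ?e)) \<le> enn2real (holder_const T \<alpha> \<gamma> t g d)"
      by (rule enn2real_mono) (use fin in simp)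
    then show ?thesis using e by (simp add: field_simps)
  qed
qed

context distorted_inducing begin

lemma return_time_on_cell: assumes "d \<in> \<delta>" "x \<in> d" shows "return_time_on T Y d = R x"
  unfolding return_time_on_def
proof (rule the_equality)
  show "\<forall>y\<in>d. R y = R x" using \<delta>_itinerary[OF assms] by blast
  show "n = R x" if "\<forall>y\<in>d. R y = n" for n using that assms(2) by simp
qed

lemma cell_Y0_nonempty: assumes d: "d \<in> \<delta>" shows "d \<inter> Y0 \<noteq> {}"
proof
  assume "d \<inter> Y0 = {}"
  then have "emeasure M d = 0"
    using emeasure_Int_Y0[OF \<delta>_sets[OF d]] \<delta>_sub_Y[OF d] by (simp add: Int_absorb2)
  then show False using \<delta>_pos[OF d] by simp
qed

lemma restrict_bij: "bij_betw (\<lambda>d. d \<inter> Y0) \<delta> \<delta>0"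
proof (rule bij_betw_imageI)
  show "inj_on (\<lambda>d. d \<inter> Y0) \<delta>"
  proof (rule inj_onI)
    fix d d' assume d: "d \<in> \<delta>" "d' \<in> \<delta>" "d \<inter> Y0 = d' \<inter> Y0"
    obtain x where "x \<in> d \<inter> Y0" using cell_Y0_nonempty[OF d(1)] by auto
    then show "d = d'" using \<delta>_disjoint[OF d(1,2), of x] d(3) by auto
  qed
qed simp

text \<open>As return times are at least \<open>1\<close> and cells have positive measure, the summability in the class \<open>I\<close> makes every
local constant finite and leaves them summable against the measure.\<close>

lemma summable_holder_const:
  fixes g :: "'a \<Rightarrow> real"
  assumes s: "(\<Sum>\<^sub>\<infinity>d\<in>\<delta>. of_nat (return_time_on T Y d) * emeasure M d * holder_const T \<alpha> \<gamma> t g d) < \<infinity>"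
    and t: "0 < t"
  obtains D where "integrable (count_space \<delta>0) (\<lambda>d. measure N d * D d)" "\<And>d. 0 \<le> D d"
    "\<And>d x y. d \<in> \<delta>0 \<Longrightarrow> x \<in> d \<Longrightarrow> y \<in> d \<Longrightarrow> \<bar>g x - g y\<bar> \<le> D d * epower t (separation_time T \<alpha> \<gamma> x y)"
proof -
  let ?H = "\<lambda>d. holder_const T \<alpha> \<gamma> t g d"
  let ?w = "\<lambda>d. of_nat (return_time_on T Y d) * emeasure M d * ?H d"
  have s': "(\<integral>\<^sup>+d. ?w d \<partial>count_space \<delta>) < \<infinity>"
    using s unfolding infsum_eq_nn_integral_count_space[OF \<delta>_countable] .
  have r1: "1 \<le> return_time_on T Y d" if d: "d \<in> \<delta>" for d
  proof -
    obtain x where x: "x \<in> d" using \<delta>_nonempty[OF d] by auto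
    show ?thesis using return_time_on_cell[OF d x] \<delta>_cell[OF d x] by simp
  qed
  have le: "emeasure M d * ?H d \<le> ?w d" if d: "d \<in> \<delta>" for d
  proof -
    have "(1::ennreal) \<le> of_nat (return_time_on T Y d)" using r1[OF d] by (metis of_nat_1 of_nat_mono)
    from mult_right_mono[OF this, of "emeasure M d * ?H d"] show ?thesis by (simp add: mult.assoc)
  qed
  have Hfin: "?H d < \<infinity>" if d: "d \<in> \<delta>" for d
  proof -
    have "?w d \<le> (\<integral>\<^sup>+d. ?w d \<partial>count_space \<delta>)" by (rule nn_integral_ge_point[OF d])
    then have "emeasure M d * ?H d < \<infinity>" using le[OF d] s' by (meson le_less_trans)
    then show ?thesis using \<delta>_pos[OF d] by (auto simp: ennreal_mult_less_top less_top)
  qed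
  define D where "D = (\<lambda>d0. enn2real (?H (inv_into \<delta> (\<lambda>d. d \<inter> Y0) d0)))"
  have Dd: "D (d \<inter> Y0) = enn2real (?H d)" if "d \<in> \<delta>" for d
    unfolding D_def using inv_into_f_f[OF bij_betw_imp_inj_on[OF restrict_bij] that] by simp
  show thesis
  proof
    show "0 \<le> D d" for d by (simp add: D_def)
    show "\<bar>g x - g y\<bar> \<le> D d0 * epower t (separation_time T \<alpha> \<gamma> x y)" if d0: "d0 \<in> \<delta>0" and xy: "x \<in> d0" "y \<in> d0" for d0 x y
    proof -
      obtain d where d: "d \<in> \<delta>" "d0 = d \<inter> Y0" using d0 by (rule \<delta>0_elim)
      show ?thesis unfolding d(2) Dd[OF d(1)]
        by (rule holder_const_bound[OF Hfin[OF d(1)] t]) (use xy d in auto)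
    qed
    have "(\<integral>\<^sup>+d. ennreal (measure N d * D d) \<partial>count_space \<delta>0) = (\<integral>\<^sup>+d. ennreal (measure N (d \<inter> Y0) * D (d \<inter> Y0)) \<partial>count_space \<delta>)"
      by (rule nn_integral_bij_count_space[OF restrict_bij, symmetric])
    also have "\<dots> \<le> (\<integral>\<^sup>+d. ?w d \<partial>count_space \<delta>)"
    proof (rule nn_integral_mono)
      fix d assume "d \<in> space (count_space \<delta>)" then have d: "d \<in> \<delta>" by simp
      have "measure N (d \<inter> Y0) = measure M (d \<inter> Y0)" by (rule measure_N) auto
      also have "\<dots> = measure M d"
        unfolding measure_def emeasure_Int_Y0[OF \<delta>_sets[OF d]] using \<delta>_sub_Y[OF d] by (simp add: Int_absorb2)
      finally have m: "measure N (d \<inter> Y0) = measure M d" .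
      have "ennreal (measure N (d \<inter> Y0) * D (d \<inter> Y0)) = emeasure M d * ?H d"
        unfolding m Dd[OF d] using Hfin[OF d] by (simp add: ennreal_mult emeasure_eq_measure)
      then show "ennreal (measure N (d \<inter> Y0) * D (d \<inter> Y0)) \<le> ?w d" using le[OF d] by simp
    qed
    also have "\<dots> < \<infinity>" by (rule s')
    finally show "integrable (count_space \<delta>0) (\<lambda>d. measure N d * D d)"
      by (intro integrableI_bounded) (simp_all add: D_def)
  qed
qed

section \<open>Passage from the tower to the original system\<close>

sublocale tw: tower N F R
  by (rule tower_N)

text \<open>The factor map from the tower onto the original system.\<close>

definition proj :: "'a \<times> nat \<Rightarrow> 'a" where "proj p = (T ^^ snd p) (fst p)"

lemma iterate_measurable_N: "(T ^^ n) \<in> measurable N M"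
  by (rule measurable_restrict_space1[OF iterate_measurable])

lemma level_count: "(\<lambda>p. snd p) \<in> measurable tw.prod_space (count_space UNIV)"
  by (rule measurable_snd)

lemma proj_measurable [measurable]: "proj \<in> measurable tw.\<Delta> M"
proof (rule tw.measurable_from_\<Delta>)
  have "(\<lambda>p. (T ^^ n) (fst p)) \<in> measurable tw.prod_space M" for n
    by (rule measurable_compose[OF measurable_fst iterate_measurable_N])
  from measurable_compose_countable[OF this level_count]
  show "proj \<in> measurable tw.prod_space M" unfolding proj_def .
qed

text \<open>The floors of the tower are disjoint copies of the sets that Kac's formula sums up.\<close>

lemma distr_proj: "distr tw.\<Delta> M proj = M"
proof (rule measure_eqI)
  fix A assume "A \<in> sets (distr tw.\<Delta> M proj)"
  then have A: "A \<in> sets M" by simp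
  let ?B = "proj -` A \<inter> space tw.\<Delta>"
  have B: "?B \<in> sets tw.\<Delta>" by (rule measurable_sets[OF proj_measurable A])
  have S: "{y \<in> Y0. n < R y \<and> (T ^^ n) y \<in> A} \<in> sets N" for n
  proof -
    have "{y \<in> Y0. n < R y \<and> (T ^^ n) y \<in> A} = (R -` {n<..} \<inter> space N) \<inter> ((T ^^ n) -` A \<inter> space N)"
      using space_N by auto
    then show ?thesis
      using measurable_sets[OF R_measurable_N, of "{n<..}"] measurable_sets[OF iterate_measurable_N A, of n] by auto
  qed
  have "emeasure (distr tw.\<Delta> M proj) A = emeasure tw.\<Delta> ?B"
    by (rule emeasure_distr[OF proj_measurable A])
  also have "\<dots> = (\<integral>\<^sup>+y. (\<integral>\<^sup>+i. indicator ?B (y, i) \<partial>count_space UNIV) \<partial>N)"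
    by (rule tw.emeasure_\<Delta>[OF B])
  also have "\<dots> = (\<integral>\<^sup>+y. (\<Sum>n. indicator {y \<in> Y0. n < R y \<and> (T ^^ n) y \<in> A} y) \<partial>N)"
  proof (rule nn_integral_cong)
    fix y assume "y \<in> space N"
    then have "indicator ?B (y, n) = (indicator {y \<in> Y0. n < R y \<and> (T ^^ n) y \<in> A} y :: ennreal)" for n
      using space_N by (auto simp: indicator_def tw.space_\<Delta> proj_def)
    then show "(\<integral>\<^sup>+i. indicator ?B (y, i) \<partial>count_space UNIV) = (\<Sum>n. indicator {y \<in> Y0. n < R y \<and> (T ^^ n) y \<in> A} y :: ennreal)"
      by (simp add: nn_integral_count_space_nat)
  qed
  also have "\<dots> = (\<Sum>n. \<integral>\<^sup>+y. indicator {y \<in> Y0. n < R y \<and> (T ^^ n) y \<in> A} y \<partial>N)"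
    by (rule nn_integral_suminf) (use S in simp)
  also have "\<dots> = (\<Sum>n. emeasure N {y \<in> Y0. n < R y \<and> (T ^^ n) y \<in> A})"
    using S by simp
  also have "\<dots> = emeasure M A" by (rule kac_N[OF A, symmetric])
  finally show "emeasure (distr tw.\<Delta> M proj) A = emeasure M A" .
qed simp

lemma proj_up: assumes p: "p \<in> space tw.\<Delta>" shows "proj (tw.up p) = T (proj p)"
proof (cases "Suc (snd p) < R (fst p)")
  case True then show ?thesis by (simp add: proj_def tw.up_def)
next
  case False
  then have r: "R (fst p) = Suc (snd p)" using p by (simp add: tw.space_\<Delta>)
  have "proj (tw.up p) = F (fst p)" using False by (simp add: proj_def tw.up_def)
  also have "\<dots> = (T ^^ Suc (snd p)) (fst p)" unfolding induced_map_def r ..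
  finally show ?thesis by (simp add: proj_def)
qed

lemma proj_iterate: "p \<in> space tw.\<Delta> \<Longrightarrow> proj ((tw.up ^^ n) p) = (T ^^ n) (proj p)"
proof (induction n)
  case (Suc n) then show ?case using proj_up[OF tw.iterate_space[OF Suc.prems, of n]] by simp
qed simp

lemma cf_proj:
  assumes [measurable]: "f \<in> borel_measurable M"
  shows "tw.cf (\<lambda>p. f (proj p)) s n = cf f s n"
proof -
  have "cf f s n = (\<integral>x. iexp (s * birkhoff_sum f n x) \<partial>distr tw.\<Delta> M proj)"
    unfolding cf_def distr_proj ..
  also have "\<dots> = (\<integral>p. iexp (s * birkhoff_sum f n (proj p)) \<partial>tw.\<Delta>)"
    by (rule integral_distr) measurable
  also have "\<dots> = tw.cf (\<lambda>p. f (proj p)) s n"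
    unfolding tw.cf_def
    by (rule Bochner_Integration.integral_cong)
      (simp_all add: birkhoff_sum_def tw.birkhoff_sum_def proj_iterate)
  finally show ?thesis ..
qed

lemma induced_function_integrable:
  assumes f: "integrable M f"
  shows "integrable N (induced_function T Y f)" "(\<integral>y. induced_function T Y f y \<partial>N) = (\<integral>x. f x \<partial>M)"
proof -
  have fm [measurable]: "f \<in> borel_measurable M" using f by auto
  have i: "integrable tw.\<Delta> (\<lambda>p. f (proj p))"
    using f integrable_distr_eq[OF proj_measurable fm] unfolding distr_proj by simp
  have "induced_function T Y f = (\<lambda>y. \<Sum>i<R y. f (proj (y, i)))"
    by (simp add: induced_function_def proj_def fun_eq_iff)
  note e = this
  show "integrable N (induced_function T Y f)" unfolding e by (rule tw.column_integral(1)[OF i])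
  have "(\<integral>y. induced_function T Y f y \<partial>N) = (\<integral>p. f (proj p) \<partial>tw.\<Delta>)"
    unfolding e by (rule tw.column_integral(2)[OF i])
  also have "\<dots> = (\<integral>x. f x \<partial>distr tw.\<Delta> M proj)" by (rule integral_distr[symmetric]) measurable
  finally show "(\<integral>y. induced_function T Y f y \<partial>N) = (\<integral>x. f x \<partial>M)" unfolding distr_proj .
qed

lemma integrable_N_of_MY:
  fixes g :: "'a \<Rightarrow> real"
  assumes "integrable MY g" shows "integrable N g"
proof -
  have "integrable M (\<lambda>x. indicator Y x *\<^sub>R g x)"
    using assms Y_sets by (subst (asm) integrable_restrict_space) auto
  from integrable_mult_indicator[OF Y0_sets this]
  have "integrable M (\<lambda>x. indicator Y0 x *\<^sub>R (indicator Y x *\<^sub>R g x))" .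
  also have "(\<lambda>x. indicator Y0 x *\<^sub>R (indicator Y x *\<^sub>R g x)) = (\<lambda>x. indicator Y0 x *\<^sub>R g x)"
    by (auto simp: indicator_def Y0_def fun_eq_iff)
  finally show ?thesis using Y0_sets by (subst integrable_restrict_space) auto
qed

lemma induced_decomposition:
  assumes fI: "f \<in> class_I M T \<alpha> \<gamma>" and f: "integrable M f" "(\<integral>x. f x \<partial>M) = 0"
    and f2: "integrable MY (\<lambda>x. (induced_function T Y f x)\<^sup>2)"
  obtains w \<psi> where "w \<in> borel_measurable N" "\<psi> \<in> borel_measurable N" "integrable N (\<lambda>x. (\<psi> x)\<^sup>2)"
    "\<And>y. y \<in> Y0 \<Longrightarrow> induced_function T Y f y = \<psi> y + w (F y) - w y"
    "\<And>g B. g \<in> borel_measurable N \<Longrightarrow> (\<And>x. x \<in> space N \<Longrightarrow> \<bar>g x\<bar> \<le> B) \<Longrightarrow> (\<integral>x. \<psi> x * g (F x) \<partial>N) = 0"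
proof -
  let ?g = "induced_function T Y f"
  obtain t2 where t2: "0 < t2" "t2 < 1"
    and s: "(\<Sum>\<^sub>\<infinity>d\<in>\<delta>. of_nat (return_time_on T Y d) * emeasure M d * holder_const T \<alpha> \<gamma> t2 ?g d) < \<infinity>"
    using fI unfolding class_I_def by blast
  obtain D where D: "integrable (count_space \<delta>0) (\<lambda>d. measure N d * D d)" "\<And>d. 0 \<le> D d"
    "\<And>d x y. d \<in> \<delta>0 \<Longrightarrow> x \<in> d \<Longrightarrow> y \<in> d \<Longrightarrow> \<bar>?g x - ?g y\<bar> \<le> D d * epower t2 (separation_time T \<alpha> \<gamma> x y)"
    by (rule summable_holder_const[OF s t2(1)]) blast
  define t where "t = max \<theta> t2"
  have t: "\<theta> \<le> t" "t2 \<le> t" "t < 1" using theta_less t2 by (auto simp: t_def)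
  interpret gm: gibbs_markov N F \<delta>0 G t "\<bar>C\<bar>" \<eta> by (rule gibbs_markov_N[OF t(1,3)])
  have reg: "\<bar>?g x - ?g y\<bar> \<le> D d * t ^ n"
    if d: "d \<in> \<delta>0" and x: "x \<in> d" and n: "1 \<le> n" and same: "same_itinerary F \<delta>0 n x y" for d n x y
  proof -
    have "\<exists>d'\<in>\<delta>0. (F ^^ 0) x \<in> d' \<and> (F ^^ 0) y \<in> d'"
      using same n unfolding same_itinerary_def by (metis less_eq_Suc_le One_nat_def)
    then obtain d' where d': "d' \<in> \<delta>0" "x \<in> d'" "y \<in> d'" by auto
    obtain e where e: "e \<in> \<delta>" "d = e \<inter> Y0" using d by (rule \<delta>0_elim)
    obtain e' where e': "e' \<in> \<delta>" "d' = e' \<inter> Y0" using d'(1) by (rule \<delta>0_elim)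
    have "e = e'" by (rule \<delta>_disjoint[OF e(1) e'(1), of x]) (use e e' d' x in auto)
    then have "y \<in> d" using e e' d' by simp
    from D(3)[OF d x this] have "\<bar>?g x - ?g y\<bar> \<le> D d * epower t2 (separation_time T \<alpha> \<gamma> x y)" .
    also have "\<dots> \<le> D d * t ^ n"
      using epower_le(1)[OF t2(1) t(2,3) separation_time_ge(3)[OF n same_\<delta>0[OF same]]] D(2)
      by (intro mult_left_mono) auto
    finally show ?thesis .
  qed
  have mean: "(\<integral>y. ?g y \<partial>N) = 0" using induced_function_integrable(2)[OF f(1)] f(2) by simp
  show thesis
  proof (rule gm.gordin_decomposition[OF induced_function_integrable(1)[OF f(1)] mean integrable_N_of_MY[OF f2] D(1,2) reg])
    fix w \<psi>
    assume *: "w \<in> borel_measurable N" "\<psi> \<in> borel_measurable N" "integrable N (\<lambda>x. (\<psi> x)\<^sup>2)"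
      "\<And>x. x \<in> space N \<Longrightarrow> ?g x = \<psi> x + w (F x) - w x"
      "\<And>g B. g \<in> borel_measurable N \<Longrightarrow> (\<And>x. x \<in> space N \<Longrightarrow> \<bar>g x\<bar> \<le> B) \<Longrightarrow> (\<integral>x. \<psi> x * g (F x) \<partial>N) = 0"
    show thesis by (rule that[OF *(1-3) _ *(5)]) (use *(4) space_N in simp)
  qed
qed

text \<open>Starting from \<open>w\<close>, \<open>\<xi>\<close> adds up \<open>f\<close> along the column. Below the roof its increment is \<open>f\<close>; on the roof the column sum \<open>f\<^sub>Y\<close> is
traded, by the decomposition on the base, for \<open>\<psi>\<close>.\<close>

lemma tower_coboundary:
  assumes dec: "\<And>y. y \<in> Y0 \<Longrightarrow> induced_function T Y f y = \<psi> y + w (F y) - w y" and p: "p \<in> space tw.\<Delta>"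
  defines "\<xi> \<equiv> \<lambda>p. w (fst p) + (\<Sum>j<snd p. f ((T ^^ j) (fst p)))"
  shows "f (proj p) = indicator tw.roof p * \<psi> (fst p) + \<xi> (tw.up p) - \<xi> p"
proof -
  obtain y i where yi: "p = (y, i)" by (cases p)
  have y: "y \<in> Y0" "i < R y" using p yi space_N by (auto simp: tw.space_\<Delta>)
  show ?thesis
  proof (cases "Suc i < R y")
    case True
    then have "p \<notin> tw.roof" by (simp add: tw.roof_def yi)
    then show ?thesis using True by (simp add: yi \<xi>_def tw.up_def proj_def)
  next
    case False
    then have r: "R y = Suc i" using y by simp
    have "p \<in> tw.roof" using p r by (simp add: tw.roof_def yi)
    moreover have "induced_function T Y f y = (\<Sum>j<i. f ((T ^^ j) y)) + f ((T ^^ i) y)"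
      unfolding induced_function_def r by simp
    ultimately show ?thesis using dec[OF y(1)] r by (simp add: yi \<xi>_def tw.up_def proj_def)
  qed
qed

lemma characteristic_limit:
  assumes [measurable]: "f \<in> borel_measurable M" and w: "w \<in> borel_measurable N"
    and psi [measurable]: "\<psi> \<in> borel_measurable N" and psi2: "integrable N (\<lambda>x. (\<psi> x)\<^sup>2)"
    and dec: "\<And>y. y \<in> Y0 \<Longrightarrow> induced_function T Y f y = \<psi> y + w (F y) - w y"
    and orth: "\<And>g B. g \<in> borel_measurable N \<Longrightarrow> (\<And>x. x \<in> space N \<Longrightarrow> \<bar>g x\<bar> \<le> B) \<Longrightarrow> (\<integral>x. \<psi> x * g (F x) \<partial>N) = 0"
  shows "(\<lambda>n. cf f (t / sqrt n) n) \<longlonglongrightarrow> of_real (exp (- (t\<^sup>2 * (\<integral>y. (\<psi> y)\<^sup>2 \<partial>N) / 2)))"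
proof -
  define \<xi> where "\<xi> = (\<lambda>p::'a \<times> nat. w (fst p) + (\<Sum>j<snd p. f ((T ^^ j) (fst p))))"
  let ?\<psi> = "\<lambda>p. indicator tw.roof p * \<psi> (fst p)"
  have rm: "tw.reverse_martingale_difference ?\<psi>" "(\<integral>p. (?\<psi> p)\<^sup>2 \<partial>tw.\<Delta>) = (\<integral>y. (\<psi> y)\<^sup>2 \<partial>N)"
    by (rule tw.reverse_martingale_on_roof[OF psi psi2]; fact orth)+
  have xi: "\<xi> \<in> borel_measurable tw.\<Delta>"
  proof (rule tw.measurable_from_\<Delta>)
    have "(\<lambda>p. w (fst p) + (\<Sum>j<n. f ((T ^^ j) (fst p)))) \<in> borel_measurable tw.prod_space" for n
    proof -
      have 1: "(\<lambda>y. w y + (\<Sum>j<n. f ((T ^^ j) y))) \<in> borel_measurable N"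
        by (intro borel_measurable_add w borel_measurable_sum measurable_compose[OF iterate_measurable_N]) measurable
      show ?thesis by (rule measurable_compose[OF measurable_fst 1])
    qed
    from measurable_compose_countable[OF this level_count]
    show "\<xi> \<in> borel_measurable tw.prod_space" unfolding \<xi>_def .
  qed
  have fp: "(\<lambda>p. f (proj p)) \<in> borel_measurable tw.\<Delta>" by measurable
  have rmm: "?\<psi> \<in> borel_measurable tw.\<Delta>" by (rule conjunct1[OF rm(1)[unfolded tw.reverse_martingale_difference_def]])
  have "AE p in tw.\<Delta>. f (proj p) = ?\<psi> p + \<xi> (tw.up p) - \<xi> p"
    unfolding \<xi>_def using tower_coboundary[of f \<psi> w, OF dec] by (intro AE_I2) auto
  from tw.cf_coboundary[OF fp rmm xi this, of t]
  have a: "(\<lambda>n. cf f (t / sqrt n) n - tw.cf ?\<psi> (t / sqrt n) n) \<longlonglongrightarrow> 0"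
    by (simp only: cf_proj[OF assms(1)])
  have b: "(\<lambda>n. tw.cf ?\<psi> (t / sqrt n) n) \<longlonglongrightarrow> of_real (exp (- (t\<^sup>2 * (\<integral>y. (\<psi> y)\<^sup>2 \<partial>N) / 2)))"
    by (rule tw.cf_limit[OF rm(1)]) (rule rm(2)[symmetric])
  from tendsto_add[OF a b] show ?thesis by simp
qed

text \<open>The first time \<open>n \<ge> 0\<close> at which the orbit is in \<open>Y\<close>; in contrast to the return time it is \<open>0\<close> on \<open>Y\<close>.\<close>

definition entrance :: "'a \<Rightarrow> nat" where "entrance x = (LEAST n. (T ^^ n) x \<in> Y)"

lemma entrance_measurable [measurable]: "entrance \<in> measurable M (count_space UNIV)"
  unfolding entrance_def by measurable

lemma entrance_step:
  assumes "(T ^^ n) x \<in> Y" "x \<notin> Y" shows "entrance x = Suc (entrance (T x))"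
proof -
  have "(LEAST n. (T ^^ n) x \<in> Y) = Suc (LEAST m. (T ^^ Suc m) x \<in> Y)"
    using assms by (intro Least_Suc) auto
  then show ?thesis unfolding entrance_def by (simp add: funpow_swap1)
qed

lemma entrance_after_Y: assumes r: "R x = Suc k" shows "entrance (T x) = k"
  unfolding entrance_def
proof (rule Least_equality)
  have "(T ^^ Suc k) x \<in> Y" "\<forall>i\<in>{1..<Suc k}. (T ^^ i) x \<notin> Y"
    using return_time_eq_iff[of "Suc k" T Y x] r by auto
  note e = this
  show "(T ^^ k) (T x) \<in> Y" using e(1) by (simp add: funpow_swap1)
  show "k \<le> m" if m: "(T ^^ m) (T x) \<in> Y" for m
  proof (rule ccontr)
    assume "\<not> k \<le> m"
    then have "Suc m \<in> {1..<Suc k}" by auto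
    moreover have "(T ^^ Suc m) x \<in> Y" using m by (simp add: funpow_swap1)
    ultimately show False using e(2) by blast
  qed
qed

text \<open>Put \<open>h x = w (z) - \<Sum> f\<close>, where \<open>z\<close> is the first point of the orbit of \<open>x\<close> in \<open>Y\<close> and the sum runs over the orbit
before \<open>z\<close>. Off \<open>Y\<close> the first entrance point is the same for \<open>x\<close> and \<open>T x\<close>; on \<open>Y\<close> the increment is
\<open>w (F x) - w x - (f\<^sub>Y x - f x) = f x\<close>.\<close>

lemma coboundary_from_base:
  assumes [measurable]: "f \<in> borel_measurable M" and w: "w \<in> borel_measurable N"
    and dec: "AE y in N. induced_function T Y f y = w (F y) - w y"
  shows "\<exists>h\<in>borel_measurable M. AE x in M. f x = h (T x) - h x"
proof
  define w' where "w' = (\<lambda>x. w x * indicator Y0 x)"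
  have w' [measurable]: "w' \<in> borel_measurable M"
    using w Y0_sets unfolding w'_def by (subst (asm) borel_measurable_restrict_space_iff) (auto simp: mult.commute)
  define h where "h = (\<lambda>x. w' ((T ^^ entrance x) x) - (\<Sum>i<entrance x. f ((T ^^ i) x)))"
  show "h \<in> borel_measurable M"
    unfolding h_def
    by (rule measurable_compose_countable[where f = "\<lambda>n x. w' ((T ^^ n) x) - (\<Sum>i<n. f ((T ^^ i) x))", OF _ entrance_measurable]) measurable
  have dec': "AE x in M. x \<in> Y0 \<longrightarrow> induced_function T Y f x = w (F x) - w x"
    using dec Y0_sets by (subst (asm) AE_restrict_space_iff) auto
  show "AE x in M. f x = h (T x) - h x"
    using dec' AE_hits AE_not_in[OF Bad_null] AE_space
  proof eventually_elim
    case (elim x)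
    then obtain n where n: "(T ^^ n) x \<in> Y" by auto
    show ?case
    proof (cases "x \<in> Y")
      case False
      have e: "entrance x = Suc (entrance (T x))" by (rule entrance_step[OF n False])
      have 1: "(T ^^ entrance x) x = (T ^^ entrance (T x)) (T x)" unfolding e by (simp add: funpow_swap1)
      have 2: "(\<Sum>i<entrance x. f ((T ^^ i) x)) = f x + (\<Sum>i<entrance (T x). f ((T ^^ i) (T x)))"
        unfolding e by (subst sum.lessThan_Suc_shift) (simp add: funpow_swap1)
      show ?thesis unfolding h_def 1 2 by simp
    next
      case True
      then have x: "x \<in> Y0" using elim by (simp add: Y0_def)
      obtain k where k: "R x = Suc k" using Y0_return[OF x] by (cases "R x") auto
      have "entrance x = 0" unfolding entrance_def using True by (intro Least_equality) auto
      then have hx: "h x = w x" using x by (simp add: h_def w'_def)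
      have Fx: "(T ^^ k) (T x) = F x" unfolding induced_map_def k by (simp add: funpow_swap1)
      have "h (T x) = w (F x) - (\<Sum>i<k. f ((T ^^ i) (T x)))"
        unfolding h_def entrance_after_Y[OF k] Fx w'_def using Y0_F[OF x] by simp
      moreover have "induced_function T Y f x = f x + (\<Sum>i<k. f ((T ^^ i) (T x)))"
        unfolding induced_function_def k by (subst sum.lessThan_Suc_shift) (simp add: funpow_swap1)
      moreover have "induced_function T Y f x = w (F x) - w x" using elim x by simp
      ultimately show ?thesis using hx by simp
    qed
  qed
qed

text \<open>The variance is \<open>v = \<integral> \<psi>\<^sup>2\<close> over the base. If it vanishes, \<open>\<psi> = 0\<close> and \<open>f\<^sub>Y\<close> is a coboundary. If \<open>f\<close> is a
coboundary, comparing it with the zero function shows that the limit law has the characteristic function \<open>1\<close>.\<close>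

theorem clt_of_induced:
  assumes fI: "f \<in> class_I M T \<alpha> \<gamma>" and f: "integrable M f" "(\<integral>x. f x \<partial>M) = 0"
    and f2: "integrable MY (\<lambda>x. (induced_function T Y f x)\<^sup>2)"
  shows "\<exists>v\<ge>0. weak_conv_m (\<lambda>n. distr M borel (\<lambda>x. birkhoff_sum f n x / sqrt n)) (centered_normal v) \<and>
    (v = 0 \<longleftrightarrow> (\<exists>h\<in>borel_measurable M. AE x in M. f x = h (T x) - h x))"
proof -
  have fm [measurable]: "f \<in> borel_measurable M" using f by auto
  show ?thesis
  proof (rule induced_decomposition[OF fI f f2])
    fix w \<psi>
    assume w: "w \<in> borel_measurable N" and psi: "\<psi> \<in> borel_measurable N" "integrable N (\<lambda>x. (\<psi> x)\<^sup>2)"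
      and dec: "\<And>y. y \<in> Y0 \<Longrightarrow> induced_function T Y f y = \<psi> y + w (F y) - w y"
      and orth: "\<And>g B. g \<in> borel_measurable N \<Longrightarrow> (\<And>x. x \<in> space N \<Longrightarrow> \<bar>g x\<bar> \<le> B) \<Longrightarrow> (\<integral>x. \<psi> x * g (F x) \<partial>N) = 0"
    define v where "v = (\<integral>y. (\<psi> y)\<^sup>2 \<partial>N)"
    have v0: "0 \<le> v" unfolding v_def by (rule Bochner_Integration.integral_nonneg) simp
    have lim: "(\<lambda>n. cf f (t / sqrt n) n) \<longlonglongrightarrow> of_real (exp (- (t\<^sup>2 * v / 2)))" for t
      unfolding v_def by (rule characteristic_limit[OF fm w psi]) (fact dec, fact orth)
    have "weak_conv_m (\<lambda>n. distr M borel (\<lambda>x. birkhoff_sum f n x / sqrt n)) (centered_normal v)"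
    proof (rule levy_continuity)
      show "real_distribution (distr M borel (\<lambda>x. birkhoff_sum f n x / sqrt n))" for n
        by (rule real_distribution_distr) measurable
      show "real_distribution (centered_normal v)" by (rule centered_normal_char(1)[OF v0])
      show "(\<lambda>n. char (distr M borel (\<lambda>x. birkhoff_sum f n x / sqrt n)) t) \<longlonglongrightarrow> char (centered_normal v) t" for t
        unfolding char_birkhoff_sum[OF fm] centered_normal_char(2)[OF v0] by (rule lim)
    qed
    moreover have "\<exists>h\<in>borel_measurable M. AE x in M. f x = h (T x) - h x" if "v = 0"
    proof (rule coboundary_from_base[OF fm w])
      have "AE y in N. (\<psi> y)\<^sup>2 = 0"
        using that integral_nonneg_eq_0_iff_AE[OF psi(2)] unfolding v_def by simp
      then show "AE y in N. induced_function T Y f y = w (F y) - w y"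
        using AE_space by eventually_elim (use dec space_N in simp)
    qed
    moreover have "v = 0" if ex: "\<exists>h\<in>borel_measurable M. AE x in M. f x = h (T x) - h x"
    proof -
      obtain h where h: "h \<in> borel_measurable M" "AE x in M. f x = h (T x) - h x" using ex by blast
      have "AE x in M. f x = 0 + h (T x) - h x" using h(2) by simp
      from cf_coboundary[OF fm _ h(1) this, of 1]
      have "(\<lambda>n. cf f (1 / sqrt n) n - cf (\<lambda>_. 0) (1 / sqrt n) n) \<longlonglongrightarrow> 0" by simp
      moreover have "cf (\<lambda>_. 0) s n = 1" for s n by (simp add: cf_def birkhoff_sum_def prob_space)
      ultimately have "(\<lambda>n. cf f (1 / sqrt n) n - 1) \<longlonglongrightarrow> 0" by simp
      then have "(\<lambda>n. cf f (1 / sqrt n) n) \<longlonglongrightarrow> 1" by (simp add: LIM_zero_iff)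
      from LIMSEQ_unique[OF this lim[of 1]] have "of_real (exp (- (1\<^sup>2 * v / 2))) = (of_real 1 :: complex)" by simp
      then have "exp (- (1\<^sup>2 * v / 2)) = 1" by (simp only: of_real_eq_iff)
      then show "v = 0" by simp
    qed
    ultimately show ?thesis using v0 by blast
  qed
qed

end

theorem theorem1p1:
  fixes M :: "'a measure" and T :: "'a \<Rightarrow> 'a" and \<alpha> \<gamma> :: "'a set set"
    and f :: "'a \<Rightarrow> real" and \<theta> :: real
  assumes "markov_map M T \<alpha>" and "probability_preserving M T" and "topologically_mixing T \<alpha>"
    and "\<gamma> \<subseteq> \<alpha>" and "\<gamma> \<noteq> {}"
    and "0 < \<theta>" and "\<theta> < 1" and "locally_holder_distortion M T \<alpha> \<gamma> \<theta>"
    and "big_image M T \<alpha> \<gamma>"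
    and "f \<in> class_I M T \<alpha> \<gamma>" and "integrable M f" and "(\<integral>x. f x \<partial>M) = 0"
    and "induced_function T (\<Union>\<gamma>) f \<in> borel_measurable (restrict_space M (\<Union>\<gamma>))"
    and "integrable (restrict_space M (\<Union>\<gamma>)) (\<lambda>x. (induced_function T (\<Union>\<gamma>) f x)\<^sup>2)"
  shows "\<exists>\<sigma>2::real. \<sigma>2 \<ge> 0 \<and>
    weak_conv_m (\<lambda>n. distr M borel (\<lambda>x. (\<Sum>i<n. f ((T ^^ i) x)) / sqrt (real n)))
      (centered_normal \<sigma>2) \<and>
    (\<sigma>2 = 0 \<longleftrightarrow> (\<exists>h\<in>borel_measurable M. AE x in M. f x = h (T x) - h x))"
proof -
  obtain u C where u: "AE x in restrict_space M (\<Union>\<gamma>). u x = ln (inverse_jacobian M T \<alpha> \<gamma> x)"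
    "\<And>x y. x \<in> \<Union>\<gamma> \<Longrightarrow> y \<in> \<Union>\<gamma> \<Longrightarrow> 1 \<le> separation_time T \<alpha> \<gamma> x y \<Longrightarrow>
      \<bar>u x - u y\<bar> \<le> C * epower \<theta> (separation_time T \<alpha> \<gamma> x y)"
    using assms(8) unfolding locally_holder_distortion_def by blast
  obtain \<eta> where "0 < \<eta>" "\<And>d. d \<in> induced_partition T \<alpha> \<gamma> \<Longrightarrow> \<eta> \<le> measure M (induced_map T (\<Union>\<gamma>) ` d)"
    using assms(9) unfolding big_image_def by blast
  note eta = this
  interpret distorted_inducing M T \<alpha> \<gamma> \<theta> C \<eta> u
    by (intro distorted_inducing.intro markov_inducing.intro distorted_inducing_axioms.intro assms(1-7,9) u eta)
  show ?thesis
    using clt_of_induced[OF assms(10-12,14)] unfolding birkhoff_sum_def .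
qed

end
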